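(* Fix an integer $q\ge 2$, and consider a tamed sequence $\{f_n : n\ge 1\}\subset L^2(Z^q)$ of mirror symmetric functions such that $\lim_{n\to\infty}\|f_n\|_{L^2(Z^q)}^2=\alpha^2<\infty$. Then the following four conditions are equivalent, as $n\to\infty$: (i) $I_q^{\hat N}(f_n)$ converges in law to $\mathcal{S}(0,\alpha^2)$; (ii) $\kappa_4\big(I_q^{\hat N}(f_n)\big)\to 0$, where $\kappa_4$ is the fourth free cumulant; (iii) $\varphi\big(I_q^{\hat N}(f_n)^4\big)\to 2\alpha^4$; (iv) $\|f_n\overset{k}{\frown}f_n\|_{L^2(Z^{2q-2k})}\to 0$ for all $k\in\{1,\dots,q-1\}$ and $\|f_n\star_k^{k-1}f_n\|_{L^2(Z^{2q-2k+1})}\to 0$ for all $k\in\{2,\dots,q\}$.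
   Context: Setting: $Z=\mathbb{R}^d$ ($d\ge1$), $\mu$ is Lebesgue measure, $\mathcal{Z}_\mu$ is the class of Borel sets of finite $\mu$-measure, and $L^2(Z^q)=L^2(Z^q,\mu^q)$ consists of complex-valued functions. Kernels. For $f\in L^2(Z^q)$ put $f^*(t_1,\dots,t_q)=\overline{f(t_q,\dots,t_1)}$; $f$ is mirror symmetric if $f=f^*$ a.e. Contractions. For functions $f$ of $m$ variables and $g$ of $n$ variables and $1\le k\le m\wedge n$, $$f\overset{k}{\frown}g(t_1,\dots,t_{m+n-2k})=\int_{Z^k}f(t_1,\dots,t_{m-k},s_k,\dots,s_1)\,g(s_1,\dots,s_k,t_{m-k+1},\dots,t_{m+n-2k})\,\mu(ds_1)\cdots\mu(ds_k),$$ $$f\star_k^{k-1}g(t_1,\dots,t_{m+n-2k+1})=\int_{Z^{k-1}}f(t_1,\dots,t_{m-k+1},s_{k-1},\dots,s_1)\,g(s_1,\dots,s_{k-1},t_{m-k+1},\dots,t_{m+n-2k+1})\,\mu(ds_1)\cdots\mu(ds_{k-1}).$$ Partitions and tensors. For $m\ge 1$, let $\pi^*$ be the partition of $[mq]=\{1,\dots,mq\}$ into $m$ consecutive blocks of size $q$. In the lattice of all partitions of $[mq]$ ordered by refinement, $\wedge$ is the meet and $\hat 0$ is the partition into singletons; so $\sigma\wedge\pi^*=\hat 0$ means that no block of $\sigma$ contains two elements of the same block of $\pi^*$. For a function $f$ of $q$ variables and a partition $\sigma$ of $[mq]$, $f_\sigma$ is the function of $|\sigma|$ variables (where $|\sigma|$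 is the number of blocks) obtained from $\prod_{j=1}^m f(x_{(j-1)q+1},\dots,x_{jq})$ by identifying $x_i$ and $x_j$ whenever $i,j$ lie in the same block of $\sigma$. Tamed sequences. $\{g_n\}\subset L^2(Z^q)$ is tamed if every $g_n$ is bounded with bounded support and, for every $m\ge 2$ and every partition $\sigma$ of $[mq]$ (not necessarily non-crossing) with $\sigma\wedge\pi^*=\hat 0$, the numerical sequence $n\mapsto\int_{Z^{|\sigma|}}(|g_n|)_\sigma\,d\mu^{|\sigma|}$ is bounded. Free Poisson integrals. $(\mathscr{A},\varphi)$ is a $W^*$-probability space with faithful tracial state $\varphi$. The centered free Poisson law $\hat P(\lambda)$ is the compactly supported law with free cumulants $\kappa_1=0$ and $\kappa_m=\lambda$ for all $m\ge 2$. A centered free Poisson measure $\hat N$ with control $\mu$ is a family of self-adjoint $\hat N(A)\in\mathscr{A}$, $A\in\mathcal{Z}_\mu$, such that $\hat N(A)$ has law $\hat P(\mu(A))$, and $\hat N$ is finitely additive on disjoint sets and takes freely independent values on disjoint sets. Centered free Charlier polynomials: $C_{0,0}=1$, $C_{0,1}(x,\lambda)=x$, $xC_{0,m}=C_{0,m+1}+C_{0,m}+\lambda C_{0,m-1}$ for $m\ge 1$. For $f=\mathbf{1}_{A_1}^{\otimes k_1}\otimes\cdots\otimes\mathbf{1}_{A_l}^{\otimes k_l}$ with $k_1+\dots+k_l=q$, each $A_j$ a bounded Borel set and $A_j\cap A_{j+1}=\emptyset$, set $I_q^{\hat N}(f)=C_{0,k_1}(\hat N(A_1),\mu(A_1))\cdots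 C_{0,k_l}(\hat N(A_l),\mu(A_l))$. This extends consistently by linearity to the span of such $f$, satisfies $\varphi(I_q^{\hat N}(g)^*I_q^{\hat N}(f))=\langle f,g\rangle_{L^2(Z^q)}$, and hence extends isometrically to all of $L^2(Z^q)$. If $f$ is bounded with bounded support, $I_q^{\hat N}(f)$ is a bounded element, self-adjoint when $f$ is mirror symmetric. Free cumulants $\kappa_m(X)$ are defined by $\varphi(X^m)=\sum_{\pi\in NC(m)}\prod_{B\in\pi}\kappa_{|B|}(X)$, $m\ge1$, where $NC(m)$ is the set of non-crossing partitions of $\{1,\dots,m\}$. Convergence in law means convergence of all moments $\varphi(X_n^k)$ to those of the limit. $\mathcal{S}(0,t)$ is the semicircular law with density $(2\pi t)^{-1}\sqrt{4t-x^2}$ on $|x|<2\sqrt t$ (mean $0$, variance $t$). *)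

theory Defs
  imports
    "HOL-Probability.Probability"
    "HOL-Library.Disjoint_Sets"
    "HOL-Library.Nonpos_Ints"
    "HOL-Computational_Algebra.Polynomial"
begin

section \<open>Von Neumann algebras with a faithful normal trace\<close>

text \<open>The underlying real Hilbert space supplies norm, topology and completeness;
  \<open>cinner\<close> is antilinear in its first argument.\<close>

class complex_hilbert_space = real_inner + banach +
  fixes scaleC :: "complex \<Rightarrow> 'a \<Rightarrow> 'a"  (infixr \<open>*\<^sub>C\<close> 75)
    and cinner :: "'a \<Rightarrow> 'a \<Rightarrow> complex"
  assumes scaleC_add_right: "scaleC c (x + y) = scaleC c x + scaleC c y"
    and scaleC_add_left: "scaleC (c + d) x = scaleC c x + scaleC d x"
    and scaleC_scaleC: "scaleC c (scaleC d x) = scaleC (c * d) x"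
    and scaleC_of_real: "scaleC (complex_of_real r) x = r *\<^sub>R x"
    and cinner_commute: "cinner x y = cnj (cinner y x)"
    and cinner_add_right: "cinner x (y + z) = cinner x y + cinner x z"
    and cinner_scaleC_right: "cinner x (scaleC c y) = c * cinner x y"
    and Re_cinner: "Re (cinner x y) = x \<bullet> y"

lemma norm_scaleC: "norm (c *\<^sub>C x) = cmod c * norm (x :: 'h::complex_hilbert_space)"
proof -
  have sym: "cinner (c *\<^sub>C x) x = cnj c * cinner x x"
    by (metis cinner_commute cinner_scaleC_right complex_cnj_mult)
  have real: "cinner x x = complex_of_real ((norm x)\<^sup>2)"
  proof -
    have "cinner x x \<in> \<real>"
      by (metis cinner_commute Reals_cnj_iff)
    then have "cinner x x = complex_of_real (Re (cinner x x))"
      by (metis of_real_Re)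
    then show ?thesis
      by (simp add: Re_cinner power2_norm_eq_inner)
  qed
  have "cinner (c *\<^sub>C x) (c *\<^sub>C x) = (c * cnj c) * complex_of_real ((norm x)\<^sup>2)"
    by (simp add: cinner_scaleC_right sym real mult.assoc)
  also have "\<dots> = complex_of_real ((cmod c)\<^sup>2 * (norm x)\<^sup>2)"
    by (simp only: complex_norm_square[symmetric] of_real_mult)
  finally have "(norm (c *\<^sub>C x))\<^sup>2 = (cmod c * norm x)\<^sup>2"
    by (metis Re_cinner Re_complex_of_real power2_norm_eq_inner power_mult_distrib)
  then show ?thesis
    by (simp add: power2_eq_iff_nonneg)
qed

text \<open>The type \<open>'h \<Rightarrow>\<^sub>L 'h\<close> contains all bounded real-linear operators; complex linearity
  is imposed separately.\<close>

definition complex_linear_ops :: "('h::complex_hilbert_space \<Rightarrow>\<^sub>L 'h) set" where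
  "complex_linear_ops = {T. \<forall>c x. blinfun_apply T (c *\<^sub>C x) = c *\<^sub>C blinfun_apply T x}"

definition op_scale :: "complex \<Rightarrow> ('h::complex_hilbert_space \<Rightarrow>\<^sub>L 'h) \<Rightarrow> ('h \<Rightarrow>\<^sub>L 'h)" where
  "op_scale c T = Blinfun (\<lambda>x. c *\<^sub>C blinfun_apply T x)"

lemma op_scale_apply: "blinfun_apply (op_scale c T) x = c *\<^sub>C blinfun_apply T x"
proof -
  have "bounded_linear (\<lambda>x. c *\<^sub>C blinfun_apply T x)"
  proof (rule bounded_linear_intro[where K = "cmod c * norm T"])
    fix x y and r :: real
    show "c *\<^sub>C blinfun_apply T (x + y) = c *\<^sub>C blinfun_apply T x + c *\<^sub>C blinfun_apply T y"
      by (simp add: blinfun.add_right scaleC_add_right)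
    show "c *\<^sub>C blinfun_apply T (r *\<^sub>R x) = r *\<^sub>R (c *\<^sub>C blinfun_apply T x)"
      by (simp only: blinfun.scaleR_right)
        (simp only: scaleC_of_real[symmetric] scaleC_scaleC mult.commute)
    show "norm (c *\<^sub>C blinfun_apply T x) \<le> norm x * (cmod c * norm T)"
      using mult_left_mono[OF norm_blinfun[of T x] norm_ge_zero[of c]]
      by (simp add: norm_scaleC algebra_simps)
  qed
  then show ?thesis
    by (simp add: op_scale_def bounded_linear_Blinfun_apply)
qed

primrec op_power :: "('h::real_normed_vector \<Rightarrow>\<^sub>L 'h) \<Rightarrow> nat \<Rightarrow> ('h \<Rightarrow>\<^sub>L 'h)" where
  "op_power T 0 = id_blinfun"
| "op_power T (Suc n) = T o\<^sub>L op_power T n"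

definition op_prod :: "('h::real_normed_vector \<Rightarrow>\<^sub>L 'h) list \<Rightarrow> ('h \<Rightarrow>\<^sub>L 'h)" where
  "op_prod Ts = foldr blinfun_compose Ts id_blinfun"

definition op_poly :: "complex poly \<Rightarrow> ('h::complex_hilbert_space \<Rightarrow>\<^sub>L 'h) \<Rightarrow> ('h \<Rightarrow>\<^sub>L 'h)" where
  "op_poly p T = (\<Sum>i\<le>degree p. op_scale (coeff p i) (op_power T i))"

definition is_adjoint ::
  "('h::complex_hilbert_space \<Rightarrow>\<^sub>L 'h) \<Rightarrow> ('h \<Rightarrow>\<^sub>L 'h) \<Rightarrow> bool" where
  "is_adjoint S T \<longleftrightarrow>
     (\<forall>x y. cinner (blinfun_apply S x) y = cinner x (blinfun_apply T y))"

definition op_adj :: "('h::complex_hilbert_space \<Rightarrow>\<^sub>L 'h) \<Rightarrow> ('h \<Rightarrow>\<^sub>L 'h)" where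
  "op_adj T = (THE S. is_adjoint S T)"

definition commutant ::
  "('h::complex_hilbert_space \<Rightarrow>\<^sub>L 'h) set \<Rightarrow> ('h \<Rightarrow>\<^sub>L 'h) set" where
  "commutant M = {T \<in> complex_linear_ops. \<forall>S\<in>M. T o\<^sub>L S = S o\<^sub>L T}"

text \<open>A self-adjoint set of operators equal to its bicommutant is a unital complex algebra.\<close>

definition von_neumann_algebra :: "('h::complex_hilbert_space \<Rightarrow>\<^sub>L 'h) set \<Rightarrow> bool" where
  "von_neumann_algebra M \<longleftrightarrow>
     M \<subseteq> complex_linear_ops \<and>
     (\<forall>T\<in>M. \<exists>S\<in>M. is_adjoint S T) \<and>
     commutant (commutant M) = M"

text \<open>Normality is expressed by a square-summable sequence of vectors, i.e. by a density operator.\<close>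

locale tracial_wstar_probability_space =
  fixes M :: "('h::complex_hilbert_space \<Rightarrow>\<^sub>L 'h) set"
    and \<phi> :: "('h \<Rightarrow>\<^sub>L 'h) \<Rightarrow> complex"
  assumes von_neumann: "von_neumann_algebra M"
    and state_add: "\<And>S T. S \<in> M \<Longrightarrow> T \<in> M \<Longrightarrow> \<phi> (S + T) = \<phi> S + \<phi> T"
    and state_scale: "\<And>c T. T \<in> M \<Longrightarrow> \<phi> (op_scale c T) = c * \<phi> T"
    and state_unit: "\<phi> id_blinfun = 1"
    and state_pos: "\<And>T. T \<in> M \<Longrightarrow> \<phi> (op_adj T o\<^sub>L T) \<in> \<real>\<^sub>\<ge>\<^sub>0"
    and faithful: "\<And>T. T \<in> M \<Longrightarrow> \<phi> (op_adj T o\<^sub>L T) = 0 \<Longrightarrow> T = 0"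
    and tracial: "\<And>S T. S \<in> M \<Longrightarrow> T \<in> M \<Longrightarrow> \<phi> (S o\<^sub>L T) = \<phi> (T o\<^sub>L S)"
    and normal: "\<exists>\<xi> :: nat \<Rightarrow> 'h. summable (\<lambda>n. (norm (\<xi> n))\<^sup>2) \<and>
      (\<forall>T\<in>M. (\<lambda>n. cinner (\<xi> n) (blinfun_apply T (\<xi> n))) sums \<phi> T)"

definition generated_algebra ::
  "('h::complex_hilbert_space \<Rightarrow>\<^sub>L 'h) \<Rightarrow> ('h \<Rightarrow>\<^sub>L 'h) set" where
  "generated_algebra X = range (\<lambda>p. op_poly p X)"

text \<open>Intended for self-adjoint operators, whose generated unital algebra is closed under
  adjoints.\<close>

definition freely_independent ::
  "(('h::complex_hilbert_space \<Rightarrow>\<^sub>L 'h) \<Rightarrow> complex) \<Rightarrow> 'i set \<Rightarrow> ('i \<Rightarrow> 'h \<Rightarrow>\<^sub>L 'h) \<Rightarrow> bool" where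
  "freely_independent \<phi> I X \<longleftrightarrow>
     (\<forall>ws. ws \<noteq> [] \<longrightarrow> distinct_adj (map fst ws) \<longrightarrow>
        (\<forall>(i, T)\<in>set ws. i \<in> I \<and> T \<in> generated_algebra (X i) \<and> \<phi> T = 0) \<longrightarrow>
        \<phi> (op_prod (map snd ws)) = 0)"


section \<open>Partitions, free cumulants and laws\<close>

text \<open>Indices start at 0: the set \<open>{1, \<dots>, m}\<close> is rendered as \<open>{..<m}\<close>.\<close>

definition noncrossing :: "nat set set \<Rightarrow> bool" where
  "noncrossing \<pi> \<longleftrightarrow>
     \<not> (\<exists>B\<in>\<pi>. \<exists>C\<in>\<pi>. B \<noteq> C \<and>
          (\<exists>a b c d. a < b \<and> b < c \<and> c < d \<and> a \<in> B \<and> b \<in> C \<and> c \<in> B \<and> d \<in> C))"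

definition NC :: "nat \<Rightarrow> nat set set set" where
  "NC m = {\<pi>. partition_on {..<m} \<pi> \<and> noncrossing \<pi>}"

text \<open>The requirement \<open>\<kappa> 0 = 0\<close> only fixes a value that the moment-cumulant relations leave open.\<close>

definition free_cumulant ::
  "(('h::real_normed_vector \<Rightarrow>\<^sub>L 'h) \<Rightarrow> complex) \<Rightarrow> nat \<Rightarrow> ('h \<Rightarrow>\<^sub>L 'h) \<Rightarrow> complex" where
  "free_cumulant \<phi> m X =
     (THE \<kappa>. \<kappa> 0 = 0 \<and>
        (\<forall>k\<ge>1. \<phi> (op_power X k) = (\<Sum>\<pi>\<in>NC k. \<Prod>B\<in>\<pi>. \<kappa> (card B)))) m"

definition centered_free_poisson_law ::
  "(('h::real_normed_vector \<Rightarrow>\<^sub>L 'h) \<Rightarrow> complex) \<Rightarrow> ('h \<Rightarrow>\<^sub>L 'h) \<Rightarrow> real \<Rightarrow> bool" where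
  "centered_free_poisson_law \<phi> X r \<longleftrightarrow>
     free_cumulant \<phi> 1 X = 0 \<and> (\<forall>m\<ge>2. free_cumulant \<phi> m X = complex_of_real r)"

text \<open>The variance \<open>0\<close> is degenerate: the law is the point mass at \<open>0\<close>.\<close>

definition semicircular :: "real \<Rightarrow> real measure" where
  "semicircular t =
     (if t = 0 then return borel 0
      else density lborel (\<lambda>x. ennreal
        (if \<bar>x\<bar> < 2 * sqrt t then sqrt (4 * t - x\<^sup>2) / (2 * pi * t) else 0)))"

definition converges_in_law ::
  "(('h::real_normed_vector \<Rightarrow>\<^sub>L 'h) \<Rightarrow> complex) \<Rightarrow> (nat \<Rightarrow> 'h \<Rightarrow>\<^sub>L 'h) \<Rightarrow> real measure \<Rightarrow> bool"
  where
  "converges_in_law \<phi> X \<nu> \<longleftrightarrow>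
     (\<forall>k. (\<lambda>n. \<phi> (op_power (X n) k)) \<longlonglongrightarrow> complex_of_real (\<integral>x. x ^ k \<partial>\<nu>))"


section \<open>Kernels\<close>

text \<open>A function of \<open>n\<close> variables takes an argument \<open>t :: nat \<Rightarrow> 'z\<close> with coordinates
  \<open>t 0, \<dots>, t (n - 1)\<close>, extensional outside \<open>{..<n}\<close>.\<close>

definition lborel_pow :: "nat \<Rightarrow> (nat \<Rightarrow> 'z::euclidean_space) measure" where
  "lborel_pow n = PiM {..<n} (\<lambda>_. lborel)"

definition in_L2 :: "nat \<Rightarrow> ((nat \<Rightarrow> 'z::euclidean_space) \<Rightarrow> complex) \<Rightarrow> bool" where
  "in_L2 n f \<longleftrightarrow> f \<in> borel_measurable (lborel_pow n) \<and>
     integrable (lborel_pow n) (\<lambda>t. (cmod (f t))\<^sup>2)"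

definition L2_norm :: "nat \<Rightarrow> ((nat \<Rightarrow> 'z::euclidean_space) \<Rightarrow> complex) \<Rightarrow> real" where
  "L2_norm n f = sqrt (\<integral>t. (cmod (f t))\<^sup>2 \<partial>lborel_pow n)"

definition mirror ::
  "nat \<Rightarrow> ((nat \<Rightarrow> 'z::euclidean_space) \<Rightarrow> complex) \<Rightarrow> (nat \<Rightarrow> 'z) \<Rightarrow> complex" where
  "mirror n f t = cnj (f (\<lambda>i\<in>{..<n}. t (n - 1 - i)))"

definition mirror_symmetric :: "nat \<Rightarrow> ((nat \<Rightarrow> 'z::euclidean_space) \<Rightarrow> complex) \<Rightarrow> bool" where
  "mirror_symmetric n f \<longleftrightarrow> (AE t in lborel_pow n. f t = mirror n f t)"

definition contraction ::
  "nat \<Rightarrow> nat \<Rightarrow> nat \<Rightarrow> ((nat \<Rightarrow> 'z::euclidean_space) \<Rightarrow> complex) \<Rightarrow> ((nat \<Rightarrow> 'z) \<Rightarrow> complex)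
     \<Rightarrow> (nat \<Rightarrow> 'z) \<Rightarrow> complex" where
  "contraction m n k f g t =
     (\<integral>s. f (\<lambda>i\<in>{..<m}. if i < m - k then t i else s (m - 1 - i)) *
          g (\<lambda>i\<in>{..<n}. if i < k then s i else t (m - k + (i - k)))
      \<partial>lborel_pow k)"

text \<open>Here the variable \<open>t (m - k)\<close> is shared by both factors and not integrated out.\<close>

definition star_contraction ::
  "nat \<Rightarrow> nat \<Rightarrow> nat \<Rightarrow> ((nat \<Rightarrow> 'z::euclidean_space) \<Rightarrow> complex) \<Rightarrow> ((nat \<Rightarrow> 'z) \<Rightarrow> complex)
     \<Rightarrow> (nat \<Rightarrow> 'z) \<Rightarrow> complex" where
  "star_contraction m n k f g t =
     (\<integral>s. f (\<lambda>i\<in>{..<m}. if i < m - k + 1 then t i else s (m - 1 - i)) *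
          g (\<lambda>i\<in>{..<n}. if i < k - 1 then s i else t (m - k + (i - (k - 1))))
      \<partial>lborel_pow (k - 1))"

text \<open>Elements of \<open>L\<^sup>2\<close> are classes, so boundedness is understood almost everywhere.\<close>

definition bounded_with_bounded_support ::
  "nat \<Rightarrow> ((nat \<Rightarrow> 'z::euclidean_space) \<Rightarrow> complex) \<Rightarrow> bool" where
  "bounded_with_bounded_support n f \<longleftrightarrow>
     (\<exists>C R. AE t in lborel_pow n. cmod (f t) \<le> C \<and> (f t \<noteq> 0 \<longrightarrow> (\<forall>i<n. norm (t i) \<le> R)))"

definition partition_meet :: "'a set set \<Rightarrow> 'a set set \<Rightarrow> 'a set set" where
  "partition_meet \<sigma> \<tau> = {B \<inter> C | B C. B \<in> \<sigma> \<and> C \<in> \<tau>} - {{}}"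

definition consecutive_blocks :: "nat \<Rightarrow> nat \<Rightarrow> nat set set" where
  "consecutive_blocks m q = (\<lambda>j. {j * q..<(j + 1) * q}) ` {..<m}"

definition singletons :: "nat \<Rightarrow> nat set set" where
  "singletons n = (\<lambda>i. {i}) ` {..<n}"

text \<open>The variables of \<open>f\<^sub>\<sigma>\<close> are indexed by the blocks of \<open>\<sigma>\<close> themselves, so its domain is
  the product of \<open>card \<sigma>\<close> copies of the space, without choosing an order of the blocks.\<close>

definition block_of :: "'a set set \<Rightarrow> 'a \<Rightarrow> 'a set" where
  "block_of \<sigma> i = (THE B. B \<in> \<sigma> \<and> i \<in> B)"

definition identified_tensor ::
  "nat \<Rightarrow> nat \<Rightarrow> ((nat \<Rightarrow> 'z) \<Rightarrow> real) \<Rightarrow> nat set set \<Rightarrow> (nat set \<Rightarrow> 'z) \<Rightarrow> real" where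
  "identified_tensor m q f \<sigma> x = (\<Prod>j<m. f (\<lambda>i\<in>{..<q}. x (block_of \<sigma> (j * q + i))))"

definition tamed ::
  "nat \<Rightarrow> (nat \<Rightarrow> (nat \<Rightarrow> 'z::euclidean_space) \<Rightarrow> complex) \<Rightarrow> bool" where
  "tamed q g \<longleftrightarrow>
     (\<forall>n. in_L2 q (g n) \<and> bounded_with_bounded_support q (g n)) \<and>
     (\<forall>m\<ge>2. \<forall>\<sigma>. partition_on {..<m * q} \<sigma> \<longrightarrow>
        partition_meet \<sigma> (consecutive_blocks m q) = singletons (m * q) \<longrightarrow>
        (\<exists>C. \<forall>n. (\<integral>\<^sup>+ x. ennreal (identified_tensor m q (\<lambda>t. cmod (g n t)) \<sigma> x)
                    \<partial>PiM \<sigma> (\<lambda>_. lborel)) \<le> ennreal C))"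


section \<open>Free Poisson measures and multiple integrals\<close>

definition finite_measure_sets :: "'z::euclidean_space set set" where
  "finite_measure_sets = {A \<in> sets borel. emeasure lborel A < \<infinity>}"

locale free_poisson_measure = tracial_wstar_probability_space M \<phi>
  for M :: "('h::complex_hilbert_space \<Rightarrow>\<^sub>L 'h) set" and \<phi> +
  fixes N :: "'z::euclidean_space set \<Rightarrow> 'h \<Rightarrow>\<^sub>L 'h"
  assumes N_mem: "\<And>A. A \<in> finite_measure_sets \<Longrightarrow> N A \<in> M"
    and N_selfadjoint: "\<And>A. A \<in> finite_measure_sets \<Longrightarrow> is_adjoint (N A) (N A)"
    and N_law: "\<And>A. A \<in> finite_measure_sets \<Longrightarrow>
      centered_free_poisson_law \<phi> (N A) (measure lborel A)"
    and N_additive: "\<And>A B. A \<in> finite_measure_sets \<Longrightarrow> B \<in> finite_measure_sets \<Longrightarrow>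
      A \<inter> B = {} \<Longrightarrow> N (A \<union> B) = N A + N B"
    and N_free: "\<And>(A :: nat \<Rightarrow> 'z set) n. (\<And>i. i < n \<Longrightarrow> A i \<in> finite_measure_sets) \<Longrightarrow>
      disjoint_family_on A {..<n} \<Longrightarrow> freely_independent \<phi> {..<n} (\<lambda>i. N (A i))"

text \<open>The recurrence \<open>x C\<^sub>m = C\<^sub>m\<^sub>+\<^sub>1 + C\<^sub>m + r C\<^sub>m\<^sub>-\<^sub>1\<close>, solved for its leading term.\<close>

fun free_charlier :: "real \<Rightarrow> nat \<Rightarrow> complex poly" where
  "free_charlier r 0 = 1"
| "free_charlier r (Suc 0) = [:0, 1:]"
| "free_charlier r (Suc (Suc m)) =
     [:-1, 1:] * free_charlier r (Suc m) - smult (complex_of_real r) (free_charlier r m)"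

text \<open>The list \<open>[(A\<^sub>1, k\<^sub>1), \<dots>, (A\<^sub>l, k\<^sub>l)]\<close> stands for the tensor product of the
  \<open>k\<^sub>j\<close>-fold tensor powers of the indicators of the sets \<open>A\<^sub>j\<close>. All \<open>k\<^sub>j\<close> must be
  positive, as otherwise two equal sets could become adjacent.\<close>

definition elementary :: "nat \<Rightarrow> ('z::euclidean_space set \<times> nat) list \<Rightarrow> bool" where
  "elementary q bs \<longleftrightarrow>
     sum_list (map snd bs) = q \<and>
     (\<forall>(A, k)\<in>set bs. A \<in> sets borel \<and> bounded A \<and> k \<ge> 1) \<and>
     (\<forall>j. Suc j < length bs \<longrightarrow> fst (bs ! j) \<inter> fst (bs ! Suc j) = {})"

definition elementary_kernel ::
  "('z set \<times> nat) list \<Rightarrow> (nat \<Rightarrow> 'z) \<Rightarrow> complex" where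
  "elementary_kernel bs t =
     (let As = concat (map (\<lambda>(A, k). replicate k A) bs)
      in \<Prod>i<length As. indicator (As ! i) (t i))"

definition elementary_integral ::
  "('z::euclidean_space set \<Rightarrow> 'h::complex_hilbert_space \<Rightarrow>\<^sub>L 'h) \<Rightarrow> ('z set \<times> nat) list
     \<Rightarrow> ('h \<Rightarrow>\<^sub>L 'h)" where
  "elementary_integral N bs =
     op_prod (map (\<lambda>(A, k). op_poly (free_charlier (measure lborel A) k) (N A)) bs)"

text \<open>A list of coefficients and elementary kernels encodes an element of their span.\<close>

definition simple_kernel ::
  "(complex \<times> ('z set \<times> nat) list) list \<Rightarrow> (nat \<Rightarrow> 'z) \<Rightarrow> complex" where
  "simple_kernel ws t = (\<Sum>(c, bs)\<leftarrow>ws. c * elementary_kernel bs t)"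

definition simple_integral ::
  "('z::euclidean_space set \<Rightarrow> 'h::complex_hilbert_space \<Rightarrow>\<^sub>L 'h)
     \<Rightarrow> (complex \<times> ('z set \<times> nat) list) list \<Rightarrow> ('h \<Rightarrow>\<^sub>L 'h)" where
  "simple_integral N ws = (\<Sum>(c, bs)\<leftarrow>ws. op_scale c (elementary_integral N bs))"

text \<open>The isometric extension, restricted to kernels whose integral is a bounded element:
  the integral is the limit of the integrals of simple kernels in the norm
  \<open>\<phi>(X\<^sup>*X)\<^sup>1\<^sup>/\<^sup>2\<close>. This covers all bounded kernels with bounded support.\<close>

definition has_multiple_integral ::
  "('h::complex_hilbert_space \<Rightarrow>\<^sub>L 'h) set \<Rightarrow> (('h \<Rightarrow>\<^sub>L 'h) \<Rightarrow> complex)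
     \<Rightarrow> ('z::euclidean_space set \<Rightarrow> 'h \<Rightarrow>\<^sub>L 'h)
     \<Rightarrow> nat \<Rightarrow> ((nat \<Rightarrow> 'z) \<Rightarrow> complex) \<Rightarrow> ('h \<Rightarrow>\<^sub>L 'h) \<Rightarrow> bool" where
  "has_multiple_integral M \<phi> N q f X \<longleftrightarrow>
     X \<in> M \<and>
     (\<exists>ws. (\<forall>j. \<forall>(c, bs)\<in>set (ws j). elementary q bs) \<and>
        (\<lambda>j. L2_norm q (\<lambda>t. simple_kernel (ws j) t - f t)) \<longlonglongrightarrow> 0 \<and>
        (\<lambda>j. \<phi> (op_adj (simple_integral N (ws j) - X) o\<^sub>L (simple_integral N (ws j) - X)))
          \<longlonglongrightarrow> 0)"

definition multiple_integral ::
  "('h::complex_hilbert_space \<Rightarrow>\<^sub>L 'h) set \<Rightarrow> (('h \<Rightarrow>\<^sub>L 'h) \<Rightarrow> complex)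
     \<Rightarrow> ('z::euclidean_space set \<Rightarrow> 'h \<Rightarrow>\<^sub>L 'h)
     \<Rightarrow> nat \<Rightarrow> ((nat \<Rightarrow> 'z) \<Rightarrow> complex) \<Rightarrow> ('h \<Rightarrow>\<^sub>L 'h)" where
  "multiple_integral M \<phi> N q f = (THE X. has_multiple_integral M \<phi> N q f X)"

end

theory Submission
  imports Defs
begin

text \<open>For a kernel that is constant on the cells of a grid, the multiple integral is a finite
  linear combination of Wick products of free centered Poisson variables, and a product of two
  such integrals is the sum of the integrals of all contractions and star contractions.
  This gives \<open>\<phi>(X\<^sup>4) = 2 \<parallel>f\<parallel>\<^sup>4\<close> plus the sum of the squared norms of the proper
  contractions, which settles everything except the convergence in law. For the latter, the
  integrals of the tensor powers of \<open>f\<close> play the role of the Chebyshev polynomials of \<open>X\<close>: they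
  satisfy the same three-term recurrence up to contraction terms, whose influence on the
  moments is controlled by Cauchy-Schwarz. The moments of \<open>X\<close> that enter this estimate are
  sums over paths of contractions, each bounded by an integral of \<open>\<bar>f\<bar>\<^sub>\<sigma>\<close>, and tamed sequences
  keep these bounded. A general kernel is the limit of uniformly bounded step kernels on a common
  ball; their integrals are bounded in operator norm, so they converge to a bounded operator
  together with all moments.\<close>

section \<open>Hilbert space preliminaries\<close>

text \<open>Star contractions appear because two adjacent letters from the same cell produce,
  besides the scalar term familiar from semicircular variables, a linear one: a variable is shared
  without being integrated. A pair \<open>(e, k)\<close> records this, \<open>e\<close> counting
  shared and \<open>k\<close> integrated variables. The parity of \<open>2 * k + e\<close> separates
  the two kinds, so the terms in the square of the integral have different degrees and are
  orthogonal; the fourth moment is a sum of squares without cancellation.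

  The integral is characterised by an L2 limit but has to be a bounded operator. A uniform operator
  bound on the approximations provides this, and it comes from the growth of their even moments.
  That bound depends on the sup norm and the support of the kernel, so it is no help along the
  sequence \<open>f n\<close>, where these may blow up; there only each moment of fixed order is
  bounded, and this is what tamedness supplies.

  The star contraction of order one is missing from condition (iv) although it enters the fourth
  moment; mirror symmetry gives it the same norm as the one of order \<open>q\<close>.\<close>

lemma cinner_add_left: "cinner (x + y) z = cinner x z + cinner y (z :: 'h::complex_hilbert_space)"
  by (metis cinner_add_right cinner_commute complex_cnj_add)

lemma cinner_scaleC_left: "cinner (c *\<^sub>C x) y = cnj c * cinner x (y :: 'h::complex_hilbert_space)"
  by (metis cinner_commute cinner_scaleC_right complex_cnj_mult)

lemma scaleC_one [simp]: "1 *\<^sub>C x = (x :: 'h::complex_hilbert_space)"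
  using scaleC_of_real[of 1 x] by simp

lemma scaleC_zero_left [simp]: "0 *\<^sub>C x = (0 :: 'h::complex_hilbert_space)"
  using scaleC_of_real[of 0 x] by simp

lemma scaleC_diff_right: "c *\<^sub>C (x - y) = c *\<^sub>C x - c *\<^sub>C (y :: 'h::complex_hilbert_space)"
  by (metis add_diff_cancel diff_add_cancel scaleC_add_right)

lemma cinner_scaleR_right: "cinner x (r *\<^sub>R y) = of_real r * cinner x (y :: 'h::complex_hilbert_space)"
  by (metis cinner_scaleC_right scaleC_of_real)

lemma cinner_minus_right: "cinner x (- y) = - cinner x (y :: 'h::complex_hilbert_space)"
  using cinner_scaleR_right[of x "-1" y] by simp

lemma cinner_diff_right: "cinner x (y - z) = cinner x y - cinner x (z :: 'h::complex_hilbert_space)"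
  using cinner_add_right[of x y "- z"] by (simp add: cinner_minus_right)

lemma cinner_diff_left: "cinner (x - y) z = cinner x z - cinner y (z :: 'h::complex_hilbert_space)"
  by (metis cinner_diff_right cinner_commute complex_cnj_diff)

lemma cinner_self: "cinner x x = complex_of_real ((norm (x :: 'h::complex_hilbert_space))\<^sup>2)"
proof -
  have "cinner x x \<in> \<real>"
    by (metis cinner_commute Reals_cnj_iff)
  then have "cinner x x = complex_of_real (Re (cinner x x))"
    by (metis of_real_Re)
  then show ?thesis
    by (simp add: Re_cinner power2_norm_eq_inner)
qed

lemma Im_cinner: "Im (cinner x y) = - (x \<bullet> (\<i> *\<^sub>C (y :: 'h::complex_hilbert_space)))"
  by (simp add: Re_cinner[symmetric] cinner_scaleC_right)

lemma cinner_eqI_left: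
  assumes "\<And>y. cinner x y = cinner x' (y :: 'h::complex_hilbert_space)"
  shows "x = x'"
proof -
  have "cinner (x - x') (x - x') = 0"
    using assms by (simp add: cinner_diff_left)
  then show ?thesis
    by (simp add: cinner_self)
qed

lemma norm_cinner: "cmod (cinner x y) \<le> norm x * norm (y :: 'h::complex_hilbert_space)"
proof (cases "cinner x y = 0")
  case False
  \<comment> \<open>A phase that rotates the inner product onto the positive real axis, where the
    real Cauchy-Schwarz inequality applies.\<close>
  define c where "c = cnj (cinner x y) / cmod (cinner x y)"
  have "cmod c = 1"
    using False by (simp add: c_def norm_divide)
  have "c * cinner x y = cmod (cinner x y)"
    using False complex_norm_square[of "cinner x y"]
    by (simp add: c_def field_simps power2_eq_square)
  then have "cmod (cinner x y) = Re (cinner x (c *\<^sub>C y))"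
    by (simp add: cinner_scaleC_right)
  also have "\<dots> \<le> norm x * norm (c *\<^sub>C y)"
    unfolding Re_cinner by (rule norm_cauchy_schwarz)
  finally show ?thesis
    using \<open>cmod c = 1\<close> by (simp add: norm_scaleC)
qed simp

text \<open>The representing vector minimises the squared norm minus twice \<open>l\<close>:
  completing the square bounds this from below, the parallelogram law makes minimising sequences
  Cauchy, and the first variation at the minimum is the claim. With the whole space for
  \<open>V\<close> this yields adjoints, with a proper subspace orthogonal projections.\<close>

lemma riesz_on_subspace:
  fixes V :: "'a::{real_inner,banach} set"
  assumes V: "subspace V" "closed V" and l: "bounded_linear l"
  obtains y where "y \<in> V" "\<And>x. x \<in> V \<Longrightarrow> l x = x \<bullet> y"
proof -
  interpret l: bounded_linear l by fact
  obtain K where K: "\<And>x. norm (l x) \<le> norm x * K"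
    using l.bounded by blast
  define J where "J x = (norm x)\<^sup>2 - 2 * l x" for x
  have J_lower: "J x \<ge> - K\<^sup>2" for x
  proof -
    have "l x \<le> norm x * K"
      using K[of x] by simp
    then have "J x \<ge> (norm x - K)\<^sup>2 - K\<^sup>2"
      by (simp add: J_def power2_diff)
    then show ?thesis
      using zero_le_power2[of "norm x - K"] by linarith
  qed
  define m where "m = Inf (J ` V)"
  have bdd: "bdd_below (J ` V)"
    using J_lower by (intro bdd_belowI2) auto
  have "0 \<in> V" using V subspace_0 by blast
  have m_le: "m \<le> J x" if "x \<in> V" for x
    unfolding m_def by (rule cInf_lower[OF _ bdd]) (use that in auto)
  have "\<exists>x\<in>V. J x < m + 1 / real (Suc n)" for n
    using cInf_lessD[of "J ` V" "m + 1 / real (Suc n)"] \<open>0 \<in> V\<close> by (auto simp: m_def)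
  then obtain x where x: "\<And>n. x n \<in> V" "\<And>n. J (x n) < m + 1 / real (Suc n)"
    by metis
  \<comment> \<open>Parallelogram identity; the linear part of \<open>J\<close> cancels because the
    midpoint stays in \<open>V\<close>.\<close>
  have par: "(norm (u - v))\<^sup>2 \<le> 2 * (J u - m) + 2 * (J v - m)" if "u \<in> V" "v \<in> V" for u v
  proof -
    have "(1/2) *\<^sub>R (u + v) \<in> V"
      using that V by (simp add: subspace_add subspace_scale)
    moreover have "(norm (u - v))\<^sup>2 = 2 * J u + 2 * J v - 4 * J ((1/2) *\<^sub>R (u + v))"
      by (simp add: J_def power2_norm_eq_inner l.add l.scaleR inner_commute inner_add_left
          inner_add_right inner_diff_left inner_diff_right field_simps)
    ultimately show ?thesis
      using m_le by force
  qed
  have "Cauchy x"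
  proof (rule metric_CauchyI)
    fix e :: real assume "e > 0"
    obtain n0 where n0: "1 / real (Suc n0) < e\<^sup>2 / 4"
      using reals_Archimedean[of "e\<^sup>2 / 4"] \<open>e > 0\<close> by (auto simp: inverse_eq_divide)
    have "dist (x i) (x j) < e" if "i \<ge> n0" "j \<ge> n0" for i j
    proof -
      have bnd: "J (x i) - m < e\<^sup>2 / 4" if "i \<ge> n0" for i
      proof -
        have "1 / real (Suc i) \<le> 1 / real (Suc n0)"
          using that by (simp add: frac_le)
        then show ?thesis using x(2)[of i] n0 by linarith
      qed
      have "(dist (x i) (x j))\<^sup>2 < e\<^sup>2"
        using par[OF x(1)[of i] x(1)[of j]] bnd[OF that(1)] bnd[OF that(2)]
        by (simp add: dist_norm)
      then show ?thesis
        using \<open>e > 0\<close> by (simp add: power2_less_imp_less)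
    qed
    then show "\<exists>M. \<forall>i\<ge>M. \<forall>j\<ge>M. dist (x i) (x j) < e" by blast
  qed
  then obtain y where y: "x \<longlonglongrightarrow> y"
    using Cauchy_convergent_iff convergent_def by blast
  have "y \<in> V"
    using V(2) x(1) y closed_sequentially by blast
  have lim: "(\<lambda>n. J (x n)) \<longlonglongrightarrow> J y"
    unfolding J_def by (intro tendsto_intros y l.tendsto)
  have "(\<lambda>n. m + 1 / real (Suc n)) \<longlonglongrightarrow> m + 0"
    by (intro tendsto_intros LIMSEQ_Suc lim_1_over_n)
  then have "J y \<le> m"
    using lim x(2) by (intro LIMSEQ_le[OF lim, of _ m]) (auto intro!: exI[of _ 0] less_imp_le)
  have "l z = z \<bullet> y" if "z \<in> V" for z
  proof -
    define d where "d = l z - z \<bullet> y"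
    define c where "c = (norm z)\<^sup>2 + 1"
    \<comment> \<open>Essentially the optimal step from \<open>y\<close> in direction
      \<open>z\<close>; the summand 1 in \<open>c\<close> avoids a division by zero for
      \<open>z = 0\<close>.\<close>
    define t where "t = d / c"
    have "c > 0" by (simp add: c_def add_nonneg_pos)
    have "y + t *\<^sub>R z \<in> V"
      using that V \<open>y \<in> V\<close> by (simp add: subspace_add subspace_scale)
    then have "J y \<le> J (y + t *\<^sub>R z)"
      using m_le \<open>J y \<le> m\<close> by force
    also have "J (y + t *\<^sub>R z) = J y - 2 * t * d + t\<^sup>2 * (norm z)\<^sup>2"
      unfolding J_def power2_norm_eq_inner d_def
      by (simp add: l.add l.scaleR inner_commute inner_add_left
          inner_add_right power2_eq_square algebra_simps)
    finally have "2 * t * d \<le> t\<^sup>2 * (c - 1)"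
      by (simp add: c_def)
    then have "2 * d\<^sup>2 / c \<le> (d / c)\<^sup>2 * c - (d / c)\<^sup>2"
      unfolding t_def right_diff_distrib by (simp add: power2_eq_square)
    also have "(d / c)\<^sup>2 * c = d\<^sup>2 / c"
      using \<open>c > 0\<close> by (simp add: power2_eq_square field_simps)
    finally have "d\<^sup>2 / c \<le> - (d / c)\<^sup>2" by simp
    then have "d\<^sup>2 / c \<le> 0"
      using zero_le_power2[of "d / c"] by linarith
    then have "d = 0"
      using \<open>c > 0\<close> by (simp add: divide_le_0_iff)
    then show ?thesis by (simp add: d_def)
  qed
  with \<open>y \<in> V\<close> show thesis by (rule that)
qed

section \<open>Uniqueness and existence of adjoints\<close>

lemma is_adjoint_sym: "is_adjoint S T \<Longrightarrow> is_adjoint T S"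
  unfolding is_adjoint_def by (metis cinner_commute)

lemma is_adjoint_unique: "is_adjoint S T \<Longrightarrow> is_adjoint S' T \<Longrightarrow> S = S'"
  unfolding is_adjoint_def by (metis blinfun_eqI cinner_eqI_left)

lemma op_adj_eq: "is_adjoint S T \<Longrightarrow> op_adj T = S"
  unfolding op_adj_def by (rule the_equality) (auto intro: is_adjoint_unique)

lemma is_adjoint_compose:
  "is_adjoint S T \<Longrightarrow> is_adjoint S' T' \<Longrightarrow> is_adjoint (S' o\<^sub>L S) (T o\<^sub>L T')"
  unfolding is_adjoint_def by simp

lemma is_adjoint_add: "is_adjoint S T \<Longrightarrow> is_adjoint S' T' \<Longrightarrow> is_adjoint (S + S') (T + T')"
  unfolding is_adjoint_def by (simp add: blinfun.add_left cinner_add_left cinner_add_right)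

lemma is_adjoint_diff: "is_adjoint S T \<Longrightarrow> is_adjoint S' T' \<Longrightarrow> is_adjoint (S - S') (T - T')"
  unfolding is_adjoint_def by (simp add: blinfun.diff_left cinner_diff_left cinner_diff_right)

lemma is_adjoint_op_scale: "is_adjoint S T \<Longrightarrow> is_adjoint (op_scale c S) (op_scale (cnj c) T)"
  unfolding is_adjoint_def by (simp add: op_scale_apply cinner_scaleC_left cinner_scaleC_right)

lemma is_adjoint_id: "is_adjoint id_blinfun (id_blinfun :: 'h::complex_hilbert_space \<Rightarrow>\<^sub>L 'h)"
  unfolding is_adjoint_def by simp

lemma op_scale_of_real: "op_scale (complex_of_real r) T = r *\<^sub>R T"
  by (rule blinfun_eqI) (simp add: op_scale_apply scaleC_of_real blinfun.scaleR_left)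

lemma is_adjoint_scaleR: "is_adjoint S T \<Longrightarrow> is_adjoint (r *\<^sub>R S) (r *\<^sub>R T)"
  using is_adjoint_op_scale[of S T "complex_of_real r"] by (simp add: op_scale_of_real)

lemma is_adjoint_zero: "is_adjoint 0 (0 :: 'h::complex_hilbert_space \<Rightarrow>\<^sub>L 'h)"
  using is_adjoint_scaleR[OF is_adjoint_id, of 0] by simp

lemma is_adjoint_sum:
  "(\<And>i. i \<in> I \<Longrightarrow> is_adjoint (S i) (T i)) \<Longrightarrow> is_adjoint (sum S I) (sum T I)"
  by (induction I rule: infinite_finite_induct) (auto simp: is_adjoint_zero intro: is_adjoint_add)

lemma complex_linear_ops_apply:
  "T \<in> complex_linear_ops \<Longrightarrow> blinfun_apply T (c *\<^sub>C x) = c *\<^sub>C blinfun_apply T x"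
  by (simp add: complex_linear_ops_def)

text \<open>Riesz only represents the real inner product. Complex linearity of \<open>T\<close>
  recovers the imaginary part, which is the real part after multiplying the second argument by the
  imaginary unit.\<close>

lemma adjoint_exists:
  fixes T :: "'h::complex_hilbert_space \<Rightarrow>\<^sub>L 'h"
  assumes "T \<in> complex_linear_ops"
  obtains S where "S \<in> complex_linear_ops" "is_adjoint S T"
proof -
  have ex: "\<exists>y. \<forall>z. blinfun_apply T z \<bullet> x = z \<bullet> y" for x
  proof -
    have "bounded_linear (\<lambda>z. blinfun_apply T z \<bullet> x)"
      using bounded_linear_compose[OF bounded_linear_inner_left blinfun.bounded_linear_right] .
    from riesz_on_subspace[OF subspace_UNIV closed_UNIV this] show ?thesis by (metis UNIV_I)
  qed
  then obtain s where s: "\<And>x z. blinfun_apply T z \<bullet> x = z \<bullet> s x" by metis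
  have cs: "cinner (s x) y = cinner x (blinfun_apply T y)" for x y
  proof (rule complex_eqI)
    show "Re (cinner (s x) y) = Re (cinner x (blinfun_apply T y))"
      using s by (simp add: Re_cinner inner_commute)
    show "Im (cinner (s x) y) = Im (cinner x (blinfun_apply T y))"
      using s[of "\<i> *\<^sub>C y" x] assms
      by (simp add: Im_cinner complex_linear_ops_apply) (metis inner_commute)
  qed
  have add: "s (x + y) = s x + s y" for x y
    by (rule cinner_eqI_left) (simp add: cs cinner_add_left)
  have sc: "s (c *\<^sub>C x) = c *\<^sub>C s x" for c x
    by (rule cinner_eqI_left) (simp add: cs cinner_scaleC_left)
  have bnd: "norm (s x) \<le> norm x * norm T" for x
  proof -
    have "(norm (s x))\<^sup>2 = blinfun_apply T (s x) \<bullet> x"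
      by (simp add: power2_norm_eq_inner s)
    also have "\<dots> \<le> norm (blinfun_apply T (s x)) * norm x"
      by (rule norm_cauchy_schwarz)
    also have "\<dots> \<le> norm T * norm (s x) * norm x"
      by (intro mult_right_mono norm_blinfun) auto
    finally have "norm (s x) * norm (s x) \<le> norm (s x) * (norm x * norm T)"
      by (simp add: power2_eq_square algebra_simps)
    then show ?thesis
      by (cases "norm (s x) = 0") (auto simp: mult_le_cancel_left)
  qed
  have "bounded_linear s"
    by (rule bounded_linear_intro[where K = "norm T"])
      (auto simp: add bnd sc scaleC_of_real[symmetric])
  then have app: "blinfun_apply (Blinfun s) = s"
    by (rule bounded_linear_Blinfun_apply)
  show thesis
    by (rule that[of "Blinfun s"]) (simp_all add: complex_linear_ops_def app sc is_adjoint_def cs)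
qed

section \<open>The tracial von Neumann algebra\<close>

lemma op_scale_simps:
  "op_scale c (S + T) = op_scale c S + op_scale c T"
  "op_scale (c + d) T = op_scale c T + op_scale d T"
  "op_scale c (S - T) = op_scale c S - op_scale c T"
  "op_scale c (op_scale d T) = op_scale (c * d) T"
  "op_scale c S o\<^sub>L T = op_scale c (S o\<^sub>L T)"
  "op_scale 1 T = T" "op_scale 0 T = 0"
  by (rule blinfun_eqI; simp add: op_scale_apply blinfun.add_left blinfun.diff_left scaleC_add_right
      scaleC_add_left scaleC_scaleC scaleC_diff_right)+

lemma op_scale_zero_right [simp]: "op_scale c 0 = 0"
  using op_scale_simps(3)[of c 0 0] by simp

lemma op_scale_sum: "op_scale c (sum F I) = (\<Sum>i\<in>I. op_scale c (F i))"
  by (induction I rule: infinite_finite_induct) (auto simp: op_scale_simps)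

lemma op_scale_sum_left: "op_scale (sum f I) T = (\<Sum>i\<in>I. op_scale (f i) T)"
  by (induction I rule: infinite_finite_induct) (auto simp: op_scale_simps)

lemma compose_op_scale:
  "S \<in> complex_linear_ops \<Longrightarrow> S o\<^sub>L op_scale c T = op_scale c (S o\<^sub>L T)"
  by (rule blinfun_eqI) (simp add: op_scale_apply complex_linear_ops_apply)

lemmas compose_linear =
  bounded_bilinear.add_left[OF bounded_bilinear_blinfun_compose]
  bounded_bilinear.add_right[OF bounded_bilinear_blinfun_compose]
  bounded_bilinear.diff_left[OF bounded_bilinear_blinfun_compose]
  bounded_bilinear.diff_right[OF bounded_bilinear_blinfun_compose]
  bounded_bilinear.scaleR_left[OF bounded_bilinear_blinfun_compose]
  bounded_bilinear.scaleR_right[OF bounded_bilinear_blinfun_compose]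
  bounded_bilinear.zero_left[OF bounded_bilinear_blinfun_compose]
  bounded_bilinear.zero_right[OF bounded_bilinear_blinfun_compose]

lemmas compose_sum_left = bounded_bilinear.sum_left[OF bounded_bilinear_blinfun_compose]
lemmas compose_sum_right = bounded_bilinear.sum_right[OF bounded_bilinear_blinfun_compose]

lemma compose_id [simp]: "T o\<^sub>L id_blinfun = T" "id_blinfun o\<^sub>L T = T"
  by (rule blinfun_eqI, simp)+

lemma compose_assoc: "(R o\<^sub>L S) o\<^sub>L T = R o\<^sub>L (S o\<^sub>L T)"
  by (rule blinfun_eqI) simp

lemma op_power_add: "op_power T (m + n) = op_power T m o\<^sub>L op_power T n"
  by (induction m) (auto simp: compose_assoc)

lemma op_power_Suc_right: "op_power T (Suc n) = op_power T n o\<^sub>L T"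
  using op_power_add[of T n 1] by simp

lemma is_adjoint_op_power: "is_adjoint T T \<Longrightarrow> is_adjoint (op_power T n) (op_power T n)"
proof (induction n)
  case (Suc n)
  then show ?case
    using is_adjoint_compose[of T T "op_power T n" "op_power T n"]
    by (simp add: op_power_Suc_right[symmetric] del: op_power.simps) (simp add: op_power.simps(2))
qed (simp add: is_adjoint_id)

context tracial_wstar_probability_space
begin

lemma M_linear: "T \<in> M \<Longrightarrow> T \<in> complex_linear_ops"
  using von_neumann by (auto simp: von_neumann_algebra_def)

text \<open>The bicommutant property as a commutation test; closure of \<open>M\<close> under
  algebraic operations and under strong limits is then checked by commuting with
  \<open>commutant M\<close>.\<close>

lemma M_iff: "T \<in> M \<longleftrightarrow> T \<in> complex_linear_ops \<and> (\<forall>S\<in>commutant M. T o\<^sub>L S = S o\<^sub>L T)"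
proof -
  have "T \<in> M \<longleftrightarrow> T \<in> commutant (commutant M)"
    using von_neumann by (simp add: von_neumann_algebra_def)
  then show ?thesis
    unfolding commutant_def[of "commutant M"] by simp
qed

lemma commutantD: "S \<in> commutant M \<Longrightarrow> T \<in> M \<Longrightarrow> T o\<^sub>L S = S o\<^sub>L T"
  by (auto simp: commutant_def)

lemma commutant_linear: "S \<in> commutant M \<Longrightarrow> S \<in> complex_linear_ops"
  by (auto simp: commutant_def)

lemma M_id: "id_blinfun \<in> M"
  by (auto simp: M_iff complex_linear_ops_def)

lemma M_compose: "S \<in> M \<Longrightarrow> T \<in> M \<Longrightarrow> S o\<^sub>L T \<in> M"
  unfolding M_iff by (auto simp: complex_linear_ops_def) (metis compose_assoc)

lemma M_add: "S \<in> M \<Longrightarrow> T \<in> M \<Longrightarrow> S + T \<in> M"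
  unfolding M_iff by (auto simp: complex_linear_ops_def blinfun.add_left scaleC_add_right compose_linear)

lemma M_scale: "T \<in> M \<Longrightarrow> op_scale c T \<in> M"
  unfolding M_iff
  by (simp add: op_scale_simps compose_op_scale commutant_linear)
    (simp add: complex_linear_ops_def op_scale_apply scaleC_scaleC mult.commute)

lemma M_scaleR: "T \<in> M \<Longrightarrow> r *\<^sub>R T \<in> M"
  using M_scale[of T "complex_of_real r"] by (simp add: op_scale_of_real)

lemma M_diff: "S \<in> M \<Longrightarrow> T \<in> M \<Longrightarrow> S - T \<in> M"
  using M_add[of S "(-1) *\<^sub>R T"] M_scaleR[of T "-1"] by simp

lemma M_zero: "0 \<in> M"
  using M_diff[OF M_id M_id] by simp

lemma M_sum: "(\<And>i. i \<in> I \<Longrightarrow> F i \<in> M) \<Longrightarrow> sum F I \<in> M"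
  by (induction I rule: infinite_finite_induct) (auto simp: M_zero M_add)

lemma M_power: "T \<in> M \<Longrightarrow> op_power T n \<in> M"
  by (induction n) (auto simp: M_id M_compose)

lemma M_adjoint: "T \<in> M \<Longrightarrow> op_adj T \<in> M \<and> is_adjoint (op_adj T) T"
  using von_neumann op_adj_eq unfolding von_neumann_algebra_def by metis

lemmas M_intros = M_id M_compose M_add M_scale M_scaleR M_diff M_zero M_sum M_power

lemma state_scaleR: "T \<in> M \<Longrightarrow> \<phi> (r *\<^sub>R T) = of_real r * \<phi> T"
  using state_scale[of T "complex_of_real r"] by (simp add: op_scale_of_real)

lemma state_zero: "\<phi> 0 = 0"
  using state_scaleR[OF M_zero, of 0] by simp

lemma state_diff: "S \<in> M \<Longrightarrow> T \<in> M \<Longrightarrow> \<phi> (S - T) = \<phi> S - \<phi> T"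
  using state_add[of S "(-1) *\<^sub>R T"] state_scaleR[of T "-1"] M_scaleR[of T "-1"] by simp

lemma state_sum: "(\<And>i. i \<in> I \<Longrightarrow> F i \<in> M) \<Longrightarrow> \<phi> (sum F I) = (\<Sum>i\<in>I. \<phi> (F i))"
  by (induction I rule: infinite_finite_induct) (auto simp: state_zero state_add M_sum)

section \<open>The trace norm\<close>

definition \<xi> :: "nat \<Rightarrow> 'h" where
  "\<xi> = (SOME \<xi>. summable (\<lambda>n. (norm (\<xi> n))\<^sup>2) \<and>
      (\<forall>T\<in>M. (\<lambda>n. cinner (\<xi> n) (blinfun_apply T (\<xi> n))) sums \<phi> T))"

lemma \<xi>_summable: "summable (\<lambda>n. (norm (\<xi> n))\<^sup>2)"
  and \<xi>_sums: "T \<in> M \<Longrightarrow> (\<lambda>n. cinner (\<xi> n) (blinfun_apply T (\<xi> n))) sums \<phi> T"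
  using someI_ex[OF normal, folded \<xi>_def] by auto

text \<open>The squared trace norm, expressed through the vectors of the state and not through an
  adjoint: it is visibly real and nonnegative, makes sense for every bounded operator, and can be
  handled by partial sums.\<close>

definition nrm2 :: "('h \<Rightarrow>\<^sub>L 'h) \<Rightarrow> real" where
  "nrm2 T = (\<Sum>n. (norm (blinfun_apply T (\<xi> n)))\<^sup>2)"

lemma state_adjoint_sums:
  assumes "S' \<in> M" "T \<in> M" "is_adjoint S' S"
  shows "(\<lambda>n. cinner (blinfun_apply S (\<xi> n)) (blinfun_apply T (\<xi> n))) sums \<phi> (S' o\<^sub>L T)"
  using \<xi>_sums[OF M_compose[OF assms(1,2)]] is_adjoint_sym[OF assms(3)]
  by (simp add: is_adjoint_def)

lemma nrm2_sums: "(\<lambda>n. (norm (blinfun_apply T (\<xi> n)))\<^sup>2) sums nrm2 T"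
proof -
  have "summable (\<lambda>n. (norm T)\<^sup>2 * (norm (\<xi> n))\<^sup>2)"
    by (intro summable_mult \<xi>_summable)
  then have "summable (\<lambda>n. (norm (blinfun_apply T (\<xi> n)))\<^sup>2)"
    by (rule summable_comparison_test[rotated])
      (auto simp: power_mult_distrib[symmetric] intro!: power_mono norm_blinfun)
  then show ?thesis by (simp add: nrm2_def summable_sums)
qed

lemma nrm2_nonneg: "nrm2 T \<ge> 0"
  unfolding nrm2_def using nrm2_sums by (intro suminf_nonneg) (auto simp: sums_iff)

lemma state_nrm2:
  assumes "T \<in> M" "S \<in> M" "is_adjoint S T"
  shows "\<phi> (S o\<^sub>L T) = of_real (nrm2 T)"
proof -
  have "(\<lambda>n. cinner (blinfun_apply T (\<xi> n)) (blinfun_apply T (\<xi> n))) sums of_real (nrm2 T)"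
    unfolding cinner_self by (intro sums_of_real nrm2_sums)
  then show ?thesis
    using state_adjoint_sums[OF assms(2,1,3)] sums_unique2 by blast
qed

lemma state_op_adj: "T \<in> M \<Longrightarrow> \<phi> (op_adj T o\<^sub>L T) = of_real (nrm2 T)"
  using state_nrm2 M_adjoint by blast

lemma nrm2_eq_0: "T \<in> M \<Longrightarrow> nrm2 T = 0 \<Longrightarrow> T = 0"
  using faithful state_op_adj by fastforce

text \<open>Here traciality enters. It makes multiplication from the right as harmless for the trace
  norm as multiplication from the left.\<close>

lemma nrm2_adjoint: "T \<in> M \<Longrightarrow> S \<in> M \<Longrightarrow> is_adjoint S T \<Longrightarrow> nrm2 S = nrm2 T"
  using state_nrm2[of T S] state_nrm2[of S T] tracial[of S T] is_adjoint_sym[of S T] by simp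

lemma nrm2_add: "nrm2 (S + T) \<le> 2 * nrm2 S + 2 * nrm2 T"
proof (rule sums_le[OF _ nrm2_sums sums_add[OF sums_mult[OF nrm2_sums] sums_mult[OF nrm2_sums]]])
  fix n
  define a b where "a = norm (blinfun_apply S (\<xi> n))" and "b = norm (blinfun_apply T (\<xi> n))"
  have "(norm (blinfun_apply (S + T) (\<xi> n)))\<^sup>2 \<le> (a + b)\<^sup>2"
    unfolding a_def b_def by (intro power_mono) (auto simp: blinfun.add_left norm_triangle_ineq)
  also have "\<dots> \<le> 2 * a\<^sup>2 + 2 * b\<^sup>2"
    using zero_le_power2[of "a - b"] by (simp add: power2_sum power2_diff)
  finally show "(norm (blinfun_apply (S + T) (\<xi> n)))\<^sup>2 \<le> 2 * a\<^sup>2 + 2 * b\<^sup>2" .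
qed

lemma nrm2_minus_commute: "nrm2 (S - T) = nrm2 (T - S)"
  by (simp add: nrm2_def blinfun.diff_left norm_minus_commute)

lemma nrm2_compose: "nrm2 (S o\<^sub>L T) \<le> (norm S)\<^sup>2 * nrm2 T"
  by (rule sums_le[OF _ nrm2_sums sums_mult[OF nrm2_sums]])
    (auto simp: power_mult_distrib[symmetric] intro!: power_mono norm_blinfun)

text \<open>Cauchy-Schwarz is applied twice, in the Hilbert space and over the index of the trace
  vectors. Working with partial sums reduces the second use to finite sums.\<close>

lemma state_cauchy_schwarz:
  assumes "S' \<in> M" "T \<in> M" "is_adjoint S' S"
  shows "cmod (\<phi> (S' o\<^sub>L T)) \<le> sqrt (nrm2 S) * sqrt (nrm2 T)"
proof -
  let ?s = "\<lambda>n. norm (blinfun_apply S (\<xi> n))" and ?t = "\<lambda>n. norm (blinfun_apply T (\<xi> n))"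
  have "cmod (\<Sum>i<n. cinner (blinfun_apply S (\<xi> i)) (blinfun_apply T (\<xi> i)))
      \<le> sqrt (nrm2 S) * sqrt (nrm2 T)" for n
  proof -
    have le: "L2_set (\<lambda>i. norm (blinfun_apply R (\<xi> i))) {..<n} \<le> sqrt (nrm2 R)" for R
      unfolding L2_set_def using nrm2_sums[of R]
      by (intro real_sqrt_le_mono) (auto simp: sums_iff nrm2_def intro!: sum_le_suminf)
    have "cmod (\<Sum>i<n. cinner (blinfun_apply S (\<xi> i)) (blinfun_apply T (\<xi> i))) \<le> (\<Sum>i<n. ?s i * ?t i)"
      by (intro order.trans[OF norm_sum] sum_mono norm_cinner)
    also have "\<dots> = (\<Sum>i<n. \<bar>?s i\<bar> * \<bar>?t i\<bar>)" by simp
    also have "\<dots> \<le> L2_set ?s {..<n} * L2_set ?t {..<n}"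
      by (rule L2_set_mult_ineq)
    also have "\<dots> \<le> sqrt (nrm2 S) * sqrt (nrm2 T)"
      by (intro mult_mono le L2_set_nonneg) (simp add: nrm2_nonneg)
    finally show ?thesis .
  qed
  moreover have "(\<lambda>n. cmod (\<Sum>i<n. cinner (blinfun_apply S (\<xi> i)) (blinfun_apply T (\<xi> i))))
      \<longlonglongrightarrow> cmod (\<phi> (S' o\<^sub>L T))"
    using state_adjoint_sums[OF assms] by (intro tendsto_norm) (simp add: sums_def)
  ultimately show ?thesis
    by (intro LIMSEQ_le_const2) auto
qed

lemma nrm2_id: "nrm2 id_blinfun = 1"
  using state_nrm2[OF M_id M_id is_adjoint_id] by (simp add: state_unit)

lemma state_le_nrm2: "T \<in> M \<Longrightarrow> cmod (\<phi> T) \<le> sqrt (nrm2 T)"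
  using state_cauchy_schwarz[OF M_id _ is_adjoint_id, of T] by (simp add: nrm2_id)

end

section \<open>The commutant orbit of the trace vectors and operator norms\<close>

lemma subspace_closure:
  fixes S :: "'a::real_normed_vector set"
  assumes "subspace S"
  shows "subspace (closure S)"
  unfolding subspace_def
proof (intro conjI allI impI ballI)
  show "0 \<in> closure S"
    using subspace_0[OF assms] closure_subset by blast
next
  fix u v assume "u \<in> closure S" "v \<in> closure S"
  then obtain x y where "\<And>n. x n \<in> S" "x \<longlonglongrightarrow> u" "\<And>n. y n \<in> S" "y \<longlonglongrightarrow> v"
    unfolding closure_sequential by metis
  then show "u + v \<in> closure S"
    unfolding closure_sequential using subspace_add[OF assms]
    by (intro exI[of _ "\<lambda>n. x n + y n"]) (auto intro: tendsto_add)
next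
  fix c v assume "v \<in> closure S"
  then obtain x where "\<And>n. x n \<in> S" "x \<longlonglongrightarrow> v"
    unfolding closure_sequential by metis
  then show "c *\<^sub>R v \<in> closure S"
    unfolding closure_sequential using subspace_scale[OF assms]
    by (intro exI[of _ "\<lambda>n. c *\<^sub>R x n"]) (auto intro: tendsto_scaleR)
qed

context tracial_wstar_probability_space
begin

lemma commutant_id: "id_blinfun \<in> commutant M"
  by (simp add: commutant_def complex_linear_ops_def)

lemma commutant_compose: "S \<in> commutant M \<Longrightarrow> T \<in> commutant M \<Longrightarrow> S o\<^sub>L T \<in> commutant M"
  by (simp add: commutant_def complex_linear_ops_def) (simp add: compose_assoc, simp flip: compose_assoc)

lemma commutant_scale_id: "op_scale c id_blinfun \<in> commutant M"
proof -
  have "op_scale c id_blinfun o\<^sub>L T = T o\<^sub>L op_scale c id_blinfun" if "T \<in> M" for T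
    using that by (simp add: op_scale_simps compose_op_scale M_linear)
  then show ?thesis
    by (simp add: commutant_def complex_linear_ops_def op_scale_apply scaleC_scaleC mult.commute)
qed

text \<open>Take adjoints in the relation that \<open>S\<close> commutes with the adjoint of
  \<open>T\<close>, which again lies in \<open>M\<close>.\<close>

lemma commutant_adjoint:
  assumes "S \<in> commutant M"
  obtains S' where "S' \<in> commutant M" "is_adjoint S' S"
proof -
  obtain S' where S': "S' \<in> complex_linear_ops" "is_adjoint S' S"
    using adjoint_exists[OF commutant_linear[OF assms]] by blast
  have "S' o\<^sub>L T = T o\<^sub>L S'" if "T \<in> M" for T
  proof -
    from M_adjoint[OF that] have T': "op_adj T \<in> M" "is_adjoint (op_adj T) T" by auto
    have "is_adjoint (S' o\<^sub>L T) (op_adj T o\<^sub>L S)"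
      by (intro is_adjoint_compose S' is_adjoint_sym[OF T'(2)])
    moreover have "is_adjoint (T o\<^sub>L S') (S o\<^sub>L op_adj T)"
      by (intro is_adjoint_compose S' is_adjoint_sym[OF T'(2)])
    ultimately show ?thesis
      using commutantD[OF assms T'(1)] is_adjoint_unique by metis
  qed
  then have "S' \<in> commutant M"
    using S'(1) by (simp add: commutant_def)
  then show thesis
    using S'(2) that by blast
qed

text \<open>On these vectors an element of \<open>M\<close> is controlled by its trace norm: it
  commutes past \<open>S\<close> and then hits a trace vector.\<close>

definition commutant_orbit :: "'h set" where
  "commutant_orbit = {blinfun_apply S (\<xi> n) |S n. S \<in> commutant M}"

lemma commutant_invariant:
  assumes "S \<in> commutant M" "x \<in> closure (span commutant_orbit)"
  shows "blinfun_apply S x \<in> closure (span commutant_orbit)"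
proof -
  have "blinfun_apply S y \<in> span commutant_orbit" if "y \<in> span commutant_orbit" for y
    using that
  proof (induction y rule: span_induct_alt)
    case base
    then show ?case by (simp add: span_zero)
  next
    case (step c x y)
    then obtain T n where x: "x = blinfun_apply T (\<xi> n)" "T \<in> commutant M"
      by (auto simp: commutant_orbit_def)
    then have "blinfun_apply S x \<in> commutant_orbit"
      unfolding commutant_orbit_def using commutant_compose[OF assms(1) x(2)]
      by (auto intro!: exI[of _ "S o\<^sub>L T"])
    with step show ?case
      by (simp add: blinfun.add_right blinfun.scaleR_right span_add span_scale span_base)
  qed
  then have "blinfun_apply S ` closure (span commutant_orbit) \<subseteq> closure (span commutant_orbit)"
    using closure_subset
    by (intro image_closure_subset linear_continuous_on blinfun.bounded_linear_right) auto
  then show ?thesis using assms(2) by auto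
qed

text \<open>The projection onto the closed span of the orbit lies in the bicommutant, and its
  complement is annihilated by the trace vectors; faithfulness then makes the orbit total.\<close>

lemma closure_span_commutant_orbit: "closure (span commutant_orbit) = UNIV"
proof -
  define V where "V = closure (span commutant_orbit)"
  have V: "subspace V" "closed V"
    by (simp_all add: V_def subspace_closure)
  have inv: "blinfun_apply S x \<in> V" if "S \<in> commutant M" "x \<in> V" for S x
    using commutant_invariant that by (simp add: V_def)
  have "\<exists>y\<in>V. \<forall>z\<in>V. z \<bullet> x = z \<bullet> y" for x
    using riesz_on_subspace[OF V bounded_linear_inner_left[of x]] by metis
  then obtain p where p: "\<And>x. p x \<in> V" "\<And>x z. z \<in> V \<Longrightarrow> z \<bullet> x = z \<bullet> p x" by metis
  \<comment> \<open>This characterisation of the projection carries all that follows: additivity and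
    commutation with the commutant are both uniqueness statements.\<close>
  have uniq: "p x = y" if "y \<in> V" "\<And>z. z \<in> V \<Longrightarrow> z \<bullet> x = z \<bullet> y" for x y
  proof -
    have "p x - y \<in> V" using p(1) that(1) V(1) by (simp add: subspace_diff)
    then have "(p x - y) \<bullet> (p x - y) = 0"
      using p(2)[of "p x - y" x] that(2)[of "p x - y"] by (simp add: inner_diff_right)
    then show ?thesis by simp
  qed
  have comm: "p (blinfun_apply S x) = blinfun_apply S (p x)" if S: "S \<in> commutant M" for S x
  proof (rule uniq)
    show "blinfun_apply S (p x) \<in> V" using inv[OF S p(1)] .
    fix z assume "z \<in> V"
    obtain S' where S': "S' \<in> commutant M" "is_adjoint S' S"
      using commutant_adjoint[OF S] by blast
    have adj: "z \<bullet> blinfun_apply S w = blinfun_apply S' z \<bullet> w" for w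
      using S'(2) by (simp add: Re_cinner[symmetric] is_adjoint_def)
    show "z \<bullet> blinfun_apply S x = z \<bullet> blinfun_apply S (p x)"
      using p(2)[OF inv[OF S'(1) \<open>z \<in> V\<close>]] by (simp add: adj)
  qed
  have add: "p (x + y) = p x + p y" for x y
    by (rule uniq) (simp_all add: subspace_add V(1) p(1) inner_add_right flip: p(2))
  \<comment> \<open>Complex homogeneity is commutation with a scalar operator, which lies in the
    commutant.\<close>
  have sc: "p (c *\<^sub>C x) = c *\<^sub>C p x" for c x
    using comm[OF commutant_scale_id, of c x] by (simp add: op_scale_apply)
  have bnd: "norm (p x) \<le> norm x * 1" for x
  proof -
    have "norm (p x) * norm (p x) = p x \<bullet> x"
      using p(2)[OF p(1), of x x] by (simp add: power2_norm_eq_inner[symmetric] power2_eq_square)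
    also have "\<dots> \<le> norm (p x) * norm x" by (rule norm_cauchy_schwarz)
    finally show ?thesis by (cases "norm (p x) = 0") (auto simp: mult_le_cancel_left)
  qed
  have "bounded_linear p"
    by (rule bounded_linear_intro[OF add _ bnd]) (metis sc scaleC_of_real)
  then have app: "blinfun_apply (Blinfun p) = p"
    by (rule bounded_linear_Blinfun_apply)
  have PM: "Blinfun p \<in> M"
    unfolding M_iff by (auto simp: complex_linear_ops_def app sc comm intro!: blinfun_eqI)
  have "\<xi> n \<in> commutant_orbit" for n
    unfolding commutant_orbit_def using commutant_id by (auto intro!: exI[of _ "id_blinfun"])
  then have "\<xi> n \<in> V" for n
    unfolding V_def by (meson closure_subset span_superset subsetD)
  then have "p (\<xi> n) = \<xi> n" for n
    by (intro uniq) auto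
  then have "nrm2 (id_blinfun - Blinfun p) = 0"
    by (simp add: nrm2_def app blinfun.diff_left)
  then have "id_blinfun = Blinfun p"
    using nrm2_eq_0[OF M_diff[OF M_id PM]] by simp
  then have "p x = x" for x
    using app by (metis blinfun_apply_id_blinfun id_apply)
  then show ?thesis
    using p(1) unfolding V_def by (metis UNIV_eq_I)
qed

lemma nrm2_term: "norm (blinfun_apply T (\<xi> n)) \<le> sqrt (nrm2 T)"
proof -
  have "(norm (blinfun_apply T (\<xi> n)))\<^sup>2 \<le> nrm2 T"
    using nrm2_sums[of T] sum_le_suminf[of "\<lambda>n. (norm (blinfun_apply T (\<xi> n)))\<^sup>2" "{n}"]
    by (auto simp: sums_iff nrm2_def)
  then show ?thesis by (simp add: real_le_rsqrt)
qed

lemma orbit_bound: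
  assumes "T \<in> M" "S \<in> commutant M"
  shows "norm (blinfun_apply T (blinfun_apply S (\<xi> n))) \<le> norm S * sqrt (nrm2 T)"
proof -
  have "blinfun_apply T (blinfun_apply S (\<xi> n)) = blinfun_apply S (blinfun_apply T (\<xi> n))"
    using commutantD[OF assms(2,1)] by (metis blinfun_apply_blinfun_compose)
  also have "norm \<dots> \<le> norm S * sqrt (nrm2 T)"
    by (intro order.trans[OF norm_blinfun] mult_left_mono nrm2_term) auto
  finally show ?thesis .
qed

text \<open>The operator norm of a self-adjoint element is the growth rate of its even moments,
  because \<open>m \<mapsto> norm (X\<^sup>m v)\<close> is logarithmically convex.\<close>

lemma norm_le_moment_growth:
  assumes X: "X \<in> M" "is_adjoint X X" and "K \<ge> 0"
    and mom: "\<And>m. cmod (\<phi> (op_power X (2 * m))) \<le> K ^ (2 * m)"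
  shows "norm X \<le> K"
proof -
  define a where "a v m = norm (blinfun_apply (op_power X m) v)" for v m
  have pw: "is_adjoint (op_power X m) (op_power X m)" "op_power X m \<in> M" for m
    using is_adjoint_op_power[OF X(2)] M_power[OF X(1)] by auto
  have nrm: "sqrt (nrm2 (op_power X m)) \<le> K ^ m" for m
  proof -
    have "\<phi> (op_power X (2 * m)) = of_real (nrm2 (op_power X m))"
      using state_nrm2[OF pw(2,2,1)] op_power_add[of X m m] by (simp add: mult_2)
    then have "nrm2 (op_power X m) \<le> (K ^ m)\<^sup>2"
      using mom[of m] nrm2_nonneg[of "op_power X m"]
      by (simp add: power_mult[symmetric] mult.commute)
    then show ?thesis
      using \<open>K \<ge> 0\<close> by (simp add: real_le_lsqrt nrm2_nonneg)
  qed
  \<comment> \<open>The constant depends on \<open>v\<close>, which is harmless: only the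
    exponential rate is compared later.\<close>
  have growth: "\<exists>c. \<forall>m. a v m \<le> c * K ^ m" if "v \<in> span commutant_orbit" for v
    using that
  proof (induction v rule: span_induct_alt)
    case base
    show ?case by (auto simp: a_def intro!: exI[of _ 0])
  next
    case (step r x y)
    obtain S n where x: "x = blinfun_apply S (\<xi> n)" "S \<in> commutant M"
      using step(1) by (auto simp: commutant_orbit_def)
    obtain c where c: "\<And>m. a y m \<le> c * K ^ m" using step(2) by blast
    have ax: "a x m \<le> norm S * K ^ m" for m
      unfolding a_def x(1)
      by (rule order.trans[OF orbit_bound[OF pw(2) x(2)]]) (intro mult_left_mono nrm norm_ge_zero)
    have "a (r *\<^sub>R x + y) m \<le> (\<bar>r\<bar> * norm S + c) * K ^ m" for m
    proof -
      have "a (r *\<^sub>R x + y) m \<le> \<bar>r\<bar> * a x m + a y m"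
        unfolding a_def blinfun.add_right blinfun.scaleR_right
        by (rule order.trans[OF norm_triangle_ineq]) simp
      also have "\<dots> \<le> \<bar>r\<bar> * (norm S * K ^ m) + c * K ^ m"
        by (intro add_mono c mult_left_mono ax) auto
      finally show ?thesis by (simp add: algebra_simps)
    qed
    then show ?case by blast
  qed
  have convex: "(a v (Suc m))\<^sup>2 \<le> a v m * a v (Suc (Suc m))" for v m
  proof -
    let ?u = "\<lambda>m. blinfun_apply (op_power X m) v"
    have "(a v (Suc m))\<^sup>2 = ?u (Suc m) \<bullet> ?u (Suc m)"
      by (simp add: a_def power2_norm_eq_inner)
    also have "\<dots> = Re (cinner (blinfun_apply X (?u m)) (?u (Suc m)))"
      by (simp add: Re_cinner)
    also have "\<dots> = ?u m \<bullet> ?u (Suc (Suc m))"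
      using X(2) unfolding is_adjoint_def by (simp add: Re_cinner)
    also have "\<dots> \<le> a v m * a v (Suc (Suc m))"
      unfolding a_def by (rule norm_cauchy_schwarz)
    finally show ?thesis .
  qed
  have bound: "norm (blinfun_apply X v) \<le> K * norm v" if v: "v \<in> span commutant_orbit" for v
  proof (rule ccontr)
    assume "\<not> ?thesis"
    then have less: "K * a v 0 < a v 1" by (simp add: a_def)
    then have pos: "a v 0 > 0"
      by (cases "v = 0") (auto simp: a_def)
    \<comment> \<open>If \<open>X\<close> stretches \<open>v\<close> by a factor \<rho> above
      \<open>K\<close>, logarithmic convexity forbids later factors to be smaller, so the powers
      grow at least like those of \<rho>, against \<open>growth\<close>.\<close>
    define \<rho> where "\<rho> = a v 1 / a v 0"
    have "\<rho> > K" using less pos by (simp add: \<rho>_def field_simps)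
    then have "\<rho> > 0" using \<open>K \<ge> 0\<close> by simp
    have step: "a v m > 0 \<and> a v (Suc m) \<ge> \<rho> * a v m" for m
    proof (induction m)
      case 0
      then show ?case using pos by (simp add: \<rho>_def)
    next
      case (Suc m)
      then have "a v (Suc m) > 0"
        using \<open>\<rho> > 0\<close> by (meson mult_pos_pos order_less_le_trans)
      moreover have "\<rho> * a v (Suc m) * a v m \<le> a v (Suc m) * a v (Suc m)"
        using Suc calculation by (simp add: mult.assoc mult.left_commute mult_left_mono)
      then have "\<rho> * a v (Suc m) * a v m \<le> a v (Suc (Suc m)) * a v m"
        using convex[of v m] by (simp add: power2_eq_square mult.commute)
      ultimately show ?case using Suc by (simp add: mult_le_cancel_right)
    qed
    have lower: "\<rho> ^ m * a v 0 \<le> a v m" for m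
    proof (induction m)
      case (Suc m)
      have "\<rho> ^ Suc m * a v 0 \<le> \<rho> * a v m"
        using Suc \<open>\<rho> > 0\<close> by (simp add: mult.assoc)
      then show ?case using step[of m] by linarith
    qed simp
    obtain c where c: "\<And>m. a v m \<le> c * K ^ m" using growth[OF v] by blast
    show False
    proof (cases "K = 0")
      case True
      then show False using lower[of 1] c[of 1] \<open>\<rho> > 0\<close> pos
        by (simp add: mult_pos_pos not_le[symmetric]) (meson mult_pos_pos not_le order.trans)
    next
      case False
      then have "K > 0" using \<open>K \<ge> 0\<close> by simp
      then obtain m where m: "c / a v 0 < (\<rho> / K) ^ m"
        using real_arch_pow[of "\<rho> / K"] \<open>\<rho> > K\<close> by auto
      have "c * K ^ m < \<rho> ^ m * a v 0"
        using m pos \<open>K > 0\<close> by (simp add: power_divide field_simps)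
      then show False using lower[of m] c[of m] by linarith
    qed
  qed
  have "closed {v. norm (blinfun_apply X v) \<le> K * norm v}"
    by (intro closed_Collect_le continuous_intros)
  then have "closure (span commutant_orbit) \<subseteq> {v. norm (blinfun_apply X v) \<le> K * norm v}"
    using bound by (intro closure_minimal) auto
  then show ?thesis
    using \<open>K \<ge> 0\<close> closure_span_commutant_orbit
    by (intro norm_blinfun_bound) auto
qed

text \<open>Such a sequence converges strongly: on the commutant orbit by
  \<open>orbit_bound\<close>, elsewhere by density and the uniform operator bound. The strong limit
  still commutes with the commutant and therefore belongs to \<open>M\<close>; without the bound the
  limit could be an unbounded operator.\<close>

lemma bounded_nrm2_Cauchy_limit:
  assumes X: "\<And>j. X j \<in> M" "\<And>j. is_adjoint (X j) (X j)" "\<And>j. norm (X j) \<le> K"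
    and Cauchy: "\<And>e. e > 0 \<Longrightarrow> \<exists>J. \<forall>i\<ge>J. \<forall>j\<ge>J. nrm2 (X i - X j) < e"
  obtains Y where "Y \<in> M" "is_adjoint Y Y" "norm Y \<le> K" "(\<lambda>j. nrm2 (X j - Y)) \<longlonglongrightarrow> 0"
proof -
  let ?x = "\<lambda>v j. blinfun_apply (X j) v"
  have "K \<ge> 0" using X(3)[of 0] norm_ge_zero order.trans by blast
  have Xb: "norm (?x v j) \<le> K * norm v" for v j
    by (intro order.trans[OF norm_blinfun] mult_right_mono X) auto
  have C1: "Cauchy (?x v)" if "v \<in> span commutant_orbit" for v
    using that
  proof (induction v rule: span_induct_alt)
    case base
    then show ?case by (simp add: convergent_Cauchy convergent_const)
  next
    case (step r x y)
    obtain S n where x: "x = blinfun_apply S (\<xi> n)" "S \<in> commutant M"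
      using step(1) by (auto simp: commutant_orbit_def)
    have "Cauchy (?x x)"
    proof (rule metric_CauchyI)
      fix e :: real assume "e > 0"
      obtain J where J: "\<forall>i\<ge>J. \<forall>j\<ge>J. nrm2 (X i - X j) < (e / (norm S + 1))\<^sup>2"
        using Cauchy[of "(e / (norm S + 1))\<^sup>2"] \<open>e > 0\<close>
        by (metis add_nonneg_pos divide_pos_pos norm_ge_zero zero_less_one zero_less_power)
      have "dist (?x x i) (?x x j) < e" if "i \<ge> J" "j \<ge> J" for i j
      proof -
        have s1: "norm S + 1 > 0" by (simp add: add_nonneg_pos)
        have "dist (?x x i) (?x x j) = norm (blinfun_apply (X i - X j) x)"
          by (simp add: dist_norm blinfun.diff_left)
        also have "\<dots> \<le> norm S * sqrt (nrm2 (X i - X j))"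
          unfolding x(1) by (intro orbit_bound x M_diff X)
        also have "\<dots> \<le> norm S * (e / (norm S + 1))"
          using J that \<open>e > 0\<close> s1
          by (intro mult_left_mono real_le_lsqrt) (auto simp: less_imp_le nrm2_nonneg)
        also have "\<dots> < e"
          using \<open>e > 0\<close> s1 by (simp add: field_simps)
        finally show ?thesis .
      qed
      then show "\<exists>J. \<forall>i\<ge>J. \<forall>j\<ge>J. dist (?x x i) (?x x j) < e" by blast
    qed
    then have "convergent (\<lambda>j. r *\<^sub>R ?x x j + ?x y j)"
      using step(2) unfolding Cauchy_convergent_iff
      by (intro convergent_add) (auto simp: convergent_def intro: tendsto_scaleR[OF tendsto_const])
    then show ?case
      by (simp add: blinfun.add_right blinfun.scaleR_right Cauchy_convergent_iff)
  qed
  have "Cauchy (?x v)" for v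
  proof (rule metric_CauchyI)
    fix e :: real assume "e > 0"
    \<comment> \<open>A third of \<open>e\<close> for each leg of the triangle inequality;
      \<open>K + 1\<close> in place of \<open>K\<close> covers \<open>K = 0\<close>.\<close>
    define d where "d = e / (3 * (K + 1))"
    have "d > 0" using \<open>e > 0\<close> \<open>K \<ge> 0\<close> by (simp add: d_def)
    obtain w where w: "w \<in> span commutant_orbit" "dist w v < d"
      using closure_span_commutant_orbit \<open>d > 0\<close> closure_approachable by (metis UNIV_I)
    obtain J where J: "\<And>i j. i \<ge> J \<Longrightarrow> j \<ge> J \<Longrightarrow> dist (?x w i) (?x w j) < e / 3"
      using metric_CauchyD[OF C1[OF w(1)], of "e / 3"] \<open>e > 0\<close> by auto
    have near: "dist (?x v i) (?x w i) < e / 3" for i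
    proof -
      have "dist (?x v i) (?x w i) \<le> K * dist w v"
        using Xb[of i "v - w"] by (simp add: dist_norm blinfun.diff_right norm_minus_commute)
      also have "\<dots> \<le> K * d"
        using w(2) \<open>K \<ge> 0\<close> by (intro mult_left_mono) auto
      also have "\<dots> < e / 3"
        using \<open>e > 0\<close> \<open>K \<ge> 0\<close> by (simp add: d_def field_simps)
      finally show ?thesis .
    qed
    have "dist (?x v i) (?x v j) < e" if "i \<ge> J" "j \<ge> J" for i j
      using near[of i] near[of j] J[OF that]
        dist_triangle[of "?x v i" "?x v j" "?x w i"] dist_triangle[of "?x w i" "?x v j" "?x w j"]
      by (simp add: dist_commute)
    then show "\<exists>J. \<forall>i\<ge>J. \<forall>j\<ge>J. dist (?x v i) (?x v j) < e" by blast
  qed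
  then obtain y where y: "\<And>v. ?x v \<longlonglongrightarrow> y v"
    unfolding Cauchy_convergent_iff convergent_def by metis
  have add: "y (v + w) = y v + y w" for v w
    using tendsto_add[OF y[of v] y[of w]] y[of "v + w"]
    by (intro LIMSEQ_unique[OF y[of "v + w"]]) (simp add: blinfun.add_right)
  have sc: "y (c *\<^sub>C v) = c *\<^sub>C y v" for c v
  proof (rule LIMSEQ_unique[OF y])
    have "(\<lambda>j. blinfun_apply (op_scale c id_blinfun) (?x v j))
        \<longlonglongrightarrow> blinfun_apply (op_scale c id_blinfun) (y v)"
      by (intro tendsto_intros y)
    then show "(\<lambda>j. ?x (c *\<^sub>C v) j) \<longlonglongrightarrow> c *\<^sub>C y v"
      by (simp add: op_scale_apply complex_linear_ops_apply M_linear X)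
  qed
  have bnd: "norm (y v) \<le> norm v * K" for v
    using tendsto_norm[OF y[of v]] Xb[of _ v] by (intro LIMSEQ_le_const2) (auto simp: mult.commute)
  have "bounded_linear y"
    by (rule bounded_linear_intro[OF add _ bnd]) (metis sc scaleC_of_real)
  then have app: "blinfun_apply (Blinfun y) = y"
    by (rule bounded_linear_Blinfun_apply)
  have "y (blinfun_apply S v) = blinfun_apply S (y v)" if "S \<in> commutant M" for S v
  proof (rule LIMSEQ_unique[OF y])
    have "(\<lambda>j. blinfun_apply S (?x v j)) \<longlonglongrightarrow> blinfun_apply S (y v)"
      by (intro tendsto_intros y)
    then show "?x (blinfun_apply S v) \<longlonglongrightarrow> blinfun_apply S (y v)"
      using commutantD[OF that X(1)] by (metis (no_types, lifting) blinfun_apply_blinfun_compose tendsto_cong_limit ext)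
  qed
  then have YM: "Blinfun y \<in> M"
    unfolding M_iff by (auto simp: complex_linear_ops_def app sc intro!: blinfun_eqI)
  have sa: "is_adjoint (Blinfun y) (Blinfun y)"
    unfolding is_adjoint_def app
  proof (intro allI complex_eqI)
    fix v w
    have inn: "y v \<bullet> w = v \<bullet> y w" for v w
    proof (rule LIMSEQ_unique)
      show "(\<lambda>j. ?x v j \<bullet> w) \<longlonglongrightarrow> y v \<bullet> w" by (intro tendsto_intros y)
      have "?x v j \<bullet> w = v \<bullet> ?x w j" for j
        using X(2)[of j] by (simp add: Re_cinner[symmetric] is_adjoint_def)
      then show "(\<lambda>j. ?x v j \<bullet> w) \<longlonglongrightarrow> v \<bullet> y w" by (auto intro!: tendsto_intros y)
    qed
    show "Re (cinner (y v) w) = Re (cinner v (y w))" by (simp add: Re_cinner inn)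
    show "Im (cinner (y v) w) = Im (cinner v (y w))" by (simp add: Im_cinner inn sc[symmetric])
  qed
  have "(\<lambda>j. nrm2 (X j - Blinfun y)) \<longlonglongrightarrow> 0"
  proof (rule LIMSEQ_I)
    fix e :: real assume "e > 0"
    then obtain J where J: "\<And>i j. i \<ge> J \<Longrightarrow> j \<ge> J \<Longrightarrow> nrm2 (X i - X j) < e / 2"
      using Cauchy[of "e / 2"] by auto
    \<comment> \<open>A Fatou argument: strong convergence passes to each finite partial sum of the
      trace norm, and the bound is independent of its length.\<close>
    have "nrm2 (X i - Blinfun y) \<le> e / 2" if "i \<ge> J" for i
    proof (unfold nrm2_def, rule suminf_le_const)
      show "summable (\<lambda>n. (norm (blinfun_apply (X i - Blinfun y) (\<xi> n)))\<^sup>2)"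
        using nrm2_sums sums_iff by blast
      fix n
      have "(\<lambda>j. \<Sum>k<n. (norm (?x (\<xi> k) i - ?x (\<xi> k) j))\<^sup>2)
          \<longlonglongrightarrow> (\<Sum>k<n. (norm (?x (\<xi> k) i - y (\<xi> k)))\<^sup>2)"
        by (intro tendsto_intros y)
      moreover have "(\<Sum>k<n. (norm (?x (\<xi> k) i - ?x (\<xi> k) j))\<^sup>2) \<le> e / 2" if "j \<ge> J" for j
      proof -
        have "(\<Sum>k<n. (norm (?x (\<xi> k) i - ?x (\<xi> k) j))\<^sup>2) \<le> nrm2 (X i - X j)"
          using nrm2_sums[of "X i - X j"]
            sum_le_suminf[of "\<lambda>k. (norm (blinfun_apply (X i - X j) (\<xi> k)))\<^sup>2" "{..<n}"]
          by (simp add: sums_iff blinfun.diff_left)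
        then show ?thesis using J[OF \<open>i \<ge> J\<close> that] by simp
      qed
      ultimately have "(\<Sum>k<n. (norm (?x (\<xi> k) i - y (\<xi> k)))\<^sup>2) \<le> e / 2"
        by - (rule LIMSEQ_le_const2, assumption, blast)
      then show "(\<Sum>k<n. (norm (blinfun_apply (X i - Blinfun y) (\<xi> k)))\<^sup>2) \<le> e / 2"
        by (simp add: blinfun.diff_left app)
    qed
    then show "\<exists>J. \<forall>i\<ge>J. norm (nrm2 (X i - Blinfun y) - 0) < e"
      using \<open>e > 0\<close> nrm2_nonneg by (intro exI[of _ J]) force
  qed
  moreover have "norm (Blinfun y) \<le> K"
    using bnd \<open>K \<ge> 0\<close> by (intro norm_blinfun_bound) (auto simp: app mult.commute)
  ultimately show thesis using that YM sa by blast
qed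

text \<open>Telescoping: the difference of powers of order \<open>m + 1\<close> is
  \<open>X j\<close> times the difference of order \<open>m\<close>, plus \<open>X j - Y\<close>
  times a power of \<open>Y\<close>. The first term uses the uniform operator bound; in the second,
  \<open>nrm2_adjoint\<close> moves the power of \<open>Y\<close> to the left, where its operator
  norm counts.\<close>

lemma state_power_tendsto:
  assumes X: "\<And>j. X j \<in> M" "\<And>j. is_adjoint (X j) (X j)" "\<And>j. norm (X j) \<le> K"
    and Y: "Y \<in> M" "is_adjoint Y Y" and lim: "(\<lambda>j. nrm2 (X j - Y)) \<longlonglongrightarrow> 0"
  shows "(\<lambda>j. \<phi> (op_power (X j) m)) \<longlonglongrightarrow> \<phi> (op_power Y m)"
proof -
  have nlim: "(\<lambda>j. nrm2 (op_power (X j) m - op_power Y m)) \<longlonglongrightarrow> 0"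
  proof (induction m)
    case 0
    then show ?case by (simp add: nrm2_def)
  next
    case (Suc m)
    define C where "C = (norm (op_power Y m))\<^sup>2"
    have le: "nrm2 (op_power (X j) (Suc m) - op_power Y (Suc m))
        \<le> 2 * (K\<^sup>2 * nrm2 (op_power (X j) m - op_power Y m)) + 2 * (C * nrm2 (X j - Y))" for j
    proof -
      let ?D = "op_power (X j) m - op_power Y m"
      have eq: "op_power (X j) (Suc m) - op_power Y (Suc m) = (X j o\<^sub>L ?D) + ((X j - Y) o\<^sub>L op_power Y m)"
        by (simp add: compose_linear)
      have 1: "nrm2 (X j o\<^sub>L ?D) \<le> K\<^sup>2 * nrm2 ?D"
        by (rule order.trans[OF nrm2_compose])
          (intro mult_right_mono power_mono X nrm2_nonneg norm_ge_zero)
      have "is_adjoint ((X j - Y) o\<^sub>L op_power Y m) (op_power Y m o\<^sub>L (X j - Y))"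
        by (intro is_adjoint_compose is_adjoint_diff is_adjoint_op_power X Y)
      then have "nrm2 ((X j - Y) o\<^sub>L op_power Y m) = nrm2 (op_power Y m o\<^sub>L (X j - Y))"
        by (intro nrm2_adjoint M_intros X Y)
      then have 2: "nrm2 ((X j - Y) o\<^sub>L op_power Y m) \<le> C * nrm2 (X j - Y)"
        unfolding C_def using nrm2_compose by simp
      show ?thesis
        unfolding eq by (rule order.trans[OF nrm2_add]) (use 1 2 in linarith)
    qed
    have "(\<lambda>j. 2 * (K\<^sup>2 * nrm2 (op_power (X j) m - op_power Y m)) + 2 * (C * nrm2 (X j - Y)))
        \<longlonglongrightarrow> 2 * (K\<^sup>2 * 0) + 2 * (C * 0)"
      by (intro tendsto_intros Suc.IH lim)
    then have "(\<lambda>j. 2 * (K\<^sup>2 * nrm2 (op_power (X j) m - op_power Y m)) + 2 * (C * nrm2 (X j - Y)))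
        \<longlonglongrightarrow> 0" by simp
    then show ?case
      by (rule Lim_null_comparison[rotated])
        (intro always_eventually allI, simp only: real_norm_def abs_of_nonneg[OF nrm2_nonneg] le)
  qed
  have bound: "cmod (\<phi> (op_power (X j) m) - \<phi> (op_power Y m)) \<le> sqrt (nrm2 (op_power (X j) m - op_power Y m))" for j
    by (subst state_diff[symmetric]) (intro state_le_nrm2 M_intros X Y)+
  have lim0: "(\<lambda>j. sqrt (nrm2 (op_power (X j) m - op_power Y m))) \<longlonglongrightarrow> 0"
    using tendsto_real_sqrt[OF nlim] by simp
  have "(\<lambda>j. \<phi> (op_power (X j) m) - \<phi> (op_power Y m)) \<longlonglongrightarrow> 0"
    by (rule Lim_null_comparison[OF _ lim0]) (intro always_eventually allI bound)
  then show ?thesis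
    by (rule LIM_zero_cancel)
qed

end

section \<open>Free cumulants\<close>

lemma NC_partition: "\<pi> \<in> NC k \<Longrightarrow> partition_on {..<k} \<pi>"
  by (simp add: NC_def)

lemma finite_NC [simp]: "finite (NC k)"
proof -
  have "NC k \<subseteq> Pow (Pow {..<k})"
    by (auto simp: NC_def partition_on_def)
  then show ?thesis
    by (rule finite_subset) simp
qed

lemma NC_finite: "\<pi> \<in> NC k \<Longrightarrow> finite \<pi>"
  using finite_elements[OF finite_lessThan NC_partition] .

lemma NC_block_less:
  assumes "\<pi> \<in> NC k" "\<pi> \<noteq> {{..<k}}" "B \<in> \<pi>"
  shows "card B < k"
proof -
  have p: "partition_on {..<k} \<pi>" using assms NC_partition by blast
  have sub: "B \<subseteq> {..<k}" using p assms(3) by (auto simp: partition_on_def)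
  moreover have "B \<noteq> {..<k}"
  proof
    assume B: "B = {..<k}"
    have "C = B" if "C \<in> \<pi>" for C
    proof (rule ccontr)
      assume "C \<noteq> B"
      then have "C \<inter> B = {}"
        using p that assms(3) by (auto simp: partition_on_def disjoint_def)
      moreover have "C \<subseteq> {..<k}" "C \<noteq> {}" using p that by (auto simp: partition_on_def)
      ultimately show False using B by blast
    qed
    then show False using assms B by blast
  qed
  ultimately have "card B < card {..<k}"
    by (intro psubset_card_mono) auto
  then show ?thesis by simp
qed

lemma top_in_NC: "k \<ge> 1 \<Longrightarrow> {{..<k}} \<in> NC k"
  using lessThan_empty_iff[of k]
  by (auto simp: NC_def partition_on_def noncrossing_def disjoint_def simp del: lessThan_empty_iff)

text \<open>The one-block partition contributes \<open>\<kappa> k\<close> itself and every other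
  partition only cumulants of smaller order, so the system is triangular.\<close>

lemma moment_cumulant_unique:
  fixes m :: "nat \<Rightarrow> complex"
  shows "\<exists>!\<kappa>. \<kappa> 0 = 0 \<and> (\<forall>k\<ge>1. m k = (\<Sum>\<pi>\<in>NC k. \<Prod>B\<in>\<pi>. \<kappa> (card B)))"
proof -
  define R where "R k \<kappa> = (\<Sum>\<pi>\<in>NC k - {{{..<k}}}. \<Prod>B\<in>\<pi>. \<kappa> (card B))" for k and \<kappa> :: "nat \<Rightarrow> complex"
  have split: "(\<Sum>\<pi>\<in>NC k. \<Prod>B\<in>\<pi>. \<kappa> (card B)) = \<kappa> k + R k \<kappa>" if "k \<ge> 1" for k and \<kappa> :: "nat \<Rightarrow> complex"
    unfolding R_def by (subst sum.remove[OF finite_NC top_in_NC[OF that]]) simp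
  have cong: "R k \<kappa> = R k \<kappa>'" if "\<And>j. j < k \<Longrightarrow> \<kappa> j = \<kappa>' j" for k \<kappa> \<kappa>'
    unfolding R_def by (intro sum.cong prod.cong refl that) (auto intro: NC_block_less)
  \<comment> \<open>\<open>K n\<close> is final up to argument \<open>n\<close>; the solution is the
    diagonal.\<close>
  define K where "K = rec_nat (\<lambda>_. 0) (\<lambda>n F. F(Suc n := m (Suc n) - R (Suc n) F))"
  have K: "K 0 = (\<lambda>_. 0)" "K (Suc n) = (K n)(Suc n := m (Suc n) - R (Suc n) (K n))" for n
    by (simp_all add: K_def)
  define \<kappa> where "\<kappa> n = K n n" for n
  have stable: "K n j = \<kappa> j" if "j \<le> n" for n j
    using that by (induction n) (auto simp: \<kappa>_def K le_Suc_eq)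
  have rec: "\<kappa> k = m k - R k \<kappa>" if k: "k \<ge> 1" for k
  proof -
    obtain n where n: "k = Suc n" using k by (cases k) auto
    have "R (Suc n) (K n) = R (Suc n) \<kappa>"
      by (rule cong) (simp add: stable)
    then show ?thesis by (simp add: \<kappa>_def n K)
  qed
  have uniq: "\<kappa>' = \<kappa>" if "\<kappa>' 0 = 0" "\<forall>k\<ge>1. m k = \<kappa>' k + R k \<kappa>'" for \<kappa>'
  proof
    show "\<kappa>' n = \<kappa> n" for n
    proof (induction n rule: less_induct)
      case (less n)
      show ?case
      proof (cases "n = 0")
        case True
        then show ?thesis using that(1) by (simp add: \<kappa>_def K)
      next
        case False
        then have "m n = \<kappa>' n + R n \<kappa>'" using that(2) by simp
        moreover have "R n \<kappa>' = R n \<kappa>" using less by (rule cong)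
        ultimately show ?thesis using rec[of n] False by simp
      qed
    qed
  qed
  show ?thesis
  proof (rule ex1I[of _ \<kappa>])
    show "\<kappa> 0 = 0 \<and> (\<forall>k\<ge>1. m k = (\<Sum>\<pi>\<in>NC k. \<Prod>B\<in>\<pi>. \<kappa> (card B)))"
      using rec by (simp add: split) (simp add: \<kappa>_def K)
    show "\<kappa>' = \<kappa>" if "\<kappa>' 0 = 0 \<and> (\<forall>k\<ge>1. m k = (\<Sum>\<pi>\<in>NC k. \<Prod>B\<in>\<pi>. \<kappa>' (card B)))" for \<kappa>'
      using that by (intro uniq) (auto simp: split)
  qed
qed

lemma free_cumulant_moment:
  assumes "k \<ge> 1"
  shows "\<phi> (op_power X k) = (\<Sum>\<pi>\<in>NC k. \<Prod>B\<in>\<pi>. free_cumulant \<phi> (card B) X)"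
  using theI'[OF moment_cumulant_unique[of "\<lambda>k. \<phi> (op_power X k)"]] assms
  unfolding free_cumulant_def by blast

text \<open>The partitions that survive when the first cumulant vanishes.\<close>

definition NC2 :: "nat \<Rightarrow> nat set set set" where
  "NC2 k = {\<pi> \<in> NC k. \<forall>B\<in>\<pi>. 2 \<le> card B}"

lemma free_cumulant_moment_centered:
  assumes "k \<ge> 1" "free_cumulant \<phi> 1 X = 0"
  shows "\<phi> (op_power X k) = (\<Sum>\<pi>\<in>NC2 k. \<Prod>B\<in>\<pi>. free_cumulant \<phi> (card B) X)"
  unfolding free_cumulant_moment[OF assms(1)]
proof (rule sum.mono_neutral_right)
  show "\<forall>\<pi>\<in>NC k - NC2 k. (\<Prod>B\<in>\<pi>. free_cumulant \<phi> (card B) X) = 0"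
  proof
    fix \<pi> assume pi: "\<pi> \<in> NC k - NC2 k"
    then obtain B where B: "B \<in> \<pi>" "card B < 2" by (auto simp: NC2_def not_le)
    have "partition_on {..<k} \<pi>" using pi NC_partition by blast
    then have "B \<noteq> {}" "finite B"
      using B(1) finite_subset[of B "{..<k}"] by (auto simp: partition_on_def)
    then have "card B = 1" using B(2) card_gt_0_iff[of B] by linarith
    moreover have "finite \<pi>" using pi NC_finite by blast
    ultimately show "(\<Prod>B\<in>\<pi>. free_cumulant \<phi> (card B) X) = 0"
      using B(1) assms(2) by (intro prod_zero) (auto intro!: bexI[of _ B])
  qed
qed (auto simp: NC2_def)

lemma partition_on_remove_block:
  assumes "partition_on A \<pi>" "B \<in> \<pi>"
  shows "partition_on (A - B) (\<pi> - {B})"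
  unfolding partition_on_def
proof (intro conjI)
  show "\<Union> (\<pi> - {B}) = A - B"
    using partition_onD1[OF assms(1)] partition_onD2[OF assms(1)] assms(2)
    unfolding disjoint_def by blast
  show "disjoint (\<pi> - {B})"
    using partition_onD2[OF assms(1)] by (auto simp: disjoint_def)
  show "{} \<notin> \<pi> - {B}"
    using partition_onD3[OF assms(1)] by auto
qed

text \<open>Two blocks of at least two points each need four points.\<close>

lemma partition_doubleton:
  assumes "partition_on A \<pi>" "\<forall>B\<in>\<pi>. 2 \<le> card B" "finite A" "card A \<le> 3"
  shows "\<pi> = (if A = {} then {} else {A})"
proof (cases "A = {}")
  case False
  then obtain B where B: "B \<in> \<pi>" using assms(1) by (auto simp: partition_on_def)
  have "C = B" if "C \<in> \<pi>" for C
  proof (rule ccontr)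
    assume "C \<noteq> B"
    then have "C \<inter> B = {}" "C \<union> B \<subseteq> A"
      using assms(1) B that by (auto simp: partition_on_def disjoint_def)
    then have "card C + card B \<le> card A"
      using assms(3) by (metis card_Un_disjoint card_mono finite_subset le_supE)
    moreover have "2 \<le> card B" "2 \<le> card C" using assms(2) B that by auto
    ultimately show False using assms(4) by linarith
  qed
  then have "\<pi> = {B}" using B by blast
  then show ?thesis using assms(1) False by (simp add: partition_on_def)
qed (use assms in \<open>auto simp: partition_on_def\<close>)

lemma NC2_2: "NC2 2 = {{{0, 1}}}"
proof -
  have "\<pi> = {{0, 1}}" if "\<pi> \<in> NC2 2" for \<pi>
    using that partition_doubleton[of "{..<2}" \<pi>]
    by (auto simp: NC2_def NC_def lessThan_Suc numeral_2_eq_2 insert_commute)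
  moreover have "{{0, 1}} \<in> NC2 2"
  proof -
    have "{..<2} = {0, 1 :: nat}" by auto
    then show ?thesis using top_in_NC[of 2] by (simp add: NC2_def)
  qed
  ultimately show ?thesis by blast
qed

lemma noncrossingD:
  "noncrossing \<pi> \<Longrightarrow> B \<in> \<pi> \<Longrightarrow> C \<in> \<pi> \<Longrightarrow> B \<noteq> C \<Longrightarrow>
    a < b \<Longrightarrow> b < c \<Longrightarrow> c < d \<Longrightarrow> a \<in> B \<Longrightarrow> b \<in> C \<Longrightarrow> c \<in> B \<Longrightarrow> d \<in> C \<Longrightarrow> False"
  unfolding noncrossing_def by blast

text \<open>The block of 0 decides: its complement is too small to be split further, a block of one
  or three points leaves a singleton somewhere, and the block of 0 and 2 crosses its
  complement.\<close>

lemma NC2_4: "NC2 4 = {{{0, 1, 2, 3}}, {{0, 1}, {2, 3}}, {{0, 3}, {1, 2}}}"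
proof
  have U: "{..<4} = {0, 1, 2, 3 :: nat}" by auto
  show "NC2 4 \<subseteq> {{{0, 1, 2, 3}}, {{0, 1}, {2, 3}}, {{0, 3}, {1, 2}}}"
  proof
    fix \<pi> assume "\<pi> \<in> NC2 4"
    then have p: "partition_on {0, 1, 2, 3} \<pi>" and nc: "noncrossing \<pi>" and c: "\<forall>B\<in>\<pi>. 2 \<le> card B"
      by (auto simp: NC2_def NC_def U)
    obtain B where B: "B \<in> \<pi>" "0 \<in> B" using partition_onD1[OF p] by blast
    have BU: "B \<subseteq> {0, 1, 2, 3}" using partition_onD1[OF p] B(1) by blast
    then have finB: "finite B" by (rule finite_subset) simp
    define A where "A = {0, 1, 2, 3} - B"
    have "partition_on A (\<pi> - {B})"
      unfolding A_def using p B(1) by (rule partition_on_remove_block)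
    moreover have "card A \<le> 3"
    proof -
      have "card A = 4 - card B" unfolding A_def using card_Diff_subset[OF finB BU] by simp
      moreover have "2 \<le> card B" using B(1) c by blast
      ultimately show ?thesis by linarith
    qed
    ultimately have rest: "\<pi> - {B} = (if A = {} then {} else {A})"
      using c by (intro partition_doubleton) (auto simp: A_def)
    then have pi: "\<pi> = insert B (if A = {} then {} else {A})" using B(1) by blast
    have cA: "A = {} \<or> 2 \<le> card A" using c unfolding pi by (cases "A = {}") simp_all
    define C where "C = B - {0}"
    have C: "B = insert 0 C" "C \<subseteq> {1, 2, 3}"
      using BU B(2) by (auto simp: C_def)
    have Pow: "Pow {1, 2, 3 :: nat} = {{}, {1}, {2}, {3}, {1, 2}, {1, 3}, {2, 3}, {1, 2, 3}}"
      by (simp add: Pow_insert insert_commute Un_commute)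
    have "C = {} \<or> C = {1} \<or> C = {2} \<or> C = {3} \<or> C = {1, 2} \<or> C = {1, 3} \<or> C = {2, 3} \<or> C = {1, 2, 3}"
      using C(2) Pow by (simp flip: Pow_iff)
    moreover have "card {1, 2 :: nat} = 2" "card {1, 3 :: nat} = 2" "card {2, 3 :: nat} = 2"
      by simp_all
    ultimately consider "C = {}" | "C = {1}" | "C = {2}" | "C = {3}" | "card C = 2" | "C = {1, 2, 3}"
      by metis
    then show "\<pi> \<in> {{{0, 1, 2, 3}}, {{0, 1}, {2, 3}}, {{0, 3}, {1, 2}}}"
    proof cases
      case 1
      then have "card B = 1" using C(1) by simp
      moreover have "2 \<le> card B" using B(1) c by blast
      ultimately show ?thesis by simp
    next
      case 2
      then have B': "B = {0, 1}" using C(1) by simp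
      then have "A = {2, 3}" unfolding A_def by auto
      then show ?thesis using pi B' by simp
    next
      case 3
      then have B': "B = {0, 2}" using C(1) by simp
      have "A = {1, 3}" unfolding A_def B' by auto
      note AB = this B'
      have "A \<in> \<pi>" "B \<noteq> A" using pi AB by auto
      from noncrossingD[OF nc B(1) this, of 0 1 2 3] show ?thesis by (simp add: AB)
    next
      case 4
      then have B': "B = {0, 3}" using C(1) by simp
      then have "A = {1, 2}" unfolding A_def by auto
      then show ?thesis using pi B' by simp
    next
      case 5
      have "0 \<notin> C" "finite C" using C(2) finite_subset by auto
      then have "card B = 3" using 5 C(1) by simp
      then have "card A = 1" unfolding A_def using card_Diff_subset[OF finB BU] by simp
      then show ?thesis using cA by auto
    next
      case 6
      then have B': "B = {0, 1, 2, 3}" using C(1) by simp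
      then have "A = {}" unfolding A_def by simp
      then show ?thesis using pi B' by simp
    qed
  qed
  have "partition_on {0, 1, 2, 3} {{0, 1}, {2, 3 :: nat}}" "partition_on {0, 1, 2, 3} {{0, 3}, {1, 2 :: nat}}"
    by (simp_all add: partition_on_def disjoint_def insert_commute)
  moreover have "noncrossing {{0, 1}, {2, 3}}" "noncrossing {{0, 3}, {1, 2}}"
    unfolding noncrossing_def by force+
  ultimately have "{{0, 1}, {2, 3}} \<in> NC2 4" "{{0, 3}, {1, 2}} \<in> NC2 4"
    unfolding NC2_def NC_def U by simp_all
  moreover have "{{0, 1, 2, 3}} \<in> NC2 4"
    using top_in_NC[of 4] by (simp add: NC2_def U)
  ultimately show "{{{0, 1, 2, 3}}, {{0, 1}, {2, 3}}, {{0, 3}, {1, 2}}} \<subseteq> NC2 4" by blast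
qed

lemma NC_1: "NC 1 = {{{0}}}"
proof -
  have "\<pi> = {{0}}" if pi: "\<pi> \<in> NC 1" for \<pi>
  proof (rule ccontr)
    assume "\<pi> \<noteq> {{0}}"
    moreover have "{..<1} = {0 :: nat}" by auto
    ultimately have less: "\<And>B. B \<in> \<pi> \<Longrightarrow> card B < 1" using NC_block_less[OF pi] by simp
    obtain B where "B \<in> \<pi>" "0 \<in> B" using NC_partition[OF pi] by (auto simp: partition_on_def)
    moreover have "finite B"
      using NC_partition[OF pi] calculation(1) finite_subset[of B "{..<1}"] by (auto simp: partition_on_def)
    ultimately show False using less[of B] by (simp add: card_eq_0_iff)
  qed
  moreover have "{{0}} \<in> NC 1"
  proof -
    have "{..<1} = {0 :: nat}" by auto
    then show ?thesis using top_in_NC[of 1] by simp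
  qed
  ultimately show ?thesis by blast
qed

text \<open>The factor 2 counts the non-crossing pairings of four points; the crossing pairing,
  which would make it 3, is absent.\<close>

lemma free_cumulant_4:
  assumes "\<phi> X = 0"
  shows "free_cumulant \<phi> 4 X = \<phi> (op_power X 4) - 2 * (\<phi> (op_power X 2))\<^sup>2"
proof -
  have k1: "free_cumulant \<phi> 1 X = 0"
    using free_cumulant_moment[of 1 \<phi> X] assms by (simp add: NC_1[unfolded One_nat_def])
  have k2: "\<phi> (op_power X 2) = free_cumulant \<phi> 2 X"
  proof -
    have "(\<Sum>\<pi>\<in>NC2 2. \<Prod>B\<in>\<pi>. free_cumulant \<phi> (card B) X) = free_cumulant \<phi> 2 X"
      unfolding NC2_2 by (simp add: numeral_2_eq_2)
    then show ?thesis
      using free_cumulant_moment_centered[OF _ k1, of 2] by simp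
  qed
  \<comment> \<open>The three partitions and their blocks are told apart by a witness, so that sums
    and products over the explicit sets split.\<close>
  have neq: "A \<noteq> B" if "x \<in> A" "x \<notin> B" for x :: 'z and A B
    using that by blast
  have n: "{0, 1, 2, 3} \<noteq> {0, 1 :: nat}" "{0, 1, 2, 3} \<noteq> {2, 3 :: nat}"
    "{0, 1, 2, 3} \<noteq> {0, 3 :: nat}" "{0, 1, 2, 3} \<noteq> {1, 2 :: nat}"
    by (rule neq[of 2], simp, simp) (rule neq[of 0], simp, simp, rule neq[of 1], simp, simp, rule neq[of 0], simp, simp)
  have m: "{0, 1} \<noteq> {2, 3 :: nat}" "{0, 3} \<noteq> {1, 2 :: nat}" "{0, 1} \<noteq> {0, 3 :: nat}" "{0, 1} \<noteq> {1, 2 :: nat}"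
    by (rule neq[of 0], simp, simp) (rule neq[of 0], simp, simp, rule neq[of 1], simp, simp, rule neq[of 0], simp, simp)
  have ne: "{{0, 1, 2, 3}} \<noteq> {{0, 1}, {2, 3 :: nat}}"
    "{{0, 1, 2, 3}} \<noteq> {{0, 3}, {1, 2 :: nat}}" "{{0, 1}, {2, 3 :: nat}} \<noteq> {{0, 3}, {1, 2}}"
    by (rule neq[of "{0, 1, 2, 3}"], simp, simp add: n del: One_nat_def)
      (rule neq[of "{0, 1, 2, 3}"], simp, simp add: n del: One_nat_def, rule neq[of "{0, 1}"], simp, simp add: m del: One_nat_def)
  have "\<phi> (op_power X 4) = free_cumulant \<phi> 4 X + 2 * (free_cumulant \<phi> 2 X)\<^sup>2"
  proof -
    have "(\<Sum>\<pi>\<in>NC2 4. \<Prod>B\<in>\<pi>. free_cumulant \<phi> (card B) X)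
        = free_cumulant \<phi> 4 X + 2 * (free_cumulant \<phi> 2 X)\<^sup>2"
    proof -
      define g where "g \<pi> = (\<Prod>B\<in>\<pi>. free_cumulant \<phi> (card B) X)" for \<pi> :: "nat set set"
      have "sum g (NC2 4) = g {{0, 1, 2, 3}} + (g {{0, 1}, {2, 3}} + g {{0, 3}, {1, 2}})"
        unfolding NC2_4 using ne
          by (simp only: sum.insert finite.intros sum.empty empty_iff insert_iff simp_thms add.right_neutral)
      moreover have "card {0, 1, 2, 3 :: nat} = 4" "card {0, 1 :: nat} = 2" "card {2, 3 :: nat} = 2"
        "card {0, 3 :: nat} = 2" "card {1, 2 :: nat} = 2" by simp_all
      then have "g {{0, 1, 2, 3}} = free_cumulant \<phi> 4 X"
        "g {{0, 1}, {2, 3}} = (free_cumulant \<phi> 2 X)\<^sup>2" "g {{0, 3}, {1, 2}} = (free_cumulant \<phi> 2 X)\<^sup>2"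
        unfolding g_def using m by (simp_all only: prod.insert finite.intros prod.empty empty_iff
          insert_iff simp_thms power2_eq_square mult_1_right)
      ultimately show ?thesis by (simp add: g_def)
    qed
    then show ?thesis
      using free_cumulant_moment_centered[OF _ k1, of 4] by simp
  qed
  then show ?thesis by (simp add: k2)
qed

section \<open>Orthogonality of the free Charlier polynomials\<close>

text \<open>Reading the points of \<open>S\<close> from right to left turns a non-crossing partition without
  singletons into a Motzkin path; the points of \<open>T\<close> stand for the blocks that are still open.\<close>

definition open_partitions :: "nat set \<Rightarrow> nat set \<Rightarrow> nat set set set" where
  "open_partitions S T = {\<pi>. partition_on (S \<union> T) \<pi> \<and> noncrossing \<pi> \<and>
     (\<forall>B\<in>\<pi>. 2 \<le> card B) \<and> (\<forall>B\<in>\<pi>. card (B \<inter> T) \<le> 1)}"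

text \<open>The three summands are the fates of the point just read: last of its block, which opens
  one more block to the right-to-left reader; first of its block, which finishes it at cost
  \<open>r\<close>; or in the middle. With nothing open only the first is possible, because
  singletons are excluded. In analytic terms this is the moment of order \<open>n\<close> of the
  centered free Poisson law against the Charlier polynomial of degree \<open>h\<close>.\<close>

fun motzkin :: "'a::comm_ring_1 \<Rightarrow> nat \<Rightarrow> nat \<Rightarrow> 'a" where
  "motzkin r 0 h = (if h = 0 then 1 else 0)"
| "motzkin r (Suc n) h =
     motzkin r n (Suc h) + (if h = 0 then 0 else r * motzkin r n (h - 1) + motzkin r n h)"

lemma partition_unique_block:
  "partition_on A \<pi> \<Longrightarrow> B \<in> \<pi> \<Longrightarrow> C \<in> \<pi> \<Longrightarrow> x \<in> B \<Longrightarrow> x \<in> C \<Longrightarrow> B = C"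
  unfolding partition_on_def disjoint_def by blast

lemma finite_open_partitions: "finite S \<Longrightarrow> finite T \<Longrightarrow> finite (open_partitions S T)"
  by (rule finite_subset[of _ "Pow (Pow (S \<union> T))"]) (auto simp: open_partitions_def partition_on_def)

lemma open_partitionsD:
  assumes "\<pi> \<in> open_partitions S T"
  shows "partition_on (S \<union> T) \<pi>" "noncrossing \<pi>" "\<And>B. B \<in> \<pi> \<Longrightarrow> 2 \<le> card B"
    "\<And>B. B \<in> \<pi> \<Longrightarrow> card (B \<inter> T) \<le> 1" "\<And>B. B \<in> \<pi> \<Longrightarrow> B \<subseteq> S \<union> T"
  using assms by (auto simp: open_partitions_def partition_on_def)

lemma noncrossing_subset: "noncrossing \<pi> \<Longrightarrow> \<rho> \<subseteq> \<pi> \<Longrightarrow> noncrossing \<rho>"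
  unfolding noncrossing_def by blast

text \<open>\<open>S\<close> holds the points still to be read and \<open>T\<close> one point for
  each open block. As \<open>s\<close> and \<open>t\<close> are neighbours, no third point can come
  between them and cause a crossing.\<close>

locale adjacent_points =
  fixes S T :: "nat set" and s t :: nat
  assumes fin: "finite S" "finite T" and less: "\<And>x y. x \<in> S \<Longrightarrow> y \<in> T \<Longrightarrow> x < y"
    and s: "s \<in> S" "\<And>x. x \<in> S \<Longrightarrow> x \<le> s" and t: "t \<in> T" "\<And>y. y \<in> T \<Longrightarrow> t \<le> y"
begin

lemma st: "s < t" using less s t by blast

lemma s_notin: "s \<notin> T" using less s(1) by blast

lemma t_notin: "t \<notin> S" using less t(1) by blast

lemma order_cases: "x \<in> S \<union> T \<Longrightarrow> x < s \<or> x = s \<or> x = t \<or> t < x"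
  using s(2) t(2) by force

text \<open>If \<open>s\<close> joined the block of a later point \<open>u\<close> of
  \<open>T\<close>, the block of \<open>t\<close>, which needs a second point and has no other in
  \<open>T\<close>, would reach to some \<open>a < s\<close> and cross along
  \<open>a < s < t < u\<close>.\<close>

lemma open_block_min:
  assumes pi: "\<pi> \<in> open_partitions S T" and B: "B \<in> \<pi>" "s \<in> B" "B \<inter> T \<noteq> {}"
  shows "t \<in> B"
proof (rule ccontr)
  assume "t \<notin> B"
  note P = open_partitionsD[OF pi]
  obtain u where u: "u \<in> B" "u \<in> T" using B(3) by blast
  have "t < u" using t(2)[OF u(2)] u(1) \<open>t \<notin> B\<close> by (cases "t = u") auto
  obtain C where C: "C \<in> \<pi>" "t \<in> C" using partition_onD1[OF P(1)] t(1) by blast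
  have "B \<noteq> C" using C \<open>t \<notin> B\<close> by blast
  have finC: "finite C" using P(5)[OF C(1)] fin finite_subset by blast
  have "C \<noteq> {t}" using P(3)[OF C(1)] by auto
  then obtain a where a: "a \<in> C" "a \<noteq> t" using C(2) by blast
  have "a \<notin> T"
  proof
    assume "a \<in> T"
    then have "card {a, t} \<le> card (C \<inter> T)" using a C t(1) finC by (intro card_mono) auto
    then show False using P(4)[OF C(1)] a by simp
  qed
  then have "a \<in> S" using P(5)[OF C(1)] a(1) by blast
  moreover have "a \<noteq> s"
    using partition_unique_block[OF P(1) B(1) C(1)] B(2) a(1) \<open>B \<noteq> C\<close> by blast
  ultimately have "a < s" using s(2) by force
  then show False
    using noncrossingD[OF P(2) C(1) B(1), of a s t u] \<open>B \<noteq> C\<close> a(1) B(2) C(2) u(1) st \<open>t < u\<close>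
    by blast
qed

text \<open>The partitions stay the same; only the role of \<open>s\<close> changes, from unread
  point to representative of an open block.\<close>

lemma closing_eq:
  "{\<pi> \<in> open_partitions S T. \<forall>B\<in>\<pi>. s \<in> B \<longrightarrow> B \<inter> T = {}} = open_partitions (S - {s}) (insert s T)"
proof -
  have U: "S - {s} \<union> insert s T = S \<union> T" using s by auto
  have "card (B \<inter> insert s T) \<le> 1 \<longleftrightarrow> card (B \<inter> T) \<le> 1 \<and> (s \<in> B \<longrightarrow> B \<inter> T = {})" for B
    using fin s_notin by (cases "s \<in> B") (auto simp: card_eq_0_iff)
  then show ?thesis unfolding open_partitions_def U by auto
qed

text \<open>A block consisting of two neighbours can be removed or inserted without creating a
  crossing.\<close>

lemma opening_bij:
  "bij_betw (insert {s, t}) (open_partitions (S - {s}) (T - {t})) {\<pi> \<in> open_partitions S T. {s, t} \<in> \<pi>}"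
proof (rule bij_betwI[where g = "\<lambda>\<pi>. \<pi> - {{s, t}}"])
  have U: "S \<union> T - {s, t} = S - {s} \<union> (T - {t})" using s_notin t_notin by auto
  show "insert {s, t} \<in> open_partitions (S - {s}) (T - {t}) \<rightarrow> {\<pi> \<in> open_partitions S T. {s, t} \<in> \<pi>}"
  proof
    fix \<pi> assume "\<pi> \<in> open_partitions (S - {s}) (T - {t})"
    note P = open_partitionsD[OF this]
    have sub: "B \<subseteq> S \<union> T - {s, t}" if "B \<in> \<pi>" for B using P(5)[OF that] U by blast
    have "partition_on (S \<union> T) (insert {s, t} \<pi>)"
      unfolding partition_on_def
    proof (intro conjI)
      show "\<Union> (insert {s, t} \<pi>) = S \<union> T"
        using partition_onD1[OF P(1)] s(1) t(1) by auto
      show "disjoint (insert {s, t} \<pi>)"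
        unfolding disjoint_def
      proof (intro ballI impI)
        fix B C assume BC: "B \<in> insert {s, t} \<pi>" "C \<in> insert {s, t} \<pi>" "B \<noteq> C"
        consider "B = {s, t}" "C \<in> \<pi>" | "C = {s, t}" "B \<in> \<pi>" | "B \<in> \<pi>" "C \<in> \<pi>"
          using BC by auto
        then show "B \<inter> C = {}"
        proof cases
          case 1
          then show ?thesis using sub[OF 1(2)] by auto
        next
          case 2
          then show ?thesis using sub[OF 2(2)] by auto
        next
          case 3
          then show ?thesis using disjointD[OF partition_onD2[OF P(1)]] BC(3) by simp
        qed
      qed
      show "{} \<notin> insert {s, t} \<pi>" using partition_onD3[OF P(1)] by auto
    qed
    moreover have "noncrossing (insert {s, t} \<pi>)"
      unfolding noncrossing_def
    proof (intro notI)
      assume "\<exists>B\<in>insert {s, t} \<pi>. \<exists>C\<in>insert {s, t} \<pi>. B \<noteq> C \<and>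
          (\<exists>a b c d. a < b \<and> b < c \<and> c < d \<and> a \<in> B \<and> b \<in> C \<and> c \<in> B \<and> d \<in> C)"
      then obtain B C a b c d where *: "B \<in> insert {s, t} \<pi>" "C \<in> insert {s, t} \<pi>" "B \<noteq> C"
        "a < b" "b < c" "c < d" "a \<in> B" "b \<in> C" "c \<in> B" "d \<in> C" by blast
      consider "B \<in> \<pi>" "C \<in> \<pi>" | "B = {s, t}" "C \<in> \<pi>" | "C = {s, t}" "B \<in> \<pi>" using * by blast
      then show False
      proof cases
        case 1
        then show ?thesis using noncrossingD[OF P(2) 1 *(3-10)] by blast
      next
        case 2
        have "b \<in> S \<union> T - {s, t}" using sub[OF 2(2)] *(8) by blast
        moreover have "a \<in> {s, t}" "c \<in> {s, t}" using *(7,9) unfolding 2(1) by auto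
        ultimately show ?thesis using order_cases[of b] *(4,5) st by auto
      next
        case 3
        have "c \<in> S \<union> T - {s, t}" using sub[OF 3(2)] *(9) by blast
        moreover have "b \<in> {s, t}" "d \<in> {s, t}" using *(8,10) unfolding 3(1) by auto
        ultimately show ?thesis using order_cases[of c] *(5,6) st by auto
      qed
    qed
    moreover have "card (B \<inter> T) \<le> 1" if "B \<in> \<pi>" for B
    proof -
      have "B \<inter> T = B \<inter> (T - {t})" using sub[OF that] by blast
      then show ?thesis using P(4)[OF that] by simp
    qed
    moreover have "{s, t} \<inter> T = {t}" using s_notin t(1) by blast
    ultimately show "insert {s, t} \<pi> \<in> {\<pi> \<in> open_partitions S T. {s, t} \<in> \<pi>}"
      using P(3) st by (simp add: open_partitions_def)
  qed
  show "(\<lambda>\<pi>. \<pi> - {{s, t}}) \<in> {\<pi> \<in> open_partitions S T. {s, t} \<in> \<pi>} \<rightarrow> open_partitions (S - {s}) (T - {t})"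
  proof
    fix \<pi> assume "\<pi> \<in> {\<pi> \<in> open_partitions S T. {s, t} \<in> \<pi>}"
    then have pi: "\<pi> \<in> open_partitions S T" and st_in: "{s, t} \<in> \<pi>" by auto
    note P = open_partitionsD[OF pi]
    have "card (B \<inter> (T - {t})) \<le> 1" if "B \<in> \<pi>" for B
    proof -
      have "card (B \<inter> (T - {t})) \<le> card (B \<inter> T)" using fin by (intro card_mono) auto
      then show ?thesis using P(4)[OF that] by simp
    qed
    then show "\<pi> - {{s, t}} \<in> open_partitions (S - {s}) (T - {t})"
      using partition_on_remove_block[OF P(1) st_in] noncrossing_subset[OF P(2)] P(3)
      unfolding open_partitions_def U by auto
  qed
  show "insert {s, t} \<pi> - {{s, t}} = \<pi>" if "\<pi> \<in> open_partitions (S - {s}) (T - {t})" for \<pi>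
  proof -
    have "{s, t} \<notin> \<pi>" using open_partitionsD(5)[OF that, of "{s, t}"] s_notin by auto
    then show ?thesis by simp
  qed
  show "insert {s, t} (\<pi> - {{s, t}}) = \<pi>" if "\<pi> \<in> {\<pi> \<in> open_partitions S T. {s, t} \<in> \<pi>}" for \<pi>
    using that by auto
qed

definition grow :: "nat set \<Rightarrow> nat set" where
  "grow B = (if t \<in> B then insert s B else B)"

text \<open>When \<open>s\<close> lies in the block of its neighbour \<open>t\<close>, it carries no
  information: deleting it is undone by \<open>grow\<close>.\<close>

lemma middle_bij:
  "bij_betw ((`) grow) (open_partitions (S - {s}) T)
     {\<pi> \<in> open_partitions S T. {s, t} \<notin> \<pi> \<and> (\<exists>B\<in>\<pi>. s \<in> B \<and> t \<in> B)}"
  (is "bij_betw _ ?A ?R")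
proof (rule bij_betwI[where g = "(`) (\<lambda>B. B - {s})"])
  show "(`) grow \<in> ?A \<rightarrow> ?R"
  proof
    fix \<pi> assume "\<pi> \<in> ?A"
    note P = open_partitionsD[OF this]
    have sB: "s \<notin> B" if "B \<in> \<pi>" for B using P(5)[OF that] s_notin by blast
    have fB: "finite B" if "B \<in> \<pi>" for B using P(5)[OF that] fin finite_subset by blast
    obtain B0 where B0: "B0 \<in> \<pi>" "t \<in> B0" using partition_onD1[OF P(1)] t(1) by blast
    have disj: "B = C" if "B \<in> \<pi>" "C \<in> \<pi>" "x \<in> grow B" "x \<in> grow C" for B C x
      using partition_unique_block[OF P(1) that(1,2)] that(3,4) sB[OF that(1)] sB[OF that(2)]
      by (auto simp: grow_def split: if_splits)
    have "partition_on (S \<union> T) (grow ` \<pi>)"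
      unfolding partition_on_def
    proof (intro conjI)
      have "\<Union> (grow ` \<pi>) = insert s (\<Union> \<pi>)" using B0 by (auto simp: grow_def)
      also have "\<dots> = S \<union> T" using partition_onD1[OF P(1)] s(1) by auto
      finally show "\<Union> (grow ` \<pi>) = S \<union> T" .
      show "disjoint (grow ` \<pi>)"
        unfolding disjoint_def using disj by blast
      show "{} \<notin> grow ` \<pi>" using partition_onD3[OF P(1)] by (auto simp: grow_def split: if_splits)
    qed
    moreover have "noncrossing (grow ` \<pi>)"
      unfolding noncrossing_def
    proof (intro notI)
      assume "\<exists>B\<in>grow ` \<pi>. \<exists>C\<in>grow ` \<pi>. B \<noteq> C \<and>
          (\<exists>a b c d. a < b \<and> b < c \<and> c < d \<and> a \<in> B \<and> b \<in> C \<and> c \<in> B \<and> d \<in> C)"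
      then obtain B C a b c d where *: "B \<in> \<pi>" "C \<in> \<pi>" "grow B \<noteq> grow C"
        "a < b" "b < c" "c < d" "a \<in> grow B" "b \<in> grow C" "c \<in> grow B" "d \<in> grow C" by blast
      \<comment> \<open>Collapsing \<open>s\<close> onto its neighbour \<open>t\<close> keeps the
        strict order between points of different blocks, so a crossing of grown blocks would descend
        to the original ones.\<close>
      define h where "h x = (if x = s then t else x)" for x
      have h: "h x \<in> B" if "B \<in> \<pi>" "x \<in> grow B" for x B
        using that sB[OF that(1)] by (auto simp: grow_def h_def split: if_splits)
      have mono: "h x < h y" if "x < y" "x \<in> grow B'" "y \<in> grow C'" "B' \<in> \<pi>" "C' \<in> \<pi>" "B' \<noteq> C'" for x y B' C'
      proof -
        have "x \<in> S \<union> T" "y \<in> S \<union> T"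
          using that P(5)[OF that(4)] P(5)[OF that(5)] s(1) by (auto simp: grow_def split: if_splits)
        moreover have "h x \<noteq> h y"
          using h[OF that(4,2)] h[OF that(5,3)] partition_unique_block[OF P(1) that(4,5)] that(6) by metis
        ultimately show ?thesis
          using order_cases[of x] order_cases[of y] \<open>x < y\<close> st by (auto simp: h_def split: if_splits)
      qed
      have "B \<noteq> C" using *(3) by blast
      then show False
        using noncrossingD[OF P(2) *(1,2), of "h a" "h b" "h c" "h d"]
          mono[OF *(4,7,8,1,2)] mono[OF *(5,8,9,2,1)] mono[OF *(6,9,10,1,2)] h * by metis
    qed
    moreover have "2 \<le> card (grow B)" if "B \<in> \<pi>" for B
      using P(3)[OF that] fB[OF that] sB[OF that] by (simp add: grow_def)
    moreover have "card (grow B \<inter> T) \<le> 1" if "B \<in> \<pi>" for B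
    proof -
      have "grow B \<inter> T = B \<inter> T" using s_notin by (auto simp: grow_def)
      then show ?thesis using P(4)[OF that] by simp
    qed
    moreover have "{s, t} \<notin> grow ` \<pi>"
    proof
      assume "{s, t} \<in> grow ` \<pi>"
      then obtain B where B: "B \<in> \<pi>" "{s, t} = grow B" by blast
      then have "t \<in> B" using sB[OF B(1)] by (auto simp: grow_def split: if_splits)
      then have "B = {t}" using B sB[OF B(1)] st by (auto simp: grow_def)
      then show False using P(3)[OF B(1)] by simp
    qed
    moreover have "s \<in> grow B0" "t \<in> grow B0" using B0 by (auto simp: grow_def)
    ultimately show "grow ` \<pi> \<in> ?R" using B0 by (auto simp: open_partitions_def)
  qed
  show "(`) (\<lambda>B. B - {s}) \<in> ?R \<rightarrow> ?A"
  proof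
    fix \<pi> assume "\<pi> \<in> ?R"
    then have pi: "\<pi> \<in> open_partitions S T" and nst: "{s, t} \<notin> \<pi>" and "\<exists>B\<in>\<pi>. s \<in> B \<and> t \<in> B" by auto
    then obtain B0 where B0: "B0 \<in> \<pi>" "s \<in> B0" "t \<in> B0" by blast
    note P = open_partitionsD[OF pi]
    have fB: "finite B" if "B \<in> \<pi>" for B using P(5)[OF that] fin finite_subset by blast
    \<comment> \<open>Only the block of \<open>s\<close> loses a point, and it has a third one
      because the block of just \<open>s\<close> and \<open>t\<close> is excluded.\<close>
    have c2: "2 \<le> card (B - {s})" if B: "B \<in> \<pi>" for B
    proof (cases "s \<in> B")
      case True
      then have "B = B0" using partition_unique_block[OF P(1) B B0(1) True B0(2)] by simp
      then have "t \<in> B" "B \<noteq> {s, t}" using B0 nst B by auto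
      then obtain u where "u \<in> B" "u \<noteq> s" "u \<noteq> t" using True by blast
      then have "card {t, u} \<le> card (B - {s})"
        using \<open>t \<in> B\<close> st fB[OF B] by (intro card_mono) auto
      then show ?thesis using \<open>u \<noteq> t\<close> by simp
    qed (use P(3)[OF B] in simp)
    have "partition_on (S - {s} \<union> T) ((\<lambda>B. B - {s}) ` \<pi>)"
      unfolding partition_on_def
    proof (intro conjI)
      have "\<Union> ((\<lambda>B. B - {s}) ` \<pi>) = \<Union> \<pi> - {s}" by auto
      also have "\<dots> = S - {s} \<union> T" using partition_onD1[OF P(1)] s_notin by auto
      finally show "\<Union> ((\<lambda>B. B - {s}) ` \<pi>) = S - {s} \<union> T" .
      show "disjoint ((\<lambda>B. B - {s}) ` \<pi>)"
        using partition_onD2[OF P(1)] unfolding disjoint_def by blast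
      show "{} \<notin> (\<lambda>B. B - {s}) ` \<pi>"
      proof
        assume "{} \<in> (\<lambda>B. B - {s}) ` \<pi>"
        then obtain B where "B \<in> \<pi>" "B - {s} = {}" by blast
        then have "card (B - {s}) = 0" by (simp only: card.empty)
        then show False using c2[OF \<open>B \<in> \<pi>\<close>] by linarith
      qed
    qed
    moreover have "noncrossing ((\<lambda>B. B - {s}) ` \<pi>)"
      using P(2) unfolding noncrossing_def by blast
    moreover have "card ((B - {s}) \<inter> T) \<le> 1" if "B \<in> \<pi>" for B
    proof -
      have "(B - {s}) \<inter> T = B \<inter> T" using s_notin by auto
      then show ?thesis using P(4)[OF that] by simp
    qed
    ultimately show "(\<lambda>B. B - {s}) ` \<pi> \<in> ?A"
      using c2 by (auto simp: open_partitions_def)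
  qed
  show "(\<lambda>B. B - {s}) ` grow ` \<pi> = \<pi>" if "\<pi> \<in> ?A" for \<pi>
  proof -
    have "grow B - {s} = B" if "B \<in> \<pi>" for B
      using open_partitionsD(5)[OF \<open>\<pi> \<in> ?A\<close> that] s_notin by (auto simp: grow_def)
    then show ?thesis by (simp add: image_image)
  qed
  show "grow ` (\<lambda>B. B - {s}) ` \<pi> = \<pi>" if R: "\<pi> \<in> ?R" for \<pi>
  proof -
    have pi: "\<pi> \<in> open_partitions S T" using R by auto
    obtain B0 where B0: "B0 \<in> \<pi>" "s \<in> B0" "t \<in> B0" using R by blast
    have "grow (B - {s}) = B" if "B \<in> \<pi>" for B
    proof (cases "B = B0")
      case True
      then show ?thesis using B0 st by (auto simp: grow_def)
    next
      case False
      then have "s \<notin> B" "t \<notin> B"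
        using partition_unique_block[OF open_partitionsD(1)[OF pi] that B0(1)] B0 by auto
      then show ?thesis by (simp add: grow_def)
    qed
    then show ?thesis by (simp add: image_image)
  qed
qed

lemma grow_card: "\<pi> \<in> open_partitions (S - {s}) T \<Longrightarrow> card (grow ` \<pi>) = card \<pi>"
proof (rule card_image)
  assume pi: "\<pi> \<in> open_partitions (S - {s}) T"
  have "grow B - {s} = B" if "B \<in> \<pi>" for B
    using open_partitionsD(5)[OF pi that] s_notin by (auto simp: grow_def)
  then show "inj_on grow \<pi>" by (metis inj_onI)
qed

end

text \<open>Induction on the last unread point, whose three possible fates give the three terms of
  \<open>motzkin\<close>. A block is counted when its first point is met, which is where the factor
  \<open>r\<close> arises.\<close>

lemma sum_open_partitions:
  fixes r :: "'a::comm_ring_1"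
  assumes "finite S" "finite T" "\<And>x y. x \<in> S \<Longrightarrow> y \<in> T \<Longrightarrow> x < y"
  shows "(\<Sum>\<pi>\<in>open_partitions S T. r ^ card \<pi>) = motzkin r (card S) (card T)"
  using assms
proof (induction "card S" arbitrary: S T)
  case 0
  then have "S = {}" by simp
  show ?case
  proof (cases "T = {}")
    case True
    have "open_partitions {} {} = {{}}"
      by (auto simp: open_partitions_def partition_on_def noncrossing_def)
    then show ?thesis by (simp add: \<open>S = {}\<close> True)
  next
    case False
    have "open_partitions {} T = {}"
    proof (rule equals0I)
      fix \<pi> assume "\<pi> \<in> open_partitions {} T"
      note P = open_partitionsD[OF this]
      obtain B where B: "B \<in> \<pi>" using False partition_onD1[OF P(1)] by blast
      then have "B \<inter> T = B" using P(5) by blast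
      then show False using P(3)[OF B] P(4)[OF B] by simp
    qed
    then show ?thesis using False 0 by (simp add: \<open>S = {}\<close>)
  qed
next
  case (Suc n)
  let ?w = "\<lambda>\<pi> :: nat set set. r ^ card \<pi>"
  define s where "s = Max S"
  have "S \<noteq> {}" using Suc(2) by auto
  have s: "s \<in> S" "\<And>x. x \<in> S \<Longrightarrow> x \<le> s" using Suc(3) \<open>S \<noteq> {}\<close> by (auto simp: s_def)
  have cS: "card (S - {s}) = n" using Suc(2,3) s by simp
  have IH: "(\<Sum>\<pi>\<in>open_partitions (S - {s}) T'. ?w \<pi>) = motzkin r n (card T')"
    if "finite T'" "\<And>x y. x \<in> S - {s} \<Longrightarrow> y \<in> T' \<Longrightarrow> x < y" for T'
    using Suc(1)[of "S - {s}" T'] cS Suc(3) that by simp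
  have sT: "s \<notin> T" using Suc(5) s(1) by blast
  have lessT: "\<And>x y. x \<in> S - {s} \<Longrightarrow> y \<in> insert s T \<Longrightarrow> x < y"
    using Suc(5) s(2) by (metis DiffE insertE insertI1 le_neq_implies_less)
  let ?C = "{\<pi> \<in> open_partitions S T. \<forall>B\<in>\<pi>. s \<in> B \<longrightarrow> B \<inter> T = {}}"
  show ?case
  proof (cases "T = {}")
    case True
    \<comment> \<open>With no open block available, \<open>s\<close> is the last point of its block
      and only the first summand remains.\<close>
    have U: "S - {s} \<union> insert s T = S \<union> T" using s by auto
    have "card (B \<inter> insert s T) \<le> 1" for B :: "nat set"
      using card_mono[of "{s}" "B \<inter> {s}"] by (simp add: True)
    then have "open_partitions S T = open_partitions (S - {s}) (insert s T)"
      unfolding open_partitions_def U by (simp add: True)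
    moreover have "(\<Sum>\<pi>\<in>open_partitions (S - {s}) (insert s T). ?w \<pi>) = motzkin r n (card (insert s T))"
      by (rule IH[OF _ lessT]) (use Suc(4) in auto)
    ultimately show ?thesis
      using sT Suc(2)[symmetric] by (simp add: True)
  next
    case False
    define t where "t = Min T"
    have t: "t \<in> T" "\<And>y. y \<in> T \<Longrightarrow> t \<le> y" using Suc(4) False by (auto simp: t_def)
    interpret adjacent_points S T s t
      using Suc s t by unfold_locales auto
    let ?O = "{\<pi> \<in> open_partitions S T. {s, t} \<in> \<pi>}"
    let ?M = "{\<pi> \<in> open_partitions S T. {s, t} \<notin> \<pi> \<and> (\<exists>B\<in>\<pi>. s \<in> B \<and> t \<in> B)}"
    have split: "open_partitions S T = ?C \<union> (?O \<union> ?M)"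
    proof (intro equalityI subsetI)
      fix \<pi> assume "\<pi> \<in> open_partitions S T"
      then show "\<pi> \<in> ?C \<union> (?O \<union> ?M)" using open_block_min[of \<pi>] by blast
    qed auto
    have key: False if "\<forall>B\<in>\<pi>. s \<in> B \<longrightarrow> B \<inter> T = {}" "B \<in> \<pi>" "s \<in> B" "t \<in> B" for \<pi> B
      using that t(1) by blast
    have d1: "?C \<inter> (?O \<union> ?M) = {}"
    proof (rule equals0I, elim IntE UnE CollectE conjE bexE)
      show False if "\<forall>B\<in>\<pi>. s \<in> B \<longrightarrow> B \<inter> T = {}" "{s, t} \<in> \<pi>" for \<pi>
        using key[OF that] by simp
      show False if "\<forall>B\<in>\<pi>. s \<in> B \<longrightarrow> B \<inter> T = {}" "B \<in> \<pi>" "s \<in> B" "t \<in> B" for \<pi> B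
        using key[OF that] .
    qed
    have d2: "?O \<inter> ?M = {}" by auto
    have finO: "finite (open_partitions S T)" using finite_open_partitions fin by blast
    have "(\<Sum>\<pi>\<in>open_partitions S T. ?w \<pi>) = sum ?w ?C + (sum ?w ?O + sum ?w ?M)"
    proof -
      have "sum ?w (?C \<union> (?O \<union> ?M)) = sum ?w ?C + sum ?w (?O \<union> ?M)"
        using finO by (intro sum.union_disjoint d1) simp_all
      also have "sum ?w (?O \<union> ?M) = sum ?w ?O + sum ?w ?M"
        using finO by (intro sum.union_disjoint d2) simp_all
      finally show ?thesis unfolding split[symmetric] .
    qed
    moreover have "sum ?w ?C = motzkin r n (Suc (card T))"
    proof -
      have "sum ?w ?C = motzkin r n (card (insert s T))"
        unfolding closing_eq by (rule IH[OF _ lessT]) (use fin in auto)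
      then show ?thesis using fin sT by simp
    qed
    moreover have "sum ?w ?O = r * motzkin r n (card T - 1)"
    proof -
      have "sum ?w ?O = (\<Sum>\<pi>\<in>open_partitions (S - {s}) (T - {t}). ?w (insert {s, t} \<pi>))"
        by (rule sum.reindex_bij_betw[OF opening_bij, symmetric])
      also have "\<dots> = (\<Sum>\<pi>\<in>open_partitions (S - {s}) (T - {t}). r * ?w \<pi>)"
      proof (rule sum.cong[OF refl])
        fix \<pi> assume pi: "\<pi> \<in> open_partitions (S - {s}) (T - {t})"
        have "finite \<pi>"
          using finite_elements[OF _ open_partitionsD(1)[OF pi]] fin by simp
        moreover have "{s, t} \<notin> \<pi>" using open_partitionsD(5)[OF pi, of "{s, t}"] s_notin by auto
        ultimately show "?w (insert {s, t} \<pi>) = r * ?w \<pi>" by simp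
      qed
      also have "\<dots> = r * motzkin r n (card (T - {t}))"
        unfolding sum_distrib_left[symmetric]
        by (rule arg_cong[OF IH]) (use fin in simp, rule lessT, auto)
      finally show ?thesis using t(1) by simp
    qed
    moreover have "sum ?w ?M = motzkin r n (card T)"
    proof -
      have "sum ?w ?M = (\<Sum>\<pi>\<in>open_partitions (S - {s}) T. ?w (grow ` \<pi>))"
        by (rule sum.reindex_bij_betw[OF middle_bij, symmetric])
      also have "\<dots> = (\<Sum>\<pi>\<in>open_partitions (S - {s}) T. ?w \<pi>)"
        by (intro sum.cong refl) (simp add: grow_card)
      also have "\<dots> = motzkin r n (card T)"
        by (rule IH) (use fin in simp, rule lessT, auto)
      finally show ?thesis .
    qed
    moreover have "card T \<noteq> 0" using False fin by simp
    ultimately show ?thesis using Suc(2)[symmetric] by simp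
  qed
qed

lemma sum_NC2: "(\<Sum>\<pi>\<in>NC2 k. r ^ card \<pi>) = motzkin r k 0" for r :: "'a::comm_ring_1"
proof -
  have "NC2 k = open_partitions {..<k} {}"
    by (auto simp: NC2_def NC_def open_partitions_def)
  then show ?thesis
    using sum_open_partitions[of "{..<k}" "{}" r] by simp
qed

text \<open>All cumulants of order at least two equal \<open>r\<close>, so a partition weighs
  \<open>r\<close> to the number of its blocks.\<close>

lemma centered_free_poisson_moment:
  assumes "centered_free_poisson_law \<phi> X r" "\<phi> id_blinfun = 1"
  shows "\<phi> (op_power X k) = motzkin (complex_of_real r) k 0"
proof (cases "k = 0")
  case False
  have "\<phi> (op_power X k) = (\<Sum>\<pi>\<in>NC2 k. \<Prod>B\<in>\<pi>. free_cumulant \<phi> (card B) X)"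
    using False assms by (intro free_cumulant_moment_centered) (auto simp: centered_free_poisson_law_def)
  also have "\<dots> = (\<Sum>\<pi>\<in>NC2 k. complex_of_real r ^ card \<pi>)"
  proof (rule sum.cong[OF refl])
    fix \<pi> assume "\<pi> \<in> NC2 k"
    then have "free_cumulant \<phi> (card B) X = complex_of_real r" if "B \<in> \<pi>" for B
      using that assms by (auto simp: centered_free_poisson_law_def NC2_def)
    then show "(\<Prod>B\<in>\<pi>. free_cumulant \<phi> (card B) X) = complex_of_real r ^ card \<pi>" by simp
  qed
  finally show ?thesis by (simp add: sum_NC2)
qed (simp add: assms)

section \<open>Moments of the semicircular law\<close>

text \<open>\<open>semicircle_path t m j\<close> is the \<open>m\<close>-th moment against the \<open>j\<close>-th monic Chebyshev
  polynomial of the second kind, i.e. a weighted count of Dyck paths from height \<open>j\<close> to \<open>0\<close>.\<close>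

fun semicircle_path :: "real \<Rightarrow> nat \<Rightarrow> nat \<Rightarrow> real" where
  "semicircle_path t 0 j = (if j = 0 then 1 else 0)"
| "semicircle_path t (Suc m) j =
     semicircle_path t m (Suc j) + (if j = 0 then 0 else t * semicircle_path t m (j - 1))"

lemma semicircle_path_zero: "semicircle_path 0 m (Suc j) = 0"
  by (induction m arbitrary: j) auto

lemma tendsto_semicircle_path:
  "(f \<longlongrightarrow> t) F \<Longrightarrow> ((\<lambda>n. semicircle_path (f n) m j) \<longlongrightarrow> semicircle_path t m j) F"
proof (induction m arbitrary: j)
  case (Suc m)
  show ?case
    using Suc.IH[OF Suc.prems] Suc.prems by (cases "j = 0") (auto intro!: tendsto_add tendsto_mult)
qed simp

text \<open>The monic Chebyshev polynomial of degree \<open>j\<close> for variance \<open>t\<close>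
  at the point \<open>- 2 * sqrt t * cos \<psi>\<close>, multiplied by \<open>sin \<psi>\<close>.
  The minus sign makes the substitution increasing on the interval from 0 to \<pi>; it accounts for
  the negative base of the power.\<close>

definition cos_chebyshev :: "real \<Rightarrow> nat \<Rightarrow> real \<Rightarrow> real" where
  "cos_chebyshev t j \<psi> = (- sqrt t) ^ j * sin (real (Suc j) * \<psi>)"

lemma cos_chebyshev_rec:
  assumes "t \<ge> 0"
  shows "(- 2 * sqrt t * cos \<psi>) * cos_chebyshev t j \<psi> =
    cos_chebyshev t (Suc j) \<psi> + (if j = 0 then 0 else t * cos_chebyshev t (j - 1) \<psi>)"
proof -
  have "2 * cos \<psi> * sin (real (Suc j) * \<psi>) = sin (real (Suc (Suc j)) * \<psi>) + sin (real j * \<psi>)"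
    using sin_add[of "real (Suc j) * \<psi>" \<psi>] sin_diff[of "real (Suc j) * \<psi>" \<psi>]
    by (simp add: algebra_simps)
  then have A: "(- 2 * sqrt t * cos \<psi>) * cos_chebyshev t j \<psi> =
      (- sqrt t) ^ Suc j * (sin (real (Suc (Suc j)) * \<psi>) + sin (real j * \<psi>))"
    unfolding cos_chebyshev_def by (simp add: algebra_simps)
  have B: "(- sqrt t) ^ Suc j * sin (real j * \<psi>) =
      (if j = 0 then 0 else t * cos_chebyshev t (j - 1) \<psi>)"
  proof (cases j)
    case (Suc i)
    have eq: "(- sqrt t) ^ Suc (Suc i) = t * (- sqrt t) ^ i"
    proof -
      have "(- sqrt t) * (- sqrt t) = t" using assms by simp
      then show ?thesis by (simp only: power_Suc mult.assoc[symmetric])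
    qed
    have "(- sqrt t) ^ Suc j * sin (real j * \<psi>) = t * (- sqrt t) ^ i * sin (real j * \<psi>)"
      unfolding Suc eq ..
    then show ?thesis using Suc by (simp del: power_Suc add: cos_chebyshev_def)
  qed simp
  show ?thesis
    unfolding A distrib_left B unfolding cos_chebyshev_def ..
qed

lemma integral_sin_sin:
  "(LBINT \<psi>. indicator {0..pi} \<psi> *\<^sub>R (sin (real (Suc j) * \<psi>) * sin \<psi>)) = (if j = 0 then pi / 2 else 0)"
proof -
  define F where "F \<psi> = (if j = 0 then \<psi> / 2 else sin (real j * \<psi>) / (2 * real j))
      - sin (real (j + 2) * \<psi>) / (2 * real (j + 2))" for \<psi>
  have der: "(F has_real_derivative sin (real (Suc j) * \<psi>) * sin \<psi>) (at \<psi>)" for \<psi>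
  proof -
    have e: "sin (real (Suc j) * \<psi>) * sin \<psi> = cos (real j * \<psi>) / 2 - cos (real (j + 2) * \<psi>) / 2"
      using cos_add[of "real (Suc j) * \<psi>" \<psi>] cos_diff[of "real (Suc j) * \<psi>" \<psi>]
      by (simp add: algebra_simps)
    have d: "((\<lambda>\<psi>. sin (c * \<psi>) / (2 * c)) has_real_derivative cos (c * \<psi>) / 2) (at \<psi>)"
      if "c \<noteq> 0" for c
      using that by (auto intro!: derivative_eq_intros)
    have d2: "((\<lambda>\<psi>. sin (real (j + 2) * \<psi>) / (2 * real (j + 2))) has_real_derivative
        cos (real (j + 2) * \<psi>) / 2) (at \<psi>)"
      by (rule d) simp
    have d1: "((\<lambda>\<psi>. if j = 0 then \<psi> / 2 else sin (real j * \<psi>) / (2 * real j)) has_real_derivative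
        cos (real j * \<psi>) / 2) (at \<psi>)"
      using d[of "real j"] by (cases "j = 0") (auto intro!: derivative_eq_intros)
    show ?thesis unfolding F_def e by (rule DERIV_diff[OF d1 d2])
  qed
  have "(LBINT \<psi>. indicator {0..pi} \<psi> *\<^sub>R (sin (real (Suc j) * \<psi>) * sin \<psi>)) = F pi - F 0"
  proof (rule integral_FTC_atLeastAtMost)
    show "(F has_vector_derivative sin (real (Suc j) * \<psi>) * sin \<psi>) (at \<psi> within {0..pi})" for \<psi>
      by (rule has_vector_derivative_at_within)
        (simp only: has_real_derivative_iff_has_vector_derivative[symmetric] der)
  qed (auto intro!: continuous_intros)
  also have "\<dots> = (if j = 0 then pi / 2 else 0)"
  proof -
    have "sin (real k * pi) = 0" for k by (metis sin_npi)
    from this[of j] this[of "j + 2"] show ?thesis unfolding F_def by simp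
  qed
  finally show ?thesis .
qed

text \<open>For \<open>m = 0\<close> this is orthogonality of sines; each further power is absorbed
  by the three-term recurrence, which is also the recursion of
  \<open>semicircle_path\<close>.\<close>

lemma integral_semicircle_path:
  assumes "t \<ge> 0"
  shows "(LBINT \<psi>. indicator {0..pi} \<psi> *\<^sub>R
      ((- 2 * sqrt t * cos \<psi>) ^ m * (cos_chebyshev t j \<psi> * sin \<psi>))) = pi / 2 * semicircle_path t m j"
proof (induction m arbitrary: j)
  case 0
  have "(LBINT \<psi>. indicator {0..pi} \<psi> *\<^sub>R ((- 2 * sqrt t * cos \<psi>) ^ 0 * (cos_chebyshev t j \<psi> * sin \<psi>)))
      = (LBINT \<psi>. (- sqrt t) ^ j * (indicator {0..pi} \<psi> *\<^sub>R (sin (real (Suc j) * \<psi>) * sin \<psi>)))"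
    by (intro Bochner_Integration.integral_cong refl) (simp add: cos_chebyshev_def mult_ac)
  also have "\<dots> = (- sqrt t) ^ j * (LBINT \<psi>. indicator {0..pi} \<psi> *\<^sub>R (sin (real (Suc j) * \<psi>) * sin \<psi>))"
    by (rule integral_mult_right_zero)
  finally show ?case unfolding integral_sin_sin by simp
next
  case (Suc m)
  let ?I = "\<lambda>j \<psi>. indicator {0..pi} \<psi> *\<^sub>R ((- 2 * sqrt t * cos \<psi>) ^ m * (cos_chebyshev t j \<psi> * sin \<psi>))"
  have int: "integrable lborel (?I j)" for j
    unfolding cos_chebyshev_def
    by (intro borel_integrable_compact compact_Icc continuous_intros)
  have "(LBINT \<psi>. indicator {0..pi} \<psi> *\<^sub>R ((- 2 * sqrt t * cos \<psi>) ^ Suc m * (cos_chebyshev t j \<psi> * sin \<psi>)))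
      = (LBINT \<psi>. ?I (Suc j) \<psi> + (if j = 0 then 0 else t) * ?I (j - 1) \<psi>)"
  proof (intro Bochner_Integration.integral_cong refl)
    fix \<psi>
    have "(- 2 * sqrt t * cos \<psi>) ^ Suc m * (cos_chebyshev t j \<psi> * sin \<psi>)
        = (- 2 * sqrt t * cos \<psi>) ^ m * (((- 2 * sqrt t * cos \<psi>) * cos_chebyshev t j \<psi>) * sin \<psi>)"
      by (simp only: power_Suc mult_ac)
    also have "\<dots> = (- 2 * sqrt t * cos \<psi>) ^ m * (cos_chebyshev t (Suc j) \<psi> * sin \<psi>)
        + (if j = 0 then 0 else t) * ((- 2 * sqrt t * cos \<psi>) ^ m * (cos_chebyshev t (j - 1) \<psi> * sin \<psi>))"
      unfolding cos_chebyshev_rec[OF assms] by (simp add: algebra_simps)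
    finally show "indicator {0..pi} \<psi> *\<^sub>R ((- 2 * sqrt t * cos \<psi>) ^ Suc m * (cos_chebyshev t j \<psi> * sin \<psi>))
        = ?I (Suc j) \<psi> + (if j = 0 then 0 else t) * ?I (j - 1) \<psi>"
      by (simp add: algebra_simps)
  qed
  also have "\<dots> = (LBINT \<psi>. ?I (Suc j) \<psi>) + (if j = 0 then 0 else t) * (LBINT \<psi>. ?I (j - 1) \<psi>)"
    by (subst Bochner_Integration.integral_add[OF int integrable_mult_right[OF int]])
      (simp only: integral_mult_right_zero)
  finally show ?case
    unfolding Suc.IH by (simp add: algebra_simps)
qed

text \<open>The cosine substitution turns the semicircle density into \<open>2 / pi\<close> times a
  squared sine. Variance 0 is treated apart because the law is then a point mass.\<close>

lemma semicircular_moment: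
  assumes "t \<ge> 0"
  shows "(\<integral>x. x ^ m \<partial>semicircular t) = semicircle_path t m 0"
proof (cases "t = 0")
  case True
  then have "(\<integral>x. x ^ m \<partial>semicircular t) = 0 ^ m"
    by (simp add: semicircular_def integral_return)
  also have "\<dots> = semicircle_path t m 0"
    by (cases m) (simp_all add: True semicircle_path_zero)
  finally show ?thesis .
next
  case False
  then have t: "t > 0" using assms by simp
  define w where "w x = (if \<bar>x\<bar> < 2 * sqrt t then sqrt (4 * t - x\<^sup>2) / (2 * pi * t) else 0)" for x
  define v where "v x = sqrt (4 * t - x\<^sup>2) / (2 * pi * t)" for x
  define g where "g \<psi> = - 2 * sqrt t * cos \<psi>" for \<psi>
  have sq: "x\<^sup>2 \<le> 4 * t \<longleftrightarrow> \<bar>x\<bar> \<le> 2 * sqrt t" for x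
    using abs_le_square_iff[of x "2 * sqrt t"] t by (simp add: power_mult_distrib)
  have "w \<in> borel_measurable lborel"
    unfolding w_def by measurable
  moreover have "w x \<ge> 0" for x
    using sq[of x] t by (auto simp: w_def intro!: divide_nonneg_nonneg)
  ultimately have "(\<integral>x. x ^ m \<partial>semicircular t) = (LBINT x. w x * x ^ m)"
    using False unfolding semicircular_def w_def[symmetric]
    by (simp add: integral_density)
  also have "\<dots> = (LBINT x. (x ^ m * v x) * indicator {g 0..g pi} x)"
  proof (intro Bochner_Integration.integral_cong refl)
    fix x
    \<comment> \<open>At the endpoints the root vanishes, so the open interval of the density may be
      replaced by the closed one of the substitution rule.\<close>
    have "4 * t - x\<^sup>2 = 0" if "\<bar>x\<bar> = 2 * sqrt t"
    proof -
      have "x\<^sup>2 = (2 * sqrt t)\<^sup>2" using that by (metis power2_abs)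
      then show ?thesis using t by (simp add: power_mult_distrib)
    qed
    then show "w x * x ^ m = (x ^ m * v x) * indicator {g 0..g pi} x"
      by (auto simp: w_def v_def g_def indicator_def)
  qed
  also have "\<dots> = (LBINT \<psi>. ((g \<psi>) ^ m * v (g \<psi>)) * (2 * sqrt t * sin \<psi>) * indicator {0..pi} \<psi>)"
  proof (rule integral_substitution(2))
    show "set_integrable lborel {g 0..g pi} (\<lambda>x. x ^ m * v x)"
      unfolding set_integrable_def v_def using t
      by (intro borel_integrable_compact compact_Icc continuous_intros) auto
    show "(g has_real_derivative 2 * sqrt t * sin \<psi>) (at \<psi>)" for \<psi>
      unfolding g_def by (auto intro!: derivative_eq_intros)
    show "continuous_on {0..pi} (\<lambda>\<psi>. 2 * sqrt t * sin \<psi>)"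
      by (intro continuous_intros)
    show "0 \<le> 2 * sqrt t * sin \<psi>" if "\<psi> \<in> {0..pi}" for \<psi>
      using that t by (simp add: sin_ge_zero)
  qed simp
  also have "\<dots> = (LBINT \<psi>. 2 / pi * (indicator {0..pi} \<psi> *\<^sub>R
      ((- 2 * sqrt t * cos \<psi>) ^ m * (cos_chebyshev t 0 \<psi> * sin \<psi>))))"
  proof (intro Bochner_Integration.integral_cong refl)
    fix \<psi>
    show "((g \<psi>) ^ m * v (g \<psi>)) * (2 * sqrt t * sin \<psi>) * indicator {0..pi} \<psi>
      = 2 / pi * (indicator {0..pi} \<psi> *\<^sub>R ((- 2 * sqrt t * cos \<psi>) ^ m * (cos_chebyshev t 0 \<psi> * sin \<psi>)))"
    proof (cases "\<psi> \<in> {0..pi}")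
      case True
      then have s: "sin \<psi> \<ge> 0" by (simp add: sin_ge_zero)
      have "4 * t - (g \<psi>)\<^sup>2 = (2 * sqrt t * sin \<psi>)\<^sup>2"
        using t by (simp add: g_def power_mult_distrib sin_squared_eq algebra_simps)
      then have "sqrt (4 * t - (g \<psi>)\<^sup>2) = 2 * sqrt t * sin \<psi>"
        using s t by (simp add: real_sqrt_unique)
      then have "v (g \<psi>) * (2 * sqrt t * sin \<psi>) = (2 * sqrt t * sin \<psi>) * (2 * sqrt t * sin \<psi>) / (2 * pi * t)"
        by (simp add: v_def)
      also have "\<dots> = 2 / pi * (sin \<psi> * sin \<psi>)"
        using t by (simp add: field_simps)
      finally have "(g \<psi>) ^ m * v (g \<psi>) * (2 * sqrt t * sin \<psi>) = (g \<psi>) ^ m * (2 / pi * (sin \<psi> * sin \<psi>))"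
        by (simp only: mult.assoc)
      then show ?thesis using True by (simp add: cos_chebyshev_def g_def mult_ac)
    qed simp
  qed
  also have "\<dots> = 2 / pi * (pi / 2 * semicircle_path t m 0)"
    unfolding integral_mult_right_zero integral_semicircle_path[OF assms] ..
  finally show ?thesis by simp
qed

section \<open>Words and Wick products\<close>

definition words :: "'a set \<Rightarrow> nat \<Rightarrow> 'a list set" where
  "words S n = {w. set w \<subseteq> S \<and> length w = n}"

lemma finite_words [simp]: "finite S \<Longrightarrow> finite (words S n)"
  unfolding words_def by (rule finite_lists_length_eq)

lemma words_0 [simp]: "words S 0 = {[]}"
  by (auto simp: words_def)

lemma in_words_iff: "w \<in> words S n \<longleftrightarrow> set w \<subseteq> S \<and> length w = n"
  by (simp add: words_def)

lemma sum_words_add: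
  "(\<Sum>w\<in>words S (a + b). G w) = (\<Sum>x\<in>words S a. \<Sum>y\<in>words S b. G (x @ y))"
proof -
  have "(\<Sum>w\<in>words S (a + b). G w) = (\<Sum>(x, y)\<in>words S a \<times> words S b. G (x @ y))"
    by (rule sum.reindex_bij_witness[where j = "\<lambda>w. (take a w, drop a w)" and i = "\<lambda>(x, y). x @ y"])
      (auto simp: in_words_iff dest: in_set_takeD in_set_dropD)
  then show ?thesis by (simp add: sum.cartesian_product)
qed

lemma sum_words_Suc:
  "(\<Sum>w\<in>words S (Suc n). G w) = (\<Sum>c\<in>S. \<Sum>w\<in>words S n. G (c # w))"
proof -
  have "(\<Sum>w\<in>words S (Suc n). G w) = (\<Sum>(c, w)\<in>S \<times> words S n. G (c # w))"
    by (rule sum.reindex_bij_witness[where j = "\<lambda>w. (hd w, tl w)" and i = "\<lambda>(c, w). c # w"])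
      (auto simp: in_words_iff length_Suc_conv)
  then show ?thesis by (simp add: sum.cartesian_product)
qed

lemma sum_words_rev: "(\<Sum>w\<in>words S n. G (rev w)) = (\<Sum>w\<in>words S n. G w)"
  by (rule sum.reindex_bij_witness[where i = rev and j = rev]) (auto simp: in_words_iff)

text \<open>The integral of a function of \<open>n\<close> variables that is constant on cells: a
  word names the cells of the variables and \<open>l\<close> gives their volumes. Concatenation of
  words takes the place of shifts of indices.\<close>

definition wsum :: "'a set \<Rightarrow> ('a \<Rightarrow> real) \<Rightarrow> nat \<Rightarrow> ('a list \<Rightarrow> 'b::real_vector) \<Rightarrow> 'b" where
  "wsum S l n F = (\<Sum>w\<in>words S n. prod_list (map l w) *\<^sub>R F w)"

lemma wsum_0 [simp]: "wsum S l 0 F = F []"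
  by (simp add: wsum_def)

lemma wsum_add: "wsum S l (a + b) F = wsum S l a (\<lambda>x. wsum S l b (\<lambda>y. F (x @ y)))"
  by (simp add: wsum_def sum_words_add scaleR_sum_right)

lemma wsum_Suc: "wsum S l (Suc n) F = (\<Sum>c\<in>S. l c *\<^sub>R wsum S l n (\<lambda>w. F (c # w)))"
  by (simp add: wsum_def sum_words_Suc scaleR_sum_right)

lemma wsum_rev: "wsum S l n (\<lambda>w. F (rev w)) = wsum S l n F"
proof -
  have "prod_list (map l (rev w)) = prod_list (map l w)" for w
    by (induction w) auto
  then show ?thesis
    unfolding wsum_def using sum_words_rev[of "\<lambda>w. prod_list (map l w) *\<^sub>R F w" S n] by simp
qed

lemma wsum_cong: "(\<And>w. w \<in> words S n \<Longrightarrow> F w = G w) \<Longrightarrow> wsum S l n F = wsum S l n G"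
  by (simp add: wsum_def)

lemma wsum_swap: "wsum S l a (\<lambda>x. wsum S l b (\<lambda>y. F x y)) = wsum S l b (\<lambda>y. wsum S l a (\<lambda>x. F x y))"
  unfolding wsum_def scaleR_sum_right
  by (subst sum.swap) (simp add: mult.commute)

text \<open>The Charlier recurrence carried out letter by letter: a constant word gives a Charlier
  polynomial, a word with distinct neighbours the plain product. For equal neighbours the two
  subtracted terms merge the letters or integrate them out.\<close>

fun wick :: "('a \<Rightarrow> 'h::complex_hilbert_space \<Rightarrow>\<^sub>L 'h) \<Rightarrow> ('a \<Rightarrow> real) \<Rightarrow> 'a list \<Rightarrow> ('h \<Rightarrow>\<^sub>L 'h)" where
  "wick N l [] = id_blinfun"
| "wick N l [i] = N i"
| "wick N l (i # j # w) =
     (N i o\<^sub>L wick N l (j # w)) - (if i = j then wick N l (j # w) + l j *\<^sub>R wick N l w else 0)"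

text \<open>The definition peels letters off the left end; the same rule holds where two words meet.
  After a contraction a product of shorter words remains, so the rule can be iterated. The induction
  goes two letters at a time, as the definition of \<open>wick\<close> does.\<close>

lemma wick_product:
  "wick N l (w @ [c]) o\<^sub>L wick N l (d # v) = wick N l (w @ c # d # v) +
     (if c = d then wick N l (w @ c # v) + l c *\<^sub>R (wick N l w o\<^sub>L wick N l v) else 0)"
proof (induction w rule: induct_list012)
  case 1
  then show ?case by simp
next
  case (2 i)
  then show ?case
    by (simp add: compose_linear compose_assoc del: wick.simps(3))
      (simp add: compose_linear compose_assoc algebra_simps)
next
  case (3 i j w)
  show ?case
  proof (cases "c = d")
    case True
    show ?thesis
      using 3 unfolding True by (simp add: compose_linear compose_assoc algebra_simps)
  next
    case False
    then show ?thesis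
      using 3 by (simp add: compose_linear compose_assoc algebra_simps)
  qed
qed

lemma wick_snoc:
  "wick N l (w @ [c, d]) = (wick N l (w @ [c]) o\<^sub>L N d)
    - (if c = d then wick N l (w @ [c]) + l c *\<^sub>R wick N l w else 0)"
  using wick_product[of N l w c d "[]"] by simp

text \<open>By \<open>wick_snoc\<close> the recursion can also be read from the right end, and that
  is the adjoint of the recursion from the left.\<close>

lemma is_adjoint_wick:
  assumes "\<And>i. i \<in> set w \<Longrightarrow> is_adjoint (N i) (N i)"
  shows "is_adjoint (wick N l (rev w)) (wick N l w)"
  using assms
proof (induction w rule: induct_list012)
  case (3 i j w)
  have 1: "is_adjoint (wick N l (rev w @ [j]) o\<^sub>L N i) (N i o\<^sub>L wick N l (j # w))"
    using 3 by (intro is_adjoint_compose) auto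
  have 2: "is_adjoint (wick N l (rev w @ [j]) + l j *\<^sub>R wick N l (rev w)) (wick N l (j # w) + l j *\<^sub>R wick N l w)"
    using 3 by (intro is_adjoint_add is_adjoint_scaleR) auto
  have "wick N l (rev (i # j # w)) = (wick N l (rev w @ [j]) o\<^sub>L N i)
    - (if j = i then wick N l (rev w @ [j]) + l j *\<^sub>R wick N l (rev w) else 0)"
    using wick_snoc[of N l "rev w" j i] by simp
  then show ?case
    using is_adjoint_diff[OF 1 2] is_adjoint_diff[OF 1 is_adjoint_zero] by (cases "i = j") auto
qed (auto simp: is_adjoint_id)

text \<open>The integral of a kernel that is constant on the cells, given by its values on words.\<close>

definition wick_sum ::
  "'a set \<Rightarrow> ('a \<Rightarrow> 'h::complex_hilbert_space \<Rightarrow>\<^sub>L 'h) \<Rightarrow> ('a \<Rightarrow> real) \<Rightarrow> nat \<Rightarrow> ('a list \<Rightarrow> complex) \<Rightarrow> ('h \<Rightarrow>\<^sub>L 'h)" where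
  "wick_sum S N l p u = (\<Sum>w\<in>words S p. op_scale (u w) (wick N l w))"

text \<open>For \<open>e = 0\<close> this is the discrete form of the contraction of order \<open>k\<close>, for \<open>e = 1\<close> that
  of the star contraction of order \<open>k + 1\<close>.\<close>

definition wcontr ::
  "'a set \<Rightarrow> ('a \<Rightarrow> real) \<Rightarrow> nat \<Rightarrow> nat \<Rightarrow> nat \<Rightarrow> ('a list \<Rightarrow> complex) \<Rightarrow> ('a list \<Rightarrow> complex) \<Rightarrow> 'a list \<Rightarrow> complex" where
  "wcontr S l q e k f u z = wsum S l k (\<lambda>s. f (take (q - k) z @ rev s) * u (s @ drop (q - k - e) z))"

definition contr_types :: "nat \<Rightarrow> nat \<Rightarrow> (nat \<times> nat) set" where
  "contr_types q p = {(e, k). e \<le> 1 \<and> k + e \<le> q \<and> k + e \<le> p}"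

lemma finite_contr_types [simp]: "finite (contr_types q p)"
  by (rule finite_subset[of _ "{..1} \<times> {..q}"]) (auto simp: contr_types_def)

lemma contr_types_0 [simp]: "contr_types 0 p = {(0, 0)}" "contr_types q 0 = {(0, 0)}"
  by (auto simp: contr_types_def)

lemma contr_types_Suc:
  "contr_types (Suc q) (Suc p) = {(0, 0), (1, 0)} \<union> (\<lambda>(e, k). (e, Suc k)) ` contr_types q p"
proof (intro equalityI subsetI)
  fix b assume "b \<in> contr_types (Suc q) (Suc p)"
  then show "b \<in> {(0, 0), (1, 0)} \<union> (\<lambda>(e, k). (e, Suc k)) ` contr_types q p"
    by (cases b; cases "snd b") (auto simp: contr_types_def image_iff le_Suc_eq)
qed (auto simp: contr_types_def)

text \<open>The trichotomy of \<open>wick_product\<close>: leave the junction alone, merge one pair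
  of letters and stop, or integrate one pair and continue with shorter words.\<close>

lemma sum_contr_types_Suc:
  "(\<Sum>b\<in>contr_types (Suc q) (Suc p). G b) =
    G (0, 0) + (G (1, 0) + (\<Sum>(e, k)\<in>contr_types q p. G (e, Suc k)))"
proof -
  have "inj_on (\<lambda>(e, k). (e, Suc k)) (contr_types q p)" by (auto simp: inj_on_def)
  then have "(\<Sum>b\<in>(\<lambda>(e, k). (e, Suc k)) ` contr_types q p. G b) = (\<Sum>(e, k)\<in>contr_types q p. G (e, Suc k))"
    by (simp add: sum.reindex case_prod_unfold)
  moreover have "(\<Sum>b\<in>contr_types (Suc q) (Suc p). G b)
      = (\<Sum>b\<in>{(0, 0), (1, 0)}. G b) + (\<Sum>b\<in>(\<lambda>(e, k). (e, Suc k)) ` contr_types q p. G b)"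
    unfolding contr_types_Suc by (rule sum.union_disjoint) auto
  ultimately show ?thesis by (simp add: add.assoc)
qed

text \<open>\<open>wick_product\<close> iterated under the sum. The left words are reversed so that
  the letters at the junction are the heads of both lists; \<open>s\<close> holds the integrated
  letters and \<open>c\<close> the merged one, if any.\<close>

lemma wick_double_sum:
  fixes N :: "'a \<Rightarrow> 'h::complex_hilbert_space \<Rightarrow>\<^sub>L 'h"
  assumes "finite S"
  shows "(\<Sum>w\<in>words S q. \<Sum>v\<in>words S p. op_scale (F w v) (wick N l (rev w) o\<^sub>L wick N l v)) =
    (\<Sum>(e, k)\<in>contr_types q p. \<Sum>w\<in>words S (q - k - e). \<Sum>c\<in>words S e. \<Sum>v\<in>words S (p - k - e).
       op_scale (wsum S l k (\<lambda>s. F (s @ c @ w) (s @ c @ v))) (wick N l (rev w @ c @ v)))"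
    (is "?Q q p F = (\<Sum>(e, k)\<in>contr_types q p. ?R q p e k F)")
proof (induction q arbitrary: p F)
  case 0
  then show ?case by simp
next
  case (Suc q)
  show ?case
  proof (cases p)
    case 0
    then show ?thesis by simp
  next
    case p: (Suc p')
    \<comment> \<open>The coefficients left after one pair of equal letters has been integrated
      out.\<close>
    define F' where "F' w v = (\<Sum>c\<in>S. of_real (l c) * F (c # w) (c # v))" for w v
    have step: "?R (Suc q) (Suc p') e (Suc k) F = ?R q p' e k F'" for e k
    proof -
      have "wsum S l (Suc k) (\<lambda>s. F (s @ c @ w) (s @ c @ v)) = wsum S l k (\<lambda>s. F' (s @ c @ w) (s @ c @ v))"
        for c w v
        unfolding wsum_Suc unfolding F'_def wsum_def scaleR_conv_of_real sum_distrib_left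
        by (subst sum.swap) (simp add: mult_ac)
      then show ?thesis by simp
    qed
    let ?w = "wick N l"
    have "?Q (Suc q) (Suc p') F = (\<Sum>c\<in>S. \<Sum>w\<in>words S q. \<Sum>d\<in>S. \<Sum>v\<in>words S p'.
        op_scale (F (c # w) (d # v)) (?w (rev w @ c # d # v)) +
        (if c = d then op_scale (F (c # w) (c # v)) (?w (rev w @ c # v)) +
          op_scale (of_real (l c) * F (c # w) (c # v)) (?w (rev w) o\<^sub>L ?w v) else 0))"
      unfolding sum_words_Suc
      by (intro sum.cong refl)
        (simp add: wick_product op_scale_simps mult.commute flip: op_scale_of_real)
    also have "\<dots> = (\<Sum>c\<in>S. \<Sum>w\<in>words S q. \<Sum>d\<in>S. \<Sum>v\<in>words S p'.
        op_scale (F (c # w) (d # v)) (?w (rev w @ c # d # v))) +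
      ((\<Sum>c\<in>S. \<Sum>w\<in>words S q. \<Sum>v\<in>words S p'. op_scale (F (c # w) (c # v)) (?w (rev w @ c # v))) +
       (\<Sum>c\<in>S. \<Sum>w\<in>words S q. \<Sum>v\<in>words S p'.
          op_scale (of_real (l c) * F (c # w) (c # v)) (?w (rev w) o\<^sub>L ?w v)))"
    proof -
      have delta: "(\<Sum>d\<in>S. \<Sum>v\<in>words S p'. if c = d then G v else 0) = (\<Sum>v\<in>words S p'. G v)"
        if "c \<in> S" for c and G :: "'a list \<Rightarrow> 'h \<Rightarrow>\<^sub>L 'h"
      proof -
        have "(\<Sum>d\<in>S. \<Sum>v\<in>words S p'. if c = d then G v else 0) = (\<Sum>d\<in>S. if c = d then \<Sum>v\<in>words S p'. G v else 0)"
          by (intro sum.cong refl) simp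
        then show ?thesis using assms that by simp
      qed
      show ?thesis
        by (simp add: sum.distrib delta)
    qed
    also have "(\<Sum>c\<in>S. \<Sum>w\<in>words S q. \<Sum>d\<in>S. \<Sum>v\<in>words S p'.
        op_scale (F (c # w) (d # v)) (?w (rev w @ c # d # v))) = ?R (Suc q) (Suc p') 0 0 F"
      by (simp add: sum_words_Suc)
    also have "(\<Sum>c\<in>S. \<Sum>w\<in>words S q. \<Sum>v\<in>words S p'. op_scale (F (c # w) (c # v)) (?w (rev w @ c # v)))
        = ?R (Suc q) (Suc p') 1 0 F"
      by (simp add: sum_words_Suc) (subst sum.swap, simp)
    also have "(\<Sum>c\<in>S. \<Sum>w\<in>words S q. \<Sum>v\<in>words S p'.
          op_scale (of_real (l c) * F (c # w) (c # v)) (?w (rev w) o\<^sub>L ?w v)) = ?Q q p' F'"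
      unfolding F'_def op_scale_sum_left
      by (subst sum.swap) (intro sum.cong refl sum.swap)
    also have "\<dots> = (\<Sum>(e, k)\<in>contr_types q p'. ?R q p' e k F')"
      by (rule Suc.IH)
    finally show ?thesis
      unfolding p sum_contr_types_Suc by (simp only: step prod.case)
  qed
qed

text \<open>Undoing the reversal of the left words in \<open>wick_double_sum\<close> puts the
  contracted variables into the order that the contractions prescribe.\<close>

theorem wick_sum_product:
  fixes N :: "'a \<Rightarrow> 'h::complex_hilbert_space \<Rightarrow>\<^sub>L 'h"
  assumes "finite S" and lin: "\<And>w. set w \<subseteq> S \<Longrightarrow> wick N l w \<in> complex_linear_ops"
  shows "wick_sum S N l q f o\<^sub>L wick_sum S N l p u =
    (\<Sum>(e, k)\<in>contr_types q p. wick_sum S N l (q + p - 2 * k - e) (wcontr S l q e k f u))"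
proof -
  have "wick_sum S N l q f o\<^sub>L wick_sum S N l p u =
      (\<Sum>w\<in>words S q. \<Sum>v\<in>words S p. op_scale (f w * u v) (wick N l w o\<^sub>L wick N l v))"
    unfolding wick_sum_def compose_sum_left unfolding compose_sum_right
    by (intro sum.cong refl) (simp add: op_scale_simps compose_op_scale lin in_words_iff)
  also have "\<dots> = (\<Sum>w\<in>words S q. \<Sum>v\<in>words S p. op_scale (f (rev w) * u v) (wick N l (rev w) o\<^sub>L wick N l v))"
    by (rule sum_words_rev[symmetric])
  also have "\<dots> = (\<Sum>(e, k)\<in>contr_types q p. wick_sum S N l (q + p - 2 * k - e) (wcontr S l q e k f u))"
    unfolding wick_double_sum[OF assms(1)]
  proof (intro sum.cong refl, clarify)
    fix e k assume "(e, k) \<in> contr_types q p"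
    then have ek: "e \<le> 1" "k + e \<le> q" "k + e \<le> p" by (auto simp: contr_types_def)
    have split: "q + p - 2 * k - e = (q - k - e) + (e + (p - k - e))" using ek by simp
    have "(\<Sum>w\<in>words S (q - k - e). \<Sum>c\<in>words S e. \<Sum>v\<in>words S (p - k - e).
        op_scale (wsum S l k (\<lambda>s. f (rev (s @ c @ w)) * u (s @ c @ v))) (wick N l (rev w @ c @ v)))
      = (\<Sum>w\<in>words S (q - k - e). \<Sum>c\<in>words S e. \<Sum>v\<in>words S (p - k - e).
        op_scale (wcontr S l q e k f u (rev w @ c @ v)) (wick N l (rev w @ c @ v)))"
    proof (intro sum.cong refl)
      fix w c v assume "w \<in> words S (q - k - e)" "c \<in> words S e" "v \<in> words S (p - k - e)"
      then have len: "length w = q - k - e" "length c = e" by (auto simp: in_words_iff)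
      \<comment> \<open>\<open>c\<close> has at most one letter.\<close>
      have "rev c = c" using len(2) ek(1) by (cases c) auto
      then show "op_scale (wsum S l k (\<lambda>s. f (rev (s @ c @ w)) * u (s @ c @ v))) (wick N l (rev w @ c @ v))
          = op_scale (wcontr S l q e k f u (rev w @ c @ v)) (wick N l (rev w @ c @ v))"
        using len ek unfolding wcontr_def by simp
    qed
    also have "\<dots> = (\<Sum>w\<in>words S (q - k - e). \<Sum>c\<in>words S e. \<Sum>v\<in>words S (p - k - e).
        op_scale (wcontr S l q e k f u (w @ c @ v)) (wick N l (w @ c @ v)))"
      by (rule sum_words_rev)
    also have "\<dots> = wick_sum S N l (q + p - 2 * k - e) (wcontr S l q e k f u)"
      unfolding split wick_sum_def sum_words_add by simp
    finally show "(\<Sum>w\<in>words S (q - k - e). \<Sum>c\<in>words S e. \<Sum>v\<in>words S (p - k - e).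
        op_scale (wsum S l k (\<lambda>s. f (rev (s @ c @ w)) * u (s @ c @ v))) (wick N l (rev w @ c @ v)))
      = wick_sum S N l (q + p - 2 * k - e) (wcontr S l q e k f u)" .
  qed
  finally show ?thesis .
qed

section \<open>Free Charlier polynomials and vanishing of the trace on Wick words\<close>

lemma op_poly_altdef:
  assumes "degree p \<le> n"
  shows "op_poly p T = (\<Sum>i\<le>n. op_scale (coeff p i) (op_power T i))"
  unfolding op_poly_def using assms
  by (intro sum.mono_neutral_left) (auto simp: coeff_eq_0 op_scale_simps)

lemma op_poly_diff: "op_poly (p - r) T = op_poly p T - op_poly r T"
proof -
  define n where "n = max (degree p) (degree r)"
  have "degree (p - r) \<le> n" by (simp add: n_def degree_diff_le)
  moreover have "op_scale (a - b) S = op_scale a S - op_scale b S" for a b and S :: "'a \<Rightarrow>\<^sub>L 'a"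
    using op_scale_simps(2)[of "a - b" b S] by (simp add: algebra_simps)
  ultimately show ?thesis
    using op_poly_altdef[of p n T] op_poly_altdef[of r n T] op_poly_altdef[of "p - r" n T]
    by (simp add: n_def sum_subtractf)
qed

lemma op_poly_smult: "op_poly (smult c p) T = op_scale c (op_poly p T)"
  using op_poly_altdef[of "smult c p" "degree p" T] op_poly_altdef[of p "degree p" T]
  by (simp add: op_scale_sum op_scale_simps degree_smult_le)

lemma op_poly_pCons_0:
  assumes "T \<in> complex_linear_ops"
  shows "op_poly (pCons 0 p) T = T o\<^sub>L op_poly p T"
proof -
  have "op_poly (pCons 0 p) T = (\<Sum>i\<le>Suc (degree p). op_scale (coeff (pCons 0 p) i) (op_power T i))"
    by (rule op_poly_altdef) (simp add: degree_pCons_le)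
  also have "\<dots> = (\<Sum>i\<le>degree p. op_scale (coeff p i) (op_power T (Suc i)))"
    by (subst sum.atMost_Suc_shift) (simp add: op_scale_simps)
  also have "\<dots> = T o\<^sub>L op_poly p T"
    by (simp add: op_poly_def compose_sum_right compose_op_scale assms)
  finally show ?thesis .
qed

lemma op_poly_1 [simp]: "op_poly 1 T = id_blinfun"
  by (simp add: op_poly_def op_scale_simps)

lemma op_poly_X [simp]: "op_poly [:0, 1:] T = T"
  by (simp add: op_poly_def op_scale_simps)

lemma op_poly_free_charlier_Suc:
  assumes "T \<in> complex_linear_ops"
  shows "op_poly (free_charlier r (Suc (Suc k))) T = (T o\<^sub>L op_poly (free_charlier r (Suc k)) T)
    - op_poly (free_charlier r (Suc k)) T - r *\<^sub>R op_poly (free_charlier r k) T"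
proof -
  have "[:-1, 1:] * p = pCons 0 p - p" for p :: "complex poly" by simp
  then show ?thesis
    by (simp only: free_charlier.simps op_poly_diff op_poly_smult op_poly_pCons_0[OF assms] op_scale_of_real)
qed

declare free_charlier.simps(3) [simp del]

text \<open>Along a run of equal letters the recursion of \<open>wick\<close> is the Charlier
  recurrence; the condition on \<open>v\<close> switches off the correction at the end of the
  run.\<close>

lemma wick_replicate:
  assumes "N i \<in> complex_linear_ops" "v = [] \<or> hd v \<noteq> i"
  shows "wick N l (replicate k i @ v) = op_poly (free_charlier (l i) k) (N i) o\<^sub>L wick N l v"
proof (induction k rule: induct_nat_012)
  case 1
  then show ?case using assms(2) by (cases v) auto
next
  case (ge2 k)
  then show ?case
    by (simp add: op_poly_free_charlier_Suc[OF assms(1)] compose_linear compose_assoc)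
qed simp

definition expand_runs :: "('a \<times> nat) list \<Rightarrow> 'a list" where
  "expand_runs rs = concat (map (\<lambda>(i, k). replicate k i) rs)"

text \<open>Maximal runs: neighbouring runs carry different letters, which is the alternation that
  freeness asks for.\<close>

definition proper_runs :: "('a \<times> nat) list \<Rightarrow> bool" where
  "proper_runs rs \<longleftrightarrow> distinct_adj (map fst rs) \<and> (\<forall>(i, k)\<in>set rs. k \<ge> 1)"

lemma hd_expand_runs: "proper_runs ((i, k) # rs) \<Longrightarrow> expand_runs rs = [] \<or> hd (expand_runs rs) \<noteq> i"
proof (cases rs)
  case (Cons r rs')
  assume "proper_runs ((i, k) # rs)"
  then show ?thesis
    using Cons by (cases r; cases "snd r") (auto simp: proper_runs_def expand_runs_def)
qed (simp add: expand_runs_def)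

lemma proper_runs_tl: "proper_runs (r # rs) \<Longrightarrow> proper_runs rs"
  by (cases rs) (auto simp: proper_runs_def)

lemma runs_exist: "\<exists>rs. proper_runs rs \<and> expand_runs rs = w"
proof (induction w)
  case Nil
  then show ?case by (intro exI[of _ "[]"]) (simp add: proper_runs_def expand_runs_def)
next
  case (Cons i w)
  then obtain rs where rs: "proper_runs rs" "expand_runs rs = w" by blast
  show ?case
  proof (cases "rs \<noteq> [] \<and> fst (hd rs) = i")
    case True
    then obtain k rs' where "rs = (i, k) # rs'" by (cases rs) auto
    then show ?thesis
      using rs by (intro exI[of _ "(i, Suc k) # rs'"]) (auto simp: proper_runs_def expand_runs_def)
  next
    case False
    then show ?thesis
      using rs by (intro exI[of _ "(i, 1) # rs"], cases rs) (auto simp: proper_runs_def expand_runs_def)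
  qed
qed

lemma set_expand_runs: "proper_runs rs \<Longrightarrow> set (expand_runs rs) = fst ` set rs"
  by (force simp: proper_runs_def expand_runs_def)

lemma length_expand_runs: "length (expand_runs rs) = sum_list (map snd rs)"
  by (induction rs) (auto simp: expand_runs_def)

lemma wick_expand_runs:
  assumes "proper_runs rs" "\<And>i k. (i, k) \<in> set rs \<Longrightarrow> N i \<in> complex_linear_ops"
  shows "wick N l (expand_runs rs) = op_prod (map (\<lambda>(i, k). op_poly (free_charlier (l i) k) (N i)) rs)"
  using assms
proof (induction rs)
  case Nil
  then show ?case by (simp add: expand_runs_def op_prod_def)
next
  case (Cons r rs)
  obtain i k where r: "r = (i, k)" by (cases r)
  have "wick N l (expand_runs (r # rs)) = wick N l (replicate k i @ expand_runs rs)"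
    by (simp add: expand_runs_def r)
  also have "\<dots> = op_poly (free_charlier (l i) k) (N i) o\<^sub>L wick N l (expand_runs rs)"
    using Cons.prems hd_expand_runs[of i k rs] by (intro wick_replicate) (auto simp: r)
  also have "wick N l (expand_runs rs) = op_prod (map (\<lambda>(i, k). op_poly (free_charlier (l i) k) (N i)) rs)"
    using Cons.prems by (intro Cons.IH) (auto dest: proper_runs_tl)
  finally show ?case by (simp add: op_prod_def r)
qed

section \<open>Moments against Charlier polynomials\<close>

context tracial_wstar_probability_space
begin

lemma M_op_poly: "T \<in> M \<Longrightarrow> op_poly p T \<in> M"
  unfolding op_poly_def by (intro M_intros)

text \<open>Multiplication by \<open>T\<close> is the Charlier recurrence on the left and the
  recursion of \<open>motzkin\<close> on the right. For \<open>n = 0\<close> this says that Charlier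
  polynomials of positive degree are centered.\<close>

lemma state_free_charlier:
  assumes T: "T \<in> M" "centered_free_poisson_law \<phi> T r"
  shows "\<phi> (op_power T n o\<^sub>L op_poly (free_charlier r h) T) = motzkin (complex_of_real r) n h"
proof (induction h arbitrary: n rule: induct_nat_012)
  case 0
  then show ?case
    using centered_free_poisson_moment[OF T(2) state_unit] by simp
next
  case 1
  then show ?case
    using centered_free_poisson_moment[OF T(2) state_unit, of "Suc n"]
    by (simp add: op_power_Suc_right[symmetric] del: op_power.simps(2))
next
  case (ge2 h)
  let ?C = "\<lambda>h. op_poly (free_charlier r h) T"
  have eq: "op_power T n o\<^sub>L ?C (Suc (Suc h)) =
      (op_power T (Suc n) o\<^sub>L ?C (Suc h)) - (op_power T n o\<^sub>L ?C (Suc h)) - r *\<^sub>R (op_power T n o\<^sub>L ?C h)"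
    unfolding op_power_Suc_right
    by (simp add: op_poly_free_charlier_Suc[OF M_linear[OF T(1)]] compose_linear compose_assoc)
  have "\<phi> (op_power T n o\<^sub>L ?C (Suc (Suc h))) = \<phi> (op_power T (Suc n) o\<^sub>L ?C (Suc h))
      - \<phi> (op_power T n o\<^sub>L ?C (Suc h)) - of_real r * \<phi> (op_power T n o\<^sub>L ?C h)"
    unfolding eq
    by (simp add: state_diff state_scaleR M_compose M_diff M_scaleR M_power M_op_poly T del: op_power.simps)
  then show ?case
    using ge2 by (simp del: op_power.simps)
qed

end

section \<open>Wick words over a grid of disjoint cells\<close>

locale poisson_grid = free_poisson_measure M \<phi> N
  for M :: "('h::complex_hilbert_space \<Rightarrow>\<^sub>L 'h) set" and \<phi> and N :: "'z::euclidean_space set \<Rightarrow> 'h \<Rightarrow>\<^sub>L 'h" +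
  fixes a :: nat and A :: "nat \<Rightarrow> 'z set"
  assumes cells: "\<And>i. i < a \<Longrightarrow> A i \<in> finite_measure_sets"
    and disjoint_cells: "disjoint_family_on A {..<a}"
begin

abbreviation Nc :: "nat \<Rightarrow> 'h \<Rightarrow>\<^sub>L 'h" where "Nc i \<equiv> N (A i)"

abbreviation vol :: "nat \<Rightarrow> real" where "vol i \<equiv> measure lborel (A i)"

lemma Nc_mem: "i < a \<Longrightarrow> Nc i \<in> M"
  by (simp add: N_mem cells)

lemma wick_mem: "set w \<subseteq> {..<a} \<Longrightarrow> wick Nc vol w \<in> M"
  by (induction w rule: induct_list012) (auto simp: M_intros Nc_mem)

text \<open>Cut into maximal runs, the Wick word becomes an alternating product of centered
  polynomials in free elements.\<close>

lemma state_wick: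
  assumes "set w \<subseteq> {..<a}" "w \<noteq> []"
  shows "\<phi> (wick Nc vol w) = 0"
proof -
  obtain rs where rs: "proper_runs rs" "expand_runs rs = w" using runs_exist by blast
  have sub: "i < a" "k \<ge> 1" if "(i, k) \<in> set rs" for i k
    using set_expand_runs[OF rs(1)] rs that assms(1) by (force simp: proper_runs_def)+
  define ws where "ws = map (\<lambda>(i, k). (i, op_poly (free_charlier (vol i) k) (Nc i))) rs"
  have "\<phi> (op_prod (map snd ws)) = 0"
  proof (rule N_free[OF cells disjoint_cells, unfolded freely_independent_def, rule_format])
    show "ws \<noteq> []" using assms(2) rs(2) by (auto simp: ws_def expand_runs_def)
    have "map fst ws = map fst rs" by (auto simp: ws_def)
    then show "distinct_adj (map fst ws)" using rs(1) by (simp add: proper_runs_def)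
    fix x assume "x \<in> set ws"
    then obtain i k where x: "x = (i, op_poly (free_charlier (vol i) k) (Nc i))" "(i, k) \<in> set rs"
      by (auto simp: ws_def)
    \<comment> \<open>The right-hand side is zero because \<open>k\<close> is positive.\<close>
    have "\<phi> (op_poly (free_charlier (vol i) k) (Nc i)) = motzkin (complex_of_real (vol i)) 0 k"
      using state_free_charlier[OF N_mem N_law, of "A i" 0 k] cells sub[OF x(2)] by simp
    then show "case x of (i, T) \<Rightarrow> i \<in> {..<a} \<and> T \<in> generated_algebra (Nc i) \<and> \<phi> T = 0"
      using sub[OF x(2)] by (simp add: x(1) generated_algebra_def)
  qed
  moreover have "op_prod (map snd ws) = wick Nc vol w"
    unfolding rs(2)[symmetric] using sub
    by (subst wick_expand_runs[OF rs(1)])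
      (auto simp: ws_def M_linear Nc_mem case_prod_unfold comp_def intro!: arg_cong[where f = op_prod])
  ultimately show ?thesis by simp
qed

text \<open>Orthogonality of Wick words. At the junction every term of \<open>wick_product\<close>
  except the contracted one is a combination of nonempty words and has trace zero.\<close>

lemma state_wick_wick:
  assumes "set w \<subseteq> {..<a}" "set v \<subseteq> {..<a}"
  shows "\<phi> (wick Nc vol (rev w) o\<^sub>L wick Nc vol v) = (if w = v then of_real (prod_list (map vol w)) else 0)"
  using assms
proof (induction w arbitrary: v)
  case Nil
  then show ?case by (cases v) (auto simp: state_unit state_wick)
next
  case (Cons c w)
  show ?case
  proof (cases v)
    case Nil
    then show ?thesis using Cons.prems state_wick[of "rev w @ [c]"] by simp
  next
    case v: (Cons d v')
    have z [simp]: "\<phi> (wick Nc vol (rev w @ c # d # v')) = 0" "\<phi> (wick Nc vol (rev w @ c # v')) = 0"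
      using Cons.prems v by (auto intro!: state_wick)
    have mem: "wick Nc vol (rev w @ c # d # v') \<in> M" "wick Nc vol (rev w @ c # v') \<in> M"
      "wick Nc vol (rev w) \<in> M" "wick Nc vol v' \<in> M"
      using Cons.prems v by (auto intro!: wick_mem)
    show ?thesis
    proof (cases "c = d")
      case True
      show ?thesis
        using Cons.IH[of v'] Cons.prems mem unfolding True
        by (simp add: v z[unfolded True] wick_product state_add state_scaleR M_add M_scaleR M_compose)
    qed (simp add: v wick_product)
  qed
qed

abbreviation I :: "nat \<Rightarrow> (nat list \<Rightarrow> complex) \<Rightarrow> 'h \<Rightarrow>\<^sub>L 'h" where
  "I \<equiv> wick_sum {..<a} Nc vol"

abbreviation Wsum :: "nat \<Rightarrow> (nat list \<Rightarrow> 'b::real_vector) \<Rightarrow> 'b" where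
  "Wsum \<equiv> wsum {..<a} vol"

abbreviation contr :: "nat \<Rightarrow> nat \<Rightarrow> nat \<Rightarrow> (nat list \<Rightarrow> complex) \<Rightarrow> (nat list \<Rightarrow> complex) \<Rightarrow> nat list \<Rightarrow> complex" where
  "contr \<equiv> wcontr {..<a} vol"

lemma I_mem: "I p u \<in> M"
  unfolding wick_sum_def by (intro M_intros wick_mem) (auto simp: in_words_iff)

lemma is_adjoint_I: "is_adjoint (I p (\<lambda>w. cnj (u (rev w)))) (I p u)"
proof -
  have "I p (\<lambda>w. cnj (u (rev w))) = (\<Sum>w\<in>words {..<a} p. op_scale (cnj (u w)) (wick Nc vol (rev w)))"
    unfolding wick_sum_def
    using sum_words_rev[of "\<lambda>w. op_scale (cnj (u w)) (wick Nc vol (rev w))" "{..<a}" p] by simp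
  moreover have "is_adjoint \<dots> (\<Sum>w\<in>words {..<a} p. op_scale (cnj (cnj (u w))) (wick Nc vol w))"
    by (intro is_adjoint_sum is_adjoint_op_scale is_adjoint_wick N_selfadjoint cells)
      (auto simp: in_words_iff)
  ultimately show ?thesis by (simp add: wick_sum_def)
qed

lemma I_selfadjoint:
  assumes "\<And>w. w \<in> words {..<a} p \<Longrightarrow> f (rev w) = cnj (f w)"
  shows "is_adjoint (I p f) (I p f)"
proof -
  have "I p (\<lambda>w. cnj (f (rev w))) = I p f"
    unfolding wick_sum_def by (intro sum.cong refl) (simp add: assms)
  then show ?thesis using is_adjoint_I[of p f] by simp
qed

lemma state_I: "\<phi> (I p u) = (if p = 0 then u [] else 0)"
proof -
  have "\<phi> (I p u) = (\<Sum>w\<in>words {..<a} p. u w * \<phi> (wick Nc vol w))"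
    unfolding wick_sum_def
    by (subst state_sum) (auto simp: in_words_iff M_scale wick_mem state_scale)
  also have "\<dots> = (\<Sum>w\<in>words {..<a} p. if w = [] then u [] else 0)"
    by (intro sum.cong refl) (auto simp: in_words_iff state_wick state_unit)
  also have "\<dots> = (if p = 0 then u [] else 0)"
    by (subst sum.delta) (auto simp: in_words_iff)
  finally show ?thesis .
qed

lemma state_I_I:
  "\<phi> (I p (\<lambda>w. cnj (u (rev w))) o\<^sub>L I r v) = (if p = r then Wsum p (\<lambda>w. cnj (u w) * v w) else 0)"
proof -
  have E: "I p (\<lambda>w. cnj (u (rev w))) = (\<Sum>w\<in>words {..<a} p. op_scale (cnj (u w)) (wick Nc vol (rev w)))"
    unfolding wick_sum_def
    using sum_words_rev[of "\<lambda>w. op_scale (cnj (u w)) (wick Nc vol (rev w))" "{..<a}" p] by simp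
  have prod: "I p (\<lambda>w. cnj (u (rev w))) o\<^sub>L I r v = (\<Sum>w\<in>words {..<a} p. \<Sum>x\<in>words {..<a} r.
      op_scale (cnj (u w) * v x) (wick Nc vol (rev w) o\<^sub>L wick Nc vol x))"
    unfolding E unfolding wick_sum_def compose_sum_left unfolding compose_sum_right
    by (intro sum.cong refl) (simp add: op_scale_simps compose_op_scale M_linear wick_mem in_words_iff)
  then have "\<phi> (I p (\<lambda>w. cnj (u (rev w))) o\<^sub>L I r v) = (\<Sum>w\<in>words {..<a} p. \<Sum>x\<in>words {..<a} r.
      (cnj (u w) * v x) * \<phi> (wick Nc vol (rev w) o\<^sub>L wick Nc vol x))"
  proof -
    have mem: "wick Nc vol (rev w) o\<^sub>L wick Nc vol x \<in> M"
      if "w \<in> words {..<a} p" "x \<in> words {..<a} r" for w x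
      using that by (intro M_compose wick_mem) (auto simp: in_words_iff)
    have "\<phi> (\<Sum>w\<in>words {..<a} p. \<Sum>x\<in>words {..<a} r. op_scale (cnj (u w) * v x) (wick Nc vol (rev w) o\<^sub>L wick Nc vol x))
      = (\<Sum>w\<in>words {..<a} p. \<phi> (\<Sum>x\<in>words {..<a} r. op_scale (cnj (u w) * v x) (wick Nc vol (rev w) o\<^sub>L wick Nc vol x)))"
      by (intro state_sum M_sum M_scale mem)
    also have "\<dots> = (\<Sum>w\<in>words {..<a} p. \<Sum>x\<in>words {..<a} r.
        \<phi> (op_scale (cnj (u w) * v x) (wick Nc vol (rev w) o\<^sub>L wick Nc vol x)))"
      by (intro sum.cong refl state_sum M_scale mem)
    also have "\<dots> = (\<Sum>w\<in>words {..<a} p. \<Sum>x\<in>words {..<a} r.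
        (cnj (u w) * v x) * \<phi> (wick Nc vol (rev w) o\<^sub>L wick Nc vol x))"
      by (intro sum.cong refl state_scale mem)
    finally show ?thesis unfolding prod .
  qed
  also have "\<dots> = (\<Sum>w\<in>words {..<a} p. \<Sum>x\<in>words {..<a} r.
      if w = x then of_real (prod_list (map vol w)) * (cnj (u w) * v w) else 0)"
    by (intro sum.cong refl) (auto simp: in_words_iff state_wick_wick)
  also have "\<dots> = (if p = r then Wsum p (\<lambda>w. cnj (u w) * v w) else 0)"
    by (auto simp: sum.delta' wsum_def scaleR_conv_of_real in_words_iff intro!: sum.cong)
  finally show ?thesis .
qed

text \<open>Pythagoras: integrals of different degrees are orthogonal, and injectivity of
  \<open>d\<close> says that all degrees differ.\<close>

lemma nrm2_sum_I:
  assumes "finite B" "inj_on d B"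
  shows "nrm2 (\<Sum>b\<in>B. I (d b) (u b)) = (\<Sum>b\<in>B. Wsum (d b) (\<lambda>w. (cmod (u b w))\<^sup>2))"
proof -
  have "complex_of_real (nrm2 (\<Sum>b\<in>B. I (d b) (u b))) =
      \<phi> ((\<Sum>b\<in>B. I (d b) (\<lambda>w. cnj (u b (rev w)))) o\<^sub>L (\<Sum>b\<in>B. I (d b) (u b)))"
    by (intro state_nrm2[symmetric] is_adjoint_sum is_adjoint_I M_sum I_mem)
  also have "\<dots> = (\<Sum>b\<in>B. \<Sum>b'\<in>B. \<phi> (I (d b) (\<lambda>w. cnj (u b (rev w))) o\<^sub>L I (d b') (u b')))"
    by (simp add: compose_sum_left compose_sum_right state_sum M_sum M_compose I_mem) (rule sum.swap)
  also have "\<dots> = (\<Sum>b\<in>B. \<Sum>b'\<in>B. if b = b' then Wsum (d b) (\<lambda>w. cnj (u b w) * u b w) else 0)"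
    using assms(2) by (intro sum.cong refl) (auto simp: state_I_I dest: inj_onD)
  also have "\<dots> = (\<Sum>b\<in>B. Wsum (d b) (\<lambda>w. cnj (u b w) * u b w))"
    using assms(1) by simp
  also have "\<dots> = of_real (\<Sum>b\<in>B. Wsum (d b) (\<lambda>w. (cmod (u b w))\<^sup>2))"
  proof -
    have "cnj z * z = of_real ((cmod z)\<^sup>2)" for z
      by (metis complex_norm_square mult.commute)
    then show ?thesis by (simp add: wsum_def scaleR_conv_of_real)
  qed
  finally show ?thesis by (simp only: of_real_eq_iff)
qed

lemma nrm2_I: "nrm2 (I p u) = Wsum p (\<lambda>w. (cmod (u w))\<^sup>2)"
  using nrm2_sum_I[of "{()}" "\<lambda>_. p" "\<lambda>_. u"] by simp

lemma I_product: "I q f o\<^sub>L I p u = (\<Sum>(e, k)\<in>contr_types q p. I (q + p - 2 * k - e) (contr q e k f u))"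
  by (intro wick_sum_product) (auto intro: M_linear wick_mem)

end

section \<open>Norms of discrete contractions\<close>

lemma wsum_mono:
  fixes F G :: "'a list \<Rightarrow> real"
  assumes "\<And>i. i \<in> S \<Longrightarrow> 0 \<le> l i" "\<And>w. w \<in> words S n \<Longrightarrow> F w \<le> G w"
  shows "wsum S l n F \<le> wsum S l n G"
  unfolding wsum_def real_scaleR_def
proof (intro sum_mono mult_left_mono assms(2))
  fix w assume "w \<in> words S n"
  then show "0 \<le> prod_list (map l w)"
    using assms(1) by (induction w arbitrary: n) (auto simp: in_words_iff)
qed

lemma wsum_nonneg:
  fixes F :: "'a list \<Rightarrow> real"
  assumes "\<And>i. i \<in> S \<Longrightarrow> 0 \<le> l i" "\<And>w. w \<in> words S n \<Longrightarrow> 0 \<le> F w"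
  shows "0 \<le> wsum S l n F"
  using wsum_mono[of S l n "\<lambda>_. 0" F] assms by (simp add: wsum_def)

lemma norm_wsum_le:
  fixes F :: "'a list \<Rightarrow> 'b::real_normed_vector"
  assumes "\<And>i. i \<in> S \<Longrightarrow> 0 \<le> l i"
  shows "norm (wsum S l n F) \<le> wsum S l n (\<lambda>w. norm (F w))"
  unfolding wsum_def
proof (rule order.trans[OF norm_sum], rule sum_mono)
  fix w assume "w \<in> words S n"
  then have "0 \<le> prod_list (map l w)"
    using assms by (induction w arbitrary: n) (auto simp: in_words_iff)
  then show "norm (prod_list (map l w) *\<^sub>R F w) \<le> prod_list (map l w) *\<^sub>R norm (F w)" by simp
qed

lemma wsum_mult_right: "wsum S l n (\<lambda>w. c * F w) = c * wsum S l n F" for c :: "'b::real_normed_field"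
  by (simp add: wsum_def sum_distrib_left mult_ac scaleR_conv_of_real)

lemma wsum_mult_left: "wsum S l n (\<lambda>w. F w * c) = wsum S l n F * c" for c :: "'b::real_normed_field"
  using wsum_mult_right[of S l n c F] by (simp add: mult.commute)

lemma wsum_const: "wsum S l n (\<lambda>_. c) = (\<Sum>i\<in>S. l i) ^ n * c" for c :: real
proof (induction n)
  case (Suc n)
  then show ?case by (simp add: wsum_Suc sum_distrib_right mult.assoc)
qed simp

lemma wsum_Cauchy_Schwarz:
  fixes f g :: "'a list \<Rightarrow> complex"
  assumes "\<And>i. i \<in> S \<Longrightarrow> 0 \<le> l i"
  shows "(cmod (wsum S l n (\<lambda>w. f w * g w)))\<^sup>2 \<le> wsum S l n (\<lambda>w. (cmod (f w))\<^sup>2) * wsum S l n (\<lambda>w. (cmod (g w))\<^sup>2)"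
proof -
  let ?L = "\<lambda>w. prod_list (map l w)"
  have L: "0 \<le> ?L w" if "w \<in> words S n" for w
    using that assms by (induction w arbitrary: n) (auto simp: in_words_iff)
  have "cmod (wsum S l n (\<lambda>w. f w * g w)) \<le> wsum S l n (\<lambda>w. cmod (f w * g w))"
    by (rule norm_wsum_le[OF assms])
  also have "\<dots> = (\<Sum>w\<in>words S n. (sqrt (?L w) * cmod (f w)) * (sqrt (?L w) * cmod (g w)))"
  proof -
    have "(sqrt t * x) * (sqrt t * y) = t * (x * y)" if "0 \<le> t" for t x y :: real
    proof -
      have "(sqrt t * x) * (sqrt t * y) = (sqrt t * sqrt t) * (x * y)" by (simp only: mult_ac)
      then show ?thesis using that by simp
    qed
    then show ?thesis unfolding wsum_def
      by (intro sum.cong refl) (simp only: L norm_mult real_scaleR_def)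
  qed
  finally have "(cmod (wsum S l n (\<lambda>w. f w * g w)))\<^sup>2 \<le> \<dots>\<^sup>2"
    by (intro power_mono) auto
  also have "\<dots> \<le> (\<Sum>w\<in>words S n. (sqrt (?L w) * cmod (f w))\<^sup>2) * (\<Sum>w\<in>words S n. (sqrt (?L w) * cmod (g w))\<^sup>2)"
    by (rule Cauchy_Schwarz_ineq_sum)
  also have "\<dots> = wsum S l n (\<lambda>w. (cmod (f w))\<^sup>2) * wsum S l n (\<lambda>w. (cmod (g w))\<^sup>2)"
    unfolding wsum_def using L by (simp add: power_mult_distrib)
  finally show ?thesis .
qed

abbreviation sqnorm :: "'a set \<Rightarrow> ('a \<Rightarrow> real) \<Rightarrow> nat \<Rightarrow> ('a list \<Rightarrow> complex) \<Rightarrow> real" where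
  "sqnorm S l p u \<equiv> wsum S l p (\<lambda>w. (cmod (u w))\<^sup>2)"

lemma wcontr_append:
  assumes "length x = q - k - e" "length c = e" "k + e \<le> q"
  shows "wcontr S l q e k f u (x @ c @ y) = wsum S l k (\<lambda>s. f (x @ c @ rev s) * u (s @ c @ y))"
  using assms by (simp add: wcontr_def)

lemma wsum_contr_split:
  assumes "(e, k) \<in> contr_types q p"
  shows "wsum S l (q + p - 2 * k - e) G =
    wsum S l (q - k - e) (\<lambda>x. wsum S l e (\<lambda>c. wsum S l (p - k - e) (\<lambda>y. G (x @ c @ y))))"
proof -
  have "q + p - 2 * k - e = (q - k - e) + (e + (p - k - e))"
    using assms by (auto simp: contr_types_def)
  then show ?thesis by (simp add: wsum_add)
qed

text \<open>A crude estimate: Cauchy-Schwarz in the contracted variables, then the sup bound on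
  \<open>f\<close> and the total volume. It need only be independent of the grid;
  \<open>1 \<le> V\<close> lets all exponents be raised to \<open>q\<close>.\<close>

lemma sqnorm_wcontr_le:
  assumes l: "\<And>i. i \<in> S \<Longrightarrow> 0 \<le> l i" and vol: "(\<Sum>i\<in>S. l i) \<le> V" "1 \<le> V"
    and f: "\<And>w. w \<in> words S q \<Longrightarrow> cmod (f w) \<le> C"
    and ek: "(e, k) \<in> contr_types q p"
  shows "sqnorm S l (q + p - 2 * k - e) (wcontr S l q e k f u) \<le> (C\<^sup>2 * V ^ q) * sqnorm S l p u"
proof -
  let ?\<Lambda> = "\<Sum>i\<in>S. l i"
  have \<Lambda>: "0 \<le> ?\<Lambda>" using l by (rule sum_nonneg)
  have ek': "k + e \<le> q" "k + e \<le> p" "e \<le> 1" using ek by (auto simp: contr_types_def)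
  have "sqnorm S l (q + p - 2 * k - e) (wcontr S l q e k f u) \<le>
      wsum S l (q - k - e) (\<lambda>x. wsum S l e (\<lambda>c. wsum S l (p - k - e) (\<lambda>y.
        (?\<Lambda> ^ k * C\<^sup>2) * wsum S l k (\<lambda>s. (cmod (u (s @ c @ y)))\<^sup>2))))"
    unfolding wsum_contr_split[OF ek]
  proof (intro wsum_mono l)
    fix x c y assume x: "x \<in> words S (q - k - e)" "c \<in> words S e" "y \<in> words S (p - k - e)"
    have "(cmod (wcontr S l q e k f u (x @ c @ y)))\<^sup>2 \<le>
        wsum S l k (\<lambda>s. (cmod (f (x @ c @ rev s)))\<^sup>2) * wsum S l k (\<lambda>s. (cmod (u (s @ c @ y)))\<^sup>2)"
      using x ek' by (subst wcontr_append) (auto simp: in_words_iff intro!: wsum_Cauchy_Schwarz l)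
    also have "wsum S l k (\<lambda>s. (cmod (f (x @ c @ rev s)))\<^sup>2) \<le> wsum S l k (\<lambda>s. C\<^sup>2)"
      using x ek' by (intro wsum_mono l power_mono f) (auto simp: in_words_iff)
    finally show "(cmod (wcontr S l q e k f u (x @ c @ y)))\<^sup>2 \<le>
        (?\<Lambda> ^ k * C\<^sup>2) * wsum S l k (\<lambda>s. (cmod (u (s @ c @ y)))\<^sup>2)"
      by (simp add: wsum_const mult_right_mono wsum_nonneg l)
  qed
  also have "\<dots> = (?\<Lambda> ^ k * C\<^sup>2) * (wsum S l (q - k - e) (\<lambda>x. sqnorm S l p u))"
  proof -
    have "sqnorm S l p u = wsum S l k (\<lambda>s. wsum S l e (\<lambda>c. wsum S l (p - k - e) (\<lambda>y. (cmod (u (s @ c @ y)))\<^sup>2)))"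
    proof -
      have "sqnorm S l (k + (e + (p - k - e))) u =
          wsum S l k (\<lambda>s. wsum S l e (\<lambda>c. wsum S l (p - k - e) (\<lambda>y. (cmod (u (s @ c @ y)))\<^sup>2)))"
        by (simp only: wsum_add)
      moreover have "k + (e + (p - k - e)) = p" using ek' by simp
      ultimately show ?thesis by (simp only:)
    qed
    also have "\<dots> = wsum S l e (\<lambda>c. wsum S l (p - k - e) (\<lambda>y. wsum S l k (\<lambda>s. (cmod (u (s @ c @ y)))\<^sup>2)))"
      by (subst wsum_swap, subst wsum_swap[of S l k]) (rule refl)
    finally show ?thesis by (simp only: wsum_mult_right)
  qed
  also have "\<dots> = ?\<Lambda> ^ (k + (q - k - e)) * C\<^sup>2 * sqnorm S l p u"
    by (simp add: wsum_const power_add)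
  also have "\<dots> \<le> V ^ q * C\<^sup>2 * sqnorm S l p u"
  proof (intro mult_right_mono)
    have "?\<Lambda> ^ (k + (q - k - e)) \<le> V ^ (k + (q - k - e))"
      by (intro power_mono vol \<Lambda>)
    also have "\<dots> \<le> V ^ q" using ek' vol by (intro power_increasing) auto
    finally show "?\<Lambda> ^ (k + (q - k - e)) \<le> V ^ q" .
  qed (auto intro: wsum_nonneg l)
  finally show ?thesis by (simp add: mult_ac)
qed

section \<open>Paths of contractions\<close>

text \<open>A path lists the contraction types met when a power is expanded; the head belongs to the
  factor multiplied last, from the left. Along valid paths the subtraction on natural numbers does
  not truncate.\<close>

fun path_degree :: "nat \<Rightarrow> (nat \<times> nat) list \<Rightarrow> nat" where
  "path_degree q [] = 0"
| "path_degree q ((e, k) # \<pi>) = q + path_degree q \<pi> - 2 * k - e"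

fun path_kernel :: "'a set \<Rightarrow> ('a \<Rightarrow> real) \<Rightarrow> nat \<Rightarrow> ('a list \<Rightarrow> complex) \<Rightarrow> (nat \<times> nat) list \<Rightarrow> 'a list \<Rightarrow> complex" where
  "path_kernel S l q f [] = (\<lambda>_. 1)"
| "path_kernel S l q f ((e, k) # \<pi>) = wcontr S l q e k f (path_kernel S l q f \<pi>)"

fun valid_path :: "nat \<Rightarrow> (nat \<times> nat) list \<Rightarrow> bool" where
  "valid_path q [] = True"
| "valid_path q (b # \<pi>) \<longleftrightarrow> b \<in> contr_types q (path_degree q \<pi>) \<and> valid_path q \<pi>"

definition paths :: "nat \<Rightarrow> nat \<Rightarrow> (nat \<times> nat) list set" where
  "paths q m = {\<pi>. length \<pi> = m \<and> valid_path q \<pi>}"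

lemma paths_0 [simp]: "paths q 0 = {[]}"
  by (auto simp: paths_def)

lemma paths_subset: "paths q m \<subseteq> {\<pi>. set \<pi> \<subseteq> {..1} \<times> {..q} \<and> length \<pi> = m}"
proof -
  have "valid_path q \<pi> \<Longrightarrow> set \<pi> \<subseteq> {..1} \<times> {..q}" for \<pi>
    by (induction \<pi>) (auto simp: contr_types_def)
  then show ?thesis by (auto simp: paths_def)
qed

lemma finite_paths [simp]: "finite (paths q m)"
  by (rule finite_subset[OF paths_subset]) (simp add: finite_lists_length_eq)

text \<open>Exponential growth in \<open>m\<close> is enough: the operator norm only sees the
  base.\<close>

lemma card_paths: "card (paths q m) \<le> (2 * (q + 1)) ^ m"
proof -
  have "card (paths q m) \<le> card {\<pi>. set \<pi> \<subseteq> {..1::nat} \<times> {..q} \<and> length \<pi> = m}"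
    by (rule card_mono[OF _ paths_subset]) (simp add: finite_lists_length_eq)
  also have "\<dots> = (2 * (q + 1)) ^ m"
    by (subst card_lists_length_eq) (auto simp: card_cartesian_product mult_2)
  finally show ?thesis .
qed

lemma sum_paths_Suc:
  "(\<Sum>\<pi>\<in>paths q (Suc m). G \<pi>) = (\<Sum>\<pi>\<in>paths q m. \<Sum>b\<in>contr_types q (path_degree q \<pi>). G (b # \<pi>))"
proof -
  have "(\<Sum>\<pi>\<in>paths q (Suc m). G \<pi>) = (\<Sum>(\<pi>, b)\<in>Sigma (paths q m) (\<lambda>\<pi>. contr_types q (path_degree q \<pi>)). G (b # \<pi>))"
    by (rule sum.reindex_bij_witness[where j = "\<lambda>\<pi>. (tl \<pi>, hd \<pi>)" and i = "\<lambda>(\<pi>, b). b # \<pi>"])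
      (auto simp: paths_def length_Suc_conv)
  then show ?thesis by (simp add: sum.Sigma)
qed

lemma sqnorm_path_kernel_le:
  assumes l: "\<And>i. i \<in> S \<Longrightarrow> 0 \<le> l i" and vol: "(\<Sum>i\<in>S. l i) \<le> V" "1 \<le> V"
    and f: "\<And>w. w \<in> words S q \<Longrightarrow> cmod (f w) \<le> C" and "valid_path q \<pi>"
  shows "sqnorm S l (path_degree q \<pi>) (path_kernel S l q f \<pi>) \<le> (C\<^sup>2 * V ^ q) ^ length \<pi>"
  using \<open>valid_path q \<pi>\<close>
proof (induction \<pi>)
  case (Cons b \<pi>)
  obtain e k where b: "b = (e, k)" by (cases b)
  then have ek: "(e, k) \<in> contr_types q (path_degree q \<pi>)" "valid_path q \<pi>" using Cons.prems by auto
  have "sqnorm S l (path_degree q (b # \<pi>)) (path_kernel S l q f (b # \<pi>))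
      \<le> (C\<^sup>2 * V ^ q) * sqnorm S l (path_degree q \<pi>) (path_kernel S l q f \<pi>)"
    using sqnorm_wcontr_le[OF l vol f ek(1)] by (simp add: b)
  also have "\<dots> \<le> (C\<^sup>2 * V ^ q) * (C\<^sup>2 * V ^ q) ^ length \<pi>"
    using vol by (intro mult_left_mono Cons.IH ek) auto
  finally show ?case by simp
qed simp

text \<open>Unfolding the contractions along a path gives an integral of a product of copies of \<open>f\<close>.
  The variables \<open>0, \<dots>, path_degree q \<pi> - 1\<close> are free, the following
  \<open>path_bound \<pi>\<close> ones are integrated out.\<close>

fun path_bound :: "(nat \<times> nat) list \<Rightarrow> nat" where
  "path_bound [] = 0"
| "path_bound ((e, k) # \<pi>) = k + path_bound \<pi>"

text \<open>Where an old variable goes when one more copy of \<open>f\<close> is contracted on. The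
  first \<open>k\<close> free ones become bound and follow the new free ones; the other free ones
  move behind the \<open>q - k\<close> places of the new copy, overlapping it by \<open>e\<close>;
  old bound variables go to the end.\<close>

definition relabel :: "nat \<Rightarrow> nat \<Rightarrow> nat \<Rightarrow> nat \<Rightarrow> nat \<Rightarrow> nat" where
  "relabel q e k p i = (let p' = q + p - 2 * k - e in
     if i < k then p' + i else if i < p then q - k - e + (i - k) else p' + k + (i - p))"

fun path_labels :: "nat \<Rightarrow> (nat \<times> nat) list \<Rightarrow> nat list list" where
  "path_labels q [] = []"
| "path_labels q ((e, k) # \<pi>) =
     (let p' = q + path_degree q \<pi> - 2 * k - e in
       ([0..<q - k] @ rev [p'..<p' + k]) # map (map (relabel q e k (path_degree q \<pi>))) (path_labels q \<pi>))"

lemma length_path_labels: "length (path_labels q \<pi>) = length \<pi>"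
  by (induction q \<pi> rule: path_labels.induct) (auto simp: Let_def)

lemma relabel_inj:
  assumes "(e, k) \<in> contr_types q p"
  shows "inj (relabel q e k p)"
  using assms by (intro injI) (auto simp: relabel_def Let_def contr_types_def split: if_splits)

text \<open>No variable is lost. Hence every variable is an argument of some copy of
  \<open>f\<close>, which later yields nonempty blocks and bounded support in all variables.\<close>

lemma relabel_image:
  assumes "(e, k) \<in> contr_types q p"
  shows "{0..<q - k} \<union> {q + p - 2 * k - e..<q + p - 2 * k - e + k} \<union> relabel q e k p ` {..<p + r}
    = {..<q + p - 2 * k - e + (k + r)}" (is "?L = ?R")
proof
  show "?L \<subseteq> ?R"
    using assms by (auto simp: relabel_def Let_def contr_types_def)
  show "?R \<subseteq> ?L"
  proof
    fix j assume j: "j \<in> ?R"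
    define p' where "p' = q + p - 2 * k - e"
    consider "j < q - k" | "q - k \<le> j" "j < p'" | "p' \<le> j" "j < p' + k" | "p' + k \<le> j" "j < p' + k + r"
      using j by (fastforce simp: p'_def)
    then show "j \<in> ?L"
    proof cases
      case 2
      then have "relabel q e k p (j - (q - k - e) + k) = j" "j - (q - k - e) + k < p + r"
        using assms by (auto simp: relabel_def Let_def contr_types_def p'_def)
      then show ?thesis by (metis UnCI image_eqI lessThan_iff)
    next
      case 4
      then have "relabel q e k p (j - p' - k + p) = j" "j - p' - k + p < p + r"
        using assms by (auto simp: relabel_def Let_def contr_types_def p'_def)
      then show ?thesis by (metis UnCI image_eqI lessThan_iff)
    qed (auto simp: p'_def)
  qed
qed

text \<open>A single copy of \<open>f\<close> never has two of its arguments identified, because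
  relabelling is injective. This is the condition on the meet of the partition with the consecutive
  blocks in the notion of a tamed sequence.\<close>

lemma path_labels_distinct:
  assumes "valid_path q \<pi>" "c \<in> set (path_labels q \<pi>)"
  shows "length c = q \<and> distinct c"
  using assms
proof (induction \<pi> arbitrary: c)
  case (Cons b \<pi>)
  obtain e k where b: "b = (e, k)" by (cases b)
  then have ek: "(e, k) \<in> contr_types q (path_degree q \<pi>)" "valid_path q \<pi>" using Cons.prems by auto
  define p' where "p' = q + path_degree q \<pi> - 2 * k - e"
  have "q - k \<le> p'" using ek(1) by (auto simp: contr_types_def p'_def)
  consider "c = [0..<q - k] @ rev [p'..<p' + k]"
    | c' where "c' \<in> set (path_labels q \<pi>)" "c = map (relabel q e k (path_degree q \<pi>)) c'"
    using Cons.prems(2) by (auto simp: b Let_def p'_def)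
  then show ?case
  proof cases
    case 1
    then show ?thesis using \<open>q - k \<le> p'\<close> ek(1) by (auto simp: contr_types_def)
  next
    case 2
    then show ?thesis
      using Cons.IH[OF ek(2) 2(1)] relabel_inj[OF ek(1)]
      by (auto simp: distinct_map intro: inj_on_subset)
  qed
qed simp

lemma path_labels_cover:
  assumes "valid_path q \<pi>"
  shows "(\<Union>c\<in>set (path_labels q \<pi>). set c) = {..<path_degree q \<pi> + path_bound \<pi>}"
  using assms
proof (induction \<pi>)
  case (Cons b \<pi>)
  obtain e k where b: "b = (e, k)" by (cases b)
  then have ek: "(e, k) \<in> contr_types q (path_degree q \<pi>)" "valid_path q \<pi>" using Cons.prems by auto
  have "(\<Union>c\<in>set (path_labels q (b # \<pi>)). set c) =
      {0..<q - k} \<union> {q + path_degree q \<pi> - 2 * k - e..<q + path_degree q \<pi> - 2 * k - e + k} \<union>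
      relabel q e k (path_degree q \<pi>) ` (\<Union>c\<in>set (path_labels q \<pi>). set c)"
    by (auto simp: b Let_def)
  then show ?case
    unfolding Cons.IH[OF ek(2)] using relabel_image[OF ek(1)] by (simp add: b)
qed simp

lemma map_nth_upt: "b \<le> length xs \<Longrightarrow> map ((!) xs) [a..<b] = take (b - a) (drop a xs)"
  by (rule nth_equalityI) auto

text \<open>Each contraction inserts its integrated variables \<open>s\<close> between the free
  variables and those bound earlier; \<open>relabel\<close> is the resulting translation of
  positions.\<close>

lemma path_kernel_eq:
  assumes "valid_path q \<pi>" "length z = path_degree q \<pi>"
  shows "path_kernel S l q f \<pi> z =
    wsum S l (path_bound \<pi>) (\<lambda>x. prod_list (map (\<lambda>c. f (map ((!) (z @ x)) c)) (path_labels q \<pi>)))"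
  using assms
proof (induction \<pi> arbitrary: z)
  case (Cons b \<pi>)
  obtain e k where b: "b = (e, k)" by (cases b)
  define p where "p = path_degree q \<pi>"
  define p' where "p' = q + p - 2 * k - e"
  define r where "r = path_bound \<pi>"
  have ek: "(e, k) \<in> contr_types q p" "valid_path q \<pi>" using Cons.prems by (auto simp: b p_def)
  then have ek': "k + e \<le> q" "k + e \<le> p" "e \<le> 1" by (auto simp: contr_types_def)
  have z: "length z = p'" using Cons.prems by (simp add: b p'_def p_def)
  have "path_kernel S l q f (b # \<pi>) z =
      wsum S l k (\<lambda>s. f (take (q - k) z @ rev s) * path_kernel S l q f \<pi> (s @ drop (q - k - e) z))"
    by (simp add: b wcontr_def)
  also have "\<dots> = wsum S l k (\<lambda>s. wsum S l r (\<lambda>x.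
      prod_list (map (\<lambda>c. f (map ((!) (z @ s @ x)) c)) (path_labels q (b # \<pi>)))))"
  proof (intro wsum_cong)
    fix s assume "s \<in> words S k"
    then have s: "length s = k" by (simp add: in_words_iff)
    have "path_kernel S l q f \<pi> (s @ drop (q - k - e) z) =
        wsum S l r (\<lambda>x. prod_list (map (\<lambda>c. f (map ((!) ((s @ drop (q - k - e) z) @ x)) c)) (path_labels q \<pi>)))"
      unfolding r_def using s z ek' by (intro Cons.IH ek(2)) (simp add: p'_def p_def)
    also have "f (take (q - k) z @ rev s) * \<dots> = wsum S l r (\<lambda>x. f (take (q - k) z @ rev s) *
        prod_list (map (\<lambda>c. f (map ((!) ((s @ drop (q - k - e) z) @ x)) c)) (path_labels q \<pi>)))"
      by (rule wsum_mult_right[symmetric])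
    also have "\<dots> = wsum S l r (\<lambda>x.
      prod_list (map (\<lambda>c. f (map ((!) (z @ s @ x)) c)) (path_labels q (b # \<pi>))))"
    proof (intro wsum_cong)
      fix x assume "x \<in> words S r"
      then have x: "length x = r" by (simp add: in_words_iff)
      have new: "map ((!) (z @ s @ x)) ([0..<q - k] @ rev [p'..<p' + k]) = take (q - k) z @ rev s"
      proof -
        have "map ((!) (z @ s @ x)) [0..<q - k] = take (q - k) z"
          using z s ek' by (subst map_nth_upt) (auto simp: p'_def)
        moreover have "map ((!) (z @ s @ x)) [p'..<p' + k] = s"
          using z s by (subst map_nth_upt) auto
        ultimately show ?thesis by (simp add: rev_map[symmetric])
      qed
      \<comment> \<open>The copies of \<open>f\<close> already present see the same values, read off
        at the translated positions.\<close>
      have old: "map ((!) ((s @ drop (q - k - e) z) @ x)) c = map ((!) (z @ s @ x)) (map (relabel q e k p) c)"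
        if c: "c \<in> set (path_labels q \<pi>)" for c
      proof -
        have "i < p + r" if "i \<in> set c" for i
          using path_labels_cover[OF ek(2)] c that by (auto simp: p_def r_def)
        moreover have "((s @ drop (q - k - e) z) @ x) ! i = (z @ s @ x) ! relabel q e k p i" if "i < p + r" for i
        proof -
          have rl: "relabel q e k p i = (if i < k then p' + i else if i < p then q - k - e + (i - k) else p' + k + (i - p))"
            by (simp only: relabel_def Let_def p'_def)
          have len: "length (drop (q - k - e) z) = p - k" using z ek' by (simp add: p'_def)
          consider "i < k" | "k \<le> i" "i < p" | "p \<le> i" by linarith
          then show ?thesis
          proof cases
            case 1
            then show ?thesis using s z by (simp add: rl nth_append)
          next
            case 2
            then have "q - k - e + (i - k) < p'" "i - k < p - k" using ek' by (simp_all add: p'_def)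
            then show ?thesis using 2 s z len ek' by (simp add: rl nth_append)
          next
            case 3
            have "length (s @ drop (q - k - e) z) = p" using s len ek' by simp
            then have "((s @ drop (q - k - e) z) @ x) ! i = x ! (i - p)"
              using 3 by (simp only: nth_append not_less[symmetric] if_False)
            moreover have "(z @ s @ x) ! (p' + k + (i - p)) = x ! (i - p)"
              using s z by (simp add: nth_append)
            moreover have "\<not> i < k" "\<not> i < p" using 3 ek' by auto
            ultimately show ?thesis by (simp add: rl)
          qed
        qed
        ultimately show ?thesis by simp
      qed
      have labels: "path_labels q (b # \<pi>) = ([0..<q - k] @ rev [p'..<p' + k]) # map (map (relabel q e k p)) (path_labels q \<pi>)"
        by (simp add: b Let_def p'_def p_def)
      show "f (take (q - k) z @ rev s) *
          prod_list (map (\<lambda>c. f (map ((!) ((s @ drop (q - k - e) z) @ x)) c)) (path_labels q \<pi>)) =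
        prod_list (map (\<lambda>c. f (map ((!) (z @ s @ x)) c)) (path_labels q (b # \<pi>)))"
        unfolding labels list.map prod_list.Cons new map_map comp_def
        using old by (simp cong: map_cong add: comp_def)
    qed
    finally show "f (take (q - k) z @ rev s) * path_kernel S l q f \<pi> (s @ drop (q - k - e) z) =
      wsum S l r (\<lambda>x. prod_list (map (\<lambda>c. f (map ((!) (z @ s @ x)) c)) (path_labels q (b # \<pi>))))" .
  qed
  also have "\<dots> = wsum S l (k + r) (\<lambda>x. prod_list (map (\<lambda>c. f (map ((!) (z @ x)) c)) (path_labels q (b # \<pi>))))"
    by (simp add: wsum_add)
  finally show ?case by (simp add: b r_def)
qed simp

lemma norm_prod_list: "norm (prod_list xs) = prod_list (map norm xs)" for xs :: "'b::real_normed_field list"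
  by (induction xs) (auto simp: norm_mult)

lemma norm_path_kernel_le:
  assumes "\<And>i. i \<in> S \<Longrightarrow> 0 \<le> l i" "valid_path q \<pi>" "path_degree q \<pi> = 0"
  shows "cmod (path_kernel S l q f \<pi> []) \<le>
    wsum S l (path_bound \<pi>) (\<lambda>x. prod_list (map (\<lambda>c. cmod (f (map ((!) x) c))) (path_labels q \<pi>)))"
  using norm_wsum_le[OF assms(1), where F = "\<lambda>x. prod_list (map (\<lambda>c. f (map ((!) x) c)) (path_labels q \<pi>))"]
  by (subst path_kernel_eq) (simp_all add: assms norm_prod_list comp_def)

section \<open>The fourth moment and the semicircular approximation for step kernels\<close>

fun tensor_power :: "nat \<Rightarrow> ('a list \<Rightarrow> complex) \<Rightarrow> nat \<Rightarrow> 'a list \<Rightarrow> complex" where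
  "tensor_power q f 0 z = 1"
| "tensor_power q f (Suc j) z = f (take q z) * tensor_power q f j (drop q z)"

lemma sqnorm_tensor:
  "sqnorm S l (a + b) (\<lambda>z. u (take a z) * v (drop a z)) = sqnorm S l a u * sqnorm S l b v"
proof -
  have "sqnorm S l (a + b) (\<lambda>z. u (take a z) * v (drop a z)) =
      wsum S l a (\<lambda>x. wsum S l b (\<lambda>y. (cmod (u x))\<^sup>2 * (cmod (v y))\<^sup>2))"
    unfolding wsum_add by (intro wsum_cong) (simp add: in_words_iff norm_mult power_mult_distrib)
  then show ?thesis by (simp add: wsum_mult_right wsum_mult_left)
qed

lemma sqnorm_tensor_power: "sqnorm S l (q * j) (tensor_power q f j) = sqnorm S l q f ^ j"
proof (induction j)
  case (Suc j)
  have "sqnorm S l (q * Suc j) (tensor_power q f (Suc j)) =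
      sqnorm S l (q + q * j) (\<lambda>z. f (take q z) * tensor_power q f j (drop q z))"
    by simp
  also have "\<dots> = sqnorm S l q f * sqnorm S l (q * j) (tensor_power q f j)"
    by (rule sqnorm_tensor)
  finally show ?case by (simp add: Suc)
qed simp

text \<open>A contraction with \<open>f\<close> consumes at most \<open>q\<close> variables, so it
  touches only the first tensor factor and the others are carried along.\<close>

lemma wcontr_tensor_power:
  assumes "k + e \<le> q" "length z \<ge> q + q - 2 * k - e"
  shows "wcontr S l q e k f (tensor_power q f (Suc j)) z =
    wcontr S l q e k f f (take (q + q - 2 * k - e) z) * tensor_power q f j (drop (q + q - 2 * k - e) z)"
proof -
  define d where "d = q + q - 2 * k - e"
  have d: "q - k \<le> d" "d - (q - k - e) = q - k" "q - k + (q - k - e) = d"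
    using assms(1) by (auto simp: d_def)
  have "f (take (q - k) z @ rev s) * tensor_power q f (Suc j) (s @ drop (q - k - e) z) =
      f (take (q - k) (take d z) @ rev s) * f (s @ drop (q - k - e) (take d z)) * tensor_power q f j (drop d z)"
    if "s \<in> words S k" for s
  proof -
    have s: "length s = k" using that by (simp add: in_words_iff)
    have "take q (s @ drop (q - k - e) z) = s @ drop (q - k - e) (take d z)"
      using s d assms(1) by (simp add: drop_take)
    moreover have "drop q (s @ drop (q - k - e) z) = drop d z"
      using s d(3) assms(1) by (simp add: add.commute)
    moreover have "take (q - k) (take d z) = take (q - k) z" using d(1) by (simp add: min_def)
    ultimately show ?thesis by simp
  qed
  then show ?thesis
    unfolding wcontr_def d_def[symmetric] wsum_mult_left[symmetric]
    by (intro wsum_cong) simp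
qed

text \<open>The recursion of \<open>semicircle_path\<close> with the Cauchy-Schwarz bound on the
  unwanted terms added at every step. Here \<open>n\<close> is the variance, \<open>G b\<close> the
  squared norm of the contraction \<open>b\<close>, \<open>\<mu> m\<close> the even moment of order
  \<open>2 * m\<close>, and \<open>n ^ (j - 1)\<close> the squared norm of the untouched tensor
  factors.\<close>

fun semicircle_error :: "'b set \<Rightarrow> real \<Rightarrow> ('b \<Rightarrow> real) \<Rightarrow> (nat \<Rightarrow> real) \<Rightarrow> nat \<Rightarrow> nat \<Rightarrow> real" where
  "semicircle_error B n G \<mu> 0 j = 0"
| "semicircle_error B n G \<mu> (Suc m) j = semicircle_error B n G \<mu> m (Suc j) +
     (if j = 0 then 0 else n * semicircle_error B n G \<mu> m (j - 1) +
       (\<Sum>b\<in>B. sqrt (\<mu> m) * sqrt (G b * n ^ (j - 1))))"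

lemma tendsto_semicircle_error:
  assumes "(n \<longlongrightarrow> n') F" "\<And>b. b \<in> B \<Longrightarrow> ((\<lambda>i. G i b) \<longlongrightarrow> G' b) F" "\<And>m. ((\<lambda>i. \<mu> i m) \<longlongrightarrow> \<mu>' m) F"
  shows "((\<lambda>i. semicircle_error B (n i) (G i) (\<mu> i) m j) \<longlongrightarrow> semicircle_error B n' G' \<mu>' m j) F"
proof (induction m arbitrary: j)
  case (Suc m)
  show ?case
  proof (cases "j = 0")
    case True
    then show ?thesis using Suc[of "Suc 0"] by simp
  next
    case False
    then show ?thesis
      using assms by (simp, intro tendsto_intros Suc) auto
  qed
qed simp

text \<open>Bounded moments suffice, no convergence of them is presupposed: every error term carries
  a factor that tends to 0 because of \<open>G\<close>.\<close>

lemma semicircle_error_tendsto_0: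
  fixes n :: "nat \<Rightarrow> real" and B :: "'b set"
  assumes "n \<longlonglongrightarrow> n'" "\<And>b. b \<in> B \<Longrightarrow> (\<lambda>i. G i b) \<longlonglongrightarrow> 0"
    and \<mu>: "\<And>m. \<exists>C. \<forall>i. \<mu> i m \<le> C" "\<And>i m. 0 \<le> \<mu> i m"
  shows "(\<lambda>i. semicircle_error B (n i) (G i) (\<mu> i) m j) \<longlonglongrightarrow> 0"
proof (induction m arbitrary: j)
  case (Suc m)
  show ?case
  proof (cases "j = 0")
    case True
    then show ?thesis using Suc[of "Suc 0"] by simp
  next
    case False
    obtain C where C: "\<And>i. \<mu> i m \<le> C" using \<mu>(1) by blast
    have "(\<lambda>i. sqrt (\<mu> i m) * sqrt (G i b * n i ^ (j - 1))) \<longlonglongrightarrow> 0" if "b \<in> B" for b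
    proof (rule Lim_null_comparison)
      have "(\<lambda>i. sqrt C * \<bar>sqrt (G i b * n i ^ (j - 1))\<bar>) \<longlonglongrightarrow> sqrt C * \<bar>sqrt (0 * n' ^ (j - 1))\<bar>"
        by (intro tendsto_intros assms that)
      then show "(\<lambda>i. sqrt C * \<bar>sqrt (G i b * n i ^ (j - 1))\<bar>) \<longlonglongrightarrow> 0" by simp
      show "\<forall>\<^sub>F i in sequentially. norm (sqrt (\<mu> i m) * sqrt (G i b * n i ^ (j - 1)))
          \<le> sqrt C * \<bar>sqrt (G i b * n i ^ (j - 1))\<bar>"
        using C \<mu>(2) by (intro always_eventually allI) (simp add: abs_mult mult_right_mono)
    qed
    then have "(\<lambda>i. \<Sum>b\<in>B. sqrt (\<mu> i m) * sqrt (G i b * n i ^ (j - 1))) \<longlonglongrightarrow> 0"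
      by (rule tendsto_null_sum)
    then have "(\<lambda>i. semicircle_error B (n i) (G i) (\<mu> i) m (Suc j) +
        (n i * semicircle_error B (n i) (G i) (\<mu> i) m (j - 1) +
         (\<Sum>b\<in>B. sqrt (\<mu> i m) * sqrt (G i b * n i ^ (j - 1))))) \<longlonglongrightarrow> 0 + (n' * 0 + 0)"
      by (intro tendsto_add tendsto_mult assms Suc)
    then show ?thesis using False by simp
  qed
qed simp

text \<open>The two excluded types are the plain tensor product and the full contraction, each
  contributing the fourth power of the norm of the kernel.\<close>

definition proper_contr_types :: "nat \<Rightarrow> (nat \<times> nat) set" where
  "proper_contr_types q = contr_types q q - {(0, 0), (0, q)}"

section \<open>Fourth moment and operator bound for one symmetric step kernel\<close>

locale symmetric_step_kernel = poisson_grid M \<phi> N a A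
  for M :: "('h::complex_hilbert_space \<Rightarrow>\<^sub>L 'h) set" and \<phi>
    and N :: "'z::euclidean_space set \<Rightarrow> 'h \<Rightarrow>\<^sub>L 'h" and a A +
  fixes q :: nat and f :: "nat list \<Rightarrow> complex"
  assumes q: "q \<ge> 1" and sym: "\<And>w. w \<in> words {..<a} q \<Longrightarrow> f (rev w) = cnj (f w)"
begin

definition X :: "'h \<Rightarrow>\<^sub>L 'h" where "X = I q f"

definition sqn :: real where "sqn = sqnorm {..<a} vol q f"

definition contr_sqn :: "nat \<times> nat \<Rightarrow> real" where
  "contr_sqn = (\<lambda>(e, k). sqnorm {..<a} vol (q + q - 2 * k - e) (contr q e k f f))"

lemma vol_nonneg: "0 \<le> vol i" by simp

lemma X_mem: "X \<in> M" by (simp add: X_def I_mem)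

lemma X_selfadjoint: "is_adjoint X X"
  unfolding X_def by (rule I_selfadjoint) (rule sym)

lemma X_pow: "op_power X m \<in> M" "is_adjoint (op_power X m) (op_power X m)"
  by (auto intro: M_power X_mem is_adjoint_op_power X_selfadjoint)

lemma sqn_nonneg: "0 \<le> sqn" unfolding sqn_def by (intro wsum_nonneg) auto

lemma state_X: "\<phi> X = 0"
  using q by (simp add: X_def state_I)

lemma state_even_power: "\<phi> (op_power X (m + m)) = of_real (nrm2 (op_power X m))"
  using state_nrm2[OF X_pow(1) X_pow(1,2)] by (simp add: op_power_add)

lemma state_X2: "\<phi> (op_power X 2) = of_real sqn"
  using state_even_power[of 1] by (simp add: nrm2_I X_def sqn_def numeral_2_eq_2)

text \<open>The degree determines \<open>2 * k + e\<close>, and its parity determines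
  \<open>e\<close>.\<close>

lemma degree_inj: "inj_on (\<lambda>(e, k). q + q - 2 * k - e) (contr_types q q)"
proof (rule inj_onI, clarify)
  fix e k e' k'
  assume "(e, k) \<in> contr_types q q" "(e', k') \<in> contr_types q q"
    and eq: "q + q - 2 * k - e = q + q - 2 * k' - e'"
  then have *: "e \<le> 1" "k + e \<le> q" "e' \<le> 1" "k' + e' \<le> q" by (auto simp: contr_types_def)
  then have "2 * k + e = 2 * k' + e'" using eq by linarith
  moreover from this have "e = e'" using *(1,3) by presburger
  ultimately show "e = e' \<and> k = k'" by simp
qed

lemma sym_product: "s \<in> words {..<a} q \<Longrightarrow> f (rev s) * f s = of_real ((cmod (f s))\<^sup>2)"
  using sym[of s] complex_norm_square[of "f s"] by (simp add: mult.commute)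

lemma contr_sqn_trivial: "contr_sqn (0, 0) = sqn\<^sup>2" "contr_sqn (0, q) = sqn\<^sup>2"
proof -
  have "contr q 0 0 f f = (\<lambda>z. f (take q z) * f (drop q z))" by (simp add: wcontr_def fun_eq_iff)
  then have "contr_sqn (0, 0) = sqnorm {..<a} vol (q + q) (\<lambda>z. f (take q z) * f (drop q z))"
    by (simp add: contr_sqn_def)
  also have "\<dots> = sqn * sqn" unfolding sqnorm_tensor sqn_def ..
  finally show "contr_sqn (0, 0) = sqn\<^sup>2" by (simp add: power2_eq_square)
  have "contr q 0 q f f [] = Wsum q (\<lambda>s. of_real ((cmod (f s))\<^sup>2))"
    unfolding wcontr_def by (intro wsum_cong) (simp add: sym_product)
  also have "\<dots> = of_real sqn" by (simp add: wsum_def sqn_def scaleR_conv_of_real)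
  finally show "contr_sqn (0, q) = sqn\<^sup>2" by (simp add: contr_sqn_def)
qed

text \<open>The fourth moment is the squared trace norm of the square of \<open>X\<close>, whose
  contraction terms are orthogonal by \<open>degree_inj\<close>. All summands are nonnegative, so
  convergence of the sum can be split into convergence of each.\<close>

lemma state_X4: "\<phi> (op_power X 4) = of_real (2 * sqn\<^sup>2 + (\<Sum>b\<in>proper_contr_types q. contr_sqn b))"
proof -
  have "op_power X 2 = (\<Sum>b\<in>contr_types q q. I (case b of (e, k) \<Rightarrow> q + q - 2 * k - e)
      (case b of (e, k) \<Rightarrow> contr q e k f f))"
    using I_product[of q f q f] by (simp add: X_def numeral_2_eq_2 case_prod_unfold)
  then have "nrm2 (op_power X 2) = (\<Sum>b\<in>contr_types q q. contr_sqn b)"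
    using nrm2_sum_I[OF finite_contr_types degree_inj, of "\<lambda>(e, k). contr q e k f f"]
    by (simp add: contr_sqn_def case_prod_unfold)
  also have "contr_types q q = insert (0, 0) (insert (0, q) (proper_contr_types q))"
    unfolding proper_contr_types_def by (auto simp: contr_types_def)
  also have "(\<Sum>b\<in>\<dots>. contr_sqn b) = 2 * sqn\<^sup>2 + (\<Sum>b\<in>proper_contr_types q. contr_sqn b)"
  proof -
    have "finite (proper_contr_types q)" by (simp add: proper_contr_types_def)
    moreover have "(0, 0) \<notin> insert (0, q) (proper_contr_types q)" "(0, q) \<notin> proper_contr_types q"
      using q by (auto simp: proper_contr_types_def)
    ultimately show ?thesis by (simp add: contr_sqn_trivial)
  qed
  finally show ?thesis using state_even_power[of 2] by simp
qed

lemma contr_sqn_nonneg: "0 \<le> contr_sqn b"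
  unfolding contr_sqn_def by (cases b) (auto intro!: wsum_nonneg)

text \<open>Let \<open>H\<close> be the integral of the squared modulus of \<open>f\<close> over all
  but its last variable. By symmetry it is also the integral over all but the first, and both sides
  are the integral of the square of \<open>H\<close>: once by Fubini, once because \<open>H\<close>
  is the star contraction itself.\<close>

lemma contr_sqn_star_1: "contr_sqn (1, 0) = contr_sqn (1, q - 1)"
proof -
  have split: "Wsum q F = Wsum (q - 1) (\<lambda>x. Wsum 1 (\<lambda>c. F (x @ c)))" "Wsum q F = Wsum 1 (\<lambda>c. Wsum (q - 1) (\<lambda>y. F (c @ y)))"
    for F :: "nat list \<Rightarrow> real"
    using wsum_add[of "{..<a}" vol "q - 1" 1 F] wsum_add[of "{..<a}" vol 1 "q - 1" F] q by simp_all
  define H where "H c = Wsum (q - 1) (\<lambda>x. (cmod (f (x @ c)))\<^sup>2)" for c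
  have H: "Wsum (q - 1) (\<lambda>y. (cmod (f (c @ y)))\<^sup>2) = H c" if "c \<in> words {..<a} 1" for c
  proof -
    have rc: "rev c = c" using that by (cases c) (auto simp: in_words_iff)
    have "H c = Wsum (q - 1) (\<lambda>x. (cmod (f (rev x @ c)))\<^sup>2)"
      unfolding H_def by (rule wsum_rev[symmetric])
    also have "\<dots> = Wsum (q - 1) (\<lambda>y. (cmod (f (c @ y)))\<^sup>2)"
    proof (intro wsum_cong)
      fix y assume "y \<in> words {..<a} (q - 1)"
      then have "c @ y \<in> words {..<a} q" using that q by (auto simp: in_words_iff)
      then show "(cmod (f (rev y @ c)))\<^sup>2 = (cmod (f (c @ y)))\<^sup>2"
        using sym[of "c @ y"] by (simp add: rc)
    qed
    finally show ?thesis by simp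
  qed
  have ct: "(1, 0) \<in> contr_types q q" "(1, q - 1) \<in> contr_types q q"
    using q by (auto simp: contr_types_def)
  have "contr_sqn (1, 0) = Wsum (q - 1) (\<lambda>x. Wsum 1 (\<lambda>c. Wsum (q - 1) (\<lambda>y.
      (cmod (f (x @ c)))\<^sup>2 * (cmod (f (c @ y)))\<^sup>2)))"
  proof -
    have "contr_sqn (1, 0) = Wsum (q - 1) (\<lambda>x. Wsum 1 (\<lambda>c. Wsum (q - 1) (\<lambda>y. (cmod (contr q 1 0 f f (x @ c @ y)))\<^sup>2)))"
      using wsum_contr_split[OF ct(1), of "{..<a}" vol "\<lambda>z. (cmod (contr q 1 0 f f z))\<^sup>2"]
      by (simp add: contr_sqn_def)
    also have "\<dots> = Wsum (q - 1) (\<lambda>x. Wsum 1 (\<lambda>c. Wsum (q - 1) (\<lambda>y. (cmod (f (x @ c)))\<^sup>2 * (cmod (f (c @ y)))\<^sup>2)))"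
      using q by (intro wsum_cong) (simp add: wcontr_append in_words_iff norm_mult power_mult_distrib)
    finally show ?thesis .
  qed
  also have "\<dots> = Wsum (q - 1) (\<lambda>x. Wsum 1 (\<lambda>c. (cmod (f (x @ c)))\<^sup>2 * H c))"
    by (intro wsum_cong) (simp only: wsum_mult_right H)
  also have "\<dots> = Wsum 1 (\<lambda>c. H c * H c)"
    by (subst wsum_swap) (simp add: wsum_mult_left H_def)
  also have "\<dots> = contr_sqn (1, q - 1)"
  proof -
    have "contr q 1 (q - 1) f f c = of_real (H c)" if "c \<in> words {..<a} 1" for c
    proof -
      have len: "length c = 1" and rc: "rev c = c" using that by (cases c; auto simp: in_words_iff)+
      have "contr q 1 (q - 1) f f c = Wsum (q - 1) (\<lambda>s. f (c @ rev s) * f (s @ c))"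
        using q len by (simp add: wcontr_def)
      also have "\<dots> = Wsum (q - 1) (\<lambda>s. of_real ((cmod (f (s @ c)))\<^sup>2))"
      proof (intro wsum_cong)
        fix s assume "s \<in> words {..<a} (q - 1)"
        then have "s @ c \<in> words {..<a} q" using that q by (auto simp: in_words_iff)
        then show "f (c @ rev s) * f (s @ c) = of_real ((cmod (f (s @ c)))\<^sup>2)"
          using sym_product[of "s @ c"] by (simp add: rc)
      qed
      also have "\<dots> = of_real (H c)" by (simp add: wsum_def H_def scaleR_conv_of_real)
      finally show ?thesis .
    qed
    moreover have "q + q - 2 * (q - 1) - 1 = 1" using q by simp
    ultimately show ?thesis
      unfolding contr_sqn_def prod.case
      by (simp only: power2_eq_square[symmetric]) (intro wsum_cong, simp)
  qed
  finally show ?thesis .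
qed

lemma power_paths: "op_power X m = (\<Sum>\<pi>\<in>paths q m. I (path_degree q \<pi>) (path_kernel {..<a} vol q f \<pi>))"
proof (induction m)
  case 0
  then show ?case by (simp add: wick_sum_def op_scale_simps)
next
  case (Suc m)
  have "op_power X (Suc m) = (\<Sum>\<pi>\<in>paths q m. X o\<^sub>L I (path_degree q \<pi>) (path_kernel {..<a} vol q f \<pi>))"
    by (simp add: Suc compose_sum_right)
  also have "\<dots> = (\<Sum>\<pi>\<in>paths q m. \<Sum>b\<in>contr_types q (path_degree q \<pi>).
      I (path_degree q (b # \<pi>)) (path_kernel {..<a} vol q f (b # \<pi>)))"
    unfolding X_def I_product by (intro sum.cong refl) auto
  finally show ?case by (simp add: sum_paths_Suc)
qed

lemma state_power_paths:
  "\<phi> (op_power X m) = (\<Sum>\<pi>\<in>{\<pi> \<in> paths q m. path_degree q \<pi> = 0}. path_kernel {..<a} vol q f \<pi> [])"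
proof -
  have "\<phi> (op_power X m) = (\<Sum>\<pi>\<in>paths q m. if path_degree q \<pi> = 0 then path_kernel {..<a} vol q f \<pi> [] else 0)"
    unfolding power_paths by (subst state_sum) (auto simp: I_mem state_I)
  then show ?thesis by (simp add: sum.inter_filter)
qed

lemma state_power_le_labels:
  "cmod (\<phi> (op_power X m)) \<le> (\<Sum>\<pi>\<in>{\<pi> \<in> paths q m. path_degree q \<pi> = 0}.
     Wsum (path_bound \<pi>) (\<lambda>x. prod_list (map (\<lambda>c. cmod (f (map ((!) x) c))) (path_labels q \<pi>))))"
  unfolding state_power_paths
  by (rule order.trans[OF norm_sum], intro sum_mono norm_path_kernel_le) (auto simp: paths_def)

text \<open>The first factor counts the choices per step of a path, the second bounds the kernel
  gained per step. The bound involves the grid only through \<open>V\<close> and \<open>C\<close>,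
  so it survives refinement.\<close>

lemma norm_X_le:
  assumes vol: "(\<Sum>i<a. vol i) \<le> V" "1 \<le> V" and f: "\<And>w. w \<in> words {..<a} q \<Longrightarrow> cmod (f w) \<le> C"
  shows "norm X \<le> real (2 * (q + 1)) * sqrt (C\<^sup>2 * V ^ q)"
proof (rule norm_le_moment_growth[OF X_mem X_selfadjoint])
  let ?b = "sqrt (C\<^sup>2 * V ^ q)"
  have b: "0 \<le> C\<^sup>2 * V ^ q" using vol by simp
  show "0 \<le> real (2 * (q + 1)) * ?b" using b by simp
  fix m
  have "cmod (\<phi> (op_power X (2 * m))) \<le> (\<Sum>\<pi>\<in>{\<pi> \<in> paths q (2 * m). path_degree q \<pi> = 0}. ?b ^ (2 * m))"
    unfolding state_power_paths
  proof (rule order.trans[OF norm_sum], rule sum_mono)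
    fix \<pi> assume "\<pi> \<in> {\<pi> \<in> paths q (2 * m). path_degree q \<pi> = 0}"
    then have pi: "valid_path q \<pi>" "length \<pi> = 2 * m" "path_degree q \<pi> = 0" by (auto simp: paths_def)
    have "(cmod (path_kernel {..<a} vol q f \<pi> []))\<^sup>2 \<le> (C\<^sup>2 * V ^ q) ^ length \<pi>"
      using sqnorm_path_kernel_le[OF vol_nonneg vol f pi(1)] pi(3) by simp
    then show "cmod (path_kernel {..<a} vol q f \<pi> []) \<le> ?b ^ (2 * m)"
      using real_le_rsqrt pi(2) by (metis real_sqrt_power)
  qed
  also have "\<dots> = real (card {\<pi> \<in> paths q (2 * m). path_degree q \<pi> = 0}) * ?b ^ (2 * m)" by simp
  also have "\<dots> \<le> real ((2 * (q + 1)) ^ (2 * m)) * ?b ^ (2 * m)"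
  proof (intro mult_right_mono)
    have "card {\<pi> \<in> paths q (2 * m). path_degree q \<pi> = 0} \<le> card (paths q (2 * m))"
      by (rule card_mono) auto
    then show "real (card {\<pi> \<in> paths q (2 * m). path_degree q \<pi> = 0}) \<le> real ((2 * (q + 1)) ^ (2 * m))"
      using card_paths[of q "2 * m"] by linarith
  qed (use b in simp)
  finally show "cmod (\<phi> (op_power X (2 * m))) \<le> (real (2 * (q + 1)) * ?b) ^ (2 * m)"
    by (simp only: power_mult_distrib of_nat_power of_nat_mult)
qed

section \<open>The Chebyshev-type recurrence for tensor powers\<close>

definition T :: "nat \<Rightarrow> 'h \<Rightarrow>\<^sub>L 'h" where "T j = I (q * j) (tensor_power q f j)"

text \<open>\<open>Suc j\<close> tensor factors meet \<open>f\<close>; after a contraction of the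
  first one, \<open>j\<close> of them are left.\<close>

definition remainder :: "nat \<Rightarrow> nat \<times> nat \<Rightarrow> 'h \<Rightarrow>\<^sub>L 'h" where
  "remainder j = (\<lambda>(e, k). I (q + q * Suc j - 2 * k - e) (contr q e k f (tensor_power q f (Suc j))))"

lemma nrm2_remainder:
  assumes "b \<in> contr_types q q"
  shows "nrm2 (remainder j b) = contr_sqn b * sqn ^ j"
proof -
  obtain e k where b: "b = (e, k)" by (cases b)
  then have ek: "e \<le> 1" "k + e \<le> q" using assms by (auto simp: contr_types_def)
  define d where "d = q + q - 2 * k - e"
  have deg: "q + q * Suc j - 2 * k - e = d + q * j" using ek by (simp add: d_def)
  have "nrm2 (remainder j b) = sqnorm {..<a} vol (d + q * j) (contr q e k f (tensor_power q f (Suc j)))"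
    by (simp only: remainder_def b prod.case nrm2_I deg)
  also have "\<dots> = sqnorm {..<a} vol (d + q * j) (\<lambda>z. contr q e k f f (take d z) * tensor_power q f j (drop d z))"
    using ek(2) by (intro wsum_cong) (simp only: wcontr_tensor_power in_words_iff d_def le_add1)
  also have "\<dots> = contr_sqn b * sqn ^ j"
    unfolding sqnorm_tensor sqnorm_tensor_power by (simp add: b contr_sqn_def sqn_def d_def)
  finally show ?thesis .
qed

text \<open>The tensor power has at least \<open>q\<close> variables, so the contraction types are
  those of \<open>f\<close> with itself. The type \<open>(0, 0)\<close> lengthens the tensor power,
  \<open>(0, q)\<close> shortens it at the price of the variance, and the rest is error.\<close>

lemma X_T_Suc:
  "X o\<^sub>L T (Suc j) = T (Suc (Suc j)) + (sqn *\<^sub>R T j + (\<Sum>b\<in>proper_contr_types q. remainder j b))"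
proof -
  have "q * Suc j \<ge> q" by simp
  then have ct: "contr_types q (q * Suc j) = contr_types q q"
    by (auto simp: contr_types_def simp del: mult_Suc_right intro: order.trans[OF _ \<open>q \<le> q * Suc j\<close>])
  have "X o\<^sub>L T (Suc j) = (\<Sum>b\<in>contr_types q q. remainder j b)"
    unfolding X_def T_def I_product ct remainder_def by (simp only: case_prod_unfold)
  also have "contr_types q q = insert (0, 0) (insert (0, q) (proper_contr_types q))"
    unfolding proper_contr_types_def by (auto simp: contr_types_def)
  also have "(\<Sum>b\<in>\<dots>. remainder j b) =
      remainder j (0, 0) + (remainder j (0, q) + (\<Sum>b\<in>proper_contr_types q. remainder j b))"
  proof -
    have "finite (proper_contr_types q)" by (simp add: proper_contr_types_def)
    moreover have "(0, 0) \<notin> insert (0, q) (proper_contr_types q)" "(0, q) \<notin> proper_contr_types q"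
      using q by (auto simp: proper_contr_types_def)
    ultimately show ?thesis by simp
  qed
  also have "remainder j (0, 0) = T (Suc (Suc j))"
  proof -
    have "contr q 0 0 f (tensor_power q f (Suc j)) = tensor_power q f (Suc (Suc j))"
      by (rule ext) (simp add: wcontr_def)
    then show ?thesis by (simp add: remainder_def T_def del: tensor_power.simps)
  qed
  also have "remainder j (0, q) = sqn *\<^sub>R T j"
  proof -
    have "contr q 0 q f (tensor_power q f (Suc j)) z = of_real sqn * tensor_power q f j z" for z
    proof -
      have "contr q 0 q f (tensor_power q f (Suc j)) z = Wsum q (\<lambda>s. of_real ((cmod (f s))\<^sup>2) * tensor_power q f j z)"
        unfolding wcontr_def
        by (intro wsum_cong) (simp add: sym_product[symmetric] in_words_iff del: of_real_power)
      also have "\<dots> = of_real sqn * tensor_power q f j z"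
        unfolding wsum_mult_left by (simp add: wsum_def sqn_def scaleR_conv_of_real)
      finally show ?thesis .
    qed
    moreover have "q + q * Suc j - 2 * q - 0 = q * j" by simp
    ultimately show ?thesis
      by (simp add: remainder_def T_def wick_sum_def op_scale_sum op_scale_simps flip: op_scale_of_real)
  qed
  finally show ?thesis .
qed

lemma X_T_0: "X o\<^sub>L T 0 = T (Suc 0)"
proof -
  have "X o\<^sub>L T 0 = I (q + 0 - 2 * 0 - 0) (contr q 0 0 f (tensor_power q f 0))"
    unfolding X_def T_def mult_0_right I_product by simp
  also have "contr q 0 0 f (tensor_power q f 0) = tensor_power q f (Suc 0)"
    by (rule ext) (simp add: wcontr_def)
  also have "I (q + 0 - 2 * 0 - 0) (tensor_power q f (Suc 0)) = T (Suc 0)"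
    by (simp add: T_def del: tensor_power.simps)
  finally show ?thesis .
qed

lemma T_mem: "T j \<in> M" and remainder_mem: "remainder j b \<in> M"
  by (auto simp: T_def remainder_def I_mem split: prod.splits)

text \<open>One factor \<open>X\<close> of the power is moved onto \<open>T j\<close>, which
  reproduces the recursion of \<open>semicircle_path\<close>. Cauchy-Schwarz separates each
  remainder from the power of \<open>X\<close>, so only trace norms enter. For \<open>j = 0\<close>
  there is no remainder.\<close>

lemma semicircle_approx:
  "cmod (\<phi> (op_power X m o\<^sub>L T j) - of_real (semicircle_path sqn m j))
    \<le> semicircle_error (proper_contr_types q) sqn contr_sqn (\<lambda>i. nrm2 (op_power X i)) m j"
proof (induction m arbitrary: j)
  case 0
  have "\<phi> (T j) = (if j = 0 then 1 else 0)"
    using q by (auto simp: T_def state_I)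
  then show ?case by simp
next
  case (Suc m)
  let ?E = "semicircle_error (proper_contr_types q) sqn contr_sqn (\<lambda>i. nrm2 (op_power X i))"
  let ?F = "\<lambda>m j. \<phi> (op_power X m o\<^sub>L T j)"
  show ?case
  proof (cases j)
    case 0
    have "?F (Suc m) j = ?F m (Suc 0)"
      by (simp only: 0 op_power_Suc_right compose_assoc X_T_0)
    then show ?thesis using Suc[of "Suc 0"] by (simp add: 0 del: op_power.simps)
  next
    case j: (Suc i)
    let ?R = "\<Sum>b\<in>proper_contr_types q. \<phi> (op_power X m o\<^sub>L remainder i b)"
    have "?F (Suc m) j = \<phi> ((op_power X m o\<^sub>L T (Suc j)) + (sqn *\<^sub>R (op_power X m o\<^sub>L T i) +
        (\<Sum>b\<in>proper_contr_types q. op_power X m o\<^sub>L remainder i b)))"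
      by (simp only: j op_power_Suc_right compose_assoc X_T_Suc compose_linear compose_sum_right)
    also have "\<dots> = ?F m (Suc j) + (of_real sqn * ?F m i + ?R)"
      by (simp add: state_add state_scaleR state_sum M_add M_scaleR M_sum M_compose X_pow T_mem remainder_mem)
    finally have eq: "?F (Suc m) j - of_real (semicircle_path sqn (Suc m) j) =
        (?F m (Suc j) - of_real (semicircle_path sqn m (Suc j))) +
        (of_real sqn * (?F m i - of_real (semicircle_path sqn m i)) + ?R)"
      by (simp add: j algebra_simps)
    have "cmod ?R \<le> (\<Sum>b\<in>proper_contr_types q. sqrt (nrm2 (op_power X m)) * sqrt (contr_sqn b * sqn ^ i))"
    proof (rule order.trans[OF norm_sum], rule sum_mono)
      fix b assume "b \<in> proper_contr_types q"
      then have b: "b \<in> contr_types q q" by (simp add: proper_contr_types_def)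
      show "cmod (\<phi> (op_power X m o\<^sub>L remainder i b)) \<le> sqrt (nrm2 (op_power X m)) * sqrt (contr_sqn b * sqn ^ i)"
        using state_cauchy_schwarz[OF X_pow(1) remainder_mem X_pow(2), of m i b] by (simp add: nrm2_remainder[OF b])
    qed
    moreover have "cmod (of_real sqn * (?F m i - of_real (semicircle_path sqn m i))) \<le> sqn * ?E m i"
      using Suc[of i] sqn_nonneg by (simp add: norm_mult mult_left_mono)
    ultimately have "cmod (?F (Suc m) j - of_real (semicircle_path sqn (Suc m) j)) \<le>
        ?E m (Suc j) + (sqn * ?E m i + (\<Sum>b\<in>proper_contr_types q. sqrt (nrm2 (op_power X m)) * sqrt (contr_sqn b * sqn ^ i)))"
      unfolding eq using Suc[of "Suc j"] by (intro norm_triangle_le add_mono)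
    then show ?thesis by (simp add: j)
  qed
qed

lemma state_power_approx:
  "cmod (\<phi> (op_power X m) - of_real (semicircle_path sqn m 0))
    \<le> semicircle_error (proper_contr_types q) sqn contr_sqn (\<lambda>i. nrm2 (op_power X i)) m 0"
proof -
  have "T 0 = id_blinfun" by (simp add: T_def wick_sum_def op_scale_simps)
  then show ?thesis using semicircle_approx[of m 0] by simp
qed

end

section \<open>Finite powers of Lebesgue measure\<close>

abbreviation LP :: "'i set \<Rightarrow> ('i \<Rightarrow> 'z::euclidean_space) measure" where
  "LP I \<equiv> PiM I (\<lambda>_. lborel)"

interpretation LP: product_sigma_finite "\<lambda>_. lborel :: 'z::euclidean_space measure"
  by standard

lemma sigma_finite_LP: "finite I \<Longrightarrow> sigma_finite_measure (LP I)"
  by (rule LP.sigma_finite)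

lemma pair_sigma_finite_LP: "finite I \<Longrightarrow> finite J \<Longrightarrow> pair_sigma_finite (LP I) (LP J)"
  by (simp add: pair_sigma_finite_def sigma_finite_LP)

lemma measurable_reindex:
  assumes "h ` K \<subseteq> I"
  shows "(\<lambda>x. \<lambda>i\<in>K. x (h i)) \<in> LP I \<rightarrow>\<^sub>M LP K"
  using assms by (intro measurable_restrict measurable_component_singleton) auto

lemma distr_LP_bij:
  assumes "finite K" "bij_betw h K J"
  shows "distr (LP J) (LP K) (\<lambda>x. \<lambda>i\<in>K. x (h i)) = (LP K :: ('i \<Rightarrow> 'z::euclidean_space) measure)"
proof (rule LP.PiM_eqI[OF assms(1)])
  have hK: "h ` K = J" "inj_on h K" using assms(2) by (auto simp: bij_betw_def)
  then have finJ: "finite J" using assms(1) by blast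
  fix A :: "'i \<Rightarrow> 'z set" assume A: "\<And>i. i \<in> K \<Longrightarrow> A i \<in> sets lborel"
  have "emeasure (distr (LP J) (LP K) (\<lambda>x. \<lambda>i\<in>K. x (h i))) (Pi\<^sub>E K A) =
      emeasure (LP J) ((\<lambda>x. \<lambda>i\<in>K. x (h i)) -` Pi\<^sub>E K A \<inter> space (LP J))"
    using A assms(1) hK by (intro emeasure_distr measurable_reindex sets_PiM_I_finite) auto
  also have "(\<lambda>x. \<lambda>i\<in>K. x (h i)) -` Pi\<^sub>E K A \<inter> space (LP J) = Pi\<^sub>E J (\<lambda>j. A (inv_into K h j))"
    using hK by (auto simp: space_PiM PiE_iff extensional_def inv_into_f_f)
  also have "emeasure (LP J) \<dots> = (\<Prod>j\<in>J. emeasure lborel (A (inv_into K h j)))"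
    using A hK finJ by (intro LP.emeasure_PiM) (auto simp: inv_into_f_f)
  also have "\<dots> = (\<Prod>i\<in>K. emeasure lborel (A i))"
    unfolding hK(1)[symmetric] using hK(2) by (subst prod.reindex) (auto simp: inv_into_f_f)
  finally show "emeasure (distr (LP J) (LP K) (\<lambda>x. \<lambda>i\<in>K. x (h i))) (Pi\<^sub>E K A) = (\<Prod>i\<in>K. emeasure lborel (A i))" .
qed simp

text \<open>An exceptional null set in some coordinates becomes a cylinder over it, which is null
  for the product measure even though the remaining factor has infinite measure.\<close>

lemma AE_LP_restrict:
  assumes "finite I" "J \<subseteq> I" "AE x in LP J. P x"
  shows "AE x in (LP I :: ('i \<Rightarrow> 'z::euclidean_space) measure). P (restrict x J)"
proof -
  have fin: "finite J" "finite (I - J)" using assms finite_subset by auto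
  interpret pair_sigma_finite "LP J :: ('i \<Rightarrow> 'z) measure" "LP (I - J)"
    by (rule pair_sigma_finite_LP[OF fin])
  obtain N where N: "{x \<in> space (LP J). \<not> P x} \<subseteq> N" "emeasure (LP J) N = 0" "N \<in> sets (LP J)"
    using assms(3) by (rule AE_E)
  have m: "(\<lambda>x. restrict x J) \<in> LP I \<rightarrow>\<^sub>M LP J"
    by (rule measurable_restrict_subset[OF assms(2)])
  have "AE p in LP J \<Otimes>\<^sub>M LP (I - J). fst p \<notin> N"
  proof (rule AE_pair_measure)
    show "{p \<in> space (LP J \<Otimes>\<^sub>M LP (I - J)). fst p \<notin> N} \<in> sets (LP J \<Otimes>\<^sub>M LP (I - J))"
      using N(3) by measurable
    have "AE x in LP J. x \<notin> N" using N by (intro AE_not_in null_setsI)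
    then show "AE x in LP J. AE y in LP (I - J). fst (x, y) \<notin> N"
      by (rule AE_mp[OF _ AE_I2]) simp
  qed
  then have "AE p in LP J \<Otimes>\<^sub>M LP (I - J). restrict (merge J (I - J) p) J \<notin> N"
  proof (rule AE_mp[OF _ AE_I2], clarify)
    fix x y assume "(x, y) \<in> space (LP J \<Otimes>\<^sub>M LP (I - J))" "fst (x, y) \<notin> N" "restrict (merge J (I - J) (x, y)) J \<in> N"
    moreover from this have "restrict x J = x"
      by (auto simp: space_pair_measure space_PiM)
    ultimately show False by simp
  qed
  then have "AE x in distr (LP J \<Otimes>\<^sub>M LP (I - J)) (LP (J \<union> (I - J))) (merge J (I - J)). restrict x J \<notin> N"
  proof (subst AE_distr_iff)
    show "merge J (I - J) \<in> LP J \<Otimes>\<^sub>M LP (I - J) \<rightarrow>\<^sub>M LP (J \<union> (I - J))" by (rule measurable_merge)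
    have "{x \<in> space (LP I). restrict x J \<notin> N} \<in> sets (LP I)"
      using measurable_sets[OF m N(3)] sets.compl_sets[of "(\<lambda>x. restrict x J) -` N \<inter> space (LP I)" "LP I"]
      by (simp add: set_diff_eq Collect_conj_eq[symmetric] conj_commute) (smt (verit) Collect_cong vimage_eq Int_iff)
    moreover have "J \<union> (I - J) = I" using assms(2) by auto
    ultimately show "{x \<in> space (LP (J \<union> (I - J))). restrict x J \<notin> N} \<in> sets (LP (J \<union> (I - J)))"
      by simp
  qed
  also have "distr (LP J \<Otimes>\<^sub>M LP (I - J)) (LP (J \<union> (I - J))) (merge J (I - J)) = LP (J \<union> (I - J))"
    using fin by (intro LP.distr_merge) auto
  also have "J \<union> (I - J) = I" using assms(2) by auto
  finally have "AE x in LP I. restrict x J \<notin> N" .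
  then show ?thesis
  proof (rule AE_mp[OF _ AE_I2], intro impI)
    fix x assume x: "x \<in> space (LP I)" "restrict x J \<notin> N"
    then have "restrict x J \<in> space (LP J)" using measurable_space[OF m] by blast
    then show "P (restrict x J)" using N(1) x(2) by blast
  qed
qed

text \<open>Injectivity is essential: with a repeated coordinate the reindexed points would lie on a
  diagonal, a null set on which \<open>P\<close> might fail everywhere.\<close>

lemma AE_LP_reindex:
  assumes "finite K" "finite I" "inj_on h K" "h ` K \<subseteq> I" "AE t in LP K. P t"
  shows "AE x in (LP I :: ('i \<Rightarrow> 'z::euclidean_space) measure). P (\<lambda>i\<in>K. x (h i))"
proof -
  have "AE t in distr (LP (h ` K)) (LP K) (\<lambda>x. \<lambda>i\<in>K. x (h i)). P t"
    using assms by (subst distr_LP_bij) (auto simp: bij_betw_def)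
  then have "AE x in LP (h ` K). P (\<lambda>i\<in>K. x (h i))"
    by (rule AE_distrD[OF measurable_reindex[OF order_refl]])
  then have "AE x in LP I. P (\<lambda>i\<in>K. restrict x (h ` K) (h i))"
    by (rule AE_LP_restrict[OF assms(2,4)])
  then show ?thesis
  proof (rule AE_mp[OF _ AE_I2], intro impI)
    fix x assume "P (\<lambda>i\<in>K. restrict x (h ` K) (h i))"
    moreover have "(\<lambda>i\<in>K. restrict x (h ` K) (h i)) = (\<lambda>i\<in>K. x (h i))" by (auto simp: fun_eq_iff)
    ultimately show "P (\<lambda>i\<in>K. x (h i))" by simp
  qed
qed

text \<open>The sum type keeps the coordinates of \<open>x\<close> and \<open>y\<close> apart, so
  that both form one point of a single finite power, to which reindexing and then Fubini
  apply.\<close>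

lemma AE_LP_pair:
  fixes h :: "'k \<Rightarrow> 'i + 'j" and P :: "('k \<Rightarrow> 'z::euclidean_space) \<Rightarrow> bool"
  assumes fin: "finite K" "finite I" "finite J" and h: "inj_on h K" "h ` K \<subseteq> Inl ` I \<union> Inr ` J"
    and P: "AE t in LP K. P t"
  shows "AE x in LP I. AE y in LP J. P (\<lambda>i\<in>K. case h i of Inl a \<Rightarrow> x a | Inr b \<Rightarrow> y b)"
proof -
  let ?I = "Inl ` I :: ('i + 'j) set" and ?J = "Inr ` J :: ('i + 'j) set"
  interpret pair_sigma_finite "LP ?I :: ('i + 'j \<Rightarrow> 'z) measure" "LP ?J"
    using fin by (intro pair_sigma_finite_LP) auto
  have "AE z in LP (?I \<union> ?J). P (\<lambda>i\<in>K. z (h i))"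
    using fin h by (intro AE_LP_reindex[OF _ _ _ _ P]) auto
  then have "AE z in distr (LP ?I \<Otimes>\<^sub>M LP ?J) (LP (?I \<union> ?J)) (merge ?I ?J). P (\<lambda>i\<in>K. z (h i))"
    using fin by (subst LP.distr_merge) auto
  then have "AE p in LP ?I \<Otimes>\<^sub>M LP ?J. P (\<lambda>i\<in>K. merge ?I ?J p (h i))"
    by (rule AE_distrD[OF measurable_merge])
  then have "AE x in LP ?I. AE y in LP ?J. P (\<lambda>i\<in>K. merge ?I ?J (x, y) (h i))"
    by (rule AE_pair)
  then have "AE x in LP I. AE y in LP ?J. P (\<lambda>i\<in>K. merge ?I ?J (\<lambda>i\<in>?I. x (projl i), y) (h i))"
    by (intro AE_LP_reindex[where K = ?I and P = "\<lambda>x. AE y in LP ?J. P (\<lambda>i\<in>K. merge ?I ?J (x, y) (h i))"])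
      (use fin in \<open>auto simp: inj_on_def\<close>)
  then show ?thesis
  proof (rule AE_mp[OF _ AE_I2], intro impI)
    fix x assume "AE y in LP ?J. P (\<lambda>i\<in>K. merge ?I ?J (\<lambda>i\<in>?I. x (projl i), y) (h i))"
    then have "AE y in LP J. P (\<lambda>i\<in>K. merge ?I ?J (\<lambda>i\<in>?I. x (projl i), \<lambda>i\<in>?J. y (projr i)) (h i))"
      by (intro AE_LP_reindex[where K = ?J and P = "\<lambda>y. P (\<lambda>i\<in>K. merge ?I ?J (\<lambda>i\<in>?I. x (projl i), y) (h i))"])
        (use fin in \<open>auto simp: inj_on_def\<close>)
    moreover have "(\<lambda>i\<in>K. merge ?I ?J (\<lambda>i\<in>?I. x (projl i), \<lambda>i\<in>?J. y (projr i)) (h i)) =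
        (\<lambda>i\<in>K. case h i of Inl a \<Rightarrow> x a | Inr b \<Rightarrow> y b)" for y
    proof (rule ext)
      fix i
      show "(\<lambda>i\<in>K. merge ?I ?J (\<lambda>i\<in>?I. x (projl i), \<lambda>i\<in>?J. y (projr i)) (h i)) i =
        (\<lambda>i\<in>K. case h i of Inl a \<Rightarrow> x a | Inr b \<Rightarrow> y b) i"
        using h(2) by (cases "i \<in> K"; cases "h i") (force simp: merge_def)+
    qed
    ultimately show "AE y in LP J. P (\<lambda>i\<in>K. case h i of Inl a \<Rightarrow> x a | Inr b \<Rightarrow> y b)" by simp
  qed
qed

section \<open>Step kernels\<close>

definition is_grid :: "nat \<Rightarrow> (nat \<Rightarrow> 'z::euclidean_space set) \<Rightarrow> bool" where
  "is_grid a A \<longleftrightarrow> (\<forall>i<a. A i \<in> sets borel \<and> bounded (A i)) \<and> disjoint_family_on A {..<a}"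

text \<open>The value \<open>a\<close> stands for the complement of all cells.\<close>

definition cell :: "nat \<Rightarrow> (nat \<Rightarrow> 'z set) \<Rightarrow> 'z \<Rightarrow> nat" where
  "cell a A z = (if \<exists>i<a. z \<in> A i then THE i. i < a \<and> z \<in> A i else a)"

text \<open>The kernel vanishes as soon as one variable lies outside all cells.\<close>

definition kernel_support :: "nat \<Rightarrow> nat \<Rightarrow> (nat list \<Rightarrow> 'b::zero) \<Rightarrow> bool" where
  "kernel_support a n G \<longleftrightarrow> (\<forall>w. length w = n \<longrightarrow> \<not> set w \<subseteq> {..<a} \<longrightarrow> G w = 0)"

definition step_kernel :: "nat \<Rightarrow> (nat \<Rightarrow> 'z set) \<Rightarrow> nat \<Rightarrow> (nat list \<Rightarrow> 'b) \<Rightarrow> (nat \<Rightarrow> 'z) \<Rightarrow> 'b" where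
  "step_kernel a A n G t = G (map (\<lambda>i. cell a A (t i)) [0..<n])"

lemma cell_eq_iff:
  assumes "is_grid a A" "i < a"
  shows "cell a A z = i \<longleftrightarrow> z \<in> A i"
proof -
  have uniq: "j = k" if "j < a" "k < a" "z \<in> A j" "z \<in> A k" for j k
    using assms(1) that by (auto simp: is_grid_def disjoint_family_on_def)
  show ?thesis
  proof (cases "\<exists>i<a. z \<in> A i")
    case True
    then have "\<exists>!i. i < a \<and> z \<in> A i" using uniq by blast
    from theI'[OF this] have "cell a A z < a" "z \<in> A (cell a A z)" by (auto simp: cell_def True)
    then show ?thesis using uniq assms(2) by blast
  next
    case False
    then show ?thesis using assms(2) by (auto simp: cell_def)
  qed
qed

lemma grid_finite_measure:
  assumes "is_grid a A" "i < a"
  shows "A i \<in> finite_measure_sets"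
proof -
  have "A i \<in> sets borel" "bounded (A i)" using assms by (auto simp: is_grid_def)
  then show ?thesis
    using emeasure_bounded_finite[of "A i"] by (simp add: finite_measure_sets_def less_top)
qed

text \<open>The integrand is a finite combination of indicators of boxes built from cells.\<close>

lemma has_integral_cells:
  fixes H :: "('i \<Rightarrow> nat) \<Rightarrow> 'b::{banach, second_countable_topology}"
  assumes g: "is_grid a A" and fin: "finite I"
    and H: "\<And>y. y \<in> extensional I \<Longrightarrow> y \<notin> (I \<rightarrow>\<^sub>E {..<a}) \<Longrightarrow> H y = 0"
  shows "has_bochner_integral (LP I) (\<lambda>x. H (\<lambda>i\<in>I. cell a A (x i)))
    (\<Sum>y\<in>(I \<rightarrow>\<^sub>E {..<a}). (\<Prod>i\<in>I. measure lborel (A (y i))) *\<^sub>R H y)"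
proof -
  have eq: "H (\<lambda>i\<in>I. cell a A (x i)) = (\<Sum>y\<in>(I \<rightarrow>\<^sub>E {..<a}). (\<Prod>i\<in>I. indicat_real (A (y i)) (x i)) *\<^sub>R H y)" for x
  proof -
    define y0 where "y0 = (\<lambda>i\<in>I. cell a A (x i))"
    have ind: "(\<Prod>i\<in>I. indicat_real (A (y i)) (x i)) = (if y = y0 then 1 else 0)" if y: "y \<in> (I \<rightarrow>\<^sub>E {..<a})" for y
    proof -
      have *: "x i \<in> A (y i) \<longleftrightarrow> y i = cell a A (x i)" if "i \<in> I" for i
        using cell_eq_iff[OF g, of "y i" "x i"] y that by (auto simp: PiE_iff)
      show ?thesis
      proof (cases "y = y0")
        case True
        then have "x i \<in> A (y i)" if "i \<in> I" for i
          using *[OF that] that by (simp add: y0_def)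
        then show ?thesis using True by (simp add: prod.neutral)
      next
        case False
        then obtain i where "i \<in> I" "y i \<noteq> cell a A (x i)"
          using y by (auto simp: y0_def fun_eq_iff PiE_iff extensional_def split: if_splits)
        then have "\<exists>i\<in>I. indicat_real (A (y i)) (x i) = 0" using * by (auto simp: indicator_def)
        then show ?thesis using False fin by (simp add: prod_zero_iff)
      qed
    qed
    have "(\<Sum>y\<in>(I \<rightarrow>\<^sub>E {..<a}). (\<Prod>i\<in>I. indicat_real (A (y i)) (x i)) *\<^sub>R H y) =
        (\<Sum>y\<in>(I \<rightarrow>\<^sub>E {..<a}). if y = y0 then H y0 else 0)"
      by (intro sum.cong refl) (simp add: ind)
    also have "\<dots> = H y0"
      using fin H[of y0] by (subst sum.delta) (auto simp: finite_PiE y0_def)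
    finally show ?thesis by (simp add: y0_def)
  qed
  have one: "has_bochner_integral (LP I) (\<lambda>x. \<Prod>i\<in>I. indicat_real (A (y i)) (x i)) (\<Prod>i\<in>I. measure lborel (A (y i)))"
    if "y \<in> (I \<rightarrow>\<^sub>E {..<a})" for y
  proof -
    have int: "integrable lborel (indicat_real (A (y i)))" if "i \<in> I" for i
      using grid_finite_measure[OF g, of "y i"] \<open>y \<in> _\<close> that
      by (auto simp: finite_measure_sets_def PiE_iff less_top)
    have "measure lborel (A (y i) \<inter> space lborel) = measure lborel (A (y i))" for i by simp
    then show ?thesis
      unfolding has_bochner_integral_iff
      using LP.product_integrable_prod[OF fin int] LP.product_integral_prod[OF fin int] by simp
  qed
  show ?thesis
    unfolding eq by (intro has_bochner_integral_sum has_bochner_integral_scaleR_left one)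
qed

lemma has_integral_step_kernel:
  fixes G :: "nat list \<Rightarrow> 'b::{banach, second_countable_topology}"
  assumes g: "is_grid a A" and G: "kernel_support a n G"
  shows "has_bochner_integral (lborel_pow n) (step_kernel a A n G)
    (wsum {..<a} (\<lambda>i. measure lborel (A i)) n G)"
proof -
  let ?H = "\<lambda>y. G (map y [0..<n])"
  have "has_bochner_integral (LP {..<n}) (\<lambda>x. ?H (\<lambda>i\<in>{..<n}. cell a A (x i)))
      (\<Sum>y\<in>({..<n} \<rightarrow>\<^sub>E {..<a}). (\<Prod>i<n. measure lborel (A (y i))) *\<^sub>R ?H y)"
  proof (intro has_integral_cells[OF g])
    fix y :: "nat \<Rightarrow> nat" assume "y \<in> extensional {..<n}" "y \<notin> {..<n} \<rightarrow>\<^sub>E {..<a}"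
    then obtain i where "i < n" "\<not> y i < a" by (auto simp: PiE_iff)
    have "y i \<in> set (map y [0..<n])" using \<open>i < n\<close> by simp
    then have "\<not> set (map y [0..<n]) \<subseteq> {..<a}" using \<open>\<not> y i < a\<close> by blast
    then show "G (map y [0..<n]) = 0" using G unfolding kernel_support_def by simp
  qed simp
  moreover have "?H (\<lambda>i\<in>{..<n}. cell a A (x i)) = step_kernel a A n G x" for x
    unfolding step_kernel_def by (intro arg_cong[where f = G] map_cong) auto
  moreover have "(\<Sum>y\<in>({..<n} \<rightarrow>\<^sub>E {..<a}). (\<Prod>i<n. measure lborel (A (y i))) *\<^sub>R ?H y) =
      wsum {..<a} (\<lambda>i. measure lborel (A i)) n G"
    unfolding wsum_def
  proof (rule sum.reindex_bij_witness[where i = "\<lambda>w. \<lambda>i\<in>{..<n}. w ! i" and j = "\<lambda>y. map y [0..<n]"])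
    fix y assume y: "y \<in> {..<n} \<rightarrow>\<^sub>E {..<a}"
    then show "(\<lambda>i\<in>{..<n}. map y [0..<n] ! i) = y"
      by (auto simp: fun_eq_iff PiE_iff extensional_def)
    show "map y [0..<n] \<in> words {..<a} n" using y by (auto simp: in_words_iff PiE_iff)
    show "prod_list (map (\<lambda>i. measure lborel (A i)) (map y [0..<n])) *\<^sub>R G (map y [0..<n]) =
        (\<Prod>i<n. measure lborel (A (y i))) *\<^sub>R G (map y [0..<n])"
      by (simp add: prod.list_conv_set_nth comp_def atLeast0LessThan)
  next
    fix w assume w: "w \<in> words {..<a} n"
    then show "map (\<lambda>i\<in>{..<n}. w ! i) [0..<n] = w"
      by (auto simp: in_words_iff intro!: nth_equalityI)
    show "(\<lambda>i\<in>{..<n}. w ! i) \<in> {..<n} \<rightarrow>\<^sub>E {..<a}"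
      using w by (auto simp: in_words_iff subset_iff)
  qed
  ultimately show ?thesis by (simp add: lborel_pow_def)
qed

lemma L2_norm_step_kernel:
  assumes g: "is_grid a A" and G: "kernel_support a n G"
  shows "L2_norm n (step_kernel a A n G) = sqrt (wsum {..<a} (\<lambda>i. measure lborel (A i)) n (\<lambda>w. (cmod (G w))\<^sup>2))"
proof -
  have "kernel_support a n (\<lambda>w. (cmod (G w))\<^sup>2)" using G by (auto simp: kernel_support_def)
  from has_bochner_integral_integral_eq[OF has_integral_step_kernel[OF g this]]
  show ?thesis unfolding L2_norm_def step_kernel_def by simp
qed

lemma measurable_step_kernel:
  fixes G :: "nat list \<Rightarrow> 'b::{banach, second_countable_topology}"
  assumes "is_grid a A" "kernel_support a n G"
  shows "step_kernel a A n G \<in> borel_measurable (lborel_pow n)"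
  using has_integral_step_kernel[OF assms] by (auto simp: has_bochner_integral_iff)

section \<open>Contractions of kernels\<close>

text \<open>Both kinds of contractions at once, with the conventions of \<^const>\<open>wcontr\<close>.\<close>

definition gcontr :: "nat \<Rightarrow> nat \<Rightarrow> nat \<Rightarrow> ((nat \<Rightarrow> 'z::euclidean_space) \<Rightarrow> complex) \<Rightarrow> (nat \<Rightarrow> 'z) \<Rightarrow> complex" where
  "gcontr q e k f t =
     (\<integral>s. f (\<lambda>i\<in>{..<q}. if i < q - k then t i else s (q - 1 - i)) *
          f (\<lambda>i\<in>{..<q}. if i < k then s i else t (q - k - e + (i - k))) \<partial>lborel_pow k)"

lemma contraction_eq_gcontr: "contraction q q k f f = gcontr q 0 k f"
  by (simp add: contraction_def gcontr_def fun_eq_iff cong: if_cong)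

lemma star_contraction_eq_gcontr:
  assumes "1 \<le> k" "k \<le> q"
  shows "star_contraction q q k f f = gcontr q 1 (k - 1) f"
proof -
  have "q - (k - 1) = q - k + 1" "q - (k - 1) - 1 = q - k" using assms by auto
  then show ?thesis by (simp only: star_contraction_def gcontr_def fun_eq_iff simp_thms)
qed

text \<open>For fixed \<open>t\<close> the integrand is a step kernel in \<open>s\<close>, and the
  integral of that is a \<open>wsum\<close>. The reversal of the integrated variables in the first
  factor becomes \<open>rev\<close> on words.\<close>

lemma gcontr_step_kernel:
  fixes A :: "nat \<Rightarrow> 'z::euclidean_space set"
  assumes g: "is_grid a A" and G: "kernel_support a q G" and ek: "k + e \<le> q"
  shows "gcontr q e k (step_kernel a A q G) = step_kernel a A (q + q - 2 * k - e)
    (wcontr {..<a} (\<lambda>i. measure lborel (A i)) q e k G G)"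
proof
  fix t :: "nat \<Rightarrow> 'z"
  let ?c = "cell a A"
  define r where "r = q + q - 2 * k - e"
  define z where "z = map (\<lambda>i. ?c (t i)) [0..<r]"
  define F where "F w = G (take (q - k) z @ rev w) * G (w @ drop (q - k - e) z)" for w
  have r: "q - k \<le> r" "r - (q - k - e) = q - k" using ek by (auto simp: r_def)
  have sup: "kernel_support a k F"
    using G r ek unfolding kernel_support_def F_def z_def by auto
  have 1: "step_kernel a A q G (\<lambda>i\<in>{..<q}. if i < q - k then t i else s (q - 1 - i)) =
      G (take (q - k) z @ rev (map (\<lambda>i. ?c (s i)) [0..<k]))" for s :: "nat \<Rightarrow> 'z"
    unfolding step_kernel_def
  proof (rule arg_cong[where f = G], rule nth_equalityI)
    fix i assume "i < length (map (\<lambda>i. ?c ((\<lambda>i\<in>{..<q}. if i < q - k then t i else s (q - 1 - i)) i)) [0..<q])"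
    then have i: "i < q" by simp
    show "map (\<lambda>i. ?c ((\<lambda>i\<in>{..<q}. if i < q - k then t i else s (q - 1 - i)) i)) [0..<q] ! i =
        (take (q - k) z @ rev (map (\<lambda>i. ?c (s i)) [0..<k])) ! i"
    proof (cases "i < q - k")
      case True
      then show ?thesis using i r by (simp add: nth_append z_def)
    next
      case False
      then have "k - Suc (i - (q - k)) = q - 1 - i" "i - (q - k) < k" using i ek by auto
      then show ?thesis using i False r ek by (simp add: nth_append z_def rev_nth min_def)
    qed
  qed (use r ek in \<open>simp add: z_def min_def\<close>)
  have 2: "step_kernel a A q G (\<lambda>i\<in>{..<q}. if i < k then s i else t (q - k - e + (i - k))) =
      G (map (\<lambda>i. ?c (s i)) [0..<k] @ drop (q - k - e) z)" for s :: "nat \<Rightarrow> 'z"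
    unfolding step_kernel_def
    by (rule arg_cong[where f = G], rule nth_equalityI) (use r ek in \<open>auto simp: z_def nth_append\<close>)
  have "gcontr q e k (step_kernel a A q G) t = (\<integral>s. step_kernel a A k F s \<partial>lborel_pow k)"
    unfolding gcontr_def 1 2 by (simp add: step_kernel_def F_def)
  also have "\<dots> = wsum {..<a} (\<lambda>i. measure lborel (A i)) k F"
    by (rule has_bochner_integral_integral_eq[OF has_integral_step_kernel[OF g sup]])
  finally show "gcontr q e k (step_kernel a A q G) t = step_kernel a A (q + q - 2 * k - e)
    (wcontr {..<a} (\<lambda>i. measure lborel (A i)) q e k G G) t"
    unfolding step_kernel_def wcontr_def F_def[abs_def] z_def r_def .
qed

lemma L2_norm_gcontr_step_kernel:
  assumes g: "is_grid a A" and G: "kernel_support a q G" and ek: "k + e \<le> q" "e \<le> 1"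
  shows "L2_norm (q + q - 2 * k - e) (gcontr q e k (step_kernel a A q G)) =
    sqrt (wsum {..<a} (\<lambda>i. measure lborel (A i)) (q + q - 2 * k - e)
      (\<lambda>w. (cmod (wcontr {..<a} (\<lambda>i. measure lborel (A i)) q e k G G w))\<^sup>2))"
  unfolding gcontr_step_kernel[OF g G ek(1)]
proof (rule L2_norm_step_kernel[OF g])
  show "kernel_support a (q + q - 2 * k - e) (wcontr {..<a} (\<lambda>i. measure lborel (A i)) q e k G G)"
    unfolding kernel_support_def
  proof (intro allI impI)
    fix w :: "nat list" assume w: "length w = q + q - 2 * k - e" "\<not> set w \<subseteq> {..<a}"
    \<comment> \<open>Together the two factors read all of \<open>w\<close>, the shared letter
      twice, so a letter outside the grid makes at least one factor vanish.\<close>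
    have "set (drop (q - k) w) \<subseteq> set (drop (q - k - e) w)"
      by (rule set_drop_subset_set_drop) simp
    moreover have "set w = set (take (q - k) w) \<union> set (drop (q - k) w)"
      by (metis append_take_drop_id set_append)
    ultimately have supp: "\<not> set (take (q - k) w) \<subseteq> {..<a} \<or> \<not> set (drop (q - k - e) w) \<subseteq> {..<a}"
      using w(2) by blast
    have z: "G (take (q - k) w @ rev s) * G (s @ drop (q - k - e) w) = 0" if "s \<in> words {..<a} k" for s
    proof -
      have s: "length s = k" using that by (simp add: in_words_iff)
      have "length (take (q - k) w @ rev s) = q" "length (s @ drop (q - k - e) w) = q"
        using s w(1) ek by auto
      moreover have "\<not> set (take (q - k) w @ rev s) \<subseteq> {..<a} \<or> \<not> set (s @ drop (q - k - e) w) \<subseteq> {..<a}"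
        using supp unfolding set_append by blast
      ultimately show ?thesis using G unfolding kernel_support_def by (metis mult_zero_left mult_zero_right)
    qed
    show "wcontr {..<a} (\<lambda>i. measure lborel (A i)) q e k G G w = 0"
      unfolding wcontr_def wsum_def
    proof (rule sum.neutral, rule ballI)
      fix s assume "s \<in> words {..<a} k"
      from z[OF this] show "(\<Prod>i\<leftarrow>s. measure lborel (A i)) *\<^sub>R (G (take (q - k) w @ rev s) * G (s @ drop (q - k - e) w)) = 0"
        by (simp only: scaleR_zero_right)
    qed
  qed
qed

section \<open>Limits of kernels with common bounded support\<close>

text \<open>The common integrable majorant: the indicator of a product of balls of radius
  \<open>R\<close>.\<close>

definition ball_box :: "'i set \<Rightarrow> real \<Rightarrow> ('i \<Rightarrow> 'z::euclidean_space) \<Rightarrow> real" where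
  "ball_box I R x = (\<Prod>i\<in>I. indicat_real (cball 0 R) (x i))"

lemma ball_box_eq: "finite I \<Longrightarrow> ball_box I R x = (if \<forall>i\<in>I. norm (x i) \<le> R then 1 else 0)"
  by (auto simp: ball_box_def prod_zero_iff indicator_def)

lemma ball_box_nonneg: "0 \<le> ball_box I R x"
  unfolding ball_box_def by (intro prod_nonneg) auto

lemma integrable_ball_box: "finite I \<Longrightarrow> integrable (LP I) (ball_box I R :: ('i \<Rightarrow> 'z::euclidean_space) \<Rightarrow> real)"
proof -
  assume I: "finite I"
  have "integrable lborel (indicat_real (cball (0 :: 'z) R))"
    using emeasure_bounded_finite[of "cball (0 :: 'z) R"] by simp
  then have "integrable (LP I) (\<lambda>x. \<Prod>i\<in>I. indicat_real (cball (0 :: 'z) R) (x i))"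
    by (intro LP.product_integrable_prod[OF I])
  then show ?thesis by (simp add: ball_box_def[abs_def])
qed

lemma L1_dominated_convergence:
  fixes f :: "'a \<Rightarrow> 'b::{banach, second_countable_topology}"
  assumes m: "f \<in> borel_measurable M" "\<And>i. s i \<in> borel_measurable M" and w: "integrable M w"
    and lim: "AE x in M. (\<lambda>i. s i x) \<longlonglongrightarrow> f x" and bound: "\<And>i. AE x in M. norm (s i x) \<le> w x"
  shows "(\<lambda>i. \<integral>x. norm (f x - s i x) \<partial>M) \<longlonglongrightarrow> 0"
proof -
  note [measurable] = m
  have f: "integrable M f"
    by (rule integrable_dominated_convergence[OF m w lim bound])
  have "(\<lambda>i. \<integral>x. norm (f x - s i x) \<partial>M) \<longlonglongrightarrow> (\<integral>x. 0 \<partial>M)"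
  proof (rule integral_dominated_convergence[where w = "\<lambda>x. norm (f x) + w x"])
    show "integrable M (\<lambda>x. norm (f x) + w x)" using f w by simp
    show "AE x in M. (\<lambda>i. norm (f x - s i x)) \<longlonglongrightarrow> 0"
      using lim
    proof eventually_elim
      case (elim x)
      then show ?case using tendsto_norm[OF tendsto_diff[OF tendsto_const[of "f x"] elim]] by simp
    qed
    show "AE x in M. norm (norm (f x - s i x)) \<le> norm (f x) + w x" for i
      using bound[of i]
    proof eventually_elim
      case (elim x)
      then show ?case using norm_triangle_ineq4[of "f x" "s i x"] by simp
    qed
  qed measurable
  then show ?thesis by simp
qed

text \<open>The bound on \<open>g\<close> holds at every point, hence also after variables have been
  identified; for \<open>f\<close> it is inherited almost everywhere.\<close>

locale kernel_approximation =
  fixes q :: nat and C R :: real and f :: "(nat \<Rightarrow> 'z::euclidean_space) \<Rightarrow> complex"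
    and g :: "nat \<Rightarrow> (nat \<Rightarrow> 'z) \<Rightarrow> complex"
  assumes f_measurable: "f \<in> borel_measurable (lborel_pow q)"
    and g_measurable: "\<And>j. g j \<in> borel_measurable (lborel_pow q)"
    and g_bound: "\<And>j t. cmod (g j t) \<le> C * ball_box {..<q} R t"
    and g_tendsto: "AE t in lborel_pow q. (\<lambda>j. g j t) \<longlonglongrightarrow> f t"
    and C_nonneg: "0 \<le> C"
begin

lemma ball_box_square: "(C * ball_box {..<q} R t)\<^sup>2 = C\<^sup>2 * ball_box {..<q} R t"
  by (simp add: ball_box_eq power_mult_distrib)

lemma f_bound: "AE t in lborel_pow q. cmod (f t) \<le> C * ball_box {..<q} R t"
  using g_tendsto
proof eventually_elim
  case (elim t)
  show ?case
    by (rule LIMSEQ_le_const2[OF tendsto_norm[OF elim]]) (use g_bound in blast)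
qed

lemma integrable_bound: "integrable (lborel_pow q) (\<lambda>t. c * ball_box {..<q} R t)"
  unfolding lborel_pow_def by (intro integrable_mult_right integrable_ball_box) simp

lemma L2_norm_tendsto: "(\<lambda>j. L2_norm q (g j)) \<longlonglongrightarrow> L2_norm q f"
proof -
  note [measurable] = f_measurable g_measurable
  have "(\<lambda>j. \<integral>t. (cmod (g j t))\<^sup>2 \<partial>lborel_pow q) \<longlonglongrightarrow> (\<integral>t. (cmod (f t))\<^sup>2 \<partial>lborel_pow q)"
  proof (rule integral_dominated_convergence[where w = "\<lambda>t. C\<^sup>2 * ball_box {..<q} R t"])
    show "AE t in lborel_pow q. (\<lambda>j. (cmod (g j t))\<^sup>2) \<longlonglongrightarrow> (cmod (f t))\<^sup>2"
      using g_tendsto by eventually_elim (intro tendsto_intros)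
    show "AE t in lborel_pow q. norm ((cmod (g j t))\<^sup>2) \<le> C\<^sup>2 * ball_box {..<q} R t" for j
      unfolding ball_box_square[symmetric] using g_bound[of j] by (intro AE_I2) (simp add: power_mono)
  qed (use integrable_bound in measurable)
  then show ?thesis unfolding L2_norm_def by (rule tendsto_real_sqrt)
qed

lemma L2_norm_diff_tendsto: "(\<lambda>j. L2_norm q (\<lambda>t. g j t - f t)) \<longlonglongrightarrow> 0"
proof -
  note [measurable] = f_measurable g_measurable
  have "(\<lambda>j. \<integral>t. (cmod (g j t - f t))\<^sup>2 \<partial>lborel_pow q) \<longlonglongrightarrow> (\<integral>t. (0::real) \<partial>(lborel_pow q :: (nat \<Rightarrow> 'z) measure))"
  proof (rule integral_dominated_convergence[where w = "\<lambda>t. (4 * C\<^sup>2) * ball_box {..<q} R t"])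
    show "AE t in lborel_pow q. (\<lambda>j. (cmod (g j t - f t))\<^sup>2) \<longlonglongrightarrow> 0"
      using g_tendsto
    proof eventually_elim
      case (elim t)
      have "(\<lambda>j. (cmod (g j t - f t))\<^sup>2) \<longlonglongrightarrow> (cmod (f t - f t))\<^sup>2"
        by (intro tendsto_intros elim)
      then show ?case by simp
    qed
    show "AE t in lborel_pow q. norm ((cmod (g j t - f t))\<^sup>2) \<le> (4 * C\<^sup>2) * ball_box {..<q} R t" for j
      using f_bound
    proof eventually_elim
      case (elim t)
      have "cmod (g j t - f t) \<le> 2 * (C * ball_box {..<q} R t)"
        using norm_triangle_ineq4[of "g j t" "f t"] g_bound[of j t] elim by simp
      then have "(cmod (g j t - f t))\<^sup>2 \<le> (2 * (C * ball_box {..<q} R t))\<^sup>2" by (intro power_mono) auto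
      then show ?case by (simp add: power_mult_distrib[of 2] ball_box_square)
    qed
  qed (use integrable_bound in measurable)
  then have "(\<lambda>j. \<integral>t. (cmod (g j t - f t))\<^sup>2 \<partial>lborel_pow q) \<longlonglongrightarrow> 0" by simp
  from tendsto_real_sqrt[OF this] show ?thesis unfolding L2_norm_def by simp
qed

text \<open>Each row of labels is injective, which transports the almost everywhere convergence to
  its factor. The rows together use every variable, so the supports confine all variables to the
  ball and dominated convergence applies.\<close>

lemma product_tendsto:
  fixes h :: "nat \<Rightarrow> nat \<Rightarrow> 'i" and I :: "'i set"
  assumes fin: "finite I" and h: "\<And>j. j < m \<Longrightarrow> inj_on (h j) {..<q}" "(\<Union>j<m. h j ` {..<q}) = I"
  shows "(\<lambda>n. \<integral>x. (\<Prod>j<m. cmod (g n (\<lambda>i\<in>{..<q}. x (h j i)))) \<partial>LP I) \<longlonglongrightarrow>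
      (\<integral>x. (\<Prod>j<m. cmod (f (\<lambda>i\<in>{..<q}. x (h j i)))) \<partial>LP I)"
    and "integrable (LP I) (\<lambda>x. \<Prod>j<m. cmod (f (\<lambda>i\<in>{..<q}. x (h j i))))"
proof -
  have sub: "h j ` {..<q} \<subseteq> I" if "j < m" for j using h(2) that by blast
  have meas: "(\<lambda>x. \<Prod>j<m. cmod (u (\<lambda>i\<in>{..<q}. x (h j i)))) \<in> borel_measurable (LP I)"
    if u: "u \<in> borel_measurable (lborel_pow q)" for u :: "(nat \<Rightarrow> 'z) \<Rightarrow> complex"
  proof (intro borel_measurable_prod)
    fix j assume "j \<in> {..<m}"
    then have "(\<lambda>x. u (\<lambda>i\<in>{..<q}. x (h j i))) \<in> borel_measurable (LP I)"
      using u measurable_reindex[OF sub] unfolding lborel_pow_def by (intro measurable_compose[OF _ u[unfolded lborel_pow_def]]) auto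
    then show "(\<lambda>x. cmod (u (\<lambda>i\<in>{..<q}. x (h j i)))) \<in> borel_measurable (LP I)" by measurable
  qed
  have lim: "AE x in LP I. (\<lambda>n. \<Prod>j<m. cmod (g n (\<lambda>i\<in>{..<q}. x (h j i)))) \<longlonglongrightarrow>
      (\<Prod>j<m. cmod (f (\<lambda>i\<in>{..<q}. x (h j i))))"
  proof -
    have "AE x in LP I. \<forall>j\<in>{..<m}. (\<lambda>n. g n (\<lambda>i\<in>{..<q}. x (h j i))) \<longlonglongrightarrow> f (\<lambda>i\<in>{..<q}. x (h j i))"
    proof (rule AE_finite_allI)
      fix j assume "j \<in> {..<m}"
      then show "AE x in LP I. (\<lambda>n. g n (\<lambda>i\<in>{..<q}. x (h j i))) \<longlonglongrightarrow> f (\<lambda>i\<in>{..<q}. x (h j i))"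
        using g_tendsto fin h(1) sub unfolding lborel_pow_def
        by (intro AE_LP_reindex[where P = "\<lambda>t. (\<lambda>n. g n t) \<longlonglongrightarrow> f t"]) auto
    qed simp
    then show ?thesis by eventually_elim (intro tendsto_prod tendsto_norm, auto)
  qed
  have bound: "norm (\<Prod>j<m. cmod (g n (\<lambda>i\<in>{..<q}. x (h j i)))) \<le> C ^ m * ball_box I R x" for n x
  proof -
    have "(\<Prod>j<m. cmod (g n (\<lambda>i\<in>{..<q}. x (h j i)))) \<le> (\<Prod>j<m. C * ball_box {..<q} R (\<lambda>i\<in>{..<q}. x (h j i)))"
      by (intro prod_mono) (simp add: g_bound)
    also have "\<dots> = C ^ m * (\<Prod>j<m. ball_box {..<q} R (\<lambda>i\<in>{..<q}. x (h j i)))"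
      by (simp add: prod.distrib)
    also have "(\<Prod>j<m. ball_box {..<q} R (\<lambda>i\<in>{..<q}. x (h j i))) \<le> ball_box I R x"
    proof (cases "\<forall>i\<in>I. norm (x i) \<le> R")
      case True
      have "(\<Prod>j<m. ball_box {..<q} R (\<lambda>i\<in>{..<q}. x (h j i))) \<le> 1"
        by (intro prod_le_1) (auto simp: ball_box_eq)
      then show ?thesis using True fin by (simp add: ball_box_eq)
    next
      case False
      then obtain j i where "j < m" "i < q" "\<not> norm (x (h j i)) \<le> R" using h(2) by blast
      then have "ball_box {..<q} R (\<lambda>i\<in>{..<q}. x (h j i)) = 0" by (auto simp: ball_box_eq)
      then have "(\<Prod>j<m. ball_box {..<q} R (\<lambda>i\<in>{..<q}. x (h j i))) = 0"
        using \<open>j < m\<close> by (intro prod_zero) auto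
      then show ?thesis by (simp only: ball_box_nonneg)
    qed
    finally show ?thesis using C_nonneg by (simp add: mult_left_mono prod_nonneg)
  qed
  have w: "integrable (LP I) (\<lambda>x. C ^ m * ball_box I R x)"
    by (intro integrable_mult_right integrable_ball_box fin)
  show "(\<lambda>n. \<integral>x. (\<Prod>j<m. cmod (g n (\<lambda>i\<in>{..<q}. x (h j i)))) \<partial>LP I) \<longlonglongrightarrow>
      (\<integral>x. (\<Prod>j<m. cmod (f (\<lambda>i\<in>{..<q}. x (h j i)))) \<partial>LP I)"
    by (rule integral_dominated_convergence[OF meas[OF f_measurable] meas[OF g_measurable] w lim AE_I2[OF bound]])
  show "integrable (LP I) (\<lambda>x. \<Prod>j<m. cmod (f (\<lambda>i\<in>{..<q}. x (h j i))))"
    by (rule integrable_dominated_convergence[OF meas[OF f_measurable] meas[OF g_measurable] w lim AE_I2[OF bound]])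
qed

text \<open>Dominated convergence twice: for almost every \<open>t\<close> in the integral that
  defines the contraction, then in its squared norm. \<open>a\<close> and \<open>b\<close> are the
  arguments of the two copies of the kernel.\<close>

lemma gcontr_tendsto:
  assumes ek: "k + e \<le> q"
  defines "r \<equiv> q + q - 2 * k - e"
  shows "(\<lambda>n. L2_norm r (gcontr q e k (g n))) \<longlonglongrightarrow> L2_norm r (gcontr q e k f)"
proof -
  define a :: "(nat \<Rightarrow> 'z) \<Rightarrow> (nat \<Rightarrow> 'z) \<Rightarrow> nat \<Rightarrow> 'z"
    where "a t s = (\<lambda>i\<in>{..<q}. if i < q - k then t i else s (q - 1 - i))" for t s
  define b :: "(nat \<Rightarrow> 'z) \<Rightarrow> (nat \<Rightarrow> 'z) \<Rightarrow> nat \<Rightarrow> 'z"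
    where "b t s = (\<lambda>i\<in>{..<q}. if i < k then s i else t (q - k - e + (i - k)))" for t s
  have gc: "gcontr q e k u t = (\<integral>s. u (a t s) * u (b t s) \<partial>LP {..<k})" for u :: "(nat \<Rightarrow> 'z) \<Rightarrow> complex" and t
    by (simp add: gcontr_def a_def b_def lborel_pow_def)
  interpret S: sigma_finite_measure "LP {..<k} :: (nat \<Rightarrow> 'z) measure"
    by (rule sigma_finite_LP) simp
  have ma: "(\<lambda>p. a (fst p) (snd p)) \<in> LP {..<r} \<Otimes>\<^sub>M LP {..<k} \<rightarrow>\<^sub>M LP {..<q}"
    unfolding a_def
  proof (rule measurable_restrict)
    fix i assume "i \<in> {..<q}"
    then show "(\<lambda>p. if i < q - k then fst p i else snd p (q - 1 - i)) \<in> LP {..<r} \<Otimes>\<^sub>M LP {..<k} \<rightarrow>\<^sub>M lborel"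
      using ek by (cases "i < q - k") (auto simp: r_def intro!: measurable_compose[OF measurable_fst measurable_component_singleton]
          measurable_compose[OF measurable_snd measurable_component_singleton])
  qed
  have mb: "(\<lambda>p. b (fst p) (snd p)) \<in> LP {..<r} \<Otimes>\<^sub>M LP {..<k} \<rightarrow>\<^sub>M LP {..<q}"
    unfolding b_def
  proof (rule measurable_restrict)
    fix i assume "i \<in> {..<q}"
    then show "(\<lambda>p. if i < k then snd p i else fst p (q - k - e + (i - k))) \<in> LP {..<r} \<Otimes>\<^sub>M LP {..<k} \<rightarrow>\<^sub>M lborel"
      using ek by (cases "i < k") (auto simp: r_def intro!: measurable_compose[OF measurable_fst measurable_component_singleton]
          measurable_compose[OF measurable_snd measurable_component_singleton])
  qed
  have joint: "case_prod (\<lambda>t s. u (a t s) * u (b t s)) \<in> borel_measurable (LP {..<r} \<Otimes>\<^sub>M LP {..<k})"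
    if u: "u \<in> borel_measurable (lborel_pow q)" for u :: "(nat \<Rightarrow> 'z) \<Rightarrow> complex"
    unfolding case_prod_unfold
    using measurable_compose[OF ma u[unfolded lborel_pow_def]] measurable_compose[OF mb u[unfolded lborel_pow_def]]
    by (rule borel_measurable_times)
  have mgc: "gcontr q e k u \<in> borel_measurable (LP {..<r})"
    if u: "u \<in> borel_measurable (lborel_pow q)" for u :: "(nat \<Rightarrow> 'z) \<Rightarrow> complex"
    unfolding gc[abs_def] by (rule S.borel_measurable_lebesgue_integral[OF joint[OF u]])
  have msec: "(\<lambda>s. u (a t s) * u (b t s)) \<in> borel_measurable (LP {..<k})"
    if u: "u \<in> borel_measurable (lborel_pow q)" and t: "t \<in> space (LP {..<r})" for u :: "(nat \<Rightarrow> 'z) \<Rightarrow> complex" and t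
    using measurable_Pair2[OF joint[OF u] t] by simp
  have bound: "norm (g n (a t s) * g n (b t s)) \<le> C\<^sup>2 * ball_box {..<r} R t * ball_box {..<k} R s" for n t s
  proof -
    have "norm (g n (a t s) * g n (b t s)) \<le> (C * ball_box {..<q} R (a t s)) * (C * ball_box {..<q} R (b t s))"
      unfolding norm_mult by (intro mult_mono g_bound) (auto simp: C_nonneg ball_box_nonneg)
    also have "\<dots> = C\<^sup>2 * (ball_box {..<q} R (a t s) * ball_box {..<q} R (b t s))"
      by (simp add: power2_eq_square)
    also have "ball_box {..<q} R (a t s) * ball_box {..<q} R (b t s) \<le> ball_box {..<r} R t * ball_box {..<k} R s"
    proof (cases "(\<forall>i<q. norm (a t s i) \<le> R) \<and> (\<forall>i<q. norm (b t s i) \<le> R)")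
      case True
      have "norm (t i) \<le> R" if "i < r" for i
      proof (cases "i < q - k")
        case True
        then have "i < q" by simp
        then have "a t s i = t i" using True by (simp add: a_def)
        then show ?thesis using \<open>_ \<and> _\<close> \<open>i < q\<close> by metis
      next
        case False
        \<comment> \<open>The place of the second copy at which the variable \<open>t i\<close>
          stands.\<close>
        define i' where "i' = i - (q - k - e) + k"
        have "i' < q" "\<not> i' < k" "q - k - e + (i' - k) = i"
          using False that ek by (auto simp: i'_def r_def)
        then have "b t s i' = t i" by (simp add: b_def)
        then show ?thesis using \<open>_ \<and> _\<close> \<open>i' < q\<close> by metis
      qed
      moreover have "norm (s i) \<le> R" if "i < k" for i
      proof -
        have "b t s i = s i" "i < q" using that ek by (auto simp: b_def)
        then show ?thesis using \<open>_ \<and> _\<close> by metis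
      qed
      ultimately show ?thesis by (simp add: ball_box_eq)
    next
      case False
      then have z: "ball_box {..<q} R (a t s) * ball_box {..<q} R (b t s) = 0" by (auto simp: ball_box_eq)
      show ?thesis unfolding z by (intro mult_nonneg_nonneg ball_box_nonneg)
    qed
    finally show ?thesis by (simp add: mult_left_mono mult.assoc)
  qed
  define V where "V = (\<integral>s. ball_box {..<k} R s \<partial>(LP {..<k} :: (nat \<Rightarrow> 'z) measure))"
  have w: "integrable (LP {..<k}) (\<lambda>s :: nat \<Rightarrow> 'z. C\<^sup>2 * ball_box {..<r} R t * ball_box {..<k} R s)" for t :: "nat \<Rightarrow> 'z"
    by (intro integrable_mult_right integrable_ball_box) simp
  have V: "0 \<le> V" unfolding V_def by (intro integral_nonneg_AE AE_I2 ball_box_nonneg)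
  have lim: "AE t in LP {..<r}. (\<lambda>n. gcontr q e k (g n) t) \<longlonglongrightarrow> gcontr q e k f t"
  proof -
    have lp: "AE t in LP {..<q}. (\<lambda>n. g n t) \<longlonglongrightarrow> f t" using g_tendsto unfolding lborel_pow_def .
    have "AE t in LP {..<r}. AE s in LP {..<k}. (\<lambda>n. g n (a t s)) \<longlonglongrightarrow> f (a t s)"
    proof -
      \<comment> \<open>\<open>Inl\<close> marks the outer variables and \<open>Inr\<close> the
        integrated ones; within one copy no variable occurs twice.\<close>
      have "AE t in LP {..<r}. AE s in LP {..<k}. (\<lambda>n. g n (\<lambda>i\<in>{..<q}. case (if i < q - k then Inl i else Inr (q - 1 - i)) of Inl j \<Rightarrow> t j | Inr j \<Rightarrow> s j))
          \<longlonglongrightarrow> f (\<lambda>i\<in>{..<q}. case (if i < q - k then Inl i else Inr (q - 1 - i)) of Inl j \<Rightarrow> t j | Inr j \<Rightarrow> s j)"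
        using ek by (intro AE_LP_pair[OF _ _ _ _ _ lp])
          (auto simp: inj_on_def r_def image_iff split: if_splits)
      then show ?thesis unfolding a_def by (simp add: if_distrib cong: if_cong)
    qed
    moreover have "AE t in LP {..<r}. AE s in LP {..<k}. (\<lambda>n. g n (b t s)) \<longlonglongrightarrow> f (b t s)"
    proof -
      have "AE t in LP {..<r}. AE s in LP {..<k}. (\<lambda>n. g n (\<lambda>i\<in>{..<q}. case (if i < k then Inr i else Inl (q - k - e + (i - k))) of Inl j \<Rightarrow> t j | Inr j \<Rightarrow> s j))
          \<longlonglongrightarrow> f (\<lambda>i\<in>{..<q}. case (if i < k then Inr i else Inl (q - k - e + (i - k))) of Inl j \<Rightarrow> t j | Inr j \<Rightarrow> s j)"
        using ek by (intro AE_LP_pair[OF _ _ _ _ _ lp])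
          (auto simp: inj_on_def r_def image_iff split: if_splits)
      then show ?thesis unfolding b_def by (simp add: if_distrib cong: if_cong)
    qed
    moreover have "AE t in LP {..<r}. t \<in> space (LP {..<r} :: (nat \<Rightarrow> 'z) measure)" by (rule AE_space)
    ultimately show ?thesis
    proof eventually_elim
      case (elim t)
      have "AE s in LP {..<k}. (\<lambda>n. g n (a t s) * g n (b t s)) \<longlonglongrightarrow> f (a t s) * f (b t s)"
        using elim(1,2) by eventually_elim (intro tendsto_intros)
      then show ?case
        unfolding gc
        by (rule integral_dominated_convergence[OF msec[OF f_measurable elim(3)] msec[OF g_measurable elim(3)] w _ AE_I2[OF bound]])
    qed
  qed
  have gb: "cmod (gcontr q e k (g n) t) \<le> C\<^sup>2 * ball_box {..<r} R t * V" if t: "t \<in> space (LP {..<r})" for n t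
  proof -
    have int: "integrable (LP {..<k}) (\<lambda>s. g n (a t s) * g n (b t s))"
      by (rule Bochner_Integration.integrable_bound[OF w msec[OF g_measurable t]])
        (use bound in \<open>auto intro!: AE_I2 order.trans[OF _ abs_ge_self]\<close>)
    have "cmod (gcontr q e k (g n) t) \<le> (\<integral>s. C\<^sup>2 * ball_box {..<r} R t * ball_box {..<k} R s \<partial>(LP {..<k} :: (nat \<Rightarrow> 'z) measure))"
    proof -
      have "cmod (gcontr q e k (g n) t) \<le> (\<integral>s. cmod (g n (a t s) * g n (b t s)) \<partial>LP {..<k})"
        unfolding gc by (rule Bochner_Integration.integral_norm_bound)
      also have "\<dots> \<le> (\<integral>s. C\<^sup>2 * ball_box {..<r} R t * ball_box {..<k} R s \<partial>(LP {..<k} :: (nat \<Rightarrow> 'z) measure))"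
        by (rule Bochner_Integration.integral_mono[OF integrable_norm[OF int] w]) (rule bound)
      finally show ?thesis .
    qed
    then show ?thesis by (simp add: V_def)
  qed
  have "(\<lambda>n. \<integral>t. (cmod (gcontr q e k (g n) t))\<^sup>2 \<partial>LP {..<r}) \<longlonglongrightarrow> (\<integral>t. (cmod (gcontr q e k f t))\<^sup>2 \<partial>LP {..<r})"
  proof (rule integral_dominated_convergence[where w = "\<lambda>t. (C\<^sup>2 * V)\<^sup>2 * ball_box {..<r} R t"])
    show "(\<lambda>t. (cmod (gcontr q e k f t))\<^sup>2) \<in> borel_measurable (LP {..<r})"
      using mgc[OF f_measurable] by measurable
    show "(\<lambda>t. (cmod (gcontr q e k (g n) t))\<^sup>2) \<in> borel_measurable (LP {..<r})" for n
      using mgc[OF g_measurable, of n] by measurable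
    show "integrable (LP {..<r}) (\<lambda>t :: nat \<Rightarrow> 'z. (C\<^sup>2 * V)\<^sup>2 * ball_box {..<r} R t)"
      by (intro integrable_mult_right integrable_ball_box) simp
    show "AE t in LP {..<r}. (\<lambda>n. (cmod (gcontr q e k (g n) t))\<^sup>2) \<longlonglongrightarrow> (cmod (gcontr q e k f t))\<^sup>2"
      using lim by eventually_elim (intro tendsto_intros)
    show "AE t in LP {..<r}. norm ((cmod (gcontr q e k (g n) t))\<^sup>2) \<le> (C\<^sup>2 * V)\<^sup>2 * ball_box {..<r} R t" for n
    proof (rule AE_I2)
      fix t :: "nat \<Rightarrow> 'z" assume "t \<in> space (LP {..<r})"
      from power_mono[OF gb[OF this, of n] norm_ge_zero, of 2]
      show "norm ((cmod (gcontr q e k (g n) t))\<^sup>2) \<le> (C\<^sup>2 * V)\<^sup>2 * ball_box {..<r} R t"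
        by (auto simp: ball_box_eq power_mult_distrib split: if_splits)
    qed
  qed
  from tendsto_real_sqrt[OF this] show ?thesis by (simp add: L2_norm_def lborel_pow_def)
qed

end

section \<open>Density of step kernels\<close>

definition rect_kernel :: "nat \<Rightarrow> (complex \<times> (nat \<Rightarrow> 'z set)) list \<Rightarrow> (nat \<Rightarrow> 'z) \<Rightarrow> complex" where
  "rect_kernel q rs t = (\<Sum>(c, B)\<leftarrow>rs. c * (\<Prod>i<q. indicator (B i) (t i)))"

definition rect_list :: "nat \<Rightarrow> (complex \<times> (nat \<Rightarrow> 'z::euclidean_space set)) list \<Rightarrow> bool" where
  "rect_list q rs \<longleftrightarrow> (\<forall>(c, B)\<in>set rs. \<forall>i<q. B i \<in> sets borel \<and> bounded (B i))"

definition L1_approximable :: "nat \<Rightarrow> ((nat \<Rightarrow> 'z::euclidean_space) \<Rightarrow> complex) \<Rightarrow> bool" where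
  "L1_approximable q f \<longleftrightarrow> integrable (LP {..<q}) f \<and>
     (\<forall>e>0. \<exists>rs. rect_list q rs \<and> (\<integral>t. cmod (f t - rect_kernel q rs t) \<partial>LP {..<q}) < e)"

lemma L1_approximable_cong:
  assumes eq: "\<And>t. t \<in> space (LP {..<q}) \<Longrightarrow> g t = f t" and f: "L1_approximable q f"
  shows "L1_approximable q g"
proof -
  have "integrable (LP {..<q}) g \<longleftrightarrow> integrable (LP {..<q}) f"
    by (intro Bochner_Integration.integrable_cong refl eq)
  moreover have "(\<integral>t. cmod (g t - rect_kernel q rs t) \<partial>LP {..<q}) = (\<integral>t. cmod (f t - rect_kernel q rs t) \<partial>LP {..<q})" for rs
    by (intro Bochner_Integration.integral_cong refl) (simp add: eq)
  ultimately show ?thesis using f by (simp add: L1_approximable_def)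
qed

lemma integrable_rect:
  fixes B :: "nat \<Rightarrow> 'z::euclidean_space set"
  assumes "\<And>i. i < q \<Longrightarrow> B i \<in> sets borel \<and> bounded (B i)"
  shows "integrable (LP {..<q}) (\<lambda>t. \<Prod>i<q. indicator (B i) (t i) :: complex)"
proof -
  have "integrable (LP {..<q}) (\<lambda>t. \<Prod>i<q. complex_of_real (indicator (B i) (t i)))"
  proof (rule LP.product_integrable_prod[OF finite_lessThan], rule integrable_of_real)
    fix i assume "i \<in> {..<q}"
    then show "integrable lborel (indicat_real (B i))"
      using assms[of i] emeasure_bounded_finite[of "B i"] by simp
  qed
  moreover have "complex_of_real (indicator (B i) z) = indicator (B i) z" for i z
    by (simp add: indicator_def)
  ultimately show ?thesis by simp
qed

lemma integrable_rect_kernel: "rect_list q rs \<Longrightarrow> integrable (LP {..<q}) (rect_kernel q rs)"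
proof (induction rs)
  case Nil
  then show ?case by (simp add: rect_kernel_def[abs_def])
next
  case (Cons r rs)
  obtain c B where r: "r = (c, B)" by (cases r)
  have "integrable (LP {..<q}) (\<lambda>t. c * (\<Prod>i<q. indicator (B i) (t i)) + rect_kernel q rs t)"
    using Cons by (intro Bochner_Integration.integrable_add integrable_mult_right integrable_rect)
      (auto simp: r rect_list_def)
  then show ?case by (simp add: rect_kernel_def[abs_def] r)
qed

lemma L1_approximable_rect:
  fixes B :: "nat \<Rightarrow> 'z::euclidean_space set"
  assumes "\<And>i. i < q \<Longrightarrow> B i \<in> sets borel \<and> bounded (B i)"
  shows "L1_approximable q (\<lambda>t. \<Prod>i<q. indicator (B i) (t i))"
proof -
  have "rect_list q [(1, B)]" using assms by (simp add: rect_list_def)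
  moreover have "rect_kernel q [(1, B)] t = (\<Prod>i<q. indicator (B i) (t i))" for t
    by (simp add: rect_kernel_def)
  ultimately show ?thesis
    unfolding L1_approximable_def using integrable_rect[OF assms]
    by (auto intro!: exI[of _ "[(1, B)]"])
qed

lemma L1_approximable_limit:
  assumes f: "integrable (LP {..<q}) f"
    and lim: "\<And>e. e > 0 \<Longrightarrow> \<exists>g. L1_approximable q g \<and> (\<integral>t. cmod (f t - g t) \<partial>LP {..<q}) < e"
  shows "L1_approximable q f"
  unfolding L1_approximable_def
proof (intro conjI allI impI f)
  fix e :: real assume "e > 0"
  obtain g where g: "L1_approximable q g" "(\<integral>t. cmod (f t - g t) \<partial>LP {..<q}) < e / 2"
    using lim[of "e / 2"] \<open>e > 0\<close> by auto
  then obtain rs where rs: "rect_list q rs" "(\<integral>t. cmod (g t - rect_kernel q rs t) \<partial>LP {..<q}) < e / 2"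
    using \<open>e > 0\<close> unfolding L1_approximable_def by (meson half_gt_zero)
  have int: "integrable (LP {..<q}) g" "integrable (LP {..<q}) (rect_kernel q rs)"
    using g rs integrable_rect_kernel by (auto simp: L1_approximable_def)
  have "(\<integral>t. cmod (f t - rect_kernel q rs t) \<partial>LP {..<q}) \<le>
      (\<integral>t. cmod (f t - g t) + cmod (g t - rect_kernel q rs t) \<partial>LP {..<q})"
  proof (intro integral_mono)
    show "cmod (f t - rect_kernel q rs t) \<le> cmod (f t - g t) + cmod (g t - rect_kernel q rs t)" for t
      using norm_triangle_ineq[of "f t - g t" "g t - rect_kernel q rs t"] by simp
  qed (use f int in auto)
  also have "\<dots> = (\<integral>t. cmod (f t - g t) \<partial>LP {..<q}) + (\<integral>t. cmod (g t - rect_kernel q rs t) \<partial>LP {..<q})"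
    using f int by (intro Bochner_Integration.integral_add) auto
  finally show "\<exists>rs. rect_list q rs \<and> (\<integral>t. cmod (f t - rect_kernel q rs t) \<partial>LP {..<q}) < e"
    using g(2) rs by (intro exI[of _ rs]) auto
qed

lemma L1_approximable_sequence:
  assumes f: "integrable (LP {..<q}) f" and s: "\<And>i. L1_approximable q (s i)"
    and lim: "(\<lambda>i. \<integral>t. cmod (f t - s i t) \<partial>LP {..<q}) \<longlonglongrightarrow> 0"
  shows "L1_approximable q f"
proof (rule L1_approximable_limit[OF f])
  fix e :: real assume "e > 0"
  then obtain i where "norm ((\<integral>t. cmod (f t - s i t) \<partial>LP {..<q}) - 0) < e"
    using LIMSEQ_D[OF lim \<open>e > 0\<close>] by blast
  then show "\<exists>g. L1_approximable q g \<and> (\<integral>t. cmod (f t - g t) \<partial>LP {..<q}) < e"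
    using s by (intro exI[of _ "s i"]) auto
qed

lemma L1_approximable_linear:
  assumes f: "L1_approximable q f" and g: "L1_approximable q g"
  shows "L1_approximable q (\<lambda>t. c * f t + g t)"
  unfolding L1_approximable_def
proof (intro conjI allI impI)
  have int: "integrable (LP {..<q}) f" "integrable (LP {..<q}) g"
    using f g by (auto simp: L1_approximable_def)
  show "integrable (LP {..<q}) (\<lambda>t. c * f t + g t)" using int by simp
  fix e :: real assume "e > 0"
  define d where "d = e / (2 * (cmod c + 1))"
  have "d > 0" using \<open>e > 0\<close> by (simp add: d_def add_nonneg_pos)
  obtain rs where rs: "rect_list q rs" "(\<integral>t. cmod (f t - rect_kernel q rs t) \<partial>LP {..<q}) < d"
    using f \<open>d > 0\<close> by (auto simp: L1_approximable_def)
  obtain rs' where rs': "rect_list q rs'" "(\<integral>t. cmod (g t - rect_kernel q rs' t) \<partial>LP {..<q}) < e / 2"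
    using g \<open>e > 0\<close> unfolding L1_approximable_def by (meson half_gt_zero)
  define us where "us = map (\<lambda>(a, B). (c * a, B)) rs @ rs'"
  have us: "rect_kernel q us t = c * rect_kernel q rs t + rect_kernel q rs' t" for t
    by (simp add: us_def rect_kernel_def sum_list_const_mult[symmetric] comp_def case_prod_unfold mult.assoc)
  have "rect_list q us" using rs(1) rs'(1) by (auto simp: us_def rect_list_def)
  note intr = integrable_rect_kernel[OF rs(1)] integrable_rect_kernel[OF rs'(1)]
  have "(\<integral>t. cmod (c * f t + g t - rect_kernel q us t) \<partial>LP {..<q}) \<le>
      (\<integral>t. cmod c * cmod (f t - rect_kernel q rs t) + cmod (g t - rect_kernel q rs' t) \<partial>LP {..<q})"
  proof (intro integral_mono)
    show "cmod (c * f t + g t - rect_kernel q us t) \<le>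
        cmod c * cmod (f t - rect_kernel q rs t) + cmod (g t - rect_kernel q rs' t)" for t
    proof -
      have "c * f t + g t - rect_kernel q us t = c * (f t - rect_kernel q rs t) + (g t - rect_kernel q rs' t)"
        by (simp add: us algebra_simps)
      then show ?thesis
        using norm_triangle_ineq[of "c * (f t - rect_kernel q rs t)" "g t - rect_kernel q rs' t"]
        by (simp only: norm_mult)
    qed
  qed (use int intr integrable_rect_kernel[OF \<open>rect_list q us\<close>] in auto)
  also have "\<dots> = cmod c * (\<integral>t. cmod (f t - rect_kernel q rs t) \<partial>LP {..<q}) +
      (\<integral>t. cmod (g t - rect_kernel q rs' t) \<partial>LP {..<q})"
    using int intr by (subst Bochner_Integration.integral_add) auto
  also have "\<dots> < (cmod c + 1) * d + e / 2"
  proof (rule add_le_less_mono[OF _ rs'(2)])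
    have "cmod c * (\<integral>t. cmod (f t - rect_kernel q rs t) \<partial>LP {..<q}) \<le> cmod c * d"
      using rs(2) by (intro mult_left_mono) auto
    then show "cmod c * (\<integral>t. cmod (f t - rect_kernel q rs t) \<partial>LP {..<q}) \<le> (cmod c + 1) * d"
      using \<open>d > 0\<close> by (simp add: algebra_simps)
  qed
  also have "(cmod c + 1) * d + e / 2 = e"
  proof -
    have "cmod c + 1 \<noteq> 0" using norm_ge_zero[of c] by linarith
    then show ?thesis by (simp add: d_def field_simps)
  qed
  finally show "\<exists>rs. rect_list q rs \<and> (\<integral>t. cmod (c * f t + g t - rect_kernel q rs t) \<partial>LP {..<q}) < e"
    using \<open>rect_list q us\<close> by blast
qed

lemma L1_approximable_zero: "L1_approximable q (\<lambda>_. 0)"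
proof -
  have "rect_kernel q [] t = 0" for t :: "nat \<Rightarrow> 'a" by (simp add: rect_kernel_def)
  then show ?thesis
    unfolding L1_approximable_def by (auto simp: rect_list_def intro!: exI[of _ "[]"])
qed

lemma L1_approximable_sum:
  "finite J \<Longrightarrow> (\<And>j. j \<in> J \<Longrightarrow> L1_approximable q (s j)) \<Longrightarrow> L1_approximable q (\<lambda>t. \<Sum>j\<in>J. s j t)"
proof (induction J rule: finite_induct)
  case (insert j J)
  then show ?case using L1_approximable_linear[of q "s j" "\<lambda>t. \<Sum>j\<in>J. s j t" 1] by simp
qed (simp add: L1_approximable_zero)

lemma ball_box_rect:
  fixes t :: "nat \<Rightarrow> 'z::euclidean_space"
  shows "complex_of_real (ball_box {..<q} R t) = (\<Prod>i<q. indicator (cball 0 R) (t i))"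
proof -
  have "complex_of_real (indicator S z) = indicator S z" for S :: "'z set" and z
    by (simp add: indicator_def)
  then show ?thesis by (simp add: ball_box_def)
qed

text \<open>Induction over a generating system of boxes, closed under complements and disjoint
  unions. The cut-off by a product of balls keeps complements integrable, since the full space has
  infinite measure.\<close>

lemma L1_approximable_set_box:
  fixes E :: "(nat \<Rightarrow> 'z::euclidean_space) set"
  assumes "E \<in> sets (LP {..<q})"
  shows "L1_approximable q (\<lambda>t. indicator E t * of_real (ball_box {..<q} R t))"
proof -
  let ?b = "\<lambda>t :: nat \<Rightarrow> 'z. complex_of_real (ball_box {..<q} R t)"
  have intb: "integrable (LP {..<q}) ?b" by (intro integrable_of_real integrable_ball_box) simp
  have box: "L1_approximable q ?b"
    unfolding ball_box_rect by (intro L1_approximable_rect) auto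
  have "E \<in> sigma_sets (\<Pi>\<^sub>E i\<in>{..<q}. space lborel) (prod_algebra {..<q} (\<lambda>_. lborel))"
    using assms by (simp add: sets_PiM)
  then show ?thesis
  proof (induction E rule: sigma_sets_induct_disjoint[OF Int_stable_prod_algebra prod_algebra_sets_into_space, consumes 1])
    case (1 E)
    then obtain X where X: "E = (\<Pi>\<^sub>E i\<in>{..<q}. X i)" "\<And>i. i < q \<Longrightarrow> X i \<in> sets lborel"
      by (subst (asm) prod_algebra_eq_finite) auto
    have ae: "indicator E t * ?b t = (\<Prod>i<q. indicator (X i \<inter> cball 0 R) (t i))" if t: "t \<in> space (LP {..<q})" for t
    proof -
      have "indicator E t = (\<Prod>i<q. indicator (X i) (t i) :: complex)"
      proof (cases "t \<in> E")
        case True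
        then show ?thesis by (auto simp: X(1) PiE_iff intro!: prod.neutral[symmetric])
      next
        case False
        then obtain i where "i < q" "t i \<notin> X i"
          using t by (auto simp: X(1) PiE_iff space_PiM)
        then have "(\<Prod>i<q. indicator (X i) (t i) :: complex) = 0"
          by (intro prod_zero bexI[of _ i]) (auto simp: indicator_def)
        then show ?thesis using False by simp
      qed
      then show ?thesis by (simp add: ball_box_rect indicator_inter_arith prod.distrib)
    qed
    have rect: "L1_approximable q (\<lambda>t. \<Prod>i<q. indicator (X i \<inter> cball 0 R) (t i))"
      using X(2) by (intro L1_approximable_rect) auto
    show ?case
      by (rule L1_approximable_cong[OF _ rect]) (simp only: ae)
  next
    case 2
    then show ?case by (simp add: L1_approximable_zero)
  next
    case (3 E)
    have E: "E \<in> sets (LP {..<q})" using 3(1) by (simp add: sets_PiM)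
    have app: "L1_approximable q (\<lambda>t. -1 * (indicator E t * ?b t) + ?b t)"
      by (rule L1_approximable_linear[OF 3(2) box])
    have eq: "indicator ((\<Pi>\<^sub>E i\<in>{..<q}. space lborel) - E) t * ?b t = -1 * (indicator E t * ?b t) + ?b t"
      if "t \<in> space (LP {..<q})" for t
      using that by (auto simp: space_PiM indicator_def)
    show ?case
      by (rule L1_approximable_cong[OF _ app]) (simp only: eq)
  next
    case (4 A)
    have A: "A i \<in> sets (LP {..<q})" for i using 4(2) by (auto simp: sets_PiM)
    have UN: "(\<Union>i. A i) \<in> sets (LP {..<q})" using A by blast
    have m: "(\<lambda>t. indicator E t * ?b t) \<in> borel_measurable (LP {..<q})" if "E \<in> sets (LP {..<q})" for E
      using that borel_measurable_integrable[OF intb] by measurable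
    have nb: "norm (indicator E t * ?b t) \<le> ball_box {..<q} R t" for E t
      using ball_box_nonneg[of "{..<q}" R t] by (auto simp: norm_mult indicator_def)
    have sumeq: "(\<Sum>i<n. indicator (A i) t * ?b t) = indicator (\<Union>i<n. A i) t * ?b t" for n t
    proof -
      have "disjoint_family_on A {..<n}" using 4(1) by (auto simp: disjoint_family_on_def)
      then have "(\<Sum>i<n. indicator (A i) t) = (indicator (\<Union>i<n. A i) t :: complex)"
        by (simp add: indicator_UN_disjoint)
      then show ?thesis by (simp add: sum_distrib_right[symmetric])
    qed
    have lim: "(\<lambda>n. \<integral>t. cmod (indicator (\<Union>i. A i) t * ?b t - (\<Sum>i<n. indicator (A i) t * ?b t)) \<partial>LP {..<q}) \<longlonglongrightarrow> 0"
    proof (rule L1_dominated_convergence)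
      show "(\<lambda>t. indicator (\<Union>i. A i) t * ?b t) \<in> borel_measurable (LP {..<q})" by (rule m[OF UN])
      show "(\<lambda>t. \<Sum>i<n. indicator (A i) t * ?b t) \<in> borel_measurable (LP {..<q})" for n
        by (intro borel_measurable_sum m A)
      show "integrable (LP {..<q}) (ball_box {..<q} R :: (nat \<Rightarrow> 'z) \<Rightarrow> real)"
        by (rule integrable_ball_box) simp
      show "AE t in LP {..<q}. (\<lambda>n. \<Sum>i<n. indicator (A i) t * ?b t) \<longlonglongrightarrow> indicator (\<Union>i. A i) t * ?b t"
        unfolding sumeq by (intro AE_I2 tendsto_intros LIMSEQ_indicator_UN)
      show "AE t in LP {..<q}. norm (\<Sum>i<n. indicator (A i) t * ?b t) \<le> ball_box {..<q} R t" for n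
        unfolding sumeq using nb by (intro AE_I2)
    qed
    have int: "integrable (LP {..<q}) (\<lambda>t. indicator (\<Union>i. A i) t * ?b t)"
      by (rule Bochner_Integration.integrable_bound[OF integrable_ball_box[where R = R] m[OF UN]])
        (simp, intro AE_I2 order.trans[OF nb], simp)
    show ?case
      by (rule L1_approximable_sequence[OF int _ lim]) (intro L1_approximable_sum 4(3), simp)
  qed
qed

text \<open>Sets of finite measure are first cut down to growing balls; combinations and dominated
  limits then reach all integrable functions.\<close>

theorem L1_approximable_integrable:
  fixes f :: "(nat \<Rightarrow> 'z::euclidean_space) \<Rightarrow> complex"
  assumes "integrable (LP {..<q}) f"
  shows "L1_approximable q f"
  using assms
proof (induction rule: integrable_induct)
  case (base E c)
  have lim: "(\<lambda>n. \<integral>t. cmod (indicator E t *\<^sub>R c - c * (indicator E t * of_real (ball_box {..<q} (real n) t))) \<partial>LP {..<q}) \<longlonglongrightarrow> 0"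
  proof (rule L1_dominated_convergence[where w = "\<lambda>t. indicator E t * cmod c"])
    show "integrable (LP {..<q}) (\<lambda>t. indicator E t * cmod c)"
      using base by (intro integrable_mult_left integrable_real_indicator) auto
    show "(\<lambda>t. indicat_real E t *\<^sub>R c) \<in> borel_measurable (LP {..<q})"
      using base(1) by measurable
    show "(\<lambda>t. c * (indicator E t * of_real (ball_box {..<q} (real n) t))) \<in> borel_measurable (LP {..<q})" for n
    proof -
      have [measurable]: "ball_box {..<q} (real n) \<in> borel_measurable (LP {..<q} :: (nat \<Rightarrow> 'z) measure)"
        by (intro borel_measurable_integrable integrable_ball_box) simp
      show ?thesis using base(1) by measurable
    qed
    show "AE t in LP {..<q}. norm (c * (indicator E t * of_real (ball_box {..<q} (real n) t))) \<le> indicator E t * cmod c" for n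
    proof (rule AE_I2)
      fix t :: "nat \<Rightarrow> 'z"
      have b: "0 \<le> ball_box {..<q} (real n) t" "ball_box {..<q} (real n) t \<le> 1"
        by (rule ball_box_nonneg) (simp add: ball_box_eq)
      show "norm (c * (indicator E t * of_real (ball_box {..<q} (real n) t))) \<le> indicator E t * cmod c"
      proof (cases "t \<in> E")
        case True
        then show ?thesis using b by (simp add: norm_mult mult_left_le)
      qed simp
    qed
    show "AE t in LP {..<q}. (\<lambda>n. c * (indicator E t * of_real (ball_box {..<q} (real n) t))) \<longlonglongrightarrow> indicat_real E t *\<^sub>R c"
    proof (rule AE_I2)
      fix t :: "nat \<Rightarrow> 'z"
      \<comment> \<open>From this radius on the ball contains all coordinates of \<open>t\<close>,
        so the sequence is constant.\<close>
      obtain m :: nat where mm: "(\<Sum>i<q. norm (t i)) \<le> real m"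
        using real_arch_simple by blast
      have m: "norm (t i) \<le> real m" if "i < q" for i
        using member_le_sum[of i "{..<q}" "\<lambda>i. norm (t i)"] that mm by simp
      have "c * (indicator E t * of_real (ball_box {..<q} (real n) t)) = indicat_real E t *\<^sub>R c" if "n \<ge> m" for n
      proof -
        have "\<forall>i\<in>{..<q}. norm (t i) \<le> real n"
        proof
          fix i assume "i \<in> {..<q}"
          then have "norm (t i) \<le> real m" using m by simp
          also have "real m \<le> real n" using that by simp
          finally show "norm (t i) \<le> real n" .
        qed
        then show ?thesis by (simp add: ball_box_eq indicator_def)
      qed
      then show "(\<lambda>n. c * (indicator E t * of_real (ball_box {..<q} (real n) t))) \<longlonglongrightarrow> indicat_real E t *\<^sub>R c"
        by (intro tendsto_eventually eventually_sequentiallyI[of m])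
    qed
  qed
  have int: "integrable (LP {..<q}) (\<lambda>t. indicat_real E t *\<^sub>R c)"
    using base by (intro integrable_scaleR_left integrable_real_indicator) auto
  show ?case
  proof (rule L1_approximable_sequence[OF int _ lim])
    fix n
    show "L1_approximable q (\<lambda>t. c * (indicator E t * of_real (ball_box {..<q} (real n) t)))"
      using L1_approximable_linear[OF L1_approximable_set_box[OF base(1)] L1_approximable_zero, of c "real n"] by simp
  qed
next
  case (add f g)
  then show ?case using L1_approximable_linear[of q f g 1] by simp
next
  case (lim f s)
  have "(\<lambda>i. \<integral>t. cmod (f t - s i t) \<partial>LP {..<q}) \<longlonglongrightarrow> 0"
    using lim by (intro L1_dominated_convergence[where w = "\<lambda>t. 2 * cmod (f t)"]) (auto intro!: AE_I2)
  then show ?case by (rule L1_approximable_sequence[rotated 2]) (fact lim)+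
qed

section \<open>Common refinements\<close>

text \<open>The cells are the nonempty atoms of the algebra generated by the given sets.
  Nonemptiness matters: a cell cannot then lie in two disjoint sets.\<close>

lemma finite_refinement:
  fixes \<C> :: "'z::euclidean_space set set"
  assumes "finite \<C>" "\<And>C. C \<in> \<C> \<Longrightarrow> C \<in> sets borel \<and> bounded C"
  shows "\<exists>a A. is_grid a A \<and> (\<forall>i<a. A i \<noteq> {}) \<and>
    (\<forall>C\<in>\<C>. C = (\<Union>i\<in>{i. i < a \<and> A i \<subseteq> C}. A i))"
proof -
  \<comment> \<open>The points of the union that lie in exactly the members of
    \<open>T\<close>.\<close>
  define atom where "atom T = {y \<in> \<Union>\<C>. \<forall>C\<in>\<C>. C \<in> T \<longleftrightarrow> y \<in> C}" for T
  define \<D> where "\<D> = atom ` Pow \<C> - {{}}"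
  have "finite \<D>" using assms(1) by (simp add: \<D>_def)
  then obtain A where A: "bij_betw A {0..<card \<D>} \<D>"
    using ex_bij_betw_nat_finite by blast
  define a where "a = card \<D>"
  have AD: "A i \<in> \<D>" if "i < a" for i using A that by (auto simp: bij_betw_def a_def)
  have DA: "\<exists>i<a. D = A i" if "D \<in> \<D>" for D
  proof -
    have "D \<in> A ` {0..<a}" using A that by (simp add: bij_betw_def a_def)
    then show ?thesis by auto
  qed
  have borel: "atom T \<in> sets borel" for T
  proof -
    have "atom T = \<Union>\<C> - (\<Union>C\<in>\<C>. if C \<in> T then - C else C)"
      unfolding atom_def by (auto split: if_splits)
    also have "\<dots> \<in> sets borel"
      using assms by (intro sets.Diff sets.finite_Union sets.finite_UN) (auto intro: borel_comp)
    finally show ?thesis .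
  qed
  have bnd: "bounded (atom T)" for T
    by (rule bounded_subset[of "\<Union>\<C>"]) (use assms in \<open>auto simp: atom_def\<close>)
  have disj: "D = D'" if "D \<in> \<D>" "D' \<in> \<D>" "z \<in> D" "z \<in> D'" for D D' z
  proof -
    have key: "T = {C \<in> \<C>. z \<in> C}" if "T \<subseteq> \<C>" "z \<in> atom T" for T
      using that by (auto simp: atom_def)
    obtain T where T: "D = atom T" "T \<subseteq> \<C>" using \<open>D \<in> \<D>\<close> unfolding \<D>_def by blast
    obtain T' where T': "D' = atom T'" "T' \<subseteq> \<C>" using \<open>D' \<in> \<D>\<close> unfolding \<D>_def by blast
    have "T = T'" using key[OF T(2)] key[OF T'(2)] that(3,4) unfolding T(1) T'(1) by simp
    then show ?thesis using T(1) T'(1) by simp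
  qed
  have inj: "i = j" if "i < a" "j < a" "A i = A j" for i j
    using A that by (auto simp: bij_betw_def a_def inj_on_def)
  have grid: "is_grid a A"
    unfolding is_grid_def disjoint_family_on_def
  proof (intro conjI allI impI ballI)
    fix i assume "i < a"
    then obtain T where "A i = atom T" using AD[of i] unfolding \<D>_def by blast
    then show "A i \<in> sets borel" "bounded (A i)" using borel bnd by simp_all
  next
    fix i j assume "i \<in> {..<a}" "j \<in> {..<a}" "i \<noteq> j"
    then show "A i \<inter> A j = {}"
      using disj[OF AD[of i] AD[of j]] inj[of i j] by (meson disjoint_iff lessThan_iff)
  qed
  have cover: "C = (\<Union>i\<in>{i. i < a \<and> A i \<subseteq> C}. A i)" if C: "C \<in> \<C>" for C
  proof
    show "C \<subseteq> (\<Union>i\<in>{i. i < a \<and> A i \<subseteq> C}. A i)"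
    proof
      fix z assume z: "z \<in> C"
      define D where "D = atom {B \<in> \<C>. z \<in> B}"
      have "z \<in> D" using z C by (auto simp: D_def atom_def)
      then have "D \<in> \<D>" by (auto simp: \<D>_def D_def)
      then obtain i where "i < a" "D = A i" using DA[of D] by blast
      moreover have "D \<subseteq> C" using z C by (auto simp: D_def atom_def)
      ultimately show "z \<in> (\<Union>i\<in>{i. i < a \<and> A i \<subseteq> C}. A i)" using \<open>z \<in> D\<close> by blast
    qed
  qed auto
  have ne: "A i \<noteq> {}" if "i < a" for i using AD[OF that] by (simp add: \<D>_def)
  show ?thesis
  proof (intro exI conjI)
    show "is_grid a A" by (rule grid)
    show "\<forall>i<a. A i \<noteq> {}" using ne by simp
    show "\<forall>C\<in>\<C>. C = (\<Union>i\<in>{i. i < a \<and> A i \<subseteq> C}. A i)" by (rule ballI) (rule cover)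
  qed
qed

lemma indicator_cell:
  assumes "is_grid a A" "C = (\<Union>i\<in>{i. i < a \<and> A i \<subseteq> C}. A i)" "\<And>i. i < a \<Longrightarrow> A i \<noteq> {}"
  shows "z \<in> C \<longleftrightarrow> cell a A z < a \<and> A (cell a A z) \<subseteq> C"
proof
  assume "z \<in> C"
  then obtain i where "i < a" "A i \<subseteq> C" "z \<in> A i" using assms(2) by blast
  then show "cell a A z < a \<and> A (cell a A z) \<subseteq> C" using cell_eq_iff[OF assms(1), of i z] by simp
next
  assume "cell a A z < a \<and> A (cell a A z) \<subseteq> C"
  then show "z \<in> C" using cell_eq_iff[OF assms(1), of "cell a A z" z] by auto
qed

lemma rect_kernel_step:
  fixes rs :: "(complex \<times> (nat \<Rightarrow> 'z::euclidean_space set)) list"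
  assumes "rect_list q rs"
  obtains a A G where "is_grid a A" "kernel_support a q G" "rect_kernel q rs = step_kernel a A q G"
proof -
  define \<C> where "\<C> = (\<Union>(c, B)\<in>set rs. B ` {..<q})"
  have f1: "finite \<C>" by (auto simp: \<C>_def)
  have f2: "C \<in> sets borel \<and> bounded C" if "C \<in> \<C>" for C
    using assms that by (auto simp: \<C>_def rect_list_def)
  from finite_refinement[OF f1 f2] obtain a where "\<exists>A. is_grid a A \<and> (\<forall>i<a. A i \<noteq> {}) \<and>
    (\<forall>C\<in>\<C>. C = (\<Union>i\<in>{i. i < a \<and> A i \<subseteq> C}. A i))" ..
  from this obtain A where "is_grid a A \<and> (\<forall>i<a. A i \<noteq> {}) \<and>
    (\<forall>C\<in>\<C>. C = (\<Union>i\<in>{i. i < a \<and> A i \<subseteq> C}. A i))" ..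
  note A' = this[THEN conjunct1] this[THEN conjunct2, THEN conjunct1] this[THEN conjunct2, THEN conjunct2]
  note A = A'(1) A'(2)[rule_format] A'(3)[rule_format]
  define G where "G w = (\<Sum>(c, B)\<leftarrow>rs. c * (\<Prod>i<q. if w ! i < a \<and> A (w ! i) \<subseteq> B i then 1 else 0))" for w
  have "kernel_support a q G"
    unfolding kernel_support_def
  proof (intro allI impI)
    fix w assume w: "length w = q" "\<not> set w \<subseteq> {..<a}"
    then obtain i where "i < q" "\<not> w ! i < a" by (auto simp: subset_iff in_set_conv_nth)
    then have z: "(\<Prod>i<q. if w ! i < a \<and> A (w ! i) \<subseteq> B i then 1 else 0) = (0 :: complex)" for B
      by (intro prod_zero) auto
    show "G w = 0" unfolding G_def z by (simp add: case_prod_unfold)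
  qed
  moreover have "rect_kernel q rs t = step_kernel a A q G t" for t
  proof -
    have "indicator (B i) (t i) = (if cell a A (t i) < a \<and> A (cell a A (t i)) \<subseteq> B i then 1 else 0 :: complex)"
      if "(c, B) \<in> set rs" "i < q" for c B i
    proof -
      have "B i \<in> \<C>" using that by (auto simp: \<C>_def)
      from indicator_cell[OF A(1) A(3)[OF this] A(2)] show ?thesis by (simp add: indicator_def)
    qed
    then show ?thesis
      unfolding rect_kernel_def step_kernel_def G_def
      by (intro arg_cong[where f = sum_list] map_cong refl) (auto intro!: prod.cong)
  qed
  ultimately show thesis using A(1) that by blast
qed

section \<open>Simple kernels on a common grid\<close>

definition sides :: "('z set \<times> nat) list \<Rightarrow> 'z set list" where
  "sides bs = concat (map (\<lambda>(C, k). replicate k C) bs)"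

lemma length_sides: "length (sides bs) = sum_list (map snd bs)"
  by (induction bs) (auto simp: sides_def)

lemma sides_Cons: "sides ((C, k) # bs) = replicate k C @ sides bs"
  by (simp add: sides_def)

text \<open>The words whose products of cells tile the product of the given sets.\<close>

definition matching :: "nat \<Rightarrow> (nat \<Rightarrow> 'z set) \<Rightarrow> 'z set list \<Rightarrow> nat list set" where
  "matching a A Cs = {w. list_all2 (\<lambda>i C. i < a \<and> A i \<subseteq> C) w Cs}"

lemma matching_replicate: "matching a A (replicate k C) = words {i. i < a \<and> A i \<subseteq> C} k"
proof -
  have "{w. list_all2 Q w (replicate k C)} = words {i. Q i C} k" for Q :: "nat \<Rightarrow> 'a set \<Rightarrow> bool"
    by (auto simp: words_def list_all2_conv_all_nth in_set_conv_nth subset_iff)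
  then show ?thesis unfolding matching_def .
qed

lemma matching_words: "matching a A Cs \<subseteq> words {..<a} (length Cs)"
  by (auto simp: matching_def words_def list_all2_conv_all_nth in_set_conv_nth)

lemma sum_matching_append:
  "(\<Sum>w\<in>matching a A (Bs @ Cs). G w) = (\<Sum>x\<in>matching a A Bs. \<Sum>y\<in>matching a A Cs. G (x @ y))"
proof -
  have "(\<Sum>w\<in>matching a A (Bs @ Cs). G w) = (\<Sum>(x, y)\<in>matching a A Bs \<times> matching a A Cs. G (x @ y))"
    by (rule sum.reindex_bij_witness[where j = "\<lambda>w. (take (length Bs) w, drop (length Bs) w)" and i = "\<lambda>(x, y). x @ y"])
      (auto simp: matching_def list_all2_append2 list_all2_appendI dest: list_all2_lengthD)
  then show ?thesis by (simp add: sum.cartesian_product)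
qed

lemma elementary_kernel_matching:
  assumes g: "is_grid a A" "\<And>i. i < a \<Longrightarrow> A i \<noteq> {}"
    and cover: "\<And>C k. (C, k) \<in> set bs \<Longrightarrow> C = (\<Union>i\<in>{i. i < a \<and> A i \<subseteq> C}. A i)"
  shows "elementary_kernel bs t =
    (if map (\<lambda>i. cell a A (t i)) [0..<length (sides bs)] \<in> matching a A (sides bs) then 1 else 0)"
proof -
  have el: "elementary_kernel bs t = (\<Prod>i<length (sides bs). indicator (sides bs ! i) (t i))"
    by (simp add: elementary_kernel_def sides_def Let_def)
  have cov: "C = (\<Union>i\<in>{i. i < a \<and> A i \<subseteq> C}. A i)" if "C \<in> set (sides bs)" for C
    using that cover by (auto simp: sides_def) (metis+)?
  have ind: "t i \<in> sides bs ! i \<longleftrightarrow> cell a A (t i) < a \<and> A (cell a A (t i)) \<subseteq> sides bs ! i"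
    if "i < length (sides bs)" for i
    by (rule indicator_cell[OF g(1) cov g(2)]) (use that in auto)
  show ?thesis
  proof (cases "\<forall>i<length (sides bs). t i \<in> sides bs ! i")
    case True
    then have "elementary_kernel bs t = 1" unfolding el by (intro prod.neutral) auto
    then show ?thesis using True ind by (simp add: matching_def list_all2_conv_all_nth)
  next
    case False
    then obtain i where "i < length (sides bs)" "t i \<notin> sides bs ! i" by blast
    then have "elementary_kernel bs t = 0"
      unfolding el by (intro prod_zero bexI[of _ i]) auto
    moreover have "map (\<lambda>i. cell a A (t i)) [0..<length (sides bs)] \<notin> matching a A (sides bs)"
    proof
      assume "map (\<lambda>i. cell a A (t i)) [0..<length (sides bs)] \<in> matching a A (sides bs)"
      then have "list_all2 (\<lambda>i C. i < a \<and> A i \<subseteq> C) (map (\<lambda>i. cell a A (t i)) [0..<length (sides bs)]) (sides bs)"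
        by (simp add: matching_def)
      from list_all2_nthD[OF this, of i] show False
        using ind[OF \<open>i < length (sides bs)\<close>] \<open>i < length (sides bs)\<close> \<open>t i \<notin> sides bs ! i\<close> by simp
    qed
    ultimately show ?thesis by simp
  qed
qed

lemma (in free_poisson_measure) N_empty: "N {} = 0"
proof -
  have "{} \<in> finite_measure_sets" by (simp add: finite_measure_sets_def)
  from N_additive[OF this this] show ?thesis by simp
qed

context poisson_grid
begin

lemma N_UN:
  assumes "J \<subseteq> {..<a}"
  shows "N (\<Union>i\<in>J. A i) = (\<Sum>i\<in>J. Nc i)" "measure lborel (\<Union>i\<in>J. A i) = (\<Sum>i\<in>J. vol i)"
    "(\<Union>i\<in>J. A i) \<in> finite_measure_sets"
proof -
  have "finite J" using assms finite_subset by blast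
  then have "N (\<Union>i\<in>J. A i) = (\<Sum>i\<in>J. Nc i) \<and> measure lborel (\<Union>i\<in>J. A i) = (\<Sum>i\<in>J. vol i) \<and>
    (\<Union>i\<in>J. A i) \<in> finite_measure_sets"
    using assms
  proof (induction J rule: finite_induct)
    case empty
    then show ?case by (simp add: N_empty finite_measure_sets_def)
  next
    case (insert i J)
    then have i: "A i \<in> finite_measure_sets" and J: "(\<Union>i\<in>J. A i) \<in> finite_measure_sets"
      using cells by auto
    have "A i \<inter> A j = {}" if "j \<in> J" for j
      using disjoint_family_onD[OF disjoint_cells, of i j] insert that by auto
    then have disj: "A i \<inter> (\<Union>j\<in>J. A j) = {}" by blast
    have "measure lborel (A i \<union> (\<Union>j\<in>J. A j)) = vol i + measure lborel (\<Union>j\<in>J. A j)"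
      using i J disj by (intro measure_Union) (auto simp: finite_measure_sets_def)
    moreover have "A i \<union> (\<Union>j\<in>J. A j) \<in> finite_measure_sets"
      using i J emeasure_subadditive[of "A i" lborel "\<Union>j\<in>J. A j"]
      by (auto simp: finite_measure_sets_def order_le_less_trans)
    ultimately show ?case
      using insert N_additive[OF i J disj] by simp
  qed
  then show "N (\<Union>i\<in>J. A i) = (\<Sum>i\<in>J. Nc i)" "measure lborel (\<Union>i\<in>J. A i) = (\<Sum>i\<in>J. vol i)"
    "(\<Union>i\<in>J. A i) \<in> finite_measure_sets" by auto
qed

text \<open>Consistency under refinement. Summed over all words in the cells of \<open>C\<close>,
  the corrections of \<open>wick\<close> for equal neighbours add up to the two lower terms of the
  Charlier recurrence for \<open>C\<close>, because \<open>N\<close> and the volume are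
  additive.\<close>

lemma free_charlier_block:
  assumes J: "J \<subseteq> {..<a}" and C: "C = (\<Union>i\<in>J. A i)"
  shows "op_poly (free_charlier (measure lborel C) k) (N C) = (\<Sum>w\<in>words J k. wick Nc vol w)"
proof (induction k rule: induct_nat_012)
  case 0
  show ?case by simp
next
  case 1
  show ?case using N_UN[OF J] by (simp add: sum_words_Suc C)
next
  case (ge2 k)
  have fin: "finite J" using J finite_subset by blast
  have lin: "N C \<in> complex_linear_ops" using N_UN(3)[OF J] C by (simp add: M_linear N_mem)
  let ?W = "\<lambda>w. wick Nc vol w"
  have "(\<Sum>w\<in>words J (Suc (Suc k)). ?W w) = (\<Sum>i\<in>J. \<Sum>j\<in>J. \<Sum>w\<in>words J k.
      (Nc i o\<^sub>L ?W (j # w)) - (if i = j then ?W (j # w) + vol j *\<^sub>R ?W w else 0))"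
    by (simp add: sum_words_Suc)
  also have "\<dots> = (\<Sum>i\<in>J. \<Sum>j\<in>J. \<Sum>w\<in>words J k. Nc i o\<^sub>L ?W (j # w)) -
      (\<Sum>i\<in>J. \<Sum>j\<in>J. if i = j then \<Sum>w\<in>words J k. ?W (j # w) + vol j *\<^sub>R ?W w else 0)"
    by (simp add: sum_subtractf) (intro sum.cong refl, simp)
  also have "(\<Sum>i\<in>J. \<Sum>j\<in>J. if i = j then \<Sum>w\<in>words J k. ?W (j # w) + vol j *\<^sub>R ?W w else 0) =
      (\<Sum>w\<in>words J (Suc k). ?W w) + measure lborel C *\<^sub>R (\<Sum>w\<in>words J k. ?W w)"
  proof -
    have "(\<Sum>i\<in>J. \<Sum>j\<in>J. if i = j then \<Sum>w\<in>words J k. ?W (j # w) + vol j *\<^sub>R ?W w else 0) =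
        (\<Sum>i\<in>J. \<Sum>w\<in>words J k. ?W (i # w) + vol i *\<^sub>R ?W w)"
      by (intro sum.cong refl) (simp add: sum.delta'[OF fin])
    also have "\<dots> = (\<Sum>i\<in>J. \<Sum>w\<in>words J k. ?W (i # w)) + (\<Sum>i\<in>J. vol i *\<^sub>R (\<Sum>w\<in>words J k. ?W w))"
      unfolding sum.distrib scaleR_sum_right ..
    also have "\<dots> = (\<Sum>w\<in>words J (Suc k). ?W w) + measure lborel C *\<^sub>R (\<Sum>w\<in>words J k. ?W w)"
      unfolding sum_words_Suc C N_UN(2)[OF J] scaleR_sum_left ..
    finally show ?thesis .
  qed
  also have "(\<Sum>i\<in>J. \<Sum>j\<in>J. \<Sum>w\<in>words J k. Nc i o\<^sub>L ?W (j # w)) = N C o\<^sub>L (\<Sum>w\<in>words J (Suc k). ?W w)"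
    unfolding C N_UN(1)[OF J] sum_words_Suc compose_sum_left unfolding compose_sum_right ..
  finally show ?case
    unfolding op_poly_free_charlier_Suc[OF lin] ge2 by (simp only: diff_diff_eq)
qed

lemma wick_append:
  assumes "w \<noteq> []" "v \<noteq> [] \<Longrightarrow> last w \<noteq> hd v"
  shows "wick Nc vol w o\<^sub>L wick Nc vol v = wick Nc vol (w @ v)"
proof (cases v)
  case (Cons d v')
  obtain u c where w: "w = u @ [c]" using assms(1) by (cases w rule: rev_cases) auto
  then have "c \<noteq> d" using assms(2) Cons by simp
  then show ?thesis
    using wick_product[of Nc vol u c d v'] by (simp add: w Cons)
qed simp

text \<open>Consecutive sets of an elementary kernel are disjoint, so the letters at a junction
  differ and Wick words concatenate without correction.\<close>

lemma elementary_integral_matching: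
  assumes "elementary q bs" and nonempty: "\<And>i. i < a \<Longrightarrow> A i \<noteq> {}"
    and cover: "\<And>C k. (C, k) \<in> set bs \<Longrightarrow> C = (\<Union>i\<in>{i. i < a \<and> A i \<subseteq> C}. A i)"
  shows "elementary_integral N bs = (\<Sum>w\<in>matching a A (sides bs). wick Nc vol w)"
  using assms(1) cover
proof (induction bs arbitrary: q)
  case Nil
  have "matching a A (sides []) = {[]}" by (auto simp: matching_def sides_def)
  then show ?case by (simp add: elementary_integral_def op_prod_def)
next
  case (Cons b bs)
  obtain C k where b: "b = (C, k)" by (cases b)
  have k: "k \<ge> 1" using Cons.prems(1) by (simp add: elementary_def b)
  have next_disj: "C \<inter> fst (bs ! 0) = {}" if "bs \<noteq> []"
    using Cons.prems(1) that by (auto simp: elementary_def b dest!: spec[of _ 0])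
  have "fst (bs ! j) \<inter> fst (bs ! Suc j) = {}" if "Suc j < length bs" for j
  proof -
    have "\<forall>j. Suc j < length (b # bs) \<longrightarrow> fst ((b # bs) ! j) \<inter> fst ((b # bs) ! Suc j) = {}"
      using Cons.prems(1) unfolding elementary_def by blast
    from this[rule_format, of "Suc j"] that show ?thesis by simp
  qed
  moreover have "sum_list (map snd bs) = q - k" "\<forall>(A, k)\<in>set bs. A \<in> sets borel \<and> bounded A \<and> k \<ge> 1"
    using Cons.prems(1) unfolding elementary_def b by auto
  ultimately have "elementary (q - k) bs"
    unfolding elementary_def by blast
  then have IH: "elementary_integral N bs = (\<Sum>w\<in>matching a A (sides bs). wick Nc vol w)"
    using Cons.prems(2) by (intro Cons.IH) auto
  define J where "J = {i. i < a \<and> A i \<subseteq> C}"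
  have C: "C = (\<Union>i\<in>J. A i)" using Cons.prems(2)[of C k] by (simp add: b J_def)
  have J: "J \<subseteq> {..<a}" by (auto simp: J_def)
  have "elementary_integral N (b # bs) =
      op_poly (free_charlier (measure lborel C) k) (N C) o\<^sub>L elementary_integral N bs"
    by (simp add: elementary_integral_def op_prod_def b)
  also have "\<dots> = (\<Sum>w\<in>words J k. \<Sum>v\<in>matching a A (sides bs). wick Nc vol w o\<^sub>L wick Nc vol v)"
    unfolding free_charlier_block[OF J C] IH compose_sum_left unfolding compose_sum_right ..
  also have "\<dots> = (\<Sum>w\<in>words J k. \<Sum>v\<in>matching a A (sides bs). wick Nc vol (w @ v))"
  proof (intro sum.cong refl wick_append)
    fix w v assume w: "w \<in> words J k" and v: "v \<in> matching a A (sides bs)"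
    then show "w \<noteq> []" using k by (auto simp: in_words_iff)
    assume "v \<noteq> []"
    have lw: "last w \<in> J" using w \<open>w \<noteq> []\<close> last_in_set by (auto simp: in_words_iff)
    have "sides bs \<noteq> []" using v \<open>v \<noteq> []\<close> by (auto simp: matching_def)
    then have "bs \<noteq> []" by (auto simp: sides_def)
    then obtain C' k' bs' where bs: "bs = (C', k') # bs'" by (metis list.exhaust surj_pair)
    have "k' \<ge> 1" using Cons.prems(1) by (simp add: elementary_def bs)
    then obtain Cs where "sides bs = C' # Cs" by (cases k') (auto simp: bs sides_Cons)
    then have "hd v < a \<and> A (hd v) \<subseteq> C'"
      using v \<open>v \<noteq> []\<close> unfolding matching_def by (cases v) (auto simp: list_all2_Cons2)
    moreover have "C \<inter> C' = {}" using next_disj by (simp add: bs)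
    moreover have "A (last w) \<subseteq> C" using lw by (simp add: J_def)
    \<comment> \<open>A common letter would be a cell inside two disjoint sets.\<close>
    ultimately have "A (hd v) = {}" if "last w = hd v"
      unfolding that by blast
    then show "last w \<noteq> hd v" using nonempty[of "hd v"] \<open>hd v < a \<and> A (hd v) \<subseteq> C'\<close> by blast
  qed
  also have "\<dots> = (\<Sum>w\<in>matching a A (sides (b # bs)). wick Nc vol w)"
    unfolding b sides_Cons sum_matching_append matching_replicate J_def ..
  finally show ?case .
qed

lemma sum_matching_eq_I:
  assumes "length Cs = q"
  shows "(\<Sum>w\<in>matching a A Cs. wick Nc vol w) = I q (\<lambda>w. if w \<in> matching a A Cs then 1 else 0)"
proof -
  have "I q (\<lambda>w. if w \<in> matching a A Cs then 1 else 0) = (\<Sum>w\<in>words {..<a} q. if w \<in> matching a A Cs then wick Nc vol w else 0)"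
    unfolding wick_sum_def by (intro sum.cong refl) (auto simp: op_scale_simps)
  also have "\<dots> = (\<Sum>w\<in>words {..<a} q \<inter> matching a A Cs. wick Nc vol w)"
    by (simp add: sum.inter_restrict)
  also have "words {..<a} q \<inter> matching a A Cs = matching a A Cs"
    using matching_words[of a A Cs] assms by (simp add: Int_absorb1)
  finally show ?thesis by simp
qed

text \<open>Equal neighbours must be collected into one set with a multiplicity, because adjacent
  sets of an elementary kernel have to be disjoint.\<close>

lemma word_elementary:
  assumes g: "is_grid a A" and w: "w \<in> words {..<a} q"
  obtains bs where "elementary q bs" "sides bs = map A w" "elementary_integral N bs = wick Nc vol w"
proof -
  obtain rs where rs: "proper_runs rs" "expand_runs rs = w" using runs_exist by blast
  have sub: "i < a" "k \<ge> 1" if "(i, k) \<in> set rs" for i k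
    using set_expand_runs[OF rs(1)] rs that w by (force simp: proper_runs_def in_words_iff)+
  define bs where "bs = map (\<lambda>(i, k). (A i, k)) rs"
  have "sum_list (map snd bs) = sum_list (map snd rs)"
    by (simp add: bs_def case_prod_unfold comp_def)
  then have len: "sum_list (map snd bs) = q"
    using length_expand_runs[of rs] rs(2) w by (simp add: in_words_iff)
  have "elementary q bs"
    unfolding elementary_def
  proof (intro conjI len)
    show "\<forall>(B, k)\<in>set bs. B \<in> sets borel \<and> bounded B \<and> 1 \<le> k"
      using sub g by (auto simp: bs_def is_grid_def)
    show "\<forall>j. Suc j < length bs \<longrightarrow> fst (bs ! j) \<inter> fst (bs ! Suc j) = {}"
    proof (intro allI impI)
      fix j assume j: "Suc j < length bs"
      have "fst (rs ! j) \<noteq> fst (rs ! Suc j)"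
        using rs(1) j by (auto simp: proper_runs_def bs_def distinct_adj_conv_nth)
      moreover have "fst (rs ! j) < a" "fst (rs ! Suc j) < a"
        using sub j nth_mem[of j rs] nth_mem[of "Suc j" rs]
        by (metis (no_types) Suc_lessD bs_def length_map surjective_pairing)+
      ultimately show "fst (bs ! j) \<inter> fst (bs ! Suc j) = {}"
        using j disjoint_cells by (auto simp: bs_def case_prod_unfold disjoint_family_on_def)
    qed
  qed
  moreover have "sides bs = map A w"
  proof -
    have "sides bs = map A (expand_runs rs)"
      unfolding sides_def bs_def expand_runs_def
      by (simp add: map_concat comp_def case_prod_unfold)
    then show ?thesis using rs(2) by simp
  qed
  moreover have "elementary_integral N bs = wick Nc vol w"
    unfolding rs(2)[symmetric] using sub
    by (subst wick_expand_runs[OF rs(1)])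
      (auto simp: elementary_integral_def bs_def M_linear Nc_mem case_prod_unfold comp_def)
  ultimately show thesis by (rule that)
qed

lemma step_kernel_simple:
  assumes g: "is_grid a A" and G: "kernel_support a q G"
  obtains ws where "\<forall>(c, bs)\<in>set ws. elementary q bs" "simple_kernel ws = step_kernel a A q G"
    "simple_integral N ws = I q G"
proof -
  obtain xs where xs: "set xs = words {..<a} q" "distinct xs"
    using finite_distinct_list[OF finite_words[OF finite_lessThan]] by blast
  have "\<exists>bs. elementary q bs \<and> sides bs = map A w \<and> elementary_integral N bs = wick Nc vol w"
    if "w \<in> words {..<a} q" for w
    using word_elementary[OF g that] by metis
  then obtain bs where bs: "\<And>w. w \<in> words {..<a} q \<Longrightarrow> elementary q (bs w)"
    "\<And>w. w \<in> words {..<a} q \<Longrightarrow> sides (bs w) = map A w"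
    "\<And>w. w \<in> words {..<a} q \<Longrightarrow> elementary_integral N (bs w) = wick Nc vol w" by metis
  define ws where "ws = map (\<lambda>w. (G w, bs w)) xs"
  have "simple_kernel ws t = step_kernel a A q G t" for t
  proof -
    let ?y = "map (\<lambda>i. cell a A (t i)) [0..<q]"
    have ek: "elementary_kernel (bs w) t = (if w = ?y then 1 else 0)" if w: "w \<in> words {..<a} q" for w
    proof -
      have el: "elementary_kernel (bs w) t = (\<Prod>i<q. indicator (A (w ! i)) (t i))"
      proof -
        have "elementary_kernel (bs w) t = (\<Prod>i<length (sides (bs w)). indicator (sides (bs w) ! i) (t i))"
          by (simp add: elementary_kernel_def sides_def Let_def)
        then show ?thesis using w by (simp add: bs(2)[OF w] in_words_iff)
      qed
      have *: "t i \<in> A (w ! i) \<longleftrightarrow> w ! i = cell a A (t i)" if "i < q" for i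
      proof -
        have "w ! i \<in> set w" using w that by (simp add: in_words_iff)
        then have "w ! i < a" using w by (auto simp: in_words_iff)
        then show ?thesis using cell_eq_iff[OF g] by metis
      qed
      show ?thesis
      proof (cases "w = ?y")
        case True
        then have "t i \<in> A (w ! i)" if "i < q" for i using *[OF that] that by simp
        then have "(\<Prod>i<q. indicator (A (w ! i)) (t i) :: complex) = 1"
          by (intro prod.neutral) (simp add: indicator_def)
        then show ?thesis unfolding el if_P[OF True] .
      next
        case False
        have "length w = q" using w by (simp add: in_words_iff)
        with False obtain i where "i < q" "w ! i \<noteq> cell a A (t i)"
          unfolding list_eq_iff_nth_eq by auto
        then have "(\<Prod>i<q. indicator (A (w ! i)) (t i) :: complex) = 0"
          using * by (intro prod_zero bexI[of _ i]) (auto simp: indicator_def)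
        then show ?thesis unfolding el if_not_P[OF False] .
      qed
    qed
    have "simple_kernel ws t = (\<Sum>w\<in>words {..<a} q. G w * elementary_kernel (bs w) t)"
      using xs by (simp add: simple_kernel_def ws_def comp_def sum_list_distinct_conv_sum_set)
    also have "\<dots> = (\<Sum>w\<in>words {..<a} q. if w = ?y then G ?y else 0)"
      by (intro sum.cong refl) (simp add: ek)
    also have "\<dots> = G ?y"
    proof -
      have "G ?y = 0" if "?y \<notin> words {..<a} q"
        using G that unfolding in_words_iff kernel_support_def by simp
      then show ?thesis by (simp only: sum.delta[OF finite_words[OF finite_lessThan]] if_split) simp
    qed
    finally show ?thesis by (simp add: step_kernel_def)
  qed
  moreover have "simple_integral N ws = I q G"
    using xs bs(3) by (simp add: simple_integral_def ws_def comp_def sum_list_distinct_conv_sum_set wick_sum_def)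
  moreover have "\<forall>(c, bs)\<in>set ws. elementary q bs" using bs(1) xs(1) by (auto simp: ws_def)
  ultimately show thesis using that by blast
qed

end

section \<open>The isometry on simple kernels\<close>

context free_poisson_measure
begin

lemma poisson_grid: "is_grid a A \<Longrightarrow> poisson_grid M \<phi> N a A"
  by (intro poisson_grid.intro poisson_grid_axioms.intro free_poisson_measure_axioms grid_finite_measure)
    (auto simp: is_grid_def)

text \<open>Kernel and operator acquire the same coefficients \<open>G\<close> on a common grid.
  Independence of the representation and the isometry both rest on this.\<close>

lemma simple_kernel_refine:
  assumes ws: "\<forall>(c, bs)\<in>set ws. elementary q bs"
  obtains a A G where "is_grid a A" "kernel_support a q G" "simple_kernel ws = step_kernel a A q G"
    "simple_integral N ws = wick_sum {..<a} (\<lambda>i. N (A i)) (\<lambda>i. measure lborel (A i)) q G"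
proof -
  define \<C> where "\<C> = (\<Union>(c, bs)\<in>set ws. fst ` set bs)"
  have f1: "finite \<C>" by (auto simp: \<C>_def)
  have f2: "C \<in> sets borel \<and> bounded C" if "C \<in> \<C>" for C
    using ws that by (fastforce simp: \<C>_def elementary_def)
  from finite_refinement[OF f1 f2] obtain a where "\<exists>A. is_grid a A \<and> (\<forall>i<a. A i \<noteq> {}) \<and>
    (\<forall>C\<in>\<C>. C = (\<Union>i\<in>{i. i < a \<and> A i \<subseteq> C}. A i))" ..
  from this obtain A where "is_grid a A \<and> (\<forall>i<a. A i \<noteq> {}) \<and>
    (\<forall>C\<in>\<C>. C = (\<Union>i\<in>{i. i < a \<and> A i \<subseteq> C}. A i))" ..
  note A' = this[THEN conjunct1] this[THEN conjunct2, THEN conjunct1] this[THEN conjunct2, THEN conjunct2]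
  note A = A'(1) A'(2)[rule_format] A'(3)[rule_format]
  interpret poisson_grid M \<phi> N a A by (rule poisson_grid[OF A(1)])
  define G where "G w = (\<Sum>(c, bs)\<leftarrow>ws. c * (if w \<in> matching a A (sides bs) then 1 else 0))" for w
  have len: "length (sides bs) = q" if "(c, bs) \<in> set ws" for c bs
    using ws that by (auto simp: length_sides elementary_def)
  have cover: "C = (\<Union>i\<in>{i. i < a \<and> A i \<subseteq> C}. A i)" if "(c, bs) \<in> set ws" "(C, k) \<in> set bs" for c bs C k
    by (rule A(3)) (use that in \<open>force simp: \<C>_def\<close>)
  have "kernel_support a q G"
    unfolding kernel_support_def
  proof (intro allI impI)
    fix w assume w: "length w = q" "\<not> set w \<subseteq> {..<a}"
    have "w \<notin> matching a A (sides bs)" for bs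
    proof
      assume "w \<in> matching a A (sides bs)"
      from subsetD[OF matching_words this] w(2) show False by (simp add: in_words_iff)
    qed
    then show "G w = 0" by (simp add: G_def case_prod_unfold)
  qed
  moreover have "simple_kernel ws t = step_kernel a A q G t" for t
    unfolding simple_kernel_def step_kernel_def G_def
  proof (intro arg_cong[where f = sum_list] map_cong refl, clarify)
    fix c bs assume "(c, bs) \<in> set ws"
    then show "c * elementary_kernel bs t =
        c * (if map (\<lambda>i. cell a A (t i)) [0..<q] \<in> matching a A (sides bs) then 1 else 0)"
      using elementary_kernel_matching[OF A(1,2), of bs t] cover len by simp
  qed
  moreover have "simple_integral N ws = I q G"
  proof -
    have "simple_integral N ws = (\<Sum>(c, bs)\<leftarrow>ws. op_scale c (I q (\<lambda>w. if w \<in> matching a A (sides bs) then 1 else 0)))"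
      unfolding simple_integral_def
    proof (intro arg_cong[where f = sum_list] map_cong refl, clarify)
      fix c bs assume cb: "(c, bs) \<in> set ws"
      have "elementary q bs" using ws cb by auto
      then show "op_scale c (elementary_integral N bs) = op_scale c (I q (\<lambda>w. if w \<in> matching a A (sides bs) then 1 else 0))"
        using elementary_integral_matching[OF _ A(2) cover[OF cb]] sum_matching_eq_I[OF len[OF cb]] by simp
    qed
    also have "\<dots> = I q G"
      unfolding G_def
    proof (induction ws)
      case Nil
      show ?case by (simp add: wick_sum_def op_scale_simps)
    next
      case (Cons x ws)
      then show ?case
        by (cases x) (simp add: wick_sum_def op_scale_simps op_scale_sum sum.distrib)
    qed
    finally show ?thesis .
  qed
  ultimately show thesis using that A(1) by blast
qed

lemma simple_integral_mem:
  assumes "\<forall>(c, bs)\<in>set ws. elementary q bs"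
  shows "simple_integral N ws \<in> M"
proof -
  obtain a A G where A: "is_grid a A" "kernel_support a q G" "simple_kernel ws = step_kernel a A q G"
    "simple_integral N ws = wick_sum {..<a} (\<lambda>i. N (A i)) (\<lambda>i. measure lborel (A i)) q G"
    by (rule simple_kernel_refine[OF assms])
  interpret poisson_grid M \<phi> N a A by (rule poisson_grid[OF A(1)])
  show ?thesis unfolding A(4) by (rule I_mem)
qed

lemma simple_integral_isometry:
  assumes "\<forall>(c, bs)\<in>set ws. elementary q bs"
  shows "nrm2 (simple_integral N ws) = (L2_norm q (simple_kernel ws))\<^sup>2"
proof -
  obtain a A G where A: "is_grid a A" "kernel_support a q G" "simple_kernel ws = step_kernel a A q G"
    "simple_integral N ws = wick_sum {..<a} (\<lambda>i. N (A i)) (\<lambda>i. measure lborel (A i)) q G"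
    by (rule simple_kernel_refine[OF assms])
  interpret poisson_grid M \<phi> N a A by (rule poisson_grid[OF A(1)])
  have "0 \<le> Wsum q (\<lambda>w. (cmod (G w))\<^sup>2)"
    using nrm2_nonneg[of "I q G"] by (simp add: nrm2_I)
  then show ?thesis
    unfolding A(3,4) L2_norm_step_kernel[OF A(1,2)] by (simp add: nrm2_I)
qed

end

section \<open>Symmetric step approximations\<close>

lemma cell_restrict: "cell a (\<lambda>i. A i \<inter> S) z = (if z \<in> S then cell a A z else a)"
  by (auto simp: cell_def)

lemma is_grid_restrict:
  assumes "is_grid a A" "S \<in> sets borel"
  shows "is_grid a (\<lambda>i. A i \<inter> S)"
  using assms by (auto simp: is_grid_def disjoint_family_on_def intro: bounded_Int)

text \<open>The nearest-point map onto a disc is continuous and fixes the disc: it enforces the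
  bound without disturbing a limit that already obeys it.\<close>

definition truncation :: "real \<Rightarrow> complex \<Rightarrow> complex" where
  "truncation C = closest_point (cball 0 C)"

lemma cmod_truncation:
  assumes "0 \<le> C"
  shows "cmod (truncation C z) \<le> C"
  using closest_point_in_set[of "cball 0 C :: complex set" z] assms
  by (simp add: truncation_def)

lemma truncation_self: "cmod z \<le> C \<Longrightarrow> truncation C z = z"
  by (simp add: truncation_def closest_point_self)

lemma isCont_truncation:
  assumes "0 \<le> C"
  shows "isCont (truncation C) z"
  using assms continuous_at_closest_point[of "cball 0 C :: complex set" z]
  by (simp add: truncation_def)

text \<open>Truncating before averaging with the mirror image keeps the bound, as an average of two
  values in the disc stays in the disc.\<close>

definition symmetrization :: "real \<Rightarrow> (nat list \<Rightarrow> complex) \<Rightarrow> nat list \<Rightarrow> complex" where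
  "symmetrization C G w = (truncation C (G w) + cnj (truncation C (G (rev w)))) / 2"

lemma cmod_symmetrization:
  assumes "0 \<le> C"
  shows "cmod (symmetrization C G w) \<le> C"
proof -
  have "cmod (truncation C (G w) + cnj (truncation C (G (rev w)))) \<le> C + C"
    using cmod_truncation[OF assms] by (intro order.trans[OF norm_triangle_ineq] add_mono) auto
  then show ?thesis by (simp add: symmetrization_def norm_divide)
qed

lemma symmetrization_rev: "symmetrization C G (rev w) = cnj (symmetrization C G w)"
  by (simp add: symmetrization_def add.commute)

lemma kernel_support_symmetrization:
  assumes "0 \<le> C" "kernel_support a q G"
  shows "kernel_support a q (symmetrization C G)"
  using assms by (simp add: kernel_support_def symmetrization_def truncation_self)

lemma mirror_reindex:
  assumes "AE t in lborel_pow q. P t"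
  shows "AE t in (lborel_pow q :: (nat \<Rightarrow> 'z::euclidean_space) measure). P (\<lambda>i\<in>{..<q}. t (q - 1 - i))"
  using assms unfolding lborel_pow_def
  by (intro AE_LP_reindex) (auto simp: inj_on_def)

definition step_approximation ::
  "nat \<Rightarrow> real \<Rightarrow> real \<Rightarrow> ((nat \<Rightarrow> 'z::euclidean_space) \<Rightarrow> complex)
    \<Rightarrow> (nat \<Rightarrow> nat) \<Rightarrow> (nat \<Rightarrow> nat \<Rightarrow> 'z set) \<Rightarrow> (nat \<Rightarrow> nat list \<Rightarrow> complex) \<Rightarrow> bool" where
  "step_approximation q C R f a A G \<longleftrightarrow>
     kernel_approximation q C R f (\<lambda>j. step_kernel (a j) (A j) q (G j)) \<and>
     (\<forall>j. is_grid (a j) (A j) \<and> (\<forall>i<a j. A j i \<subseteq> cball 0 R) \<and> kernel_support (a j) q (G j) \<and>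
        (\<forall>w. cmod (G j w) \<le> C \<and> G j (rev w) = cnj (G j w)))"

text \<open>Approximation in L1 gives convergence almost everywhere only along a subsequence, hence
  the reindexing by \<open>r\<close>.\<close>

lemma L1_step_approximation:
  assumes f: "integrable (lborel_pow q) (f :: (nat \<Rightarrow> 'z::euclidean_space) \<Rightarrow> complex)"
  obtains a A G where "\<And>j. is_grid (a j) (A j)" "\<And>j. kernel_support (a j) q (G j)"
    "AE t in lborel_pow q. (\<lambda>j. step_kernel (a j :: nat) (A j) q (G j) t) \<longlonglongrightarrow> f t"
proof -
  have ex: "\<forall>j. \<exists>a A G. is_grid a A \<and> kernel_support a q G \<and>
      (\<integral>t. cmod (f t - step_kernel a A q G t) \<partial>lborel_pow q) < 1 / Suc j"
  proof
    fix j
    have "L1_approximable q f"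
      using f unfolding lborel_pow_def by (rule L1_approximable_integrable)
    moreover have "(0::real) < 1 / Suc j" by simp
    ultimately obtain rs where rs: "rect_list q rs"
      "(\<integral>t. cmod (f t - rect_kernel q rs t) \<partial>LP {..<q}) < 1 / Suc j"
      unfolding L1_approximable_def by blast
    obtain a A G where "is_grid a A" "kernel_support a q G" "rect_kernel q rs = step_kernel a A q G"
      using rect_kernel_step[OF rs(1)] .
    then show "\<exists>a A G. is_grid a A \<and> kernel_support a q G \<and>
      (\<integral>t. cmod (f t - step_kernel a A q G t) \<partial>lborel_pow q) < 1 / Suc j"
      using rs(2) unfolding lborel_pow_def by metis
  qed
  obtain a where "\<forall>j. \<exists>A G. is_grid (a j) A \<and> kernel_support (a j) q G \<and>
      (\<integral>t. cmod (f t - step_kernel (a j) A q G t) \<partial>lborel_pow q) < 1 / Suc j"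
    using choice[OF ex] ..
  from choice[OF this] obtain A where "\<forall>j. \<exists>G. is_grid (a j) (A j) \<and> kernel_support (a j) q G \<and>
      (\<integral>t. cmod (f t - step_kernel (a j) (A j) q G t) \<partial>lborel_pow q) < 1 / Suc j" ..
  from choice[OF this] obtain G where G: "\<forall>j. is_grid (a j) (A j) \<and> kernel_support (a j) q (G j) \<and>
      (\<integral>t. cmod (f t - step_kernel (a j) (A j) q (G j) t) \<partial>lborel_pow q) < 1 / Suc j" ..
  let ?u = "\<lambda>j t. f t - step_kernel (a j) (A j) q (G j) t"
  have "integrable (lborel_pow q) (?u j)" for j
    using f has_integral_step_kernel[of "a j" "A j" q "G j"] G
    by (auto simp: has_bochner_integral_iff)
  moreover have "(\<lambda>j. \<integral>t. norm (?u j t) \<partial>lborel_pow q) \<longlonglongrightarrow> 0"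
  proof (rule real_tendsto_sandwich[OF _ _ tendsto_const LIMSEQ_inverse_real_of_nat])
    show "\<forall>\<^sub>F j in sequentially. (\<integral>t. norm (?u j t) \<partial>lborel_pow q) \<le> inverse (real (Suc j))"
      using G unfolding inverse_eq_divide by (intro always_eventually allI less_imp_le) blast
  qed simp
  ultimately obtain r where "AE t in lborel_pow q. (\<lambda>j. ?u (r j) t) \<longlonglongrightarrow> 0"
    using tendsto_L1_AE_subseq[of "lborel_pow q" ?u] by blast
  then have "AE t in lborel_pow q. (\<lambda>j. step_kernel (a (r j)) (A (r j)) q (G (r j)) t) \<longlonglongrightarrow> f t"
  proof eventually_elim
    case (elim t)
    then have "(\<lambda>j. f t - (f t - step_kernel (a (r j)) (A (r j)) q (G (r j)) t)) \<longlonglongrightarrow> f t - 0"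
      by (intro tendsto_intros)
    then show ?case by simp
  qed
  then show thesis using that[of "\<lambda>j. a (r j)" "\<lambda>j. A (r j)" "\<lambda>j. G (r j)"] G by blast
qed

text \<open>Cells are cut to the ball, values truncated and symmetrised. None of this affects the
  limit, since \<open>f\<close> itself is bounded, supported in the ball and mirror symmetric almost
  everywhere.\<close>

lemma step_approximation_exists:
  fixes f :: "(nat \<Rightarrow> 'z::euclidean_space) \<Rightarrow> complex"
  assumes f: "f \<in> borel_measurable (lborel_pow q)" "bounded_with_bounded_support q f" "mirror_symmetric q f"
  shows "\<exists>C R a A G. step_approximation q C R f a A G"
proof -
  obtain C' R where "AE t in lborel_pow q. cmod (f t) \<le> C' \<and> (f t \<noteq> 0 \<longrightarrow> (\<forall>i<q. norm (t i) \<le> R))"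
    using f(2) unfolding bounded_with_bounded_support_def by blast
  \<comment> \<open>The bound \<open>C'\<close> may be negative when \<open>f\<close> vanishes
    almost everywhere, hence the maximum with 0.\<close>
  then have bound': "AE t in lborel_pow q. cmod (f t) \<le> max 0 C' * ball_box {..<q} R t"
    by eventually_elim (auto simp: ball_box_eq)
  define C where "C = max 0 C'"
  have C: "0 \<le> C" by (simp add: C_def)
  note bound = bound'[folded C_def]
  have "integrable (lborel_pow q) (\<lambda>t :: nat \<Rightarrow> 'z. C * ball_box {..<q} R t)"
    unfolding lborel_pow_def by (intro integrable_mult_right integrable_ball_box) auto
  then have "integrable (lborel_pow q) f"
    by (rule Bochner_Integration.integrable_bound[OF _ f(1)])
      (use bound C in \<open>simp add: ball_box_nonneg\<close>)
  then obtain a A G where grid: "\<And>j. is_grid (a j) (A j)" and supp: "\<And>j. kernel_support (a j) q (G j)"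
    and lim: "AE t in lborel_pow q. (\<lambda>j. step_kernel (a j :: nat) (A j) q (G j) t) \<longlonglongrightarrow> f t"
    using L1_step_approximation[of q f] by blast
  define A' where "A' j = (\<lambda>i. A j i \<inter> cball 0 R)" for j
  define G' where "G' j = symmetrization C (G j)" for j
  have grid': "is_grid (a j) (A' j)" for j
    unfolding A'_def by (rule is_grid_restrict[OF grid]) simp
  have supp': "kernel_support (a j) q (G' j)" for j
    unfolding G'_def by (rule kernel_support_symmetrization[OF C supp])
  have in_box: "step_kernel (a j) (A' j) q (G' j) t =
      (truncation C (step_kernel (a j) (A j) q (G j) t) +
       cnj (truncation C (step_kernel (a j) (A j) q (G j) (\<lambda>i\<in>{..<q}. t (q - 1 - i))))) / 2"
    if "\<forall>i<q. norm (t i) \<le> R" for j t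
  proof -
    have 1: "map (\<lambda>i. cell (a j) (A' j) (t i)) [0..<q] = map (\<lambda>i. cell (a j) (A j) (t i)) [0..<q]"
      unfolding A'_def using that by (simp add: cell_restrict)
    have 2: "rev (map (\<lambda>i. cell (a j) (A j) (t i)) [0..<q]) =
        map (\<lambda>i. cell (a j) (A j) ((\<lambda>i\<in>{..<q}. t (q - 1 - i)) i)) [0..<q]"
      by (rule nth_equalityI) (auto simp: rev_nth)
    show ?thesis
      unfolding step_kernel_def 1 G'_def symmetrization_def 2 ..
  qed
  \<comment> \<open>A point outside the ball has a coordinate in no cut cell, which yields the
    letter outside the grid.\<close>
  have off_box: "step_kernel (a j) (A' j) q (G' j) t = 0" if t: "\<not> (\<forall>i<q. norm (t i) \<le> R)" for j t
  proof -
    obtain i where i: "i < q" "\<not> norm (t i) \<le> R" using t by blast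
    have "\<not> set (map (\<lambda>i. cell (a j) (A' j) (t i)) [0..<q]) \<subseteq> {..<a j}"
    proof
      assume "set (map (\<lambda>i. cell (a j) (A' j) (t i)) [0..<q]) \<subseteq> {..<a j}"
      then have "cell (a j) (A' j) (t i) \<in> {..<a j}" by (rule subsetD) (use i(1) in simp)
      then show False using i(2) unfolding A'_def cell_restrict by simp
    qed
    then show ?thesis
      using supp'[of j] unfolding kernel_support_def step_kernel_def by simp
  qed
  have "kernel_approximation q C R f (\<lambda>j. step_kernel (a j) (A' j) q (G' j))"
  proof
    show "f \<in> borel_measurable (lborel_pow q)" by (rule f)
    show "step_kernel (a j) (A' j) q (G' j) \<in> borel_measurable (lborel_pow q)" for j
      by (rule measurable_step_kernel[OF grid' supp'])
    show "0 \<le> C" by (rule C)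
    show "cmod (step_kernel (a j) (A' j) q (G' j) t) \<le> C * ball_box {..<q} R t" for j t
    proof (cases "\<forall>i<q. norm (t i) \<le> R")
      case True
      then have "ball_box {..<q} R t = 1" by (simp add: ball_box_eq)
      then show ?thesis using cmod_symmetrization[OF C] by (simp add: step_kernel_def G'_def)
    next
      case False
      then show ?thesis by (simp add: off_box ball_box_nonneg C)
    qed
    have "AE t in lborel_pow q. f t = mirror q f t"
      using f(3) by (simp add: mirror_symmetric_def)
    then show "AE t in lborel_pow q. (\<lambda>j. step_kernel (a j) (A' j) q (G' j) t) \<longlonglongrightarrow> f t"
      using bound lim mirror_reindex[OF lim]
    proof eventually_elim
      case (elim t)
      show ?case
      proof (cases "\<forall>i<q. norm (t i) \<le> R")
        case True
        let ?t = "\<lambda>i\<in>{..<q}. t (q - 1 - i)"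
        have ft: "cmod (f t) \<le> C" using elim(2) True by (simp add: ball_box_eq)
        have f't: "cnj (f ?t) = f t" using elim(1) by (simp add: mirror_def)
        have ft': "cmod (f ?t) \<le> C" using ft unfolding f't[symmetric] complex_mod_cnj .
        have "(\<lambda>j. (truncation C (step_kernel (a j) (A j) q (G j) t) +
           cnj (truncation C (step_kernel (a j) (A j) q (G j) ?t))) / 2)
          \<longlonglongrightarrow> (truncation C (f t) + cnj (truncation C (f ?t))) / 2"
          by (intro tendsto_intros isCont_tendsto_compose[OF isCont_truncation[OF C]] elim) simp
        then show ?thesis
          unfolding in_box[OF True] truncation_self[OF ft] truncation_self[OF ft'] f't by simp
      next
        case False
        then have "ball_box {..<q} R t = 0" by (auto simp: ball_box_eq)
        then have "f t = 0" using elim(2) by simp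
        then show ?thesis by (simp add: off_box[OF False])
      qed
    qed
  qed
  moreover have "A' j i \<subseteq> cball 0 R" for j i by (auto simp: A'_def)
  moreover have "cmod (G' j w) \<le> C \<and> G' j (rev w) = cnj (G' j w)" for j w
    using cmod_symmetrization[OF C] by (simp add: G'_def symmetrization_rev)
  ultimately have "step_approximation q C R f a A' G'"
    using grid' supp' unfolding step_approximation_def by blast
  then show ?thesis by blast
qed

section \<open>Square integrable kernels\<close>

lemma in_L2_diff:
  assumes "in_L2 q u" "in_L2 q v"
  shows "in_L2 q (\<lambda>t. u t - v t)"
    and "(L2_norm q (\<lambda>t. u t - v t))\<^sup>2 \<le> 2 * (L2_norm q u)\<^sup>2 + 2 * (L2_norm q v)\<^sup>2"
proof -
  have le: "(cmod (u t - v t))\<^sup>2 \<le> 2 * (cmod (u t))\<^sup>2 + 2 * (cmod (v t))\<^sup>2" for t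
  proof -
    have "(cmod (u t - v t))\<^sup>2 \<le> (cmod (u t) + cmod (v t))\<^sup>2"
      by (intro power_mono norm_triangle_ineq4) auto
    also have "\<dots> \<le> 2 * (cmod (u t))\<^sup>2 + 2 * (cmod (v t))\<^sup>2"
      using zero_le_power2[of "cmod (u t) - cmod (v t)"] by (simp add: power2_eq_square algebra_simps)
    finally show ?thesis .
  qed
  have meas: "(\<lambda>t. u t - v t) \<in> borel_measurable (lborel_pow q)"
    using assms unfolding in_L2_def by (intro borel_measurable_diff) auto
  have int: "integrable (lborel_pow q) (\<lambda>t. 2 * (cmod (u t))\<^sup>2 + 2 * (cmod (v t))\<^sup>2)"
    using assms unfolding in_L2_def by (intro Bochner_Integration.integrable_add integrable_mult_right) auto
  have int': "integrable (lborel_pow q) (\<lambda>t. (cmod (u t - v t))\<^sup>2)"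
  proof (rule Bochner_Integration.integrable_bound[OF int])
    show "(\<lambda>t. (cmod (u t - v t))\<^sup>2) \<in> borel_measurable (lborel_pow q)"
      using meas by measurable
    show "AE t in lborel_pow q. norm ((cmod (u t - v t))\<^sup>2) \<le> norm (2 * (cmod (u t))\<^sup>2 + 2 * (cmod (v t))\<^sup>2)"
      using le by (intro always_eventually allI) simp
  qed
  then show "in_L2 q (\<lambda>t. u t - v t)" using meas by (simp add: in_L2_def)
  have sq: "(L2_norm q w)\<^sup>2 = (\<integral>t. (cmod (w t))\<^sup>2 \<partial>lborel_pow q)" for w
    by (simp add: L2_norm_def)
  have "(\<integral>t. (cmod (u t - v t))\<^sup>2 \<partial>lborel_pow q) \<le> (\<integral>t. 2 * (cmod (u t))\<^sup>2 + 2 * (cmod (v t))\<^sup>2 \<partial>lborel_pow q)"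
    by (intro integral_mono int int' le)
  also have "\<dots> = 2 * (\<integral>t. (cmod (u t))\<^sup>2 \<partial>lborel_pow q) + 2 * (\<integral>t. (cmod (v t))\<^sup>2 \<partial>lborel_pow q)"
    using assms unfolding in_L2_def by simp
  finally show "(L2_norm q (\<lambda>t. u t - v t))\<^sup>2 \<le> 2 * (L2_norm q u)\<^sup>2 + 2 * (L2_norm q v)\<^sup>2"
    unfolding sq .
qed

lemma in_L2_step_kernel:
  assumes g: "is_grid a A" and G: "kernel_support a q G"
  shows "in_L2 q (step_kernel a A q G)"
proof -
  have "kernel_support a q (\<lambda>w. (cmod (G w))\<^sup>2)"
    using G by (simp add: kernel_support_def)
  from has_integral_step_kernel[OF g this]
  have "integrable (lborel_pow q) (\<lambda>t. (cmod (step_kernel a A q G t))\<^sup>2)"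
    by (simp add: has_bochner_integral_iff step_kernel_def[abs_def])
  then show ?thesis
    using measurable_step_kernel[OF g G] by (simp add: in_L2_def)
qed

lemma op_scale_minus: "op_scale (- c) T = - op_scale c T"
proof -
  have "op_scale (- c) T + op_scale c T = 0"
    using op_scale_simps(2)[of "- c" c T] op_scale_simps(7)[of T] by simp
  then show ?thesis by (simp add: eq_neg_iff_add_eq_0)
qed

context free_poisson_measure
begin

lemma in_L2_simple_kernel:
  fixes ws :: "(complex \<times> ('z set \<times> nat) list) list"
  assumes "\<forall>(c, bs)\<in>set ws. elementary q bs"
  shows "in_L2 q (simple_kernel ws)"
proof -
  obtain a A G where "is_grid a A" "kernel_support a q G" "simple_kernel ws = step_kernel a A q G"
    by (rule simple_kernel_refine[OF assms])
  then show ?thesis using in_L2_step_kernel by metis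
qed

text \<open>A difference of simple kernels is one simple kernel, obtained by appending the list with
  negated coefficients; the isometry for single lists then covers differences.\<close>

lemma simple_integral_diff:
  assumes ws: "\<forall>(c, bs)\<in>set ws. elementary q bs" and ws': "\<forall>(c, bs)\<in>set ws'. elementary q bs"
  shows "nrm2 (simple_integral N ws - simple_integral N ws') =
    (L2_norm q (\<lambda>t. simple_kernel ws t - simple_kernel ws' t))\<^sup>2"
proof -
  define vs where "vs = ws @ map (\<lambda>(c, bs). (- c, bs)) ws'"
  have k: "simple_kernel (map (\<lambda>(c, bs). (- c, bs)) ws') t = - simple_kernel ws' t" for t
    by (induction ws') (auto simp: simple_kernel_def)
  have i: "simple_integral N (map (\<lambda>(c, bs). (- c, bs)) ws') = - simple_integral N ws'"
    by (induction ws') (auto simp: simple_integral_def op_scale_minus)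
  have "\<forall>(c, bs)\<in>set vs. elementary q bs" using ws ws' by (auto simp: vs_def)
  from simple_integral_isometry[OF this]
  show ?thesis
    using i k by (simp add: vs_def simple_integral_def simple_kernel_def[abs_def])
qed

text \<open>The simple integrals of two approximating sequences approach each other by the isometry,
  and faithfulness of the trace identifies the limits. This gives the definite description in
  \<open>multiple_integral\<close> its meaning.\<close>

lemma has_multiple_integral_unique:
  assumes f: "in_L2 q f" and X: "has_multiple_integral M \<phi> N q f X" and Y: "has_multiple_integral M \<phi> N q f Y"
  shows "X = Y"
proof -
  obtain ws where M: "X \<in> M" and ws: "\<And>j. \<forall>(c, bs)\<in>set (ws j). elementary q bs"
    "(\<lambda>j. L2_norm q (\<lambda>t. simple_kernel (ws j) t - f t)) \<longlonglongrightarrow> 0"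
    "(\<lambda>j. \<phi> (op_adj (simple_integral N (ws j) - X) o\<^sub>L (simple_integral N (ws j) - X))) \<longlonglongrightarrow> 0"
    using X unfolding has_multiple_integral_def by blast
  obtain vs where M': "Y \<in> M" and vs: "\<And>j. \<forall>(c, bs)\<in>set (vs j). elementary q bs"
    "(\<lambda>j. L2_norm q (\<lambda>t. simple_kernel (vs j) t - f t)) \<longlonglongrightarrow> 0"
    "(\<lambda>j. \<phi> (op_adj (simple_integral N (vs j) - Y) o\<^sub>L (simple_integral N (vs j) - Y))) \<longlonglongrightarrow> 0"
    using Y unfolding has_multiple_integral_def by blast
  have to_nrm2: "(\<lambda>j. nrm2 (S j)) \<longlonglongrightarrow> 0"
    if "(\<lambda>j. \<phi> (op_adj (S j) o\<^sub>L S j)) \<longlonglongrightarrow> 0" "\<And>j. S j \<in> M" for S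
    using tendsto_Re[OF that(1)] that(2) by (simp add: state_op_adj)
  note nX = to_nrm2[OF ws(3) M_diff[OF simple_integral_mem[OF ws(1)] M]]
  note nY = to_nrm2[OF vs(3) M_diff[OF simple_integral_mem[OF vs(1)] M']]
  let ?d = "\<lambda>us j. L2_norm q (\<lambda>t. simple_kernel (us j) t - f t)"
  let ?b = "\<lambda>j. 2 * nrm2 (simple_integral N (ws j) - X) +
      2 * (2 * nrm2 (simple_integral N (vs j) - Y) + 2 * (2 * (?d ws j)\<^sup>2 + 2 * (?d vs j)\<^sup>2))"
  have le: "nrm2 (X - Y) \<le> ?b j" for j
  proof -
    let ?V = "simple_integral N (ws j)" and ?W = "simple_integral N (vs j)"
    have "X - Y = (X - ?V) + ((?W - Y) + (?V - ?W))" by simp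
    then have "nrm2 (X - Y) \<le> 2 * nrm2 (X - ?V) + 2 * (2 * nrm2 (?W - Y) + 2 * nrm2 (?V - ?W))"
      using nrm2_add[of "X - ?V" "(?W - Y) + (?V - ?W)"] nrm2_add[of "?W - Y" "?V - ?W"] by simp
    moreover have "nrm2 (?V - ?W) \<le> 2 * (?d ws j)\<^sup>2 + 2 * (?d vs j)\<^sup>2"
    proof -
      have "nrm2 (?V - ?W) = (L2_norm q (\<lambda>t. (simple_kernel (ws j) t - f t) - (simple_kernel (vs j) t - f t)))\<^sup>2"
      using simple_integral_diff[OF ws(1) vs(1), of j j] by simp
      also have "\<dots> \<le> 2 * (?d ws j)\<^sup>2 + 2 * (?d vs j)\<^sup>2"
        by (intro in_L2_diff(2) in_L2_diff(1) in_L2_simple_kernel f ws vs)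
      finally show ?thesis .
    qed
    moreover have arith: "x \<le> 2 * a + 2 * (2 * b + 2 * d)" if "x \<le> 2 * a + 2 * (2 * b + 2 * c)" "c \<le> d"
      for x a b c d :: real
      by (rule order.trans[OF that(1)]) (intro add_left_mono mult_left_mono that(2); simp)
    ultimately have "nrm2 (X - Y) \<le> 2 * nrm2 (X - ?V) + 2 * (2 * nrm2 (?W - Y) + 2 * (2 * (?d ws j)\<^sup>2 + 2 * (?d vs j)\<^sup>2))"
      by blast
    then show ?thesis
      unfolding nrm2_minus_commute[of X ?V] .
  qed
  have "?b \<longlonglongrightarrow> 2 * 0 + 2 * (2 * 0 + 2 * (2 * 0\<^sup>2 + 2 * 0\<^sup>2))"
    by (intro tendsto_intros nX nY ws vs)
  then have "nrm2 (X - Y) \<le> 2 * 0 + 2 * (2 * 0 + 2 * (2 * 0\<^sup>2 + 2 * 0\<^sup>2))"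
    by (rule LIMSEQ_le_const) (use le in blast)
  then have "nrm2 (X - Y) = 0" using nrm2_nonneg[of "X - Y"] by simp
  then show ?thesis using nrm2_eq_0[OF M_diff[OF M M']] by simp
qed

end

section \<open>Multiple integrals of bounded kernels\<close>

definition contr_norm2 :: "nat \<Rightarrow> ((nat \<Rightarrow> 'z::euclidean_space) \<Rightarrow> complex) \<Rightarrow> nat \<times> nat \<Rightarrow> real" where
  "contr_norm2 q f = (\<lambda>(e, k). (L2_norm (q + q - 2 * k - e) (gcontr q e k f))\<^sup>2)"

locale integral_approximation = free_poisson_measure M \<phi> N
  for M :: "('h::complex_hilbert_space \<Rightarrow>\<^sub>L 'h) set" and \<phi>
    and N :: "'z::euclidean_space set \<Rightarrow> 'h \<Rightarrow>\<^sub>L 'h" +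
  fixes q :: nat and C R :: real and f :: "(nat \<Rightarrow> 'z) \<Rightarrow> complex"
    and a :: "nat \<Rightarrow> nat" and A :: "nat \<Rightarrow> nat \<Rightarrow> 'z set" and G :: "nat \<Rightarrow> nat list \<Rightarrow> complex"
  assumes q_pos: "q \<ge> 1" and f_L2: "in_L2 q f" and approx: "step_approximation q C R f a A G"
begin

abbreviation g :: "nat \<Rightarrow> (nat \<Rightarrow> 'z) \<Rightarrow> complex" where
  "g j \<equiv> step_kernel (a j) (A j) q (G j)"

lemma grid: "is_grid (a j) (A j)" and support: "kernel_support (a j) q (G j)"
  and G_bound: "cmod (G j w) \<le> C" and A_ball: "i < a j \<Longrightarrow> A j i \<subseteq> cball 0 R"
  using approx unfolding step_approximation_def by blast+

sublocale K: kernel_approximation q C R f g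
  using approx unfolding step_approximation_def by blast

sublocale S: symmetric_step_kernel M \<phi> N "a j" "A j" q "G j" for j
proof (intro symmetric_step_kernel.intro symmetric_step_kernel_axioms.intro poisson_grid grid q_pos)
  show "G j (rev w) = cnj (G j w)" for w
    using approx unfolding step_approximation_def by blast
qed

lemma sqn_eq: "S.sqn j = (L2_norm q (g j))\<^sup>2"
  unfolding L2_norm_step_kernel[OF grid support]
  using S.sqn_nonneg[of j] by (simp add: S.sqn_def)

lemma contr_sqn_eq:
  assumes "(e, k) \<in> contr_types q q"
  shows "S.contr_sqn j (e, k) = (L2_norm (q + q - 2 * k - e) (gcontr q e k (g j)))\<^sup>2"
proof -
  have ek: "k + e \<le> q" "e \<le> 1" using assms by (auto simp: contr_types_def)
  show ?thesis
    unfolding L2_norm_gcontr_step_kernel[OF grid support ek]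
    using S.contr_sqn_nonneg[of j "(e, k)"] by (simp add: S.contr_sqn_def)
qed

lemma sqn_tendsto: "S.sqn \<longlonglongrightarrow> (L2_norm q f)\<^sup>2"
  unfolding sqn_eq by (intro tendsto_power K.L2_norm_tendsto)

lemma contr_sqn_tendsto:
  assumes "b \<in> contr_types q q"
  shows "(\<lambda>j. S.contr_sqn j b) \<longlonglongrightarrow> contr_norm2 q f b"
proof -
  obtain e k where b: "b = (e, k)" by (cases b)
  have ek: "k + e \<le> q" using assms by (auto simp: contr_types_def b)
  have "(\<lambda>j. S.contr_sqn j (e, k)) = (\<lambda>j. (L2_norm (q + q - 2 * k - e) (gcontr q e k (g j)))\<^sup>2)"
    using contr_sqn_eq assms by (auto simp: b)
  then show ?thesis
    using tendsto_power[OF K.gcontr_tendsto[OF ek], of 2] by (simp add: b contr_norm2_def)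
qed

text \<open>The constant of \<open>norm_X_le\<close> with the volume of the ball in place of the
  total volume of the cells, hence the same for all grids.\<close>

definition bound :: real where
  "bound = real (2 * (q + 1)) * sqrt (C\<^sup>2 * max 1 (measure lborel (cball (0::'z) R)) ^ q)"

lemma norm_X_bound: "norm (S.X j) \<le> bound"
  unfolding bound_def
proof (rule S.norm_X_le)
  have "(\<Sum>i<a j. measure lborel (A j i)) = measure lborel (\<Union>i<a j. A j i)"
    using S.N_UN(2)[of "{..<a j}" j] by simp
  also have "\<dots> \<le> measure lborel (cball (0::'z) R)"
  proof (rule measure_mono_fmeasurable)
    show "(\<Union>i<a j. A j i) \<subseteq> cball 0 R" using A_ball by blast
    show "(\<Union>i<a j. A j i) \<in> sets lborel"
      using S.N_UN(3)[of "{..<a j}" j] by (simp add: finite_measure_sets_def)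
    show "cball (0::'z) R \<in> fmeasurable lborel"
      using emeasure_bounded_finite[OF bounded_cball, of "0::'z" R] by (intro fmeasurableI) simp_all
  qed
  finally show "(\<Sum>i<a j. measure lborel (A j i)) \<le> max 1 (measure lborel (cball (0::'z) R))" by simp
qed (simp_all add: G_bound)

text \<open>The step integrals are Cauchy in trace norm by the isometry and bounded in operator
  norm, so \<open>bounded_nrm2_Cauchy_limit\<close> supplies a bounded limit.\<close>

lemma integral_exists:
  obtains Y where "Y \<in> M" "is_adjoint Y Y" "has_multiple_integral M \<phi> N q f Y"
    "(\<lambda>j. nrm2 (S.X j - Y)) \<longlonglongrightarrow> 0"
proof -
  have "\<exists>ws. (\<forall>(c, bs)\<in>set ws. elementary q bs) \<and> simple_kernel ws = g j \<and> simple_integral N ws = S.X j" for j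
    using S.step_kernel_simple[OF grid support, of j] unfolding S.X_def by metis
  then obtain ws where ws: "\<And>j. \<forall>(c, bs)\<in>set (ws j). elementary q bs"
    "\<And>j. simple_kernel (ws j) = g j" "\<And>j. simple_integral N (ws j) = S.X j" by metis
  have diff: "nrm2 (S.X i - S.X j) \<le> 2 * (L2_norm q (\<lambda>t. g i t - f t))\<^sup>2 + 2 * (L2_norm q (\<lambda>t. g j t - f t))\<^sup>2" for i j
  proof -
    have "nrm2 (S.X i - S.X j) = (L2_norm q (\<lambda>t. (g i t - f t) - (g j t - f t)))\<^sup>2"
      using simple_integral_diff[OF ws(1) ws(1), of i j] by (simp add: ws(2,3))
    also have "\<dots> \<le> 2 * (L2_norm q (\<lambda>t. g i t - f t))\<^sup>2 + 2 * (L2_norm q (\<lambda>t. g j t - f t))\<^sup>2"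
      by (intro in_L2_diff(2) in_L2_diff(1) in_L2_step_kernel grid support f_L2)
    finally show ?thesis .
  qed
  have "(\<lambda>j. 2 * (L2_norm q (\<lambda>t. g j t - f t))\<^sup>2) \<longlonglongrightarrow> 2 * 0\<^sup>2"
    by (intro tendsto_intros K.L2_norm_diff_tendsto)
  then have d0: "(\<lambda>j. 2 * (L2_norm q (\<lambda>t. g j t - f t))\<^sup>2) \<longlonglongrightarrow> 0" by simp
  have Cauchy: "\<exists>J. \<forall>i\<ge>J. \<forall>j\<ge>J. nrm2 (S.X i - S.X j) < e" if "e > 0" for e
  proof -
    have "e / 2 > 0" using that by simp
    from order_tendstoD(2)[OF d0 this] obtain J where
      J: "\<And>j. j \<ge> J \<Longrightarrow> 2 * (L2_norm q (\<lambda>t. g j t - f t))\<^sup>2 < e / 2"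
      unfolding eventually_sequentially by blast
    have "nrm2 (S.X i - S.X j) < e" if "i \<ge> J" "j \<ge> J" for i j
      using diff[of i j] J[OF that(1)] J[OF that(2)] by argo
    then show ?thesis by blast
  qed
  obtain Y where Y: "Y \<in> M" "is_adjoint Y Y" "(\<lambda>j. nrm2 (S.X j - Y)) \<longlonglongrightarrow> 0"
    using bounded_nrm2_Cauchy_limit[OF S.X_mem S.X_selfadjoint norm_X_bound Cauchy] by blast
  have "has_multiple_integral M \<phi> N q f Y"
    unfolding has_multiple_integral_def
  proof (intro conjI exI[of _ ws] allI)
    show "Y \<in> M" by (rule Y)
    show "\<forall>(c, bs)\<in>set (ws j). elementary q bs" for j by (rule ws)
    show "(\<lambda>j. L2_norm q (\<lambda>t. simple_kernel (ws j) t - f t)) \<longlonglongrightarrow> 0"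
      unfolding ws(2) by (rule K.L2_norm_diff_tendsto)
    show "(\<lambda>j. \<phi> (op_adj (simple_integral N (ws j) - Y) o\<^sub>L (simple_integral N (ws j) - Y))) \<longlonglongrightarrow> 0"
      unfolding ws(3) state_op_adj[OF M_diff[OF S.X_mem Y(1)]]
      using tendsto_of_real[OF Y(3), where 'a = complex] by simp
  qed
  then show thesis using that Y by blast
qed

abbreviation Y :: "'h \<Rightarrow>\<^sub>L 'h" where "Y \<equiv> multiple_integral M \<phi> N q f"

lemma integral_facts: "Y \<in> M" "is_adjoint Y Y" "(\<lambda>j. nrm2 (S.X j - Y)) \<longlonglongrightarrow> 0"
proof -
  obtain Z where Z: "Z \<in> M" "is_adjoint Z Z" "has_multiple_integral M \<phi> N q f Z"
    "(\<lambda>j. nrm2 (S.X j - Z)) \<longlonglongrightarrow> 0" using integral_exists .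
  have "Y = Z"
    unfolding multiple_integral_def
    by (rule the_equality[where P = "has_multiple_integral M \<phi> N q f", OF Z(3)])
      (rule has_multiple_integral_unique[OF f_L2 _ Z(3)])
  then show "Y \<in> M" "is_adjoint Y Y" "(\<lambda>j. nrm2 (S.X j - Y)) \<longlonglongrightarrow> 0" using Z by auto
qed

lemma moment_tendsto: "(\<lambda>j. \<phi> (op_power (S.X j) m)) \<longlonglongrightarrow> \<phi> (op_power Y m)"
  by (rule state_power_tendsto[OF S.X_mem S.X_selfadjoint norm_X_bound integral_facts])

lemma state_Y: "\<phi> Y = 0"
proof -
  have "op_power T 1 = T" for T :: "'h \<Rightarrow>\<^sub>L 'h" by simp
  then show ?thesis
    using moment_tendsto[of 1] by (simp add: S.state_X LIMSEQ_const_iff)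
qed

lemma state_Y2: "\<phi> (op_power Y 2) = of_real ((L2_norm q f)\<^sup>2)"
  using LIMSEQ_unique[OF moment_tendsto[of 2]] tendsto_of_real[OF sqn_tendsto, where 'a = complex]
  unfolding S.state_X2 by blast

lemma proper_subset: "b \<in> proper_contr_types q \<Longrightarrow> b \<in> contr_types q q"
  by (simp add: proper_contr_types_def)

lemma state_Y4:
  "\<phi> (op_power Y 4) = of_real (2 * ((L2_norm q f)\<^sup>2)\<^sup>2 + (\<Sum>b\<in>proper_contr_types q. contr_norm2 q f b))"
proof -
  have "(\<lambda>j. complex_of_real (2 * (S.sqn j)\<^sup>2 + (\<Sum>b\<in>proper_contr_types q. S.contr_sqn j b))) \<longlonglongrightarrow>
      of_real (2 * ((L2_norm q f)\<^sup>2)\<^sup>2 + (\<Sum>b\<in>proper_contr_types q. contr_norm2 q f b))"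
    by (intro tendsto_of_real tendsto_add tendsto_mult tendsto_const tendsto_power sqn_tendsto
        tendsto_sum contr_sqn_tendsto proper_subset)
  then show ?thesis
    using LIMSEQ_unique[OF moment_tendsto[of 4]] unfolding S.state_X4 by blast
qed

text \<open>Taken over from step kernels in the limit, which avoids a second Fubini
  argument.\<close>

lemma contr_norm2_star_1:
  shows "contr_norm2 q f (1, 0) = contr_norm2 q f (1, q - 1)"
proof -
  have "(1, 0) \<in> contr_types q q" "(1, q - 1) \<in> contr_types q q"
    using q_pos by (auto simp: contr_types_def)
  from contr_sqn_tendsto[OF this(1)] contr_sqn_tendsto[OF this(2)]
  show ?thesis unfolding S.contr_sqn_star_1 by (rule LIMSEQ_unique)
qed

lemma even_moment_real: "Re (\<phi> (op_power Y (m + m))) = nrm2 (op_power Y m)"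
proof -
  have "op_power Y (m + m) = op_power Y m o\<^sub>L op_power Y m" by (rule op_power_add)
  then show ?thesis
    using state_nrm2[OF M_power M_power is_adjoint_op_power, OF integral_facts(1) integral_facts(1) integral_facts(2)] by simp
qed

text \<open>Both sides of the estimate for step kernels are continuous in the variance, the
  contraction norms and the moments, all of which converge.\<close>

lemma moment_approx:
  "cmod (\<phi> (op_power Y m) - of_real (semicircle_path ((L2_norm q f)\<^sup>2) m 0))
    \<le> semicircle_error (proper_contr_types q) ((L2_norm q f)\<^sup>2) (contr_norm2 q f)
        (\<lambda>i. nrm2 (op_power Y i)) m 0"
proof (rule LIMSEQ_le)
  have "(\<lambda>j. nrm2 (op_power (S.X j) i)) \<longlonglongrightarrow> nrm2 (op_power Y i)" for i
    using tendsto_Re[OF moment_tendsto[of "i + i"]]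
    unfolding S.state_even_power even_moment_real by simp
  then show "(\<lambda>j. semicircle_error (proper_contr_types q) (S.sqn j) (S.contr_sqn j)
      (\<lambda>i. nrm2 (op_power (S.X j) i)) m 0) \<longlonglongrightarrow>
    semicircle_error (proper_contr_types q) ((L2_norm q f)\<^sup>2) (contr_norm2 q f) (\<lambda>i. nrm2 (op_power Y i)) m 0"
    by (intro tendsto_semicircle_error sqn_tendsto contr_sqn_tendsto proper_subset)
  show "(\<lambda>j. cmod (\<phi> (op_power (S.X j) m) - of_real (semicircle_path (S.sqn j) m 0))) \<longlonglongrightarrow>
      cmod (\<phi> (op_power Y m) - of_real (semicircle_path ((L2_norm q f)\<^sup>2) m 0))"
    by (intro tendsto_norm tendsto_diff moment_tendsto tendsto_of_real tendsto_semicircle_path sqn_tendsto)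
  show "\<exists>J. \<forall>j\<ge>J. cmod (\<phi> (op_power (S.X j) m) - of_real (semicircle_path (S.sqn j) m 0)) \<le>
      semicircle_error (proper_contr_types q) (S.sqn j) (S.contr_sqn j) (\<lambda>i. nrm2 (op_power (S.X j) i)) m 0"
    using S.state_power_approx by blast
qed

end

section \<open>Paths and tamed kernels\<close>

text \<open>The block of all positions that carry the variable \<open>l\<close>.\<close>

definition fibre :: "nat \<Rightarrow> (nat \<Rightarrow> nat) \<Rightarrow> nat \<Rightarrow> nat set" where
  "fibre n h l = {p. p < n \<and> h p = l}"

lemma fibre_partition:
  assumes h: "h ` {..<n} = {..<b}"
  shows "partition_on {..<n} (fibre n h ` {..<b})" "bij_betw (fibre n h) {..<b} (fibre n h ` {..<b})"
    and "p < n \<Longrightarrow> block_of (fibre n h ` {..<b}) p = fibre n h (h p)"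
proof -
  have less: "h p < b" if "p < n" for p using h that by blast
  have ne: "\<exists>p<n. h p = l" if "l < b" for l
  proof -
    have "l \<in> h ` {..<n}" using h that by simp
    then show ?thesis by auto
  qed
  show "partition_on {..<n} (fibre n h ` {..<b})"
  proof (rule partition_onI)
    show "\<Union> (fibre n h ` {..<b}) = {..<n}" using less by (auto simp: fibre_def)
    show "disjnt p r" if "p \<in> fibre n h ` {..<b}" "r \<in> fibre n h ` {..<b}" "p \<noteq> r" for p r
      using that by (auto simp: fibre_def disjnt_def)
    show "{} \<notin> fibre n h ` {..<b}"
    proof
      assume "{} \<in> fibre n h ` {..<b}"
      then obtain l where "l < b" "fibre n h l = {}" by auto
      with ne[of l] show False by (auto simp: fibre_def)
    qed
  qed
  have "inj_on (fibre n h) {..<b}"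
  proof (rule inj_onI)
    fix k l assume "k \<in> {..<b}" "l \<in> {..<b}" and eq: "fibre n h k = fibre n h l"
    then obtain p where "p < n" "h p = k" using ne by auto
    then have "p \<in> fibre n h l" unfolding eq[symmetric] by (simp add: fibre_def)
    then show "k = l" using \<open>h p = k\<close> by (simp add: fibre_def)
  qed
  then show "bij_betw (fibre n h) {..<b} (fibre n h ` {..<b})" by (rule inj_on_imp_bij_betw)
  show "block_of (fibre n h ` {..<b}) p = fibre n h (h p)" if p: "p < n"
    unfolding block_of_def
    by (rule the_equality) (use p less in \<open>auto simp: fibre_def\<close>)
qed

text \<open>Within one consecutive block the labelling is injective, so a fibre meets it in at most
  one position.\<close>

lemma fibre_meet_singletons:
  assumes h: "h ` {..<m * q} = {..<b}" and inj: "\<And>j. j < m \<Longrightarrow> inj_on h {j * q..<(j + 1) * q}"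
  shows "partition_meet (fibre (m * q) h ` {..<b}) (consecutive_blocks m q) = singletons (m * q)"
proof -
  have eq: "fibre (m * q) h (h p) \<inter> {j * q..<(j + 1) * q} = {p}"
    if "j < m" "p \<in> {j * q..<(j + 1) * q}" for j p
  proof -
    have le: "(j + 1) * q \<le> m * q" using that(1) by (intro mult_le_mono1) simp
    show ?thesis
      using that le inj_onD[OF inj[OF that(1)]] by (auto simp: fibre_def)
  qed
  have block: "\<exists>j<m. p \<in> {j * q..<(j + 1) * q}" if p: "p < m * q" for p
  proof (intro exI[of _ "p div q"] conjI)
    have "q > 0" using p by (cases q) auto
    show "p div q < m" using p \<open>q > 0\<close> by (simp add: less_mult_imp_div_less)
    show "p \<in> {p div q * q..<(p div q + 1) * q}"
      using \<open>q > 0\<close> by (simp add: dividend_less_times_div mult.commute)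
  qed
  show ?thesis
  proof
    show "partition_meet (fibre (m * q) h ` {..<b}) (consecutive_blocks m q) \<subseteq> singletons (m * q)"
    proof
      fix B assume "B \<in> partition_meet (fibre (m * q) h ` {..<b}) (consecutive_blocks m q)"
      then obtain l j where B: "B = fibre (m * q) h l \<inter> {j * q..<(j + 1) * q}" "B \<noteq> {}" "j < m"
        by (auto simp: partition_meet_def consecutive_blocks_def)
      obtain p where "p \<in> B" using B(2) by blast
      then have p: "p < m * q" "h p = l" "p \<in> {j * q..<(j + 1) * q}"
        unfolding B(1) by (simp_all add: fibre_def)
      have "B = {p}" using eq[OF B(3) p(3)] p(2) B(1) by simp
      then show "B \<in> singletons (m * q)" using p(1) by (simp add: singletons_def)
    qed
    show "singletons (m * q) \<subseteq> partition_meet (fibre (m * q) h ` {..<b}) (consecutive_blocks m q)"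
    proof
      fix B assume "B \<in> singletons (m * q)"
      then obtain p where p: "p < m * q" "B = {p}" by (auto simp: singletons_def)
      obtain j where j: "j < m" "p \<in> {j * q..<(j + 1) * q}" using block[OF p(1)] by blast
      have "h p \<in> {..<b}" unfolding h[symmetric] using p(1) by simp
      then show "B \<in> partition_meet (fibre (m * q) h ` {..<b}) (consecutive_blocks m q)"
        unfolding partition_meet_def consecutive_blocks_def
      proof (intro DiffI CollectI exI conjI)
        show "B = fibre (m * q) h (h p) \<inter> {j * q..<(j + 1) * q}" by (simp only: p(2) eq[OF j])
        show "B \<notin> {{}}" using p(2) by simp
        show "{j * q..<(j + 1) * q} \<in> (\<lambda>j. {j * q..<(j + 1) * q}) ` {..<m}" using j(1) by (intro imageI) simp
      qed (rule imageI)
    qed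
  qed
qed

definition path_label :: "nat \<Rightarrow> (nat \<times> nat) list \<Rightarrow> nat \<Rightarrow> nat" where
  "path_label q \<pi> p = path_labels q \<pi> ! (p div q) ! (p mod q)"

definition path_partition :: "nat \<Rightarrow> (nat \<times> nat) list \<Rightarrow> nat set set" where
  "path_partition q \<pi> = fibre (length \<pi> * q) (path_label q \<pi>) ` {..<path_bound \<pi>}"

definition closed_paths :: "nat \<Rightarrow> nat \<Rightarrow> (nat \<times> nat) list set" where
  "closed_paths q m = {\<pi> \<in> paths q m. path_degree q \<pi> = 0}"

lemma path_label_image:
  assumes "\<pi> \<in> closed_paths q m" "q \<ge> 1"
  shows "path_label q \<pi> ` {..<m * q} = {..<path_bound \<pi>}"
    and "\<And>j. j < m \<Longrightarrow> inj_on (path_label q \<pi>) {j * q..<(j + 1) * q}"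
    and "(\<Union>j<m. (\<lambda>i. path_labels q \<pi> ! j ! i) ` {..<q}) = {..<path_bound \<pi>}"
    and "\<And>j. j < m \<Longrightarrow> inj_on (\<lambda>i. path_labels q \<pi> ! j ! i) {..<q}"
proof -
  have v: "valid_path q \<pi>" "path_degree q \<pi> = 0" and m: "length \<pi> = m"
    using assms(1) by (auto simp: closed_paths_def paths_def)
  have len: "length (path_labels q \<pi>) = m" by (simp add: length_path_labels m)
  have row: "length (path_labels q \<pi> ! j) = q" "distinct (path_labels q \<pi> ! j)" if "j < m" for j
    using path_labels_distinct[OF v(1) nth_mem, of j] that by (auto simp: len)
  have set_row: "set (path_labels q \<pi> ! j) = (\<lambda>i. path_labels q \<pi> ! j ! i) ` {..<q}" if "j < m" for j
    using row(1)[OF that] by (auto simp: set_conv_nth)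
  have "(\<Union>j<m. set (path_labels q \<pi> ! j)) = {..<path_bound \<pi>}"
    using path_labels_cover[OF v(1)] by (simp add: v(2) set_conv_nth[of "path_labels q \<pi>"] len) blast
  then show cover: "(\<Union>j<m. (\<lambda>i. path_labels q \<pi> ! j ! i) ` {..<q}) = {..<path_bound \<pi>}"
    using set_row by simp
  show inj: "inj_on (\<lambda>i. path_labels q \<pi> ! j ! i) {..<q}" if "j < m" for j
    using row[OF that] by (auto simp: inj_on_def nth_eq_iff_index_eq)
  have label: "path_label q \<pi> (j * q + i) = path_labels q \<pi> ! j ! i" if "i < q" for i j
    using that by (simp add: path_label_def)
  show "inj_on (path_label q \<pi>) {j * q..<(j + 1) * q}" if "j < m" for j
  proof (rule inj_onI)
    fix x y assume x: "x \<in> {j * q..<(j + 1) * q}" and y: "y \<in> {j * q..<(j + 1) * q}"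
      and eq: "path_label q \<pi> x = path_label q \<pi> y"
    obtain i i' where i: "x = j * q + i" "y = j * q + i'"
      using x y by (metis atLeastLessThan_iff le_Suc_ex)
    then have l: "i < q" "i' < q" using x y by auto
    then show "x = y" using eq inj_onD[OF inj[OF that], of i i'] by (simp add: i label)
  qed
  have "{..<m * q} = (\<Union>j<m. (\<lambda>i. j * q + i) ` {..<q})"
  proof (intro equalityI subsetI)
    fix p assume p: "p \<in> {..<m * q}"
    then have "p = p div q * q + p mod q" "p div q < m" "p mod q < q"
      using assms(2) by (auto simp: less_mult_imp_div_less)
    then show "p \<in> (\<Union>j<m. (\<lambda>i. j * q + i) ` {..<q})" by blast
  next
    fix p assume "p \<in> (\<Union>j<m. (\<lambda>i. j * q + i) ` {..<q})"
    then obtain j i where "j < m" "i < q" "p = j * q + i" by blast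
    moreover have "Suc j * q \<le> m * q" using \<open>j < m\<close> by (intro mult_le_mono1) simp
    ultimately show "p \<in> {..<m * q}" by simp
  qed
  then have "path_label q \<pi> ` {..<m * q} = (\<Union>j<m. (\<lambda>i. path_label q \<pi> (j * q + i)) ` {..<q})"
    by (simp add: image_UN image_image)
  also have "\<dots> = {..<path_bound \<pi>}" using cover label by simp
  finally show "path_label q \<pi> ` {..<m * q} = {..<path_bound \<pi>}" .
qed

definition path_integrand ::
  "nat \<Rightarrow> (nat \<times> nat) list \<Rightarrow> ((nat \<Rightarrow> 'z) \<Rightarrow> complex) \<Rightarrow> (nat \<Rightarrow> 'z) \<Rightarrow> real" where
  "path_integrand q \<pi> u x = (\<Prod>j<length \<pi>. cmod (u (\<lambda>i\<in>{..<q}. x (path_labels q \<pi> ! j ! i))))"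

text \<open>The variables of a path are numbered, those of the identified tensor are the blocks
  themselves. \<open>fibre\<close> is a bijection between the two index sets, under which the finite
  powers of Lebesgue measure correspond.\<close>

lemma path_integrand_identified_tensor:
  fixes f :: "(nat \<Rightarrow> 'z::euclidean_space) \<Rightarrow> complex"
  assumes \<pi>: "\<pi> \<in> closed_paths q m" and q: "q \<ge> 1" and f: "f \<in> borel_measurable (lborel_pow q)"
  shows "(\<integral>\<^sup>+x. ennreal (path_integrand q \<pi> f x) \<partial>LP {..<path_bound \<pi>}) =
    (\<integral>\<^sup>+x. ennreal (identified_tensor m q (\<lambda>t. cmod (f t)) (path_partition q \<pi>) x) \<partial>LP (path_partition q \<pi>))"
proof -
  have m: "length \<pi> = m" using \<pi> by (simp add: closed_paths_def paths_def)
  note image = path_label_image[OF \<pi> q]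
  note part = fibre_partition[OF image(1)]
  let ?\<sigma> = "path_partition q \<pi>" and ?b = "{..<path_bound \<pi>}" and ?F = "fibre (m * q) (path_label q \<pi>)"
  have \<sigma>: "?\<sigma> = ?F ` ?b" by (simp add: path_partition_def m)
  have label_mem: "path_labels q \<pi> ! j ! i \<in> ?b" if "j < m" "i < q" for i j
    using image(3) that by blast
  have meas: "path_integrand q \<pi> f \<in> borel_measurable (LP ?b)"
    unfolding path_integrand_def
  proof (intro borel_measurable_prod)
    fix j assume "j \<in> {..<length \<pi>}"
    then have "(\<lambda>i. path_labels q \<pi> ! j ! i) ` {..<q} \<subseteq> ?b" using label_mem m by auto
    from measurable_compose[OF measurable_reindex[OF this] f[unfolded lborel_pow_def]]
    have "(\<lambda>x. f (\<lambda>i\<in>{..<q}. x (path_labels q \<pi> ! j ! i))) \<in> borel_measurable (LP ?b)" .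
    then show "(\<lambda>x. cmod (f (\<lambda>i\<in>{..<q}. x (path_labels q \<pi> ! j ! i)))) \<in> borel_measurable (LP ?b)"
      by measurable
  qed
  have eq: "path_integrand q \<pi> f (\<lambda>l\<in>?b. x (?F l)) = identified_tensor m q (\<lambda>t. cmod (f t)) ?\<sigma> x" for x
    unfolding path_integrand_def identified_tensor_def m
  proof (intro prod.cong refl arg_cong[where f = "\<lambda>t. cmod (f t)"] restrict_ext)
    fix j i assume j: "j \<in> {..<m}" and i: "i \<in> {..<q}"
    have "Suc j * q \<le> m * q" using j by (intro mult_le_mono1) simp
    then have "j * q + i < m * q" using i by simp
    from part(3)[OF this] have "block_of ?\<sigma> (j * q + i) = ?F (path_labels q \<pi> ! j ! i)"
      using i by (simp add: \<sigma> path_label_def)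
    then show "(\<lambda>l\<in>?b. x (?F l)) (path_labels q \<pi> ! j ! i) = x (block_of ?\<sigma> (j * q + i))"
      using label_mem i j by simp
  qed
  have "(\<integral>\<^sup>+x. ennreal (path_integrand q \<pi> f x) \<partial>LP ?b) =
      (\<integral>\<^sup>+x. ennreal (path_integrand q \<pi> f x) \<partial>distr (LP ?\<sigma>) (LP ?b) (\<lambda>x. \<lambda>l\<in>?b. x (?F l)))"
    unfolding \<sigma> distr_LP_bij[OF finite_lessThan part(2)] ..
  also have "\<dots> = (\<integral>\<^sup>+x. ennreal (path_integrand q \<pi> f (\<lambda>l\<in>?b. x (?F l))) \<partial>LP ?\<sigma>)"
    using meas by (intro nn_integral_distr measurable_reindex) (simp_all add: \<sigma>)
  also have "\<dots> = (\<integral>\<^sup>+x. ennreal (identified_tensor m q (\<lambda>t. cmod (f t)) ?\<sigma> x) \<partial>LP ?\<sigma>)"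
    unfolding eq ..
  finally show ?thesis .
qed

lemma prod_list_map_nth: "prod_list (map F xs) = (\<Prod>j<length xs. F (xs ! j))"
  for F :: "'a \<Rightarrow> 'b::comm_monoid_mult"
  by (induction xs) (simp_all add: prod.lessThan_Suc_shift del: prod.lessThan_Suc)

context integral_approximation
begin

lemma path_integral_step:
  assumes \<pi>: "\<pi> \<in> closed_paths q m"
  shows "S.Wsum n (path_bound \<pi>) (\<lambda>x. prod_list (map (\<lambda>c. cmod (G n (map ((!) x) c))) (path_labels q \<pi>))) =
    (\<integral>x. path_integrand q \<pi> (g n) x \<partial>LP {..<path_bound \<pi>})"
proof -
  have v: "valid_path q \<pi>" and m: "length \<pi> = m" using \<pi> by (auto simp: closed_paths_def paths_def)
  note image = path_label_image[OF \<pi> q_pos]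
  let ?H = "\<lambda>x. prod_list (map (\<lambda>c. cmod (G n (map ((!) x) c))) (path_labels q \<pi>))"
  have row: "length (path_labels q \<pi> ! j) = q" if "j < m" for j
    using path_labels_distinct[OF v nth_mem, of j] that by (simp add: length_path_labels m)
  have supp: "kernel_support (a n) (path_bound \<pi>) ?H"
    unfolding kernel_support_def
  proof (intro allI impI)
    fix w assume w: "length w = path_bound \<pi>" "\<not> set w \<subseteq> {..<a n}"
    then obtain l where l: "l < path_bound \<pi>" "\<not> w ! l < a n" by (auto simp: in_set_conv_nth subset_iff)
    \<comment> \<open>Every variable stands in some copy of the kernel, so a letter outside the grid
      annihilates the whole product.\<close>
    then have "l \<in> (\<Union>j<m. (\<lambda>i. path_labels q \<pi> ! j ! i) ` {..<q})" unfolding image(3) by simp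
    then obtain j i where ji: "j < m" "i < q" "path_labels q \<pi> ! j ! i = l" by auto
    let ?c = "path_labels q \<pi> ! j"
    have "map ((!) w) ?c ! i = w ! l" using ji row[OF ji(1)] by simp
    moreover have "map ((!) w) ?c ! i \<in> set (map ((!) w) ?c)"
      using ji row[OF ji(1)] by (intro nth_mem) simp
    ultimately have "\<not> set (map ((!) w) ?c) \<subseteq> {..<a n}" using l(2) by auto
    then have "G n (map ((!) w) ?c) = 0"
      using support[of n] row[OF ji(1)] unfolding kernel_support_def by simp
    moreover have "?c \<in> set (path_labels q \<pi>)" using ji(1) by (simp add: length_path_labels m)
    ultimately show "?H w = 0" unfolding prod_list_zero_iff by force
  qed
  have eq: "step_kernel (a n) (A n) (path_bound \<pi>) ?H x = path_integrand q \<pi> (g n) x" for x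
    unfolding step_kernel_def path_integrand_def prod_list_map_nth length_path_labels
  proof (intro prod.cong refl arg_cong[where f = "\<lambda>w. cmod (G n w)"])
    fix j assume "j \<in> {..<length \<pi>}"
    then have j: "j < m" by (simp add: m)
    have "path_labels q \<pi> ! j ! i < path_bound \<pi>" if "i < q" for i
    proof -
      have "path_labels q \<pi> ! j ! i \<in> (\<Union>j<m. (\<lambda>i. path_labels q \<pi> ! j ! i) ` {..<q})"
        using j that by blast
      then show ?thesis unfolding image(3) by simp
    qed
    then show "map ((!) (map (\<lambda>i. cell (a n) (A n) (x i)) [0..<path_bound \<pi>])) (path_labels q \<pi> ! j) =
        map (\<lambda>i. cell (a n) (A n) ((\<lambda>i\<in>{..<q}. x (path_labels q \<pi> ! j ! i)) i)) [0..<q]"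
      using row[OF j] by (intro nth_equalityI) auto
  qed
  show ?thesis
    using has_integral_step_kernel[OF grid supp] unfolding eq[abs_def] lborel_pow_def
    by (simp add: has_bochner_integral_iff eq)
qed

lemma path_integral_tendsto:
  assumes \<pi>: "\<pi> \<in> closed_paths q m"
  shows "(\<lambda>n. \<integral>x. path_integrand q \<pi> (g n) x \<partial>LP {..<path_bound \<pi>}) \<longlonglongrightarrow>
      (\<integral>x. path_integrand q \<pi> f x \<partial>LP {..<path_bound \<pi>})"
    and "integrable (LP {..<path_bound \<pi>}) (path_integrand q \<pi> f)"
proof -
  have m: "length \<pi> = m" using \<pi> by (auto simp: closed_paths_def paths_def)
  note image = path_label_image[OF \<pi> q_pos]
  show "(\<lambda>n. \<integral>x. path_integrand q \<pi> (g n) x \<partial>LP {..<path_bound \<pi>}) \<longlonglongrightarrow>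
      (\<integral>x. path_integrand q \<pi> f x \<partial>LP {..<path_bound \<pi>})"
    unfolding path_integrand_def m
    by (rule K.product_tendsto(1)[where h = "\<lambda>j i. path_labels q \<pi> ! j ! i"]) (use image in auto)
  show "integrable (LP {..<path_bound \<pi>}) (path_integrand q \<pi> f)"
    unfolding path_integrand_def[abs_def] m
    by (rule K.product_tendsto(2)[where h = "\<lambda>j i. path_labels q \<pi> ! j ! i"]) (use image in auto)
qed

lemma moment_le_paths:
  "cmod (\<phi> (op_power Y m)) \<le> (\<Sum>\<pi>\<in>closed_paths q m. \<integral>x. path_integrand q \<pi> f x \<partial>LP {..<path_bound \<pi>})"
proof (rule LIMSEQ_le)
  show "(\<lambda>n. cmod (\<phi> (op_power (S.X n) m))) \<longlonglongrightarrow> cmod (\<phi> (op_power Y m))"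
    by (intro tendsto_norm moment_tendsto)
  show "(\<lambda>n. \<Sum>\<pi>\<in>closed_paths q m. \<integral>x. path_integrand q \<pi> (g n) x \<partial>LP {..<path_bound \<pi>}) \<longlonglongrightarrow>
      (\<Sum>\<pi>\<in>closed_paths q m. \<integral>x. path_integrand q \<pi> f x \<partial>LP {..<path_bound \<pi>})"
    by (intro tendsto_sum path_integral_tendsto)
  have "cmod (\<phi> (op_power (S.X n) m)) \<le> (\<Sum>\<pi>\<in>closed_paths q m. \<integral>x. path_integrand q \<pi> (g n) x \<partial>LP {..<path_bound \<pi>})" for n
  proof (rule order.trans[OF S.state_power_le_labels])
    show "(\<Sum>\<pi>\<in>{\<pi> \<in> paths q m. path_degree q \<pi> = 0}.
        S.Wsum n (path_bound \<pi>) (\<lambda>x. prod_list (map (\<lambda>c. cmod (G n (map ((!) x) c))) (path_labels q \<pi>)))) \<le>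
      (\<Sum>\<pi>\<in>closed_paths q m. \<integral>x. path_integrand q \<pi> (g n) x \<partial>LP {..<path_bound \<pi>})"
      unfolding closed_paths_def[symmetric] by (intro eq_refl sum.cong refl path_integral_step)
  qed
  then show "\<exists>N. \<forall>n\<ge>N. cmod (\<phi> (op_power (S.X n) m)) \<le>
      (\<Sum>\<pi>\<in>closed_paths q m. \<integral>x. path_integrand q \<pi> (g n) x \<partial>LP {..<path_bound \<pi>})" by blast
qed

lemma path_integral_le_tamed:
  assumes \<pi>: "\<pi> \<in> closed_paths q m"
    and le: "(\<integral>\<^sup>+x. ennreal (identified_tensor m q (\<lambda>t. cmod (f t)) (path_partition q \<pi>) x)
      \<partial>LP (path_partition q \<pi>)) \<le> ennreal D"
  shows "(\<integral>x. path_integrand q \<pi> f x \<partial>LP {..<path_bound \<pi>}) \<le> max 0 D"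
proof -
  have "0 \<le> path_integrand q \<pi> f x" for x by (auto simp: path_integrand_def intro: prod_nonneg)
  then have "(\<integral>\<^sup>+x. ennreal (path_integrand q \<pi> f x) \<partial>LP {..<path_bound \<pi>}) =
      ennreal (\<integral>x. path_integrand q \<pi> f x \<partial>LP {..<path_bound \<pi>})"
    by (intro nn_integral_eq_integral path_integral_tendsto(2)[OF \<pi>]) simp
  then have "ennreal (\<integral>x. path_integrand q \<pi> f x \<partial>LP {..<path_bound \<pi>}) \<le> ennreal D"
    using le path_integrand_identified_tensor[OF \<pi> q_pos K.f_measurable] by simp
  \<comment> \<open>The bound from tamedness may be negative, in which case \<open>ennreal\<close>
    sends it to 0.\<close>
  also have "\<dots> \<le> ennreal (max 0 D)" by (simp add: ennreal_leI)
  finally show ?thesis by (simp only: ennreal_le_iff[OF max.cobounded1])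
qed

end

lemma path_partition_tamed:
  assumes "\<pi> \<in> closed_paths q m" "q \<ge> 1"
  shows "partition_on {..<m * q} (path_partition q \<pi>)"
    "partition_meet (path_partition q \<pi>) (consecutive_blocks m q) = singletons (m * q)"
proof -
  have m: "length \<pi> = m" using assms(1) by (simp add: closed_paths_def paths_def)
  note image = path_label_image[OF assms]
  show "partition_on {..<m * q} (path_partition q \<pi>)"
    unfolding path_partition_def m by (rule fibre_partition(1)[OF image(1)])
  show "partition_meet (path_partition q \<pi>) (consecutive_blocks m q) = singletons (m * q)"
    unfolding path_partition_def m by (rule fibre_meet_singletons[OF image(1,2)])
qed

section \<open>The fourth moment theorem\<close>

lemma (in free_poisson_measure) integral_approximation_exists:
  assumes "q \<ge> 1" "in_L2 q f" "bounded_with_bounded_support q f" "mirror_symmetric q f"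
  shows "\<exists>C R a A G. integral_approximation M \<phi> N q C R f a A G"
proof -
  obtain C R a A G where "step_approximation q C R f a A G"
    using step_approximation_exists[of f q] assms by (auto simp: in_L2_def)
  then have "integral_approximation M \<phi> N q C R f a A G"
    using assms free_poisson_measure_axioms
    by (intro integral_approximation.intro integral_approximation_axioms.intro)
  then show ?thesis by blast
qed

text \<open>A star contraction of order \<open>k\<close> integrates only \<open>k - 1\<close>
  variables. The type \<open>(1, 0)\<close>, of order one, is the only one outside the two families
  of condition (iv).\<close>

lemma proper_contr_types_iff:
  assumes "q \<ge> 2"
  shows "b \<in> proper_contr_types q \<longleftrightarrow> (\<exists>k\<in>{1..q - 1}. b = (0, k)) \<or> b = (1, 0) \<or> (\<exists>k\<in>{2..q}. b = (1, k - 1))"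
proof -
  obtain e k where b: "b = (e, k)" by (cases b)
  have "(\<exists>k'\<in>{2..q}. k = k' - 1) \<longleftrightarrow> 1 \<le> k \<and> k + 1 \<le> q"
    by (auto intro!: bexI[of _ "Suc k"])
  then show ?thesis
    using assms by (auto simp: b proper_contr_types_def contr_types_def)
qed

lemma finite_proper_contr_types [simp]: "finite (proper_contr_types q)"
  by (simp add: proper_contr_types_def)

lemma tendsto_power2_0_iff: "(\<lambda>n. (x n)\<^sup>2) \<longlonglongrightarrow> 0 \<longleftrightarrow> x \<longlonglongrightarrow> 0" for x :: "nat \<Rightarrow> real"
proof
  assume "(\<lambda>n. (x n)\<^sup>2) \<longlonglongrightarrow> 0"
  from tendsto_real_sqrt[OF this] show "x \<longlonglongrightarrow> 0" by (simp add: tendsto_rabs_zero_iff)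
next
  assume "x \<longlonglongrightarrow> 0"
  from tendsto_power[OF this, of 2] show "(\<lambda>n. (x n)\<^sup>2) \<longlonglongrightarrow> 0" by simp
qed

text \<open>The extra type \<open>(1, 0)\<close> is absorbed by \<open>(1, q - 1)\<close>, which is
  the star contraction of order \<open>q\<close> and belongs to the list.\<close>

lemma contr_norm2_tendsto_0_iff:
  fixes f :: "nat \<Rightarrow> (nat \<Rightarrow> 'z::euclidean_space) \<Rightarrow> complex"
  assumes "q \<ge> 2" and star_1: "\<And>n. contr_norm2 q (f n) (1, 0) = contr_norm2 q (f n) (1, q - 1)"
  shows "(\<forall>b\<in>proper_contr_types q. (\<lambda>n. contr_norm2 q (f n) b) \<longlonglongrightarrow> 0) \<longleftrightarrow>
    (\<forall>k\<in>{1..q - 1}. (\<lambda>n. L2_norm (2 * q - 2 * k) (contraction q q k (f n) (f n))) \<longlonglongrightarrow> 0) \<and>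
    (\<forall>k\<in>{2..q}. (\<lambda>n. L2_norm (2 * q - 2 * k + 1) (star_contraction q q k (f n) (f n))) \<longlonglongrightarrow> 0)"
proof -
  let ?P = "\<lambda>b. (\<lambda>n. contr_norm2 q (f n) b) \<longlonglongrightarrow> 0"
  have contr: "?P (0, k) \<longleftrightarrow> (\<lambda>n. L2_norm (2 * q - 2 * k) (contraction q q k (f n) (f n))) \<longlonglongrightarrow> 0" for k
    unfolding contr_norm2_def prod.case tendsto_power2_0_iff contraction_eq_gcontr by (simp add: mult_2)
  have star: "?P (1, k - 1) \<longleftrightarrow> (\<lambda>n. L2_norm (2 * q - 2 * k + 1) (star_contraction q q k (f n) (f n))) \<longlonglongrightarrow> 0"
    if "k \<in> {2..q}" for k
  proof -
    have "q + q - 2 * (k - 1) - 1 = 2 * q - 2 * k + 1" "1 \<le> k" "k \<le> q" using that by auto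
    then show ?thesis
      unfolding contr_norm2_def prod.case tendsto_power2_0_iff by (simp add: star_contraction_eq_gcontr)
  qed
  have "?P (1, 0) \<longleftrightarrow> ?P (1, q - 1)" by (simp only: star_1)
  moreover have "q \<in> {2..q}" using assms(1) by simp
  ultimately have "(\<forall>b\<in>proper_contr_types q. ?P b) \<longleftrightarrow> (\<forall>k\<in>{1..q - 1}. ?P (0, k)) \<and> (\<forall>k\<in>{2..q}. ?P (1, k - 1))"
    unfolding Ball_def proper_contr_types_iff[OF assms(1)] by blast
  then show ?thesis using contr star by simp
qed

lemma semicircle_path_4: "semicircle_path t 4 0 = 2 * t\<^sup>2"
  by (simp add: eval_nat_numeral algebra_simps)

theorem theorem4p1:
  fixes M :: "('h::complex_hilbert_space \<Rightarrow>\<^sub>L 'h) set"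
    and \<phi> :: "('h \<Rightarrow>\<^sub>L 'h) \<Rightarrow> complex"
    and N :: "(real ^ 'd) set \<Rightarrow> 'h \<Rightarrow>\<^sub>L 'h"
    and q :: nat
    and f :: "nat \<Rightarrow> (nat \<Rightarrow> real ^ 'd) \<Rightarrow> complex"
    and \<alpha> :: real
  defines "X \<equiv> \<lambda>n. multiple_integral M \<phi> N q (f n)"
  assumes "free_poisson_measure M \<phi> N"
    and "q \<ge> 2"
    and "tamed q f"
    and "\<And>n. mirror_symmetric q (f n)"
    and "(\<lambda>n. (L2_norm q (f n))\<^sup>2) \<longlonglongrightarrow> \<alpha>\<^sup>2"
  shows
    "(converges_in_law \<phi> X (semicircular (\<alpha>\<^sup>2))
        \<longleftrightarrow> (\<lambda>n. free_cumulant \<phi> 4 (X n)) \<longlonglongrightarrow> 0) \<and>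
     ((\<lambda>n. free_cumulant \<phi> 4 (X n)) \<longlonglongrightarrow> 0
        \<longleftrightarrow> (\<lambda>n. \<phi> (op_power (X n) 4)) \<longlonglongrightarrow> complex_of_real (2 * \<alpha> ^ 4)) \<and>
     ((\<lambda>n. \<phi> (op_power (X n) 4)) \<longlonglongrightarrow> complex_of_real (2 * \<alpha> ^ 4)
        \<longleftrightarrow>
          (\<forall>k\<in>{1..q - 1}.
             (\<lambda>n. L2_norm (2 * q - 2 * k) (contraction q q k (f n) (f n))) \<longlonglongrightarrow> 0) \<and>
          (\<forall>k\<in>{2..q}.
             (\<lambda>n. L2_norm (2 * q - 2 * k + 1) (star_contraction q q k (f n) (f n)))
               \<longlonglongrightarrow> 0))"
proof -
  interpret free_poisson_measure M \<phi> N by (rule assms(2))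
  define s where "s n = (L2_norm q (f n))\<^sup>2" for n
  define c where "c n = contr_norm2 q (f n)" for n
  have q: "q \<ge> 1" using \<open>q \<ge> 2\<close> by simp
  have s: "s \<longlonglongrightarrow> \<alpha>\<^sup>2" using assms(6) by (simp add: s_def[abs_def])
  have c_nonneg: "0 \<le> c n b" for n b by (simp add: c_def contr_norm2_def case_prod_unfold)
  have approx: "\<exists>C R a A G. integral_approximation M \<phi> N q C R (f n) a A G" for n
    using assms(4,5) q unfolding tamed_def by (intro integral_approximation_exists) auto
  have mean: "\<phi> (X n) = 0" and m2: "\<phi> (op_power (X n) 2) = of_real (s n)"
    and m4: "\<phi> (op_power (X n) 4) = of_real (2 * (s n)\<^sup>2 + (\<Sum>b\<in>proper_contr_types q. c n b))"
    and star_1: "c n (1, 0) = c n (1, q - 1)"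
    and path_approx: "cmod (\<phi> (op_power (X n) m) - of_real (semicircle_path (s n) m 0))
      \<le> semicircle_error (proper_contr_types q) (s n) (c n) (\<lambda>i. nrm2 (op_power (X n) i)) m 0"
    and even: "nrm2 (op_power (X n) m) = Re (\<phi> (op_power (X n) (m + m)))"
    and paths: "cmod (\<phi> (op_power (X n) m)) \<le>
      (\<Sum>\<pi>\<in>closed_paths q m. \<integral>x. path_integrand q \<pi> (f n) x \<partial>LP {..<path_bound \<pi>})"
    and path_le: "\<lbrakk>\<pi> \<in> closed_paths q m;
      (\<integral>\<^sup>+x. ennreal (identified_tensor m q (\<lambda>t. cmod (f n t)) (path_partition q \<pi>) x)
        \<partial>LP (path_partition q \<pi>)) \<le> ennreal D\<rbrakk> \<Longrightarrow>
      (\<integral>x. path_integrand q \<pi> (f n) x \<partial>LP {..<path_bound \<pi>}) \<le> max 0 D" for n m \<pi> D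
  proof -
    \<comment> \<open>Approximating grid, bound and radius are chosen separately for each
      \<open>n\<close>; only facts that do not mention them leave this block.\<close>
    obtain C R a A G where "integral_approximation M \<phi> N q C R (f n) a A G" using approx by blast
    then interpret A: integral_approximation M \<phi> N q C R "f n" a A G .
    show "\<phi> (X n) = 0" "\<phi> (op_power (X n) 2) = of_real (s n)"
      "\<phi> (op_power (X n) 4) = of_real (2 * (s n)\<^sup>2 + (\<Sum>b\<in>proper_contr_types q. c n b))"
      unfolding X_def s_def c_def by (rule A.state_Y A.state_Y2 A.state_Y4)+
    show "c n (1, 0) = c n (1, q - 1)" unfolding c_def by (rule A.contr_norm2_star_1)
    show "cmod (\<phi> (op_power (X n) m) - of_real (semicircle_path (s n) m 0))
      \<le> semicircle_error (proper_contr_types q) (s n) (c n) (\<lambda>i. nrm2 (op_power (X n) i)) m 0"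
      unfolding X_def s_def c_def by (rule A.moment_approx)
    show "nrm2 (op_power (X n) m) = Re (\<phi> (op_power (X n) (m + m)))"
      unfolding X_def by (rule A.even_moment_real[symmetric])
    show "cmod (\<phi> (op_power (X n) m)) \<le>
      (\<Sum>\<pi>\<in>closed_paths q m. \<integral>x. path_integrand q \<pi> (f n) x \<partial>LP {..<path_bound \<pi>})"
      unfolding X_def by (rule A.moment_le_paths)
    show "(\<integral>x. path_integrand q \<pi> (f n) x \<partial>LP {..<path_bound \<pi>}) \<le> max 0 D"
      if "\<pi> \<in> closed_paths q m" "(\<integral>\<^sup>+x. ennreal (identified_tensor m q (\<lambda>t. cmod (f n t)) (path_partition q \<pi>) x)
        \<partial>LP (path_partition q \<pi>)) \<le> ennreal D"
      by (rule A.path_integral_le_tamed[OF that])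
  qed
  have s2: "(\<lambda>n. 2 * (s n)\<^sup>2) \<longlonglongrightarrow> 2 * \<alpha> ^ 4"
    using tendsto_mult[OF tendsto_const tendsto_power[OF s], of 2 2] by (simp flip: power_mult)
  have i_iii: "(\<lambda>n. \<phi> (op_power (X n) 4)) \<longlonglongrightarrow> complex_of_real (2 * \<alpha> ^ 4)"
    if "converges_in_law \<phi> X (semicircular (\<alpha>\<^sup>2))"
  proof -
    have "(\<lambda>n. \<phi> (op_power (X n) 4)) \<longlonglongrightarrow> complex_of_real (\<integral>x. x ^ 4 \<partial>semicircular (\<alpha>\<^sup>2))"
      using that by (simp add: converges_in_law_def)
    then show ?thesis by (simp add: semicircular_moment semicircle_path_4 flip: power_mult)
  qed
  have ii_iii: "(\<lambda>n. free_cumulant \<phi> 4 (X n)) \<longlonglongrightarrow> 0 \<longleftrightarrow>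
      (\<lambda>n. \<phi> (op_power (X n) 4)) \<longlonglongrightarrow> complex_of_real (2 * \<alpha> ^ 4)"
  proof -
    have \<kappa>: "free_cumulant \<phi> 4 (X n) = \<phi> (op_power (X n) 4) - complex_of_real (2 * (s n)\<^sup>2)" for n
      using free_cumulant_4[of \<phi>, OF mean] by (simp add: m2)
    have s2': "(\<lambda>n. complex_of_real (2 * (s n)\<^sup>2)) \<longlonglongrightarrow> of_real (2 * \<alpha> ^ 4)"
      by (intro tendsto_of_real s2)
    show ?thesis
    proof
      assume "(\<lambda>n. free_cumulant \<phi> 4 (X n)) \<longlonglongrightarrow> 0"
      from tendsto_add[OF this s2'] show "(\<lambda>n. \<phi> (op_power (X n) 4)) \<longlonglongrightarrow> complex_of_real (2 * \<alpha> ^ 4)"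
        by (simp add: \<kappa>)
    next
      assume "(\<lambda>n. \<phi> (op_power (X n) 4)) \<longlonglongrightarrow> complex_of_real (2 * \<alpha> ^ 4)"
      from tendsto_diff[OF this s2'] show "(\<lambda>n. free_cumulant \<phi> 4 (X n)) \<longlonglongrightarrow> 0" by (simp add: \<kappa>)
    qed
  qed
  have iii_iv: "(\<lambda>n. \<phi> (op_power (X n) 4)) \<longlonglongrightarrow> complex_of_real (2 * \<alpha> ^ 4) \<longleftrightarrow>
      (\<forall>b\<in>proper_contr_types q. (\<lambda>n. c n b) \<longlonglongrightarrow> 0)"
  proof
    assume "(\<lambda>n. \<phi> (op_power (X n) 4)) \<longlonglongrightarrow> complex_of_real (2 * \<alpha> ^ 4)"
    then have "(\<lambda>n. 2 * (s n)\<^sup>2 + (\<Sum>b\<in>proper_contr_types q. c n b)) \<longlonglongrightarrow> 2 * \<alpha> ^ 4"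
      unfolding m4 tendsto_of_real_iff .
    from tendsto_diff[OF this s2] have sum0: "(\<lambda>n. \<Sum>b\<in>proper_contr_types q. c n b) \<longlonglongrightarrow> 0" by simp
    show "\<forall>b\<in>proper_contr_types q. (\<lambda>n. c n b) \<longlonglongrightarrow> 0"
    proof
      fix b assume b: "b \<in> proper_contr_types q"
      \<comment> \<open>Nonnegative summands: each is squeezed between 0 and a sum that vanishes in
        the limit.\<close>
      have "c n b \<le> (\<Sum>b\<in>proper_contr_types q. c n b)" for n
        by (rule member_le_sum[OF b]) (simp_all add: c_nonneg)
      then show "(\<lambda>n. c n b) \<longlonglongrightarrow> 0"
        by (intro tendsto_sandwich[OF _ _ tendsto_const sum0] always_eventually allI c_nonneg)
    qed
  next
    assume "\<forall>b\<in>proper_contr_types q. (\<lambda>n. c n b) \<longlonglongrightarrow> 0"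
    then have "(\<lambda>n. 2 * (s n)\<^sup>2 + (\<Sum>b\<in>proper_contr_types q. c n b)) \<longlonglongrightarrow> 2 * \<alpha> ^ 4 + (\<Sum>b\<in>proper_contr_types q. 0)"
      by (intro tendsto_add s2 tendsto_sum) blast
    then show "(\<lambda>n. \<phi> (op_power (X n) 4)) \<longlonglongrightarrow> complex_of_real (2 * \<alpha> ^ 4)"
      unfolding m4 tendsto_of_real_iff by simp
  qed
  \<comment> \<open>The uniform part of tamedness enters here, applied to the finitely many
    partitions of closed paths with \<open>i + i\<close> factors. The case \<open>i = 0\<close> is
    separate because tamedness starts at two factors.\<close>
  have moment_bound: "\<exists>K. \<forall>n. nrm2 (op_power (X n) i) \<le> K" for i
  proof (cases "i = 0")
    case True
    then show ?thesis using nrm2_id by auto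
  next
    case False
    then have m: "i + i \<ge> 2" by simp
    have "\<exists>D. \<forall>n. (\<integral>\<^sup>+x. ennreal (identified_tensor (i + i) q (\<lambda>t. cmod (f n t)) (path_partition q \<pi>) x)
        \<partial>LP (path_partition q \<pi>)) \<le> ennreal D" if "\<pi> \<in> closed_paths q (i + i)" for \<pi>
      using assms(4) m path_partition_tamed[OF that q] unfolding tamed_def by blast
    then obtain D where D: "\<And>\<pi> n. \<pi> \<in> closed_paths q (i + i) \<Longrightarrow>
      (\<integral>\<^sup>+x. ennreal (identified_tensor (i + i) q (\<lambda>t. cmod (f n t)) (path_partition q \<pi>) x)
        \<partial>LP (path_partition q \<pi>)) \<le> ennreal (D \<pi>)" by metis
    have "nrm2 (op_power (X n) i) \<le> (\<Sum>\<pi>\<in>closed_paths q (i + i). max 0 (D \<pi>))" for n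
    proof -
      have "nrm2 (op_power (X n) i) \<le> cmod (\<phi> (op_power (X n) (i + i)))"
        unfolding even by (rule complex_Re_le_cmod)
      also have "\<dots> \<le> (\<Sum>\<pi>\<in>closed_paths q (i + i). \<integral>x. path_integrand q \<pi> (f n) x \<partial>LP {..<path_bound \<pi>})"
        by (rule paths)
      also have "\<dots> \<le> (\<Sum>\<pi>\<in>closed_paths q (i + i). max 0 (D \<pi>))"
      proof (rule sum_mono)
        fix \<pi> assume \<pi>: "\<pi> \<in> closed_paths q (i + i)"
        show "(\<integral>x. path_integrand q \<pi> (f n) x \<partial>LP {..<path_bound \<pi>}) \<le> max 0 (D \<pi>)"
          by (rule path_le[OF \<pi> D[OF \<pi>, of n]])
      qed
      finally show ?thesis .
    qed
    then show ?thesis by blast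
  qed
  have iv_i: "converges_in_law \<phi> X (semicircular (\<alpha>\<^sup>2))"
    if "\<forall>b\<in>proper_contr_types q. (\<lambda>n. c n b) \<longlonglongrightarrow> 0"
    unfolding converges_in_law_def
  proof
    fix m
    have "(\<lambda>n. semicircle_error (proper_contr_types q) (s n) (c n) (\<lambda>i. nrm2 (op_power (X n) i)) m 0) \<longlonglongrightarrow> 0"
      by (rule semicircle_error_tendsto_0[OF s]) (use that moment_bound nrm2_nonneg in auto)
    then have "(\<lambda>n. \<phi> (op_power (X n) m) - of_real (semicircle_path (s n) m 0)) \<longlonglongrightarrow> 0"
      by (rule Lim_null_comparison[rotated]) (simp add: path_approx)
    moreover have "(\<lambda>n. complex_of_real (semicircle_path (s n) m 0)) \<longlonglongrightarrow> of_real (semicircle_path (\<alpha>\<^sup>2) m 0)"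
      by (intro tendsto_of_real tendsto_semicircle_path s)
    ultimately have "(\<lambda>n. (\<phi> (op_power (X n) m) - of_real (semicircle_path (s n) m 0)) + of_real (semicircle_path (s n) m 0))
        \<longlonglongrightarrow> 0 + of_real (semicircle_path (\<alpha>\<^sup>2) m 0)"
      by (rule tendsto_add)
    then show "(\<lambda>n. \<phi> (op_power (X n) m)) \<longlonglongrightarrow> complex_of_real (\<integral>x. x ^ m \<partial>semicircular (\<alpha>\<^sup>2))"
      by (simp add: semicircular_moment)
  qed
  have iv: "(\<forall>b\<in>proper_contr_types q. (\<lambda>n. c n b) \<longlonglongrightarrow> 0) \<longleftrightarrow>
    (\<forall>k\<in>{1..q - 1}. (\<lambda>n. L2_norm (2 * q - 2 * k) (contraction q q k (f n) (f n))) \<longlonglongrightarrow> 0) \<and>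
    (\<forall>k\<in>{2..q}. (\<lambda>n. L2_norm (2 * q - 2 * k + 1) (star_contraction q q k (f n) (f n))) \<longlonglongrightarrow> 0)"
    unfolding c_def by (rule contr_norm2_tendsto_0_iff[OF \<open>q \<ge> 2\<close> star_1[unfolded c_def]])
  \<comment> \<open>(iii) and (iv) are equivalent, (iv) implies (i), and (i) contains (iii) as its
    moment of order four; (ii) differs from (iii) only by the converging square of the
    variance.\<close>
  show ?thesis
    unfolding iv[symmetric] using i_iii ii_iii iii_iv iv_i by blast
qed

end
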